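(* Assume $\psi'(0+)>-\infty$ and $q>0$. For any $x\in\mathbb{R}$, $$\mathbb{E}_x\left(\int_{[0,\infty)}e^{-qt}\,dR_t\right)=-\tilde r^{(q)}(x)+\left(\int_b^\infty e^{-\varphi(q)(y-b)}Z^{(q)}(y)\,dy\right)\frac{r^{(q)}(x)}{q\int_b^\infty e^{-\varphi(q)(y-b)}W^{(q)}(y)\,dy},$$ where $$\tilde r^{(q)}(x):=\overline{Z}^{(q)}(x)+\frac{\psi'(0+)}{q}+\delta\int_b^x\mathbb{W}^{(q)}(x-y)Z^{(q)}(y)\,dy,\qquad r^{(q)}(x):=Z^{(q)}(x)+q\delta\int_b^x\mathbb{W}^{(q)}(x-y)W^{(q)}(y)\,dy.$$
   Context: Let $X=(X_t)_{t\ge0}$ be a spectrally negative Lévy process (no positive jumps, not the negative of a subordinator); $\mathbb{P}_x$ is its law when $X_0=x$, with expectation $\mathbb{E}_x$. Its Laplace exponent is $\psi(\theta)=\log\mathbb{E}_0[e^{\theta X_1}]=\gamma\theta+\frac{\sigma^2}{2}\theta^2+\int_{(-\infty,0)}(e^{\theta x}-1-\theta x1_{\{x>-1\}})\Pi(dx)$, $\theta\ge0$, with $\gamma\in\mathbb{R}$, $\sigma\ge0$ and Lévy measure $\Pi$ on $(-\infty,0)$, $\int(1\wedge x^2)\Pi(dx)<\infty$. If $X$ has paths of bounded variation, then $X_t=X_0+ct-S_t$ with $c:=\gamma-\int_{(-1,0)}x\,\Pi(dx)>0$ and $S$ a driftless subordinator. Fix $b>0$ and $\delta\ge0$, and assume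 $\delta<c$ whenever $X$ has paths of bounded variation. Put $Y_t:=X_t-\delta t$, a spectrally negative Lévy process with Laplace exponent $\psi_Y(\theta)=\psi(\theta)-\delta\theta$. Refracted-reflected process $V$ under $\mathbb{P}_x$ (reflected at $0$, refracted above $b$): Step 0: set $V_{0-}=x$; if $x\ge0$ set $\underline\tau:=0$ and go to Step 1, otherwise set $\overline\tau:=0$ and go to Step 2. Step 1: let $(\widetilde A_t)_{t\ge\underline\tau}$ be the refracted Lévy process started at time $\underline\tau$ at level $x$, i.e. the unique strong solution of $d\widetilde A_t=dX_t-\delta1_{\{\widetilde A_t>b\}}dt$ with $\widetilde A_{\underline\tau}=x$; let $\overline\tau:=\inf\{t>\underline\tau:\widetilde A_t<0\}$, set $V_t=\widetilde A_t$ for $\underline\tau\le t<\overline\tau$, and go to Step 2. Step 2: let $\widetilde U_t=(X_t-X_{\overline\tau})+\sup_{\overline\tau\le s\le t}(-(X_s-X_{\overline\tau}))\vee0$, $t\ge\overline\tau$, be the process reflected at $0$ started at time $\overline\tau$ at $0$; let $\underline\tau:=\inf\{t>\overline\tau:\widetilde U_t>b\}$, set $V_t=\widetilde U_t$ for $\overline\tau\le t<\underline\tau$, set $x=b$, and go to Step 1. $V$ decomposes as $V_t=X_t+R_t-L_t$, where $L_t=\delta\int_0^t1_{\{V_s>b\}}ds$ and $R$ is the nondecreasing right-continuous process with $R_{0-}=0$ giving the cumulative upward modification at $0$, i.e. $R_t=V_t-X_t+L_t$ (so $R_0=(-x)\vee0$ under $\mathbb{P}_x$, and this atom at time $0$ is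 included in integrals over $[0,\infty)$). Scale functions: for $q\ge0$, $\Phi(q):=\sup\{\lambda\ge0:\psi(\lambda)=q\}$ and $\varphi(q):=\sup\{\lambda\ge0:\psi_Y(\lambda)=q\}$. $W^{(q)}$ (resp. $\mathbb{W}^{(q)}$) is the scale function of $X$ (resp. $Y$): zero on $(-\infty,0)$, continuous and strictly increasing on $[0,\infty)$, with $\int_0^\infty e^{-\theta x}W^{(q)}(x)dx=1/(\psi(\theta)-q)$ for $\theta>\Phi(q)$ (resp. $\int_0^\infty e^{-\theta x}\mathbb{W}^{(q)}(x)dx=1/(\psi_Y(\theta)-q)$ for $\theta>\varphi(q)$). Also, for $x\in\mathbb{R}$, $Z^{(q)}(x):=1+q\int_0^xW^{(q)}(y)dy$ and $\overline{Z}^{(q)}(x):=\int_0^xZ^{(q)}(z)dz$ (so $Z^{(q)}(x)=1$, $\overline{Z}^{(q)}(x)=x$ for $x\le0$). Integrals $\int_b^x\mathbb{W}^{(q)}(x-y)\cdots dy$ vanish for $x\le b$.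
   Formalization: For δ = 0 one has φ(q) = Φ(q) and both integrals over [b,∞) diverge, so the printed quotient is ∞/∞; there the right-hand side is read as the limit as N→∞ of the same expression with both integrals taken over [b,N]. For δ > 0 the formula is as printed. *)

theory Defs
  imports "HOL-Probability.Probability"
begin

section \<open>Spectrally negative Levy processes\<close>

definition cadlag :: "(real \<Rightarrow> real) \<Rightarrow> bool" where
  "cadlag f \<longleftrightarrow> (\<forall>t\<ge>0. continuous (at_right t) f) \<and> (\<forall>t>0. \<exists>l. (f \<longlongrightarrow> l) (at_left t))"

definition no_positive_jumps :: "(real \<Rightarrow> real) \<Rightarrow> bool" where
  "no_positive_jumps f \<longleftrightarrow> (\<forall>t>0. \<forall>l. (f \<longlongrightarrow> l) (at_left t) \<longrightarrow> f t \<le> l)"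

definition bounded_variation_upto :: "(real \<Rightarrow> real) \<Rightarrow> real \<Rightarrow> bool" where
  "bounded_variation_upto f T \<longleftrightarrow>
     (\<exists>B. \<forall>n ts. mono ts \<and> range ts \<subseteq> {0..T} \<longrightarrow>
        (\<Sum>i<n. \<bar>f (ts (Suc i)) - f (ts (i::nat))\<bar>) \<le> B)"

definition levy_khintchine :: "real \<Rightarrow> real \<Rightarrow> real measure \<Rightarrow> real \<Rightarrow> real" where
  "levy_khintchine \<gamma> \<sigma> \<nu> \<theta> = \<gamma> * \<theta> + \<sigma>\<^sup>2 / 2 * \<theta>\<^sup>2 +
     (LINT x:{..<0}|\<nu>. exp (\<theta> * x) - 1 - \<theta> * x * indicator {-1<..} x)"

text \<open>
  The process \<open>X\<close> below starts at 0, so that \<open>M\<close> plays the role of the law of the process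
  started at 0.  The law of the process started at \<open>x\<close> is that of \<open>\<lambda>t. x + X t\<close> under \<open>M\<close>.
  Only the times \<open>t \<ge> 0\<close> matter.
\<close>

locale spectrally_negative_levy = prob_space M
  for M :: "'a measure" +
  fixes X :: "real \<Rightarrow> 'a \<Rightarrow> real" and \<gamma> \<sigma> :: real and \<nu> :: "real measure"
  assumes random_variable_X: "\<And>t. 0 \<le> t \<Longrightarrow> X t \<in> borel_measurable M"
    and start_zero: "AE \<omega> in M. X 0 \<omega> = 0"
    and cadlag_paths: "AE \<omega> in M. cadlag (\<lambda>t. X t \<omega>)"
    and independent_increments: "\<And>(ts :: nat \<Rightarrow> real) n. 0 \<le> ts 0 \<Longrightarrow> mono ts \<Longrightarrow>
          indep_vars (\<lambda>_. borel) (\<lambda>i \<omega>. X (ts (Suc i)) \<omega> - X (ts i) \<omega>) {..<n}"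
    and stationary_increments: "\<And>s t. 0 \<le> s \<Longrightarrow> 0 \<le> t \<Longrightarrow>
          distr M borel (\<lambda>\<omega>. X (s + t) \<omega> - X s \<omega>) = distr M borel (X t)"
    and spectrally_negative: "AE \<omega> in M. no_positive_jumps (\<lambda>t. X t \<omega>)"
    and not_negative_subordinator: "\<not> (AE \<omega> in M. antimono_on {0..} (\<lambda>t. X t \<omega>))"
    and sigma_nonneg: "0 \<le> \<sigma>"
    and sets_nu: "sets \<nu> = sets borel"
    and nu_negative: "emeasure \<nu> {0..} = 0"
    and nu_levy_measure: "(\<integral>\<^sup>+x. ennreal (min 1 (x\<^sup>2)) \<partial>\<nu>) < \<infinity>"
    and exponential_moments: "\<And>\<theta>. 0 \<le> \<theta> \<Longrightarrow> integrable M (\<lambda>\<omega>. exp (\<theta> * X 1 \<omega>))"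
    and laplace_exponent: "\<And>\<theta>. 0 \<le> \<theta> \<Longrightarrow>
          ln (expectation (\<lambda>\<omega>. exp (\<theta> * X 1 \<omega>))) = levy_khintchine \<gamma> \<sigma> \<nu> \<theta>"

definition bounded_variation_paths :: "'a measure \<Rightarrow> (real \<Rightarrow> 'a \<Rightarrow> real) \<Rightarrow> bool" where
  "bounded_variation_paths M X \<longleftrightarrow> (AE \<omega> in M. \<forall>T\<ge>0. bounded_variation_upto (\<lambda>t. X t \<omega>) T)"

definition bv_drift :: "real \<Rightarrow> real measure \<Rightarrow> real" where
  "bv_drift \<gamma> \<nu> = \<gamma> - (LINT x:{-1<..<0}|\<nu>. x)"


section \<open>The refracted-reflected process\<close>

text \<open>
  Everything here is pathwise: \<open>f\<close> is a path of the driving process (with \<open>f 0\<close> its starting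
  point), \<open>v\<close> a path of the refracted-reflected process.
\<close>

text \<open>Solution of \<open>dA = df - \<delta> 1{A > b} dt\<close> started at time \<open>s\<close> at level \<open>a\<close>; such a solution is
  unique on \<open>[s, \<infinity>)\<close> for every path \<open>f\<close>.\<close>

definition refracted_path ::
    "real \<Rightarrow> real \<Rightarrow> (real \<Rightarrow> real) \<Rightarrow> real \<Rightarrow> real \<Rightarrow> (real \<Rightarrow> real) \<Rightarrow> bool" where
  "refracted_path \<delta> b f s a A \<longleftrightarrow>
     (\<forall>t\<ge>s. set_integrable lborel {s..t} (\<lambda>u. indicat_real {b<..} (A u)) \<and>
        A t = a + (f t - f s) - \<delta> * (LBINT u:{s..t}. indicat_real {b<..} (A u)))"

definition reflected_path :: "(real \<Rightarrow> real) \<Rightarrow> real \<Rightarrow> real \<Rightarrow> real" where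
  "reflected_path f s t = (f t - f s) + (SUP u\<in>{s..t}. max (- (f u - f s)) 0)"

definition first_time_after :: "real \<Rightarrow> (real \<Rightarrow> bool) \<Rightarrow> ereal" where
  "first_time_after s P = Inf (ereal ` {t. s < t \<and> P t})"

text \<open>
  \<open>step1_start \<delta> b f s a\<close>: the construction enters Step 1 at time \<open>s\<close> with level \<open>a\<close>;
  \<open>step2_start \<delta> b f s\<close>: it enters Step 2 at time \<open>s\<close>.  A step whose exit time is infinite has
  no successor.
\<close>

inductive step1_start :: "real \<Rightarrow> real \<Rightarrow> (real \<Rightarrow> real) \<Rightarrow> real \<Rightarrow> real \<Rightarrow> bool"
  and step2_start :: "real \<Rightarrow> real \<Rightarrow> (real \<Rightarrow> real) \<Rightarrow> real \<Rightarrow> bool"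
  for \<delta> b :: real and f :: "real \<Rightarrow> real" where
  start_nonneg: "0 \<le> f 0 \<Longrightarrow> step1_start \<delta> b f 0 (f 0)"
| start_neg: "f 0 < 0 \<Longrightarrow> step2_start \<delta> b f 0"
| down: "step1_start \<delta> b f s a \<Longrightarrow> refracted_path \<delta> b f s a A \<Longrightarrow>
    first_time_after s (\<lambda>t. A t < 0) = ereal s' \<Longrightarrow> step2_start \<delta> b f s'"
| up: "step2_start \<delta> b f s \<Longrightarrow>
    first_time_after s (\<lambda>t. reflected_path f s t > b) = ereal s' \<Longrightarrow> step1_start \<delta> b f s' b"

definition refracted_reflected_path ::
    "real \<Rightarrow> real \<Rightarrow> (real \<Rightarrow> real) \<Rightarrow> (real \<Rightarrow> real) \<Rightarrow> bool" where
  "refracted_reflected_path \<delta> b f v \<longleftrightarrow>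
     (\<forall>s a. step1_start \<delta> b f s a \<longrightarrow>
        (\<exists>A. refracted_path \<delta> b f s a A \<and>
             (\<forall>t\<ge>s. ereal t < first_time_after s (\<lambda>u. A u < 0) \<longrightarrow> v t = A t))) \<and>
     (\<forall>s. step2_start \<delta> b f s \<longrightarrow>
        (\<forall>t\<ge>s. ereal t < first_time_after s (\<lambda>u. reflected_path f s u > b) \<longrightarrow>
             v t = reflected_path f s t))"

definition cumulative_refraction :: "real \<Rightarrow> real \<Rightarrow> (real \<Rightarrow> real) \<Rightarrow> real \<Rightarrow> real" where
  "cumulative_refraction \<delta> b v t = \<delta> * (LBINT s:{0..t}. indicat_real {b<..} (v s))"

text \<open>Extended by 0 to negative times, so that the measure \<open>dR\<close> given by
  \<open>interval_measure\<close> has the atom \<open>R\<^sub>0\<close> at time 0.\<close>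

definition cumulative_reflection ::
    "real \<Rightarrow> real \<Rightarrow> (real \<Rightarrow> real) \<Rightarrow> (real \<Rightarrow> real) \<Rightarrow> real \<Rightarrow> real" where
  "cumulative_reflection \<delta> b f v t =
     (if t < 0 then 0 else v t - f t + cumulative_refraction \<delta> b v t)"


section \<open>Scale functions\<close>

definition right_inverse :: "(real \<Rightarrow> real) \<Rightarrow> real \<Rightarrow> real" where
  "right_inverse \<psi> q = Sup {l. 0 \<le> l \<and> \<psi> l = q}"

text \<open>Of all functions on the real line exactly one satisfies this, by uniqueness of Laplace
  transforms.\<close>

definition scale_function :: "(real \<Rightarrow> real) \<Rightarrow> real \<Rightarrow> (real \<Rightarrow> real) \<Rightarrow> bool" where
  "scale_function \<psi> q W \<longleftrightarrow>
     (\<forall>x<0. W x = 0) \<and> continuous_on {0..} W \<and> strict_mono_on {0..} W \<and>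
     (\<forall>\<theta>>right_inverse \<psi> q.
        set_integrable lborel {0..} (\<lambda>x. exp (- (\<theta> * x)) * W x) \<and>
        (LBINT x:{0..}. exp (- (\<theta> * x)) * W x) = 1 / (\<psi> \<theta> - q))"

definition Z_fun :: "real \<Rightarrow> (real \<Rightarrow> real) \<Rightarrow> real \<Rightarrow> real" where
  "Z_fun q W x = 1 + q * (LBINT y=0..ereal x. W y)"

definition Z_bar :: "real \<Rightarrow> (real \<Rightarrow> real) \<Rightarrow> real \<Rightarrow> real" where
  "Z_bar q W x = (LBINT z=0..ereal x. Z_fun q W z)"

text \<open>In the next two definitions \<open>W\<close> and \<open>WY\<close> are the \<open>q\<close>-scale functions of \<open>X\<close> and of
  \<open>Y = (X t - \<delta> t)\<close>, and \<open>m\<close> is the right limit at 0 of the derivative of the Laplace exponent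
  of \<open>X\<close>.\<close>

definition r_tilde ::
    "real \<Rightarrow> real \<Rightarrow> real \<Rightarrow> real \<Rightarrow> (real \<Rightarrow> real) \<Rightarrow> (real \<Rightarrow> real) \<Rightarrow> real \<Rightarrow> real" where
  "r_tilde q \<delta> b m W WY x =
     Z_bar q W x + m / q + \<delta> * (LBINT y:{b..x}. WY (x - y) * Z_fun q W y)"

definition r_fun ::
    "real \<Rightarrow> real \<Rightarrow> real \<Rightarrow> (real \<Rightarrow> real) \<Rightarrow> (real \<Rightarrow> real) \<Rightarrow> real \<Rightarrow> real" where
  "r_fun q \<delta> b W WY x =
     Z_fun q W x + q * \<delta> * (LBINT y:{b..x}. WY (x - y) * W y)"

end

(*
Idea.  For a constant C let g_C = - r_tilde + C * r_fun.  The resolvent identity for scale functions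
gives that, up to errors of order o(t) away from 0 and b, one time step t of X, refracted above b and
reflected at 0, changes exp (- q t) g_C by minus the expected push at 0; the exceptional zones around
0 and b carry small occupation time.  Hence for the chain that samples the process on the grid i/n the
expected discounted pushes telescope: they are at most g_C (x) if g_C tends to infinity, and at least
g_C (x) if g_C is negative somewhere to the right of x.  Laplace transforms at phi show that the first
case holds for all C above, the second for all C below the constant of the corollary, and g_C (x) is
affine in C.  The pushes of the chain converge to R pathwise: V solves the Skorokhod equation
V = X - L + R with R the running supremum of (L - X)^+, and a chain with refraction level b + epsilon
(resp. b - epsilon) can overtake (fall behind) L only in the finitely many grid intervals that contain
a large oscillation of the cadlag path.
*)
theory Submission
 imports Defs "HOL-Complex_Analysis.Complex_Analysis" "HOL-Real_Asymp.Real_Asymp"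
begin

section \<open>Laplace transforms\<close>

text \<open>The scale functions enter only through their Laplace transforms and need not be smooth,
  so no generator is applied to g_C. That convolution with \<open>W\<close> inverts generator minus
  \<open>q\<close> is proved instead by comparing bilateral Laplace transforms in the space
  variable. At the critical constant g_C is unbounded and its discounted value along the chain is
  hard to control; this is why constants on both sides are used. For them a bounded test function
  arises by cutting g_C off: beyond a point where it is negative for the lower bound, beyond a point
  where it is large for the upper one. Overshooting the cut by a fixed margin in one step
  contributes only o(t), as there are no positive jumps; this enters through the quadratic growth of
  the exponent. The chain decides about refraction once per step, whereas V may cross b many times
  within it; moving the level by epsilon makes one inequality between the two refractions robust,
  and the one-step estimate tolerates either decision near b.\<close>

lemma holomorphic_exponential_integral:
 fixes \<mu> :: "real measure"
 assumes [measurable_cong]: "sets \<mu> = sets borel"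
  and int: "!!\<theta>. a < \<theta> ==> integrable \<mu> (%x. exp (\<theta> * x))"
 shows "(%z. \<integral>x. exp (z * of_real x) \<partial>\<mu>) holomorphic_on {z. a < Re z}"
proof -
 have "EX D. ((%z. \<integral>x. exp (z * of_real x) \<partial>\<mu>) has_field_derivative D) (at z)" if z: "a < Re z" for z
 proof -
  \<comment> \<open>A quarter of the distance to the boundary: on the disc of radius
    \<open>r\<close> the derivative is at most \<bar>x\<bar> exp (Re z * x + r * \<bar>x\<bar>), the
    factor \<bar>x\<bar> costs another \<open>r\<close> in the exponent, and Re z - 2 * r still
    exceeds \<open>a\<close>.\<close>
  define r where "r = (Re z - a) / 4"
  have r: "r > 0" using z by (simp add: r_def)
  define B where "B = (%x. (exp ((Re z + 2*r) * x) + exp ((Re z - 2*r) * x)) / r)"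
  have Bint: "integrable \<mu> B"
   unfolding B_def using r z by (intro Bochner_Integration.integrable_divide Bochner_Integration.integrable_add int) (auto simp: r_def field_simps)
  have intz: "integrable \<mu> (%x. exp (w * of_real x))" if "a < Re w" for w :: complex
   by (rule Bochner_Integration.integrable_bound[OF int[OF that]]) (auto intro!: AE_I2)
  have bound: "norm ((exp (w * of_real x) - exp (z * of_real x)) / (w - z)) <= B x"
   if w: "norm (w - z) <= r" "w ~= z" for w x
  proof -
   have "norm (exp (w * of_real x) - exp (z * of_real x)) <= (r * B x) / r * norm (w - z)"
   proof (rule field_differentiable_bound[where S="cball z r"])
    fix \<zeta> assume \<zeta>: "\<zeta> \<in> cball z r"
    show "((%w. exp (w * of_real x)) has_field_derivative (of_real x * exp (\<zeta> * of_real x))) (at \<zeta> within cball z r)"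
     by (auto intro!: derivative_eq_intros)
    have d: "\<bar>Re \<zeta> - Re z\<bar> <= r"
     using \<zeta> abs_Re_le_cmod[of "\<zeta> - z"] by (simp add: dist_norm norm_minus_commute)
    have "Re \<zeta> * x = Re z * x + (Re \<zeta> - Re z) * x" by (simp add: algebra_simps)
    also have "... <= Re z * x + r * \<bar>x\<bar>"
     using mult_right_mono[OF d, of "\<bar>x\<bar>"] abs_ge_self[of "(Re \<zeta> - Re z) * x"] unfolding abs_mult by simp
    finally have 1: "exp (Re \<zeta> * x) <= exp (Re z * x + r * \<bar>x\<bar>)" by simp
    have "r * \<bar>x\<bar> <= exp (r * \<bar>x\<bar>)" using exp_ge_add_one_self[of "r * \<bar>x\<bar>"] by linarith
    hence 2: "\<bar>x\<bar> <= exp (r * \<bar>x\<bar>) / r" using r by (simp add: field_simps)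
    have "norm (of_real x * exp (\<zeta> * of_real x)) = \<bar>x\<bar> * exp (Re \<zeta> * x)" by (simp add: norm_mult)
    also have "... <= exp (r * \<bar>x\<bar>) / r * exp (Re z * x + r * \<bar>x\<bar>)"
     by (intro mult_mono 1 2) (use r in auto)
    also have "... = exp (Re z * x + 2 * (r * \<bar>x\<bar>)) / r" by (simp add: mult_exp_exp algebra_simps)
    also have "... <= B x"
     unfolding B_def using r
     by (cases "0 <= x") (auto simp: divide_right_mono algebra_simps intro!: divide_right_mono)
    finally show "norm (of_real x * exp (\<zeta> * of_real x)) <= r * B x / r" using r by simp
   qed (use w r in \<open>auto simp: dist_norm norm_minus_commute\<close>)
   thus ?thesis using w r by (simp add: norm_divide divide_le_eq)
  qed
  have "((%w. ((\<integral>x. exp (w * of_real x) \<partial>\<mu>) - (\<integral>x. exp (z * of_real x) \<partial>\<mu>)) / (w - z))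
      \<longlongrightarrow> (\<integral>x. of_real x * exp (z * of_real x) \<partial>\<mu>)) (at z)"
   unfolding tendsto_at_iff_sequentially
  proof (intro allI impI)
   fix h :: "nat => complex" assume h0: "ALL i. h i \<in> UNIV - {z}" and h: "h \<longlonglongrightarrow> z"
   have "\<forall>\<^sub>F i in sequentially. dist (h i) z < r" using h r by (rule tendstoD)
   then obtain n0 where n0: "!!i. i >= n0 ==> norm (h i - z) <= r"
    unfolding eventually_sequentially dist_norm by (meson less_imp_le)
   have "(%i. \<integral>x. (exp (h (i+n0) * of_real x) - exp (z * of_real x)) / (h (i+n0) - z) \<partial>\<mu>)
     \<longlonglongrightarrow> (\<integral>x. of_real x * exp (z * of_real x) \<partial>\<mu>)"
   proof (rule integral_dominated_convergence[OF _ _ Bint])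
    show "AE x in \<mu>. (%i. (exp (h (i+n0) * of_real x) - exp (z * of_real x)) / (h (i+n0) - z))
     \<longlonglongrightarrow> of_real x * exp (z * of_real x)"
    proof (rule AE_I2)
     fix x :: real
     have "((%w. exp (w * of_real x)) has_field_derivative (of_real x * exp (z * of_real x))) (at z)"
      by (auto intro!: derivative_eq_intros)
     hence "((%w. (exp (w * of_real x) - exp (z * of_real x)) / (w - z)) \<longlongrightarrow> of_real x * exp (z * of_real x)) (at z)"
      by (simp add: has_field_derivative_iff)
     hence "((%w. (exp (w * of_real x) - exp (z * of_real x)) / (w - z)) \<circ> h) \<longlonglongrightarrow> of_real x * exp (z * of_real x)"
      using h0 h unfolding tendsto_at_iff_sequentially by auto
     thus "(%i. (exp (h (i+n0) * of_real x) - exp (z * of_real x)) / (h (i+n0) - z)) \<longlonglongrightarrow> of_real x * exp (z * of_real x)"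
      unfolding o_def by (rule LIMSEQ_ignore_initial_segment)
    qed
    show "AE x in \<mu>. norm ((exp (h (i+n0) * of_real x) - exp (z * of_real x)) / (h (i+n0) - z)) <= B x" for i
     using bound n0 h0 by (intro AE_I2) auto
   qed (measurable)
   moreover have "(\<integral>x. (exp (h (i+n0) * of_real x) - exp (z * of_real x)) / (h (i+n0) - z) \<partial>\<mu>)
     = ((\<integral>x. exp (h (i+n0) * of_real x) \<partial>\<mu>) - (\<integral>x. exp (z * of_real x) \<partial>\<mu>)) / (h (i+n0) - z)" for i
   proof -
    have "\<bar>Re (h (i+n0)) - Re z\<bar> <= r"
     using n0[of "i+n0"] abs_Re_le_cmod[of "h (i+n0) - z"] by simp
    hence "a < Re (h (i+n0))"
     using abs_ge_minus_self[of "Re (h (i+n0)) - Re z"] r z unfolding r_def by argo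
    thus ?thesis using intz z by (subst Bochner_Integration.integral_diff[symmetric]) auto
   qed
   ultimately have "(%i. ((%w. ((\<integral>x. exp (w * of_real x) \<partial>\<mu>) - (\<integral>x. exp (z * of_real x) \<partial>\<mu>)) / (w - z)) \<circ> h) (i + n0)) \<longlonglongrightarrow>
      (\<integral>x. of_real x * exp (z * of_real x) \<partial>\<mu>)"
    unfolding o_def by (simp only:)
   thus "((%w. ((\<integral>x. exp (w * of_real x) \<partial>\<mu>) - (\<integral>x. exp (z * of_real x) \<partial>\<mu>)) / (w - z)) \<circ> h) \<longlonglongrightarrow>
      (\<integral>x. of_real x * exp (z * of_real x) \<partial>\<mu>)"
    by (rule LIMSEQ_offset)
  qed
  thus ?thesis unfolding has_field_derivative_iff by blast
 qed
 thus ?thesis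
  by (subst holomorphic_on_open) (auto simp: open_halfspace_Re_gt)
qed

text \<open>The difference of the two transforms is analytic on the half plane to the right of
  \<open>a\<close> and vanishes on the real ray, hence on the vertical line through
  \<open>\<theta>0\<close>. After tilting both measures by \<open>exp (\<theta>0 * x) / c\<close>
  this is equality of characteristic functions of probability measures, and the tilt can be undone.
  If \<open>c = 0\<close> both measures vanish and there is nothing to normalise.\<close>

lemma bilateral_laplace_unique:
 fixes \<mu>1 \<mu>2 :: "real measure"
 assumes S1[measurable_cong]: "sets \<mu>1 = sets borel" and S2[measurable_cong]: "sets \<mu>2 = sets borel"
  and fin: "!!\<theta>. a < \<theta> ==> (\<integral>\<^sup>+x. ennreal (exp (\<theta> * x)) \<partial>\<mu>1) < \<infinity>"
  and eq: "!!\<theta>. a < \<theta> ==> (\<integral>\<^sup>+x. ennreal (exp (\<theta> * x)) \<partial>\<mu>1) = (\<integral>\<^sup>+x. ennreal (exp (\<theta> * x)) \<partial>\<mu>2)"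
 shows "\<mu>1 = \<mu>2"
proof -
 define \<theta>0 where "\<theta>0 = a + 1"
 have int1: "integrable \<mu>1 (%x. exp (\<theta> * x))" if "a < \<theta>" for \<theta>
  using fin[OF that] by (intro integrableI_bounded) auto
 have int2: "integrable \<mu>2 (%x. exp (\<theta> * x))" if "a < \<theta>" for \<theta>
  using fin[OF that] eq[OF that] by (intro integrableI_bounded) auto
 define F1 where "F1 = (%z::complex. \<integral>x. exp (z * of_real x) \<partial>\<mu>1)"
 define F2 where "F2 = (%z::complex. \<integral>x. exp (z * of_real x) \<partial>\<mu>2)"
 have hol: "(%z. F1 z - F2 z) holomorphic_on {z. a < Re z}"
  unfolding F1_def F2_def
  by (intro holomorphic_on_diff holomorphic_exponential_integral[OF S1 int1] holomorphic_exponential_integral[OF S2 int2])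
 have real_eq: "F1 (of_real \<theta>) = F2 (of_real \<theta>)" if "a < \<theta>" for \<theta>
 proof -
  have "F1 (of_real \<theta>) = of_real (\<integral>x. exp (\<theta> * x) \<partial>\<mu>1)"
   unfolding F1_def by (simp flip: integral_complex_of_real exp_of_real)
  moreover have "F2 (of_real \<theta>) = of_real (\<integral>x. exp (\<theta> * x) \<partial>\<mu>2)"
   unfolding F2_def by (simp flip: integral_complex_of_real exp_of_real)
  moreover have "(\<integral>x. exp (\<theta> * x) \<partial>\<mu>1) = (\<integral>x. exp (\<theta> * x) \<partial>\<mu>2)"
   using eq[OF that] by (subst (1 2) integral_eq_nn_integral) auto
  ultimately show ?thesis by simp
 qed
 have Feq: "F1 w = F2 w" if "a < Re w" for w
 proof -
  have "F1 w - F2 w = 0"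
  proof (rule analytic_continuation[OF hol _ _ _ _ _ _ , where U="of_real ` {a<..}" and \<xi>="of_real \<theta>0"])
   show "open {z. a < Re z}" by (rule open_halfspace_Re_gt)
   show "connected {z. a < Re z}" by (intro convex_connected convex_halfspace_Re_gt)
   show "complex_of_real \<theta>0 islimpt of_real ` {a<..}"
    unfolding islimpt_sequential
   proof (intro exI[of _ "%n. of_real (\<theta>0 + inverse (real (Suc n)))"] conjI allI)
    show "complex_of_real (\<theta>0 + inverse (real (Suc n))) \<in> of_real ` {a<..} - {of_real \<theta>0}" for n
     by (auto simp: \<theta>0_def of_real_eq_iff add_pos_pos simp del: of_real_add)
    have "(%n. \<theta>0 + inverse (real (Suc n))) \<longlonglongrightarrow> \<theta>0 + 0"
     by (intro tendsto_intros LIMSEQ_inverse_real_of_nat)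
    thus "(%n. complex_of_real (\<theta>0 + inverse (real (Suc n)))) \<longlonglongrightarrow> of_real \<theta>0"
     by (simp del: of_real_add add: tendsto_of_real_iff)
   qed
  qed (use that real_eq in \<open>auto simp: \<theta>0_def\<close>)
  thus ?thesis by simp
 qed
 define c where "c = (\<integral>x. exp (\<theta>0 * x) \<partial>\<mu>1)"
 have c2: "c = (\<integral>x. exp (\<theta>0 * x) \<partial>\<mu>2)"
  unfolding c_def using eq[of \<theta>0] by (subst (1 2) integral_eq_nn_integral) (auto simp: \<theta>0_def)
 have a0: "a < \<theta>0" by (simp add: \<theta>0_def)
 show ?thesis
 proof (cases "c = 0")
  case True
  have "emeasure \<mu>1 (space \<mu>1) = 0"
   using integral_nonneg_eq_0_iff_AE[OF int1[OF a0]] True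
   by (auto simp: c_def AE_iff_measurable[OF _ refl])
  moreover have "emeasure \<mu>2 (space \<mu>2) = 0"
   using integral_nonneg_eq_0_iff_AE[OF int2[OF a0]] True
   by (auto simp: c2 AE_iff_measurable[OF _ refl])
  ultimately show ?thesis
  proof (intro measure_eqI)
   fix A assume "emeasure \<mu>1 (space \<mu>1) = 0" "emeasure \<mu>2 (space \<mu>2) = 0" "A \<in> sets \<mu>1"
   moreover have "A \<in> sets \<mu>2" using S1 S2 \<open>A \<in> sets \<mu>1\<close> by simp
   ultimately show "emeasure \<mu>1 A = emeasure \<mu>2 A"
    by (metis emeasure_space le_zero_eq)
  qed (simp add: S1 S2)
 next
  case False
  have "c >= 0" unfolding c_def by (rule integral_nonneg_AE) auto
  hence c: "c > 0" using False by simp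
  have mass1: "(\<integral>\<^sup>+x. ennreal (exp (\<theta>0 * x) / c) \<partial>\<mu>1) = 1"
   using int1[OF a0] c by (subst nn_integral_eq_integral) (auto simp flip: c_def)
  have mass2: "(\<integral>\<^sup>+x. ennreal (exp (\<theta>0 * x) / c) \<partial>\<mu>2) = 1"
   using int2[OF a0] c by (subst nn_integral_eq_integral) (auto simp flip: c2)
  have conv: "M1 = M2"
   if M1: "M1 = density \<mu>1 (%x. ennreal (exp (\<theta>0 * x) / c))" and M2: "M2 = density \<mu>2 (%x. ennreal (exp (\<theta>0 * x) / c))" for M1 M2
  proof (rule Levy_uniqueness)
   show "real_distribution M1"
    unfolding M1 real_distribution_def real_distribution_axioms_def
    using mass1 sets_eq_imp_space_eq[OF S1]
    by (auto intro!: prob_spaceI simp: emeasure_density S1)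
   show "real_distribution M2"
    unfolding M2 real_distribution_def real_distribution_axioms_def
    using mass2 sets_eq_imp_space_eq[OF S2]
    by (auto intro!: prob_spaceI simp: emeasure_density S2)
   show "char M1 = char M2"
   proof
    fix t :: real
    have *: "(exp (\<theta>0 * x) / c) *\<^sub>R iexp (t * x) = exp (Complex \<theta>0 t * of_real x) / of_real c" for x
     by (simp add: scaleR_conv_of_real exp_of_real[symmetric] mult_exp_exp Complex_eq algebra_simps)
    have "char M1 t = F1 (Complex \<theta>0 t) / c"
    proof -
     have "char M1 t = (\<integral>x. (exp (\<theta>0 * x) / c) *\<^sub>R iexp (t * x) \<partial>\<mu>1)"
      unfolding char_def M1 using c by (intro integral_density) auto
     thus ?thesis unfolding * F1_def by simp
    qed
    moreover have "char M2 t = F2 (Complex \<theta>0 t) / c"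
    proof -
     have "char M2 t = (\<integral>x. (exp (\<theta>0 * x) / c) *\<^sub>R iexp (t * x) \<partial>\<mu>2)"
      unfolding char_def M2 using c by (intro integral_density) auto
     thus ?thesis unfolding * F2_def by simp
    qed
    ultimately show "char M1 t = char M2 t" using Feq[of "Complex \<theta>0 t"] a0 by simp
   qed
  qed
  have "\<mu>1 = density (density \<mu>1 (%x. ennreal (exp (\<theta>0 * x) / c))) (%x. ennreal (c * exp (- \<theta>0 * x)))"
   using c by (subst density_density_eq) (auto simp: ennreal_mult[symmetric] mult_exp_exp density_1)
  also have "... = density (density \<mu>2 (%x. ennreal (exp (\<theta>0 * x) / c))) (%x. ennreal (c * exp (- \<theta>0 * x)))"
   using conv[OF refl refl] by simp
  also have "... = \<mu>2"
   using c by (subst density_density_eq) (auto simp: ennreal_mult[symmetric] mult_exp_exp density_1)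
  finally show ?thesis .
 qed
qed

section \<open>Potentials of exponential functionals\<close>

text \<open>The right-hand side of the potential identity is an absolutely continuous measure plus
  an occupation measure that need not have a density. To be determined by its Laplace transform the
  sum has to be one measure.\<close>

definition add_measure :: "'a measure => 'a measure => 'a measure" where
 "add_measure \<mu> \<nu> = measure_of (space \<mu>) (sets \<mu>) (%A. emeasure \<mu> A + emeasure \<nu> A)"

lemma sets_add_measure [simp, measurable_cong]: "sets (add_measure \<mu> \<nu>) = sets \<mu>"
 by (simp add: add_measure_def)

lemma emeasure_add_measure:
 assumes "sets \<nu> = sets \<mu>" "A \<in> sets \<mu>"
 shows "emeasure (add_measure \<mu> \<nu>) A = emeasure \<mu> A + emeasure \<nu> A"
proof (rule emeasure_measure_of[OF add_measure_def])
 show "countably_additive (sets (add_measure \<mu> \<nu>)) (%A. emeasure \<mu> A + emeasure \<nu> A)"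
  unfolding countably_additive_def
 proof (intro allI impI)
  fix A :: "nat => 'a set"
  assume A: "range A \<subseteq> sets (add_measure \<mu> \<nu>)" "disjoint_family A"
  thus "(\<Sum>i. emeasure \<mu> (A i) + emeasure \<nu> (A i)) = emeasure \<mu> (\<Union> (range A)) + emeasure \<nu> (\<Union> (range A))"
   by (subst suminf_add[symmetric]) (auto simp: suminf_emeasure assms(1))
 qed
qed (use assms sets.sets_into_space[of _ \<mu>] in \<open>auto simp: positive_def\<close>)

lemma nn_integral_add_measure:
 assumes s: "sets \<nu> = sets \<mu>" and f: "f \<in> borel_measurable \<mu>"
 shows "(\<integral>\<^sup>+x. f x \<partial>add_measure \<mu> \<nu>) = (\<integral>\<^sup>+x. f x \<partial>\<mu>) + (\<integral>\<^sup>+x. f x \<partial>\<nu>)"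
 using f
proof (induction rule: borel_measurable_induct)
 case (cong f g)
 have sp: "space \<nu> = space \<mu>" "space (add_measure \<mu> \<nu>) = space \<mu>"
  using s sets_add_measure[of \<mu> \<nu>] sets_eq_imp_space_eq by blast+
 have "integral\<^sup>N N f = integral\<^sup>N N g" if "space N = space \<mu>" for N
  using cong(3) that by (intro nn_integral_cong) auto
 thus ?case using cong(4) sp by metis
next
 case (set A)
 thus ?case using s by (simp add: emeasure_add_measure)
next
 case (mult u c)
 have "u \<in> borel_measurable \<nu>" "u \<in> borel_measurable (add_measure \<mu> \<nu>)"
  using mult(2) s by (auto cong: measurable_cong_sets)
 thus ?case using mult by (simp add: nn_integral_cmult distrib_left)
next
 case (add u v)
 have "u \<in> borel_measurable \<nu>" "u \<in> borel_measurable (add_measure \<mu> \<nu>)"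
  "v \<in> borel_measurable \<nu>" "v \<in> borel_measurable (add_measure \<mu> \<nu>)"
  using add(1,3) s by (auto cong: measurable_cong_sets)
 thus ?case using add by (simp add: nn_integral_add add_ac)
next
 case (seq U)
 have m: "!!i. U i \<in> borel_measurable \<nu>" "!!i. U i \<in> borel_measurable (add_measure \<mu> \<nu>)"
  using seq(1) s by (auto cong: measurable_cong_sets)
 have inc: "incseq (%i. integral\<^sup>N \<mu> (U i))" "incseq (%i. integral\<^sup>N \<nu> (U i))"
  using seq(3) by (auto simp: incseq_def le_fun_def intro!: nn_integral_mono)
 have "integral\<^sup>N N (Sup (range U)) = (SUP i. integral\<^sup>N N (U i))" if "!!i. U i \<in> borel_measurable N" for N
  using nn_integral_monotone_convergence_SUP[OF seq(3) that] by (simp add: SUP_apply[abs_def])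
 note * = this
 show ?case
  unfolding *[OF m(1)] *[OF m(2)] *[OF seq(1)] seq.IH by (rule ennreal_SUP_add[OF inc])
qed

text \<open>Only exponential moments of the one-dimensional marginals are recorded, so that both
  \<open>X\<close> and the drifted process \<open>X t w - \<delta> * t\<close> are
  instances.\<close>

locale exponential_process = prob_space M for M :: "'a measure" +
 fixes X :: "real => 'a => real" and \<psi> :: "real => real"
 assumes X_joint [measurable]: "(%(t, w). X t w) \<in> borel_measurable (borel \<Otimes>\<^sub>M M)"
  and exp_integrable: "!!t r. 0 <= t ==> 0 <= r ==> integrable M (%w. exp (r * X t w))"
  and exp_expectation: "!!t r. 0 <= t ==> 0 <= r ==> expectation (%w. exp (r * X t w)) = exp (t * \<psi> r)"
begin

lemma X_meas [measurable]: "X t \<in> borel_measurable M"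
 using measurable_Pair2[OF X_joint, of t] by simp

lemma nn_exp: "0 <= t ==> 0 <= r ==> (\<integral>\<^sup>+w. ennreal (exp (r * X t w)) \<partial>M) = ennreal (exp (t * \<psi> r))"
 using exp_integrable[of t r] exp_expectation[of t r] by (simp add: nn_integral_eq_integral)

end

locale scaled_process = exponential_process M X \<psi> for M :: "'a measure" and X \<psi> +
 fixes q a :: real and W :: "real => real"
 assumes a_nonneg: "0 <= a"
  and W_meas [measurable]: "W \<in> borel_measurable borel"
  and W_nonneg: "!!x. 0 <= W x"
  and psi_gt: "!!r. a < r ==> q < \<psi> r"
  and W_transform: "!!r. a < r ==> (\<integral>\<^sup>+x. ennreal (exp (- (r * x)) * W x) \<partial>lborel) = ennreal (1 / (\<psi> r - q))"
begin

lemma W_transform_shift: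
 assumes "a < r"
 shows "(\<integral>\<^sup>+z. ennreal (W (y - z)) * ennreal (exp (r * z)) \<partial>lborel) = ennreal (exp (r * y) / (\<psi> r - q))"
proof -
 have "(\<integral>\<^sup>+z. ennreal (W (y - z)) * ennreal (exp (r * z)) \<partial>lborel)
   = (\<integral>\<^sup>+x. ennreal (W x) * ennreal (exp (r * (y - x))) \<partial>lborel)"
  by (subst nn_integral_real_affine[where c="-1" and t=y]) auto
 also have "... = (\<integral>\<^sup>+x. ennreal (exp (r * y)) * ennreal (exp (- (r * x)) * W x) \<partial>lborel)"
  by (intro nn_integral_cong) (auto simp: ennreal_mult[symmetric] W_nonneg exp_diff right_diff_distrib exp_minus field_simps)
 also have "... = ennreal (exp (r * y) / (\<psi> r - q))"
  using psi_gt[OF assms] by (subst nn_integral_cmult) (auto simp: W_transform[OF assms] ennreal_mult[symmetric])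
 finally show ?thesis .
qed

text \<open>Both sides are integrals of \<open>k\<close> against measures on the line. For
  \<open>k z = exp (r * z)\<close> each of them equals exp ((\<psi> r - q) * t) / (\<psi> r - q), so
  the measures agree by uniqueness. Formally this is Dynkin's formula: convolution with
  \<open>W\<close> inverts generator minus \<open>q\<close>.\<close>

lemma potential_identity_0:
 fixes k :: "real => ennreal"
 assumes [measurable]: "k \<in> borel_measurable borel" and t: "0 <= t"
 shows "ennreal (exp (- (q * t))) * (\<integral>\<^sup>+w. (\<integral>\<^sup>+z. ennreal (W (X t w - z)) * k z \<partial>lborel) \<partial>M)
   = (\<integral>\<^sup>+z. ennreal (W (- z)) * k z \<partial>lborel)
    + (\<integral>\<^sup>+s\<in>{0..t}. ennreal (exp (- (q * s))) * (\<integral>\<^sup>+w. k (X s w) \<partial>M) \<partial>lborel)"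
proof -
 interpret P: pair_sigma_finite lborel M ..
 define \<mu>1 where "\<mu>1 = density lborel (%z. \<integral>\<^sup>+w. ennreal (exp (- (q * t))) * ennreal (W (X t w - z)) \<partial>M)"
 \<comment> \<open>Discounted occupation measure of the process up to time \<open>t\<close>.\<close>
 define U where "U = distr (density (lborel \<Otimes>\<^sub>M M) (%(s, w). ennreal (exp (- (q * s))) * indicator {0..t} s)) borel (%(s, w). X s w)"
 define \<mu>2 where "\<mu>2 = add_measure (density lborel (%z. ennreal (W (- z)))) U"
 have [measurable]: "(%x. X (fst x) (snd x)) \<in> borel_measurable (borel \<Otimes>\<^sub>M M)"
  using X_joint by (simp add: case_prod_beta')
 have 1: "(\<integral>\<^sup>+z. f z \<partial>\<mu>1) = ennreal (exp (- (q * t))) * (\<integral>\<^sup>+w. (\<integral>\<^sup>+z. ennreal (W (X t w - z)) * f z \<partial>lborel) \<partial>M)"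
  if [measurable]: "f \<in> borel_measurable borel" for f :: "real => ennreal"
 proof -
  have "(\<integral>\<^sup>+z. f z \<partial>\<mu>1) = (\<integral>\<^sup>+z. (\<integral>\<^sup>+w. ennreal (exp (- (q * t))) * (ennreal (W (X t w - z)) * f z) \<partial>M) \<partial>lborel)"
   unfolding \<mu>1_def
   by (subst nn_integral_density) (auto simp: nn_integral_multc[symmetric] mult.assoc)
  also have "... = (\<integral>\<^sup>+w. (\<integral>\<^sup>+z. ennreal (exp (- (q * t))) * (ennreal (W (X t w - z)) * f z) \<partial>lborel) \<partial>M)"
   by (rule P.Fubini'[symmetric]) measurable
  also have "... = (\<integral>\<^sup>+w. ennreal (exp (- (q * t))) * (\<integral>\<^sup>+z. ennreal (W (X t w - z)) * f z \<partial>lborel) \<partial>M)"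
   by (intro nn_integral_cong nn_integral_cmult) measurable
  also have "... = ennreal (exp (- (q * t))) * (\<integral>\<^sup>+w. (\<integral>\<^sup>+z. ennreal (W (X t w - z)) * f z \<partial>lborel) \<partial>M)"
   by (intro nn_integral_cmult) measurable
  finally show ?thesis .
 qed
 have 2: "(\<integral>\<^sup>+z. f z \<partial>\<mu>2) = (\<integral>\<^sup>+z. ennreal (W (- z)) * f z \<partial>lborel)
    + (\<integral>\<^sup>+s\<in>{0..t}. ennreal (exp (- (q * s))) * (\<integral>\<^sup>+w. f (X s w) \<partial>M) \<partial>lborel)"
  if [measurable]: "f \<in> borel_measurable borel" for f :: "real => ennreal"
 proof -
  have "(\<integral>\<^sup>+z. f z \<partial>\<mu>2) = (\<integral>\<^sup>+z. f z \<partial>density lborel (%z. ennreal (W (- z)))) + (\<integral>\<^sup>+z. f z \<partial>U)"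
   unfolding \<mu>2_def by (rule nn_integral_add_measure) (auto simp: U_def)
  also have "(\<integral>\<^sup>+z. f z \<partial>density lborel (%z. ennreal (W (- z)))) = (\<integral>\<^sup>+z. ennreal (W (- z)) * f z \<partial>lborel)"
   by (rule nn_integral_density) auto
  also have "(\<integral>\<^sup>+z. f z \<partial>U) = (\<integral>\<^sup>+p. ennreal (exp (- (q * fst p))) * indicator {0..t} (fst p) * f (X (fst p) (snd p)) \<partial>(lborel \<Otimes>\<^sub>M M))"
   unfolding U_def by (simp add: nn_integral_distr nn_integral_density case_prod_beta')
  also have "... = (\<integral>\<^sup>+s. (\<integral>\<^sup>+w. (ennreal (exp (- (q * s))) * indicator {0..t} s) * f (X s w) \<partial>M) \<partial>lborel)"
   by (subst nn_integral_fst[symmetric]) auto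
  also have "... = (\<integral>\<^sup>+s\<in>{0..t}. ennreal (exp (- (q * s))) * (\<integral>\<^sup>+w. f (X s w) \<partial>M) \<partial>lborel)"
   by (intro nn_integral_cong, subst nn_integral_cmult) (auto simp: mult_ac)
  finally show ?thesis .
 qed
 have s1: "sets \<mu>1 = sets borel" and s2: "sets \<mu>2 = sets borel" by (auto simp: \<mu>1_def \<mu>2_def)
 have T1: "(\<integral>\<^sup>+z. ennreal (exp (r * z)) \<partial>\<mu>1) = ennreal (exp ((\<psi> r - q) * t) / (\<psi> r - q))" if r: "a < r" for r
 proof -
  have "(\<integral>\<^sup>+z. ennreal (exp (r * z)) \<partial>\<mu>1) = ennreal (exp (- (q * t))) * (\<integral>\<^sup>+w. ennreal (1 / (\<psi> r - q)) * ennreal (exp (r * X t w)) \<partial>M)"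
   using psi_gt[OF r] by (simp add: 1 W_transform_shift[OF r] ennreal_mult[symmetric])
  also have "... = ennreal (exp (- (q * t)) * (1 / (\<psi> r - q) * exp (t * \<psi> r)))"
   using psi_gt[OF r] t r a_nonneg by (subst nn_integral_cmult) (auto simp: nn_exp ennreal_mult[symmetric])
  finally show ?thesis by (simp add: mult_exp_exp algebra_simps)
 qed
 have T2: "(\<integral>\<^sup>+z. ennreal (exp (r * z)) \<partial>\<mu>2) = ennreal (exp ((\<psi> r - q) * t) / (\<psi> r - q))" if r: "a < r" for r
 proof -
  let ?c = "\<psi> r - q"
  have c: "?c > 0" using psi_gt[OF r] by simp
  have "(\<integral>\<^sup>+z. ennreal (exp (r * z)) \<partial>\<mu>2) = ennreal (1 / ?c) + (\<integral>\<^sup>+s\<in>{0..t}. ennreal (exp (- (q * s))) * (\<integral>\<^sup>+w. ennreal (exp (r * X s w)) \<partial>M) \<partial>lborel)"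
   using W_transform_shift[OF r, of 0] by (simp add: 2)
  also have "(\<integral>\<^sup>+s\<in>{0..t}. ennreal (exp (- (q * s))) * (\<integral>\<^sup>+w. ennreal (exp (r * X s w)) \<partial>M) \<partial>lborel)
    = (\<integral>\<^sup>+s\<in>{0..t}. ennreal (exp (?c * s)) \<partial>lborel)"
  proof (intro nn_integral_cong)
   fix s :: real
   show "ennreal (exp (- (q * s))) * (\<integral>\<^sup>+w. ennreal (exp (r * X s w)) \<partial>M) * indicator {0..t} s = ennreal (exp (?c * s)) * indicator {0..t} s"
    using nn_exp[of s r] r a_nonneg
    by (auto simp: indicator_def ennreal_mult[symmetric] mult_exp_exp algebra_simps)
  qed
  also have "... = ennreal (exp (?c * t) / ?c - exp (?c * 0) / ?c)"
   using c t by (intro nn_integral_FTC_Icc) (auto intro!: derivative_eq_intros)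
  also have "ennreal (1 / ?c) + ennreal (exp (?c * t) / ?c - exp (?c * 0) / ?c) = ennreal (exp (?c * t) / ?c)"
   using c t by (subst ennreal_plus[symmetric]) (auto simp: divide_right_mono diff_divide_distrib[symmetric] add_divide_distrib[symmetric])
  finally show ?thesis .
 qed
 have "\<mu>1 = \<mu>2"
  by (rule bilateral_laplace_unique[OF s1 s2, of a]) (auto simp: T1 T2)
 thus ?thesis using 1[of k] 2[of k] by simp
qed

lemma potential_identity_nn:
 fixes k :: "real => ennreal"
 assumes [measurable]: "k \<in> borel_measurable borel" and t: "0 <= t"
 shows "ennreal (exp (- (q * t))) * (\<integral>\<^sup>+w. (\<integral>\<^sup>+z. ennreal (W (y + X t w - z)) * k z \<partial>lborel) \<partial>M)
   = (\<integral>\<^sup>+z. ennreal (W (y - z)) * k z \<partial>lborel)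
    + (\<integral>\<^sup>+s\<in>{0..t}. ennreal (exp (- (q * s))) * (\<integral>\<^sup>+w. k (y + X s w) \<partial>M) \<partial>lborel)"
proof -
 have shift: "(\<integral>\<^sup>+z. ennreal (W (u - z)) * k (y + z) \<partial>lborel) = (\<integral>\<^sup>+z. ennreal (W (y + u - z)) * k z \<partial>lborel)" for u
  by (subst nn_integral_real_affine[where c="1" and t="-y"]) (auto simp: algebra_simps)
 show ?thesis
  using potential_identity_0[of "%z. k (y + z)", OF _ t] shift shift[of 0] by simp
qed

definition pot :: "(real => real) => real => real" where
 "pot k y = (LBINT z. W (y - z) * k z)"

text \<open>The bound also forces decay at minus infinity, so that the convolution over the whole
  line converges; an exponent above \<open>a\<close> is one at which the transform of
  \<open>W\<close> is finite.\<close>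

definition dominated :: "(real => real) => bool" where
 "dominated k \<longleftrightarrow> k \<in> borel_measurable borel & (EX A r. a < r & (ALL z. \<bar>k z\<bar> <= A * exp (r * z)))"

lemma dominated_E:
 assumes "dominated k"
 obtains A r where "a < r" "0 <= A" "!!z. \<bar>k z\<bar> <= A * exp (r * z)"
proof -
 from assms obtain A r where *: "a < r" "!!z. \<bar>k z\<bar> <= A * exp (r * z)" unfolding dominated_def by auto
 hence "0 <= A" using *(2)[of 0] abs_ge_zero[of "k 0"] by simp
 thus ?thesis using * that by blast
qed

lemma dominated_pos_part: "dominated k ==> dominated (%z. max 0 (k z))"
 and dominated_neg_part: "dominated k ==> dominated (%z. max 0 (- k z))"
 unfolding dominated_def
 by (auto simp: abs_le_iff intro!: borel_measurable_max) (meson abs_ge_zero order_trans abs_le_iff)+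

lemma pot_integrable:
 assumes "dominated k"
 shows "integrable lborel (%z. W (y - z) * k z)"
proof -
 obtain A r where A: "a < r" "0 <= A" "!!z. \<bar>k z\<bar> <= A * exp (r * z)" using dominated_E[OF assms] by metis
 have [measurable]: "k \<in> borel_measurable borel" using assms by (simp add: dominated_def)
 have "integrable lborel (%z. W (y - z) * exp (r * z))"
  using W_transform_shift[OF A(1), of y]
  by (intro integrableI_bounded) (auto simp: abs_mult W_nonneg ennreal_mult)
 hence "integrable lborel (%z. A * (W (y - z) * exp (r * z)))" by simp
 thus ?thesis
 proof (rule Bochner_Integration.integrable_bound)
  show "AE z in lborel. norm (W (y - z) * k z) <= norm (A * (W (y - z) * exp (r * z)))"
   using A by (intro AE_I2) (auto simp: abs_mult W_nonneg mult.left_commute[of A] intro!: mult_left_mono)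
 qed measurable
qed

lemma expect_integrable:
 assumes "dominated k" "0 <= s"
 shows "integrable M (%w. k (y + X s w))"
proof -
 obtain A r where A: "a < r" "0 <= A" "!!z. \<bar>k z\<bar> <= A * exp (r * z)" using dominated_E[OF assms(1)] by metis
 have [measurable]: "k \<in> borel_measurable borel" using assms by (simp add: dominated_def)
 have "integrable M (%w. A * exp (r * y) * exp (r * X s w))"
  using A a_nonneg assms(2) by (intro integrable_mult_right exp_integrable) auto
 thus ?thesis
  by (rule Bochner_Integration.integrable_bound)
    (use A in \<open>auto simp: abs_mult mult.assoc mult_exp_exp distrib_left[symmetric]\<close>)
qed

lemma pot_identity_nonneg:
 assumes k: "dominated k" and k0: "!!z. 0 <= k z" and t: "0 <= t"
 shows "integrable M (%w. pot k (y + X t w))" (is ?A)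
  and "set_integrable lborel {0..t} (%s. exp (- (q * s)) * expectation (%w. k (y + X s w)))" (is ?B)
  and "exp (- (q * t)) * expectation (%w. pot k (y + X t w)) =
   pot k y + (LBINT s:{0..t}. exp (- (q * s)) * expectation (%w. k (y + X s w)))" (is ?C)
proof -
 obtain A r where A: "a < r" "0 <= A" "!!z. \<bar>k z\<bar> <= A * exp (r * z)" using dominated_E[OF k] by metis
 have [measurable]: "k \<in> borel_measurable borel" using k by (simp add: dominated_def)
 have nnpot: "(\<integral>\<^sup>+z. ennreal (W (y - z)) * ennreal (k z) \<partial>lborel) = ennreal (pot k y)" for y
  using pot_integrable[OF k, of y] k0 W_nonneg unfolding pot_def
  by (subst nn_integral_eq_integral[symmetric]) (auto simp: ennreal_mult)
 have pot0: "0 <= pot k y" for y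
  unfolding pot_def using k0 W_nonneg by (intro integral_nonneg_AE) auto
 have [measurable]: "pot k \<in> borel_measurable borel"
  unfolding pot_def[abs_def] by measurable
 have E: "(\<integral>\<^sup>+w. ennreal (k (y + X s w)) \<partial>M) = ennreal (expectation (%w. k (y + X s w)))" if "0 <= s" for s
  using expect_integrable[OF k that, of y] k0 by (intro nn_integral_eq_integral) auto
 have E0: "0 <= expectation (%w. k (y + X s w))" for s
  using k0 by (intro integral_nonneg_AE) auto
 have id: "ennreal (exp (- (q * t))) * (\<integral>\<^sup>+w. ennreal (pot k (y + X t w)) \<partial>M) =
   ennreal (pot k y) + (\<integral>\<^sup>+s. ennreal (exp (- (q * s)) * expectation (%w. k (y + X s w)) * indicator {0..t} s) \<partial>lborel)"
 proof -
  have "(\<integral>\<^sup>+s\<in>{0..t}. ennreal (exp (- (q * s))) * (\<integral>\<^sup>+w. ennreal (k (y + X s w)) \<partial>M) \<partial>lborel) =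
   (\<integral>\<^sup>+s. ennreal (exp (- (q * s)) * expectation (%w. k (y + X s w)) * indicator {0..t} s) \<partial>lborel)"
   using E0 by (intro nn_integral_cong) (auto simp: E ennreal_mult indicator_def)
  thus ?thesis
   using potential_identity_nn[of "%z. ennreal (k z)" t y, OF _ t] by (simp add: nnpot)
 qed
 have Ebound: "expectation (%w. k (y + X s w)) <= A * exp (r * y) * exp (s * \<psi> r)" if "0 <= s" for s
 proof -
  have "expectation (%w. k (y + X s w)) <= expectation (%w. A * exp (r * y) * exp (r * X s w))"
   using A a_nonneg that abs_ge_self
   by (intro integral_mono expect_integrable k integrable_mult_right exp_integrable)
     (auto simp: mult.assoc mult_exp_exp distrib_left[symmetric] intro: order_trans)
  also have "... = A * exp (r * y) * exp (s * \<psi> r)"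
   using exp_expectation[OF that, of r] A(1) a_nonneg by simp
  finally show ?thesis .
 qed
 have [measurable]: "(%x. X (fst x) (snd x)) \<in> borel_measurable (borel \<Otimes>\<^sub>M M)"
  using X_joint by (simp add: case_prod_beta')
 have meas: "(%s. exp (- (q * s)) * expectation (%w. k (y + X s w))) \<in> borel_measurable lborel"
  by measurable
 have "continuous_on {0..t} (%s. exp (- (q * s)) * (A * exp (r * y) * exp (s * \<psi> r)))"
  by (intro continuous_intros)
 hence ci: "set_integrable lborel {0..t} (%s. exp (- (q * s)) * (A * exp (r * y) * exp (s * \<psi> r)))"
  by (intro borel_integrable_atLeastAtMost')
 show B: ?B
  using meas E0 Ebound A by (intro set_integrable_bound[OF ci]) (auto simp: set_borel_measurable_def abs_mult mult.assoc intro!: mult_left_mono)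
 let ?I = "LBINT s:{0..t}. exp (- (q * s)) * expectation (%w. k (y + X s w))"
 have I: "(\<integral>\<^sup>+s. ennreal (exp (- (q * s)) * expectation (%w. k (y + X s w)) * indicator {0..t} s) \<partial>lborel) = ennreal ?I"
  unfolding set_lebesgue_integral_def
  using B E0 unfolding set_integrable_def
  by (subst nn_integral_eq_integral[symmetric]) (auto simp: mult_ac)
 have I0: "0 <= ?I"
  unfolding set_lebesgue_integral_def using E0 by (intro integral_nonneg_AE) auto
 have id': "ennreal (exp (- (q * t))) * (\<integral>\<^sup>+w. ennreal (pot k (y + X t w)) \<partial>M) = ennreal (pot k y + ?I)"
  using id I I0 pot0 by (simp add: ennreal_plus)
 hence "(\<integral>\<^sup>+w. ennreal (pot k (y + X t w)) \<partial>M) < \<infinity>"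
  by (auto simp: less_top[symmetric] ennreal_mult_eq_top_iff)
 thus A': ?A
  using pot0 by (intro integrableI_nonneg) auto
 hence "(\<integral>\<^sup>+w. ennreal (pot k (y + X t w)) \<partial>M) = ennreal (expectation (%w. pot k (y + X t w)))"
  using pot0 by (intro nn_integral_eq_integral) auto
 moreover have "0 <= expectation (%w. pot k (y + X t w))" using pot0 by (intro integral_nonneg_AE) auto
 ultimately show ?C
  using id' I0 pot0[of y] by (auto simp: ennreal_mult[symmetric] simp del: ennreal_plus)
qed

lemma pot_split:
 assumes k: "dominated k"
 shows "pot k y = pot (%z. max 0 (k z)) y - pot (%z. max 0 (- k z)) y"
proof -
 have "pot (%z. max 0 (k z)) y - pot (%z. max 0 (- k z)) y = (LBINT z. W (y - z) * max 0 (k z) - W (y - z) * max 0 (- k z))"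
  unfolding pot_def by (intro Bochner_Integration.integral_diff[symmetric] pot_integrable dominated_pos_part dominated_neg_part k)
 also have "... = pot k y" unfolding pot_def by (intro Bochner_Integration.integral_cong) (auto simp: max_def)
 finally show ?thesis by simp
qed

theorem pot_identity:
 assumes k: "dominated k" and t: "0 <= t"
 shows "integrable M (%w. pot k (y + X t w))" (is ?A)
  and "set_integrable lborel {0..t} (%s. exp (- (q * s)) * expectation (%w. k (y + X s w)))" (is ?B)
  and "exp (- (q * t)) * expectation (%w. pot k (y + X t w)) =
   pot k y + (LBINT s:{0..t}. exp (- (q * s)) * expectation (%w. k (y + X s w)))" (is ?C)
proof -
 let ?p = "%z. max 0 (k z)" and ?n = "%z. max 0 (- k z)"
 have p: "dominated ?p" and n: "dominated ?n" using k dominated_pos_part dominated_neg_part by auto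
 note P = pot_identity_nonneg[OF p _ t, of y] and N = pot_identity_nonneg[OF n _ t, of y]
 have Es: "expectation (%w. k (y + X s w)) = expectation (%w. ?p (y + X s w)) - expectation (%w. ?n (y + X s w))" if "0 <= s" for s
  unfolding Bochner_Integration.integral_diff[OF expect_integrable[OF p that] expect_integrable[OF n that], symmetric]
  by (rule arg_cong[where f=expectation]) (auto simp: max_def fun_eq_iff)
 show ?A using P(1) N(1) by (simp add: pot_split[OF k])
 have D: "set_integrable lborel {0..t} (%s. exp (- (q * s)) * expectation (%w. ?p (y + X s w)) - exp (- (q * s)) * expectation (%w. ?n (y + X s w)))"
  using P(2) N(2) by (intro set_integral_diff) auto
 show ?B
  by (rule iffD1[OF set_integrable_cong[OF refl refl] D]) (auto simp: Es algebra_simps)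
 have "(LBINT s:{0..t}. exp (- (q * s)) * expectation (%w. k (y + X s w))) =
   (LBINT s:{0..t}. exp (- (q * s)) * expectation (%w. ?p (y + X s w)) - exp (- (q * s)) * expectation (%w. ?n (y + X s w)))"
  by (intro set_lebesgue_integral_cong) (auto simp: Es algebra_simps)
 also have "... = (LBINT s:{0..t}. exp (- (q * s)) * expectation (%w. ?p (y + X s w))) - (LBINT s:{0..t}. exp (- (q * s)) * expectation (%w. ?n (y + X s w)))"
  using P(2) N(2) by (intro set_integral_diff) auto
 finally show ?C
  using P N by (simp add: pot_split[OF k] right_diff_distrib)
qed

end

section \<open>Small-time bounds for exponential moments of the increments\<close>

definition ell :: "real => real => real" where
 "ell \<rho> x = exp (\<rho> * x) - 1 - \<rho> * x"

lemma ell_nonneg: "0 <= ell \<rho> x"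
 using exp_ge_add_one_self[of "\<rho> * x"] unfolding ell_def by linarith

lemma one_plus_exp_minus_mono:
 fixes v v0 :: real
 assumes "0 < v0" "v0 <= v"
 shows "(1 + v) * exp (- v) <= (1 + v0) * exp (- v0)"
proof -
 have "1 + (v - v0) / (1 + v0) <= exp (v - v0)"
 proof -
  have "(v - v0) / (1 + v0) <= (v - v0) / 1" using assms by (intro divide_left_mono) auto
  thus ?thesis using exp_ge_add_one_self[of "v - v0"] unfolding div_by_1 by linarith
 qed
 hence "(1 + v0) * (1 + (v - v0) / (1 + v0)) <= (1 + v0) * exp (v - v0)"
  using assms by (intro mult_left_mono) auto
 moreover have "(1 + v0) * (1 + (v - v0) / (1 + v0)) = 1 + v" using assms by (simp add: field_simps)
 ultimately have "(1 + v) * exp (- v) <= (1 + v0) * exp (v - v0) * exp (- v)"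
  by (simp add: mult_right_mono)
 thus ?thesis by (simp add: mult.assoc mult_exp_exp)
qed

lemma one_plus_exp_minus_less:
 fixes v :: real
 assumes "0 < v"
 shows "(1 + v) * exp (- v) < 1"
proof -
 have "1 + v < exp v" using assms exp_minus_greater[of "- v"] by simp
 thus ?thesis by (simp add: exp_minus field_simps)
qed

text \<open>\<open>ell\<close> is the exponential minus its first-order Taylor polynomial. With
  \<open>v = \<rho> * x\<close> it factors as \<open>exp v * (1 - (1 + v) * exp (- v))\<close>, and
  the bracket increases in \<open>v > 0\<close>.\<close>

lemma exp_le_ell:
 assumes "0 < \<rho>" "0 < \<epsilon>" "\<epsilon> <= x"
 shows "exp (\<rho> * x) * (1 - (1 + \<rho> * \<epsilon>) * exp (- (\<rho> * \<epsilon>))) <= ell \<rho> x"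
proof -
 have "(1 + \<rho> * x) * exp (- (\<rho> * x)) <= (1 + \<rho> * \<epsilon>) * exp (- (\<rho> * \<epsilon>))"
  using assms by (intro one_plus_exp_minus_mono) auto
 hence "exp (\<rho> * x) * (1 - (1 + \<rho> * \<epsilon>) * exp (- (\<rho> * \<epsilon>))) <= exp (\<rho> * x) * (1 - (1 + \<rho> * x) * exp (- (\<rho> * x)))"
  by (intro mult_left_mono) auto
 also have "... = ell \<rho> x"
  by (simp add: ell_def algebra_simps mult_exp_exp exp_minus)
 finally show ?thesis .
qed

lemma abs_le_ell:
 assumes l: "0 < \<rho>" and e: "0 < \<epsilon>"
 obtains c where "0 < c" "!!x. x <= - \<epsilon> ==> c * \<bar>x\<bar> <= ell \<rho> x"
proof -
 \<comment> \<open>\<open>g\<close> is the value of \<open>ell\<close> at minus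
   \<open>\<epsilon>\<close>, and minus \<open>s\<close> is its slope there. By convexity the
   tangent line at that point lies below \<open>ell\<close>; to the left of the point it dominates
   \<open>c * \<bar>x\<bar>\<close>.\<close>
 define s where "s = \<rho> * (1 - exp (- (\<rho> * \<epsilon>)))"
 define g where "g = exp (- (\<rho> * \<epsilon>)) - 1 + \<rho> * \<epsilon>"
 have le: "\<rho> * \<epsilon> > 0" using l e by simp
 have s: "s > 0" using le l by (simp add: s_def)
 have "(1 - \<rho> * \<epsilon>) < exp (- (\<rho> * \<epsilon>))"
  using exp_minus_greater[of "\<rho> * \<epsilon>"] le by (metis less_irrefl)
 hence g: "g > 0" by (simp add: g_def)
 define c where "c = min (g / \<epsilon>) s"
 have c: "c > 0" using s g e by (simp add: c_def)
 moreover have "c * \<bar>x\<bar> <= ell \<rho> x" if x: "x <= - \<epsilon>" for x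
 proof -
  define u where "u = - x"
  have u: "u >= \<epsilon>" "x = - u" using x by (auto simp: u_def)
  have "exp (- (\<rho> * \<epsilon>)) * (1 + (- (\<rho> * (u - \<epsilon>)))) <= exp (- (\<rho> * \<epsilon>)) * exp (- (\<rho> * (u - \<epsilon>)))"
   by (intro mult_left_mono exp_ge_add_one_self) auto
  also have "... = exp (- (\<rho> * u))" by (simp add: mult_exp_exp algebra_simps)
  finally have 1: "exp (- (\<rho> * \<epsilon>)) * (1 - \<rho> * (u - \<epsilon>)) <= exp (- (\<rho> * u))" by simp
  have "c * \<epsilon> <= g" "c <= s" using e by (auto simp: c_def min_le_iff_disj pos_le_divide_eq[symmetric])
  moreover have "c * (u - \<epsilon>) <= s * (u - \<epsilon>)" using \<open>c <= s\<close> u by (intro mult_right_mono) auto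
  ultimately have "c * u <= g + s * (u - \<epsilon>)" by (simp add: algebra_simps)
  also have "... = exp (- (\<rho> * \<epsilon>)) * (1 - \<rho> * (u - \<epsilon>)) - 1 + \<rho> * u"
   by (simp add: g_def s_def algebra_simps)
  also have "... <= ell \<rho> x" using 1 u by (simp add: ell_def)
  finally show ?thesis using u e by simp
 qed
 ultimately show ?thesis using that by blast
qed

locale levy_marginals = exponential_process M X \<psi> for M :: "'a measure" and X \<psi> +
 fixes m K :: real
 assumes X_integrable: "!!t. 0 <= t ==> integrable M (X t)"
  and X_mean: "!!t. 0 <= t ==> expectation (X t) = m * t"
  and psi_growth: "!!\<rho>. 1 <= \<rho> ==> \<psi> \<rho> <= K * \<rho>\<^sup>2"
begin

lemma ell_integrable: "0 <= t ==> 0 <= \<rho> ==> integrable M (%w. ell \<rho> (X t w))"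
 unfolding ell_def by (intro Bochner_Integration.integrable_diff exp_integrable integrable_mult_right X_integrable) auto

lemma ell_expectation: "0 <= t ==> 0 <= \<rho> ==> expectation (%w. ell \<rho> (X t w)) = exp (t * \<psi> \<rho>) - 1 - \<rho> * m * t"
 unfolding ell_def
 by (subst Bochner_Integration.integral_diff Bochner_Integration.integral_diff)
   (auto simp: exp_integrable X_integrable exp_expectation X_mean prob_space Bochner_Integration.integral_diff)

lemma exp_minus_one_le:
 fixes s c :: real
 assumes "0 <= s" "s <= 1"
 shows "exp (s * c) - 1 <= s * (\<bar>c\<bar> * exp \<bar>c\<bar>)"
proof -
 have "exp (- (s * \<bar>c\<bar>)) >= 1 - s * \<bar>c\<bar>" using exp_ge_add_one_self[of "- (s * \<bar>c\<bar>)"] by simp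
 hence "exp (s * \<bar>c\<bar>) * (1 - s * \<bar>c\<bar>) <= exp (s * \<bar>c\<bar>) * exp (- (s * \<bar>c\<bar>))"
  by (intro mult_left_mono) auto
 hence "exp (s * \<bar>c\<bar>) - 1 <= s * \<bar>c\<bar> * exp (s * \<bar>c\<bar>)" by (simp add: mult_exp_exp algebra_simps)
 also have "... <= s * \<bar>c\<bar> * exp \<bar>c\<bar>"
  using assms by (intro mult_left_mono) (auto simp: mult_left_le_one_le)
 finally have "exp (s * \<bar>c\<bar>) - 1 <= s * (\<bar>c\<bar> * exp \<bar>c\<bar>)" by (simp add: mult.assoc)
 moreover have "exp (s * c) <= exp (s * \<bar>c\<bar>)" using assms by (simp add: mult_left_mono)
 ultimately show ?thesis by linarith
qed

lemma ell_expectation_linear: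
 assumes "0 <= \<rho>"
 obtains B where "0 <= B" "!!s. 0 <= s ==> s <= 1 ==> expectation (%w. ell \<rho> (X s w)) <= B * s"
proof -
 let ?B = "\<bar>\<psi> \<rho>\<bar> * exp \<bar>\<psi> \<rho>\<bar> + \<rho> * \<bar>m\<bar>"
 have "expectation (%w. ell \<rho> (X s w)) <= ?B * s" if "0 <= s" "s <= 1" for s
 proof -
  have "- (\<rho> * m * s) <= \<rho> * \<bar>m\<bar> * s"
   using mult_right_mono[OF mult_left_mono[OF abs_ge_minus_self[of m], of \<rho>], of s] assms that by simp
  thus ?thesis
   using exp_minus_one_le[OF that, of "\<psi> \<rho>"] that assms by (simp add: ell_expectation algebra_simps)
 qed
 moreover have "0 <= ?B" using assms by simp
 ultimately show ?thesis using that by blast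
qed

text \<open>Outside the interval of radius \<open>\<epsilon>\<close> the integrand is at most a
  multiple of \<open>ell (r + 1)\<close>: on the right because the larger exponent wins, on the left
  because \<open>ell\<close> grows linearly there. The expectation of \<open>ell\<close> is explicit
  and O(s).\<close>

lemma tail_bound:
 assumes th: "0 <= r" and e: "0 < \<epsilon>"
 obtains B where "0 <= B" "!!s. 0 <= s ==> s <= 1 ==>
  expectation (%w. (1 + \<bar>X s w\<bar> + exp (r * X s w)) * indicator {w. \<epsilon> <= \<bar>X s w\<bar>} w) <= B * s"
  "!!s. 0 <= s ==> integrable M (%w. (1 + \<bar>X s w\<bar> + exp (r * X s w)) * indicator {w. \<epsilon> <= \<bar>X s w\<bar>} w)"
proof -
 define \<rho> where "\<rho> = r + 1"
 have l: "\<rho> >= 1" "\<rho> > 0" using th by (auto simp: \<rho>_def)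
 obtain B1 where B1: "0 <= B1" "!!s. 0 <= s ==> s <= 1 ==> expectation (%w. ell \<rho> (X s w)) <= B1 * s"
  using ell_expectation_linear[of \<rho>] l by auto
 obtain c where c: "0 < c" "!!x. x <= - \<epsilon> ==> c * \<bar>x\<bar> <= ell \<rho> x" using abs_le_ell[of \<rho> \<epsilon>] l e by auto
 define d where "d = 1 - (1 + \<rho> * \<epsilon>) * exp (- (\<rho> * \<epsilon>))"
 have d: "d > 0" unfolding d_def using one_plus_exp_minus_less[of "\<rho> * \<epsilon>"] l e by simp
 define A where "A = (2 / \<epsilon> + 1) / c + 3 / d"
 have A: "A >= 0" unfolding A_def using c d e by (intro add_nonneg_nonneg divide_nonneg_nonneg) auto
 have pw: "(1 + \<bar>x\<bar> + exp (r * x)) * indicator {x. \<epsilon> <= \<bar>x\<bar>} x <= A * ell \<rho> x" for x :: real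
 proof -
  consider "\<epsilon> <= x" | "x <= - \<epsilon>" | "\<bar>x\<bar> < \<epsilon>" by linarith
  thus ?thesis
  proof cases
   case 1
   have "exp (r * x) <= exp (\<rho> * x)" "1 <= exp (\<rho> * x)" using 1 e l by (auto simp: \<rho>_def intro!: mult_right_mono)
   moreover have "x <= exp (\<rho> * x)"
   proof -
    have "x <= \<rho> * x" using 1 e l by simp
    also have "... <= exp (\<rho> * x)" using exp_ge_add_one_self[of "\<rho> * x"] by linarith
    finally show ?thesis .
   qed
   ultimately have "1 + \<bar>x\<bar> + exp (r * x) <= 3 * exp (\<rho> * x)" using 1 e by linarith
   also have "... = 3 / d * (exp (\<rho> * x) * d)" using d by simp
   also have "... <= 3 / d * ell \<rho> x"
    using exp_le_ell[of \<rho> \<epsilon> x] 1 e l d by (intro mult_left_mono) (auto simp: d_def)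
   also have "... <= A * ell \<rho> x"
    unfolding A_def using c d e ell_nonneg by (intro mult_right_mono) auto
   finally show ?thesis using 1 e by (simp add: indicator_def)
  next
   case 2
   have "r * x <= 0" using 2 e th by (simp add: mult_nonneg_nonpos)
   hence "exp (r * x) <= 1" by simp
   moreover have "2 <= 2 / \<epsilon> * \<bar>x\<bar>" using 2 e by (simp add: field_simps)
   ultimately have "1 + \<bar>x\<bar> + exp (r * x) <= (2 / \<epsilon> + 1) * \<bar>x\<bar>" unfolding distrib_right by linarith
   also have "... = (2 / \<epsilon> + 1) / c * (c * \<bar>x\<bar>)" using c by simp
   also have "... <= (2 / \<epsilon> + 1) / c * ell \<rho> x"
    using c 2 e by (intro mult_left_mono) auto
   also have "... <= A * ell \<rho> x"
    unfolding A_def using c d e ell_nonneg by (intro mult_right_mono) auto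
   finally show ?thesis using 2 e by (simp add: indicator_def)
  next
   case 3
   thus ?thesis using A ell_nonneg[of \<rho> x] by (simp add: indicator_def)
  qed
 qed
 let ?f = "%s w. (1 + \<bar>X s w\<bar> + exp (r * X s w)) * indicator {w. \<epsilon> <= \<bar>X s w\<bar>} w"
 have pw': "?f s w <= A * ell \<rho> (X s w)" "0 <= ?f s w" for s w
  using pw[of "X s w"] by (auto simp: indicator_def)
 have int: "integrable M (?f s)" if "0 <= s" for s
 proof (rule Bochner_Integration.integrable_bound)
  show "integrable M (%w. A * ell \<rho> (X s w))" using ell_integrable[OF that] l by auto
  show "?f s \<in> borel_measurable M" by measurable
  show "AE x in M. norm (?f s x) <= norm (A * ell \<rho> (X s x))"
   using pw' A ell_nonneg by (intro AE_I2) (metis abs_of_nonneg order_trans real_norm_def)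
 qed
 have "expectation (?f s) <= A * B1 * s" if "0 <= s" "s <= 1" for s
 proof -
  have "expectation (?f s) <= expectation (%w. A * ell \<rho> (X s w))"
   using pw' l that by (intro integral_mono int integrable_mult_right ell_integrable) auto
  also have "... <= A * (B1 * s)" using B1(2)[OF that] A by (simp add: mult_left_mono)
  finally show ?thesis by (simp add: mult.assoc)
 qed
 thus ?thesis using that[of "A * B1"] A B1 int by simp
qed

text \<open>Here the absence of positive jumps shows. For rate \<open>\<rho>\<close> the expectation
  of \<open>ell\<close> is at most of order \<open>\<rho>\<^sup>2 * t\<close>, by the quadratic
  growth of the exponent, while beyond \<open>\<epsilon>\<close> the ratio of
  \<open>exp (r * x)\<close> to \<open>ell \<rho> x\<close> is at most
  \<open>2 * exp ((r - \<rho>) * \<epsilon>)\<close>. Letting \<open>\<rho>\<close> grow makes the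
  product as small a multiple of \<open>t\<close> as wanted.\<close>

lemma overshoot_bound:
 assumes th: "0 <= r" and e: "0 < \<epsilon>" and \<eta>: "0 < \<eta>"
 obtains t0 where "0 < t0" "!!t. 0 <= t ==> t <= t0 ==>
  expectation (%w. exp (r * X t w) * indicator {w. \<epsilon> <= X t w} w) <= \<eta> * t"
proof -
 have lim: "((%\<rho>. 2 * exp ((r - \<rho>) * \<epsilon>) * (2 * (\<bar>K\<bar> * \<rho>\<^sup>2) + \<rho> * \<bar>m\<bar>)) \<longlongrightarrow> 0) at_top"
  using e by real_asymp
 have lim2: "((%\<rho>. (1 + \<rho> * \<epsilon>) * exp (- (\<rho> * \<epsilon>))) \<longlongrightarrow> 0) at_top"
  using e by real_asymp
 have "\<forall>\<^sub>F \<rho> in at_top. 2 * exp ((r - \<rho>) * \<epsilon>) * (2 * (\<bar>K\<bar> * \<rho>\<^sup>2) + \<rho> * \<bar>m\<bar>) < \<eta> & (1 + \<rho> * \<epsilon>) * exp (- (\<rho> * \<epsilon>)) < 1/2 & \<rho> >= r + 1"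
  by (intro eventually_conj order_tendstoD(2)[OF lim] order_tendstoD(2)[OF lim2] \<eta> eventually_ge_at_top) auto
 then obtain \<rho> where l: "2 * exp ((r - \<rho>) * \<epsilon>) * (2 * (\<bar>K\<bar> * \<rho>\<^sup>2) + \<rho> * \<bar>m\<bar>) < \<eta>" "(1 + \<rho> * \<epsilon>) * exp (- (\<rho> * \<epsilon>)) < 1/2" "\<rho> >= r + 1"
  by (auto simp: eventually_at_top_linorder)
 have l1: "\<rho> >= 1" using l(3) th by simp
 define c where "c = \<bar>K\<bar> * \<rho>\<^sup>2"
 have c: "0 <= c" "\<psi> \<rho> <= c"
  using psi_growth[OF l1] order_trans[OF psi_growth[OF l1], of c] by (auto simp: c_def mult_right_mono)
 \<comment> \<open>Keeps \<open>t * c\<close> at most 1/2, where the exponential is at most 1 plus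
   twice its argument.\<close>
 define t0 where "t0 = 1 / (2 * (1 + c))"
 have t0: "t0 > 0" "t0 <= 1/2" "t0 * c <= 1/2" using c by (auto simp: t0_def field_simps)
 have pw: "exp (r * x) * indicator {x. \<epsilon> <= x} x <= 2 * exp ((r - \<rho>) * \<epsilon>) * ell \<rho> x" for x :: real
 proof (cases "\<epsilon> <= x")
  case True
  have "exp (\<rho> * x) * (1/2) <= exp (\<rho> * x) * (1 - (1 + \<rho> * \<epsilon>) * exp (- (\<rho> * \<epsilon>)))"
   using l(2) by (intro mult_left_mono) auto
  hence 1: "exp (\<rho> * x) <= 2 * ell \<rho> x" using exp_le_ell[of \<rho> \<epsilon> x] True e l1 by linarith
  have "(r - \<rho>) * x <= (r - \<rho>) * \<epsilon>" using True l(3) by (intro mult_left_mono_neg) auto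
  hence "exp (r * x) <= exp ((r - \<rho>) * \<epsilon>) * exp (\<rho> * x)" by (simp add: mult_exp_exp algebra_simps)
  also have "... <= exp ((r - \<rho>) * \<epsilon>) * (2 * ell \<rho> x)" using 1 by (intro mult_left_mono) auto
  finally show ?thesis using True by (simp add: mult_ac)
 qed (use ell_nonneg in auto)
 have "expectation (%w. exp (r * X t w) * indicator {w. \<epsilon> <= X t w} w) <= \<eta> * t" if t: "0 <= t" "t <= t0" for t
 proof -
  have "expectation (%w. exp (r * X t w) * indicator {w. \<epsilon> <= X t w} w) <= expectation (%w. 2 * exp ((r - \<rho>) * \<epsilon>) * ell \<rho> (X t w))"
  proof (rule integral_mono)
   show "integrable M (%w. exp (r * X t w) * indicator {w. \<epsilon> <= X t w} w)"
    by (rule Bochner_Integration.integrable_bound[OF exp_integrable[OF t(1) th]]) (auto simp: indicator_def)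
   show "integrable M (%w. 2 * exp ((r - \<rho>) * \<epsilon>) * ell \<rho> (X t w))"
    using t l1 by (intro integrable_mult_right ell_integrable) auto
   show "exp (r * X t w) * indicator {w. \<epsilon> <= X t w} w <= 2 * exp ((r - \<rho>) * \<epsilon>) * ell \<rho> (X t w)" for w
    using pw[of "X t w"] by (simp add: indicator_def)
  qed
  also have "... = 2 * exp ((r - \<rho>) * \<epsilon>) * (exp (t * \<psi> \<rho>) - 1 - \<rho> * m * t)"
   using ell_expectation[OF t(1), of \<rho>] l1 by simp
  also have "... <= 2 * exp ((r - \<rho>) * \<epsilon>) * ((2 * c + \<rho> * \<bar>m\<bar>) * t)"
  proof (intro mult_left_mono)
   have tc: "t * c <= 1/2" using mult_right_mono[OF t(2) c(1)] t0(3) by linarith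
   have "exp (t * \<psi> \<rho>) <= exp (t * c)" using c t by (simp add: mult_left_mono)
   also have "... <= 1 + 2 * (t * c)"
    using exp_bound_half[of "t * c"] exp_bound_lemma[of "t * c"] tc t c by simp
   finally have "exp (t * \<psi> \<rho>) <= 1 + 2 * (t * c)" .
   moreover have "- (\<rho> * m * t) <= \<rho> * \<bar>m\<bar> * t"
    using mult_right_mono[OF mult_left_mono[OF abs_ge_minus_self[of m], of \<rho>], of t] l1 t by simp
   ultimately show "exp (t * \<psi> \<rho>) - 1 - \<rho> * m * t <= (2 * c + \<rho> * \<bar>m\<bar>) * t" by (simp add: algebra_simps)
  qed auto
  also have "... = (2 * exp ((r - \<rho>) * \<epsilon>) * (2 * (\<bar>K\<bar> * \<rho>\<^sup>2) + \<rho> * \<bar>m\<bar>)) * t" by (simp add: c_def mult.assoc)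
  also have "... <= \<eta> * t" using l(1) t by (intro mult_right_mono) auto
  finally show ?thesis .
 qed
 thus ?thesis using that t0 by blast
qed

end

section \<open>Scale functions\<close>

lemma interval_integral_nonpos:
 fixes f :: "real => real"
 assumes "x <= 0"
 shows "(LBINT y=0..ereal x. f y) = - (LBINT y:{x<..<0}. f y)"
proof (cases "x = 0")
 case False
 hence "(LBINT y=0..ereal x. f y) = - (LBINT y=ereal x..0. f y)"
  using interval_integral_endpoints_reverse by blast
 also have "(LBINT y=ereal x..0. f y) = (LBINT y:{x<..<0}. f y)"
  using assms unfolding interval_lebesgue_integral_def zero_ereal_def by simp
 finally show ?thesis .
qed (simp add: zero_ereal_def set_lebesgue_integral_def)

text \<open>If \<open>f\<close> is not integrable its integral is 0 by convention; since
  \<open>h\<close> is nonnegative on \<open>A\<close>, the inequality holds in that case as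
  well.\<close>

lemma set_integral_indicator_bound:
 fixes f h :: "real => real"
 assumes h: "set_integrable lborel A h" and le: "!!s. s \<in> A ==> \<bar>f s\<bar> <= h s"
 shows "\<bar>LBINT s:A. f s\<bar> <= (LBINT s:A. h s)"
proof (cases "set_integrable lborel A f")
 case True
 have "\<bar>LBINT s:A. f s\<bar> <= (LBINT s:A. \<bar>f s\<bar>)"
  unfolding set_lebesgue_integral_def
  using integral_norm_bound[of lborel "%s. indicator A s *\<^sub>R f s"] by (simp add: abs_mult)
 also have "... <= (LBINT s:A. h s)"
  using True h le by (intro set_integral_mono set_integrable_abs) auto
 finally show ?thesis .
next
 case False
 have "0 <= (LBINT s:A. h s)"
  unfolding set_lebesgue_integral_def
  using le by (intro integral_nonneg_AE AE_I2) (auto simp: indicator_def intro: order_trans[OF abs_ge_zero])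
 thus ?thesis using False by (simp add: set_lebesgue_integral_def set_integrable_def not_integrable_integral_eq)
qed

locale scale_calculus =
 fixes W :: "real => real" and q :: real
 assumes W_neg: "!!x. x < 0 ==> W x = 0"
  and W_cont: "continuous_on {0..} W"
  and W_mono0: "!!x y. 0 <= x ==> x <= y ==> W x <= W y"
  and W_ge0: "!!x. 0 <= W x"
begin

lemma W_mono: "x <= y ==> W x <= W y"
 using W_mono0[of x y] W_neg[of x] W_ge0[of y] by (cases "x < 0") auto

lemma W_contI: "0 <= a ==> continuous_on {a..b} W"
 by (rule continuous_on_subset[OF W_cont]) auto

lemma W_borel: "W \<in> borel_measurable borel"
 by (rule borel_measurable_mono) (auto simp: mono_def W_mono)

abbreviation Z where "Z \<equiv> Z_fun q W"
abbreviation Zb where "Zb \<equiv> Z_bar q W"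

definition IW :: "real => real" where "IW x = (LBINT y=0..ereal x. W y)"

lemma Z_eq: "Z x = 1 + q * IW x"
 by (simp add: Z_fun_def IW_def)

lemma W_integrable_Icc: "0 <= x ==> set_integrable lborel {0..x} W"
 by (intro borel_integrable_atLeastAtMost' W_contI) simp

lemma IW_nonpos: "x <= 0 ==> IW x = 0"
proof -
 assume x: "x <= 0"
 have "(LBINT y:{x<..<0}. W y) = (LBINT y:{x<..<0}. 0)"
  by (intro set_lebesgue_integral_cong) (auto simp: W_neg)
 thus ?thesis unfolding IW_def interval_integral_nonpos[OF x] by simp
qed

lemma IW_integral: "0 <= x ==> IW x = integral {0..x} W"
 unfolding IW_def zero_ereal_def by (intro interval_integral_eq_integral W_integrable_Icc)

lemma IW_deriv:
 assumes "0 <= x" "x <= T"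
 shows "(IW has_real_derivative W x) (at x within {0..T})"
proof -
 have "((%x. integral {0..x} W) has_real_derivative W x) (at x within {0..T})"
  using assms by (intro integral_has_real_derivative W_contI) auto
 thus ?thesis
  by (rule has_field_derivative_transform_within[OF _ zero_less_one]) (use assms in \<open>auto simp: IW_integral\<close>)
qed

lemma IW_cont: "continuous_on UNIV IW"
proof -
 have "continuous_on {..0} IW"
  by (rule continuous_on_eq[OF continuous_on_const[of _ 0]]) (auto simp: IW_nonpos)
 moreover have "continuous_on {0..} IW"
  unfolding continuous_on_eq_continuous_within
 proof
  fix x :: real assume x: "x \<in> {0..}"
  have "continuous (at x within {0..x+1}) IW"
   using IW_deriv[of x "x+1"] x by (auto intro: DERIV_continuous)
  moreover have "at x within {0..x+1} = at x within {0..}"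
   by (rule at_within_nhd[of _ "{..<x+1}"]) auto
  ultimately show "continuous (at x within {0..}) IW" by simp
 qed
 ultimately have "continuous_on ({..0} \<union> {0..}) IW" by (intro continuous_on_closed_Un) auto
 moreover have "{..0} \<union> {0..} = (UNIV :: real set)" by auto
 ultimately show ?thesis by metis
qed

lemma IW_mono: "x <= y ==> IW x <= IW y"
proof -
 assume xy: "x <= y"
 have *: "IW x <= IW y" if "0 <= x" "x <= y" for x y
  using that W_ge0 unfolding IW_integral[OF that(1)] IW_integral[OF order_trans[OF that]]
  by (intro integral_subset_le integrable_continuous_real W_contI) auto
 show ?thesis
  using *[of x y] *[of 0 y] xy by (cases "0 <= x"; cases "0 <= y") (auto simp: IW_nonpos)
qed

lemma IW_ge0: "0 <= IW x"
 using IW_mono[of 0 x] IW_nonpos[of x] IW_nonpos[of 0] by (cases "0 <= x") auto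

lemma IW_le: "0 <= x ==> IW x <= x * W x"
proof -
 assume x: "0 <= x"
 have "integral {0..x} W <= integral {0..x} (%_. W x)"
  using W_mono x by (intro integral_le integrable_continuous_real W_contI continuous_on_const) auto
 thus ?thesis using x by (simp add: IW_integral)
qed

lemma Z_nonpos: "x <= 0 ==> Z x = 1"
 by (simp add: Z_eq IW_nonpos)

lemma Z_cont: "continuous_on A Z"
 unfolding Z_eq[abs_def] by (intro continuous_intros continuous_on_subset[OF IW_cont]) auto

lemma Z_deriv: "0 <= x ==> x <= T ==> (Z has_real_derivative q * W x) (at x within {0..T})"
 unfolding Z_eq[abs_def] by (auto intro!: derivative_eq_intros IW_deriv)

lemma Z_integrable_Icc: "set_integrable lborel {a..b} Z"
 by (intro borel_integrable_atLeastAtMost' Z_cont)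

lemma Zb_integral: "0 <= x ==> Zb x = integral {0..x} Z"
 unfolding Z_bar_def zero_ereal_def by (intro interval_integral_eq_integral Z_integrable_Icc)

lemma Zb_nonpos: "x <= 0 ==> Zb x = x"
proof -
 assume x: "x <= 0"
 have "(LBINT y:{x<..<0}. Z y) = (LBINT y:{x<..<0}. 1)"
  by (intro set_lebesgue_integral_cong) (auto simp: Z_nonpos)
 also have "... = - x" using x by (simp add: set_lebesgue_integral_def)
 finally show ?thesis using x unfolding Z_bar_def interval_integral_nonpos[OF x] by simp
qed

lemma Zb_deriv: "0 <= x ==> x <= T ==> (Zb has_real_derivative Z x) (at x within {0..T})"
proof -
 assume a: "0 <= x" "x <= T"
 have "((%x. integral {0..x} Z) has_real_derivative Z x) (at x within {0..T})"
  using a by (intro integral_has_real_derivative Z_cont) auto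
 thus ?thesis
  by (rule has_field_derivative_transform_within[OF _ zero_less_one]) (use a in \<open>auto simp: Zb_integral\<close>)
qed

lemma conv_one: "(LBINT z. W (y - z) * indicator {0<..} z) = IW y"
proof -
 have "(LBINT z. W (y - z) * indicator {0<..} z) = (LBINT x. W x * indicator {0<..} (y - x))"
  by (subst lborel_integral_real_affine[where c="-1" and t=y]) auto
 also have "... = IW y"
 proof (cases "0 <= y")
  case True
  have "(LBINT x. W x * indicator {0<..} (y - x)) = (LBINT x:{0<..<y}. W x)"
   unfolding set_lebesgue_integral_def
  proof (rule integral_cong_AE)
   show "AE x in lborel. W x * indicator {0<..} (y - x) = indicator {0<..<y} x *\<^sub>R W x"
    using AE_lborel_singleton[of 0]
   proof eventually_elim
    case (elim x)
    thus ?case using W_neg[of x] by (cases "x < 0") (simp_all add: indicator_def)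
   qed
  qed (use W_borel in measurable)
  thus ?thesis using True unfolding IW_def interval_lebesgue_integral_def zero_ereal_def by simp
 next
  case False
  hence "(%x. W x * indicator {0<..} (y - x)) = (%x. 0)" by (auto simp: fun_eq_iff indicator_def W_neg)
  thus ?thesis using False by (simp add: IW_nonpos)
 qed
 finally show ?thesis .
qed

lemma conv_id: "(LBINT z. W (y - z) * (z * indicator {0<..} z)) = (if y <= 0 then 0 else integral {0..y} IW)"
proof -
 have "(LBINT z. W (y - z) * (z * indicator {0<..} z)) = (LBINT x. W x * ((y - x) * indicator {0<..} (y - x)))"
  by (subst lborel_integral_real_affine[where c="-1" and t=y]) auto
 also have "... = (if y <= 0 then 0 else integral {0..y} IW)"
 proof (cases "0 < y")
  case True
  have c: "continuous_on {0..y} (%x. (y - x) * W x)" by (intro continuous_intros W_contI) simp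
  have "(LBINT x. W x * ((y - x) * indicator {0<..} (y - x))) = (LBINT x:{0..y}. (y - x) * W x)"
   unfolding set_lebesgue_integral_def
   by (intro Bochner_Integration.integral_cong) (auto simp: indicator_def W_neg not_less)
  also have "... = integral {0..y} (%x. (y - x) * W x)"
   by (intro set_borel_integral_eq_integral borel_integrable_atLeastAtMost' c)
  also have "... = integral {0..y} IW"
  proof -
   \<comment> \<open>The antiderivative \<open>(y - x) * IW x\<close> vanishes at both end points,
     so this is integration by parts without boundary terms.\<close>
   have "((%x. - IW x + (y - x) * W x) has_integral ((y - y) * IW y - (y - 0) * IW 0)) {0..y}"
    using True by (intro fundamental_theorem_of_calculus)
     (auto intro!: derivative_eq_intros IW_deriv simp flip: has_real_derivative_iff_has_vector_derivative)
   hence "integral {0..y} (%x. - IW x + (y - x) * W x) = 0" by (simp add: IW_nonpos integral_unique)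
   moreover have "integral {0..y} (%x. - IW x + (y - x) * W x) = integral {0..y} (%x. - IW x) + integral {0..y} (%x. (y - x) * W x)"
    by (intro Henstock_Kurzweil_Integration.integral_add integrable_continuous_real c continuous_intros continuous_on_subset[OF IW_cont]) auto
   ultimately show ?thesis by simp
  qed
  finally show ?thesis using True by simp
 next
  case False
  hence "(%x. W x * ((y - x) * indicator {0<..} (y - x))) = (%x. 0)" by (auto simp: fun_eq_iff indicator_def W_neg)
  thus ?thesis using False by simp
 qed
 finally show ?thesis .
qed

lemma Zb_eq: "Zb y = y + q * (LBINT z. W (y - z) * (z * indicator {0<..} z))"
proof (cases "y <= 0")
 case True thus ?thesis by (simp add: conv_id Zb_nonpos)
next
 case False
 hence "Zb y = integral {0..y} (%x. 1 + q * IW x)"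
  by (simp add: Zb_integral Z_eq[abs_def])
 also have "... = integral {0..y} (%x. 1) + integral {0..y} (%x. q * IW x)"
  by (intro Henstock_Kurzweil_Integration.integral_add integrable_continuous_real continuous_intros continuous_on_subset[OF IW_cont]) auto
 finally show ?thesis using False by (simp add: conv_id)
qed

text \<open>\<open>W\<close> is monotone, so on \<open>{y..y+1}\<close> it is at least
  \<open>W y\<close>; its finite transform at \<open>r\<close> therefore bounds \<open>W y\<close>
  by a multiple of \<open>exp (r * (y + 1))\<close>.\<close>

lemma exponential_bound:
 assumes "0 < q" "integrable lborel (%x. exp (- (r * x)) * W x)"  and th: "0 <= r"
 obtains A where "0 <= A" "!!y. W y <= A * exp (r * y)" "!!y. 0 <= y ==> Z y <= A * exp ((r + 1) * y)"
proof -
 define T where "T = (LBINT x. exp (- (r * x)) * W x)"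
 have T0: "0 <= T" unfolding T_def using W_ge0 by (intro integral_nonneg_AE) auto
 have W: "W y <= T * exp r * exp (r * y)" for y
 proof -
  have "(LBINT x. exp (- (r * (y + 1))) * W y * indicator {y..y+1} x) <= T"
   unfolding T_def
  proof (rule integral_mono[OF _ assms(2)])
   fix x :: real
   show "exp (- (r * (y + 1))) * W y * indicator {y..y+1} x <= exp (- (r * x)) * W x"
   proof (cases "x \<in> {y..y+1}")
    case True
    hence "exp (- (r * (y + 1))) <= exp (- (r * x))" using th by (simp add: mult_left_mono)
    hence "exp (- (r * (y + 1))) * W y <= exp (- (r * x)) * W x"
     using W_mono[of y x] W_ge0[of y] True by (intro mult_mono) auto
    thus ?thesis using True by simp
   qed (simp add: W_ge0)
  qed simp
  hence "exp (- (r * (y + 1))) * W y <= T" by simp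
  hence "exp (r * (y + 1)) * (exp (- (r * (y + 1))) * W y) <= exp (r * (y + 1)) * T"
   by (intro mult_left_mono) auto
  moreover have "exp (r * (y + 1)) * (exp (- (r * (y + 1))) * W y) = W y"
   unfolding mult.assoc[symmetric] mult_exp_exp by simp
  moreover have "exp (r * (y + 1)) * T = T * exp r * exp (r * y)"
   by (simp add: distrib_left exp_add)
  ultimately show ?thesis by linarith
 qed
 define A where "A = T * exp r + 1 + q * (T * exp r)"
 have A: "T * exp r <= A" "0 <= A" using T0 assms(1) by (auto simp: A_def)
 have ZZ: "Z y <= A * exp ((r + 1) * y)" if y: "0 <= y" for y
 proof -
  have "y <= exp y" using exp_ge_add_one_self[of y] by linarith
  define E where "E = exp ((r + 1) * y)"
  define P where "P = T * exp r"
  have "0 <= (r + 1) * y" using y th by simp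
  hence E1: "1 <= E" by (simp add: E_def)
  have P0: "0 <= P" using T0 by (simp add: P_def)
  have "IW y <= y * W y" using IW_le y by simp
  also have "... <= exp y * (P * exp (r * y))"
   using W[of y] W_ge0 \<open>y <= exp y\<close> y unfolding P_def by (intro mult_mono) auto
  also have "... = P * E" by (simp add: E_def distrib_right exp_add)
  finally have "q * IW y <= q * (P * E)" using assms(1) by (intro mult_left_mono) auto
  moreover have "0 <= P * E" using P0 E1 by simp
  moreover have "A * E = P * E + E + q * (P * E)" by (simp add: A_def P_def algebra_simps)
  ultimately show ?thesis unfolding Z_eq E_def[symmetric] using E1 by linarith
 qed
 have WW: "W y <= A * exp (r * y)" for y
  by (rule order_trans[OF W mult_right_mono[OF A(1)]]) simp
 show ?thesis by (rule that[OF A(2) WW ZZ])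
qed

end

section \<open>One step of the refracted and reflected process\<close>

locale refraction =
 LX: levy_marginals M X \<psi> m K +
 SX: scaled_process M X \<psi> q \<Phi> W +
 SY: scaled_process M "%t w. X t w - \<delta> * t" "%r. \<psi> r - \<delta> * r" q \<phi> WY +
 CX: scale_calculus W q +
 CY: scale_calculus WY q
 for M :: "'a measure" and X \<psi> m K q \<Phi> W \<delta> \<phi> WY +
 fixes b :: real
 assumes delta: "0 <= \<delta>" and b: "0 < b" and q: "0 < q"
begin

abbreviation Y :: "real => 'a => real" where "Y s w == X s w - \<delta> * s"
abbreviation expX :: "('a => real) => real" (binder "\<E>" 10) where "expX U == LX.expectation U"

abbreviation Z where "Z \<equiv> Z_fun q W"
abbreviation Zb where "Zb \<equiv> Z_bar q W"

definition slope :: "real => real => real" where "slope C z = C * q * W z - Z z"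
text \<open>This is g_C for \<open>\<delta> = 0\<close>. \<open>slope C\<close> is its derivative on
  the positive half line, and formally generator minus \<open>q\<close> maps it to
  \<open>kap C\<close>, which is 0 on the positive half line.\<close>

definition base :: "real => real => real" where "base C y = - Zb y - m / q + C * Z y"
definition kap :: "real => real => real" where "kap C z = q * (z - C) * indicator {..0} z"
definition slope_b :: "real => real => real" where "slope_b C z = slope C z * indicator {b<..} z"
text \<open>Formally, generator minus \<open>q\<close> of \<open>Y\<close> maps
  \<open>SY.pot (slope_b C)\<close> to the derivative of \<open>base C\<close> above
  \<open>b\<close> and to 0 elsewhere. Above \<open>b\<close> the generator of \<open>X\<close> is
  replaced by that of \<open>Y\<close>, which subtracts \<open>\<delta>\<close> times that
  derivative; the second summand makes up for it, and it vanishes up to \<open>b\<close>.\<close>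

definition gfun :: "real => real => real" where "gfun C y = base C y + \<delta> * SY.pot (slope_b C) y"
text \<open>The neighbourhoods of 0 and \<open>b\<close> in which one-step errors are O(t) rather
  than o(t). The radius at \<open>b\<close> exceeds the \<open>2 * \<epsilon>\<close> allowed for
  starting points, so that a path that starts close to \<open>b\<close> and moves little stays
  inside.\<close>

definition zone :: "real => real => real" where
 "zone \<epsilon> z = indicator {- \<epsilon><..<\<epsilon>} z + indicator {b - 3*\<epsilon><..<b + 3*\<epsilon>} z"

lemma W_exp:
 obtains A r where "0 <= A" "\<Phi> < r" "\<phi> < r" "0 <= r" "!!y. W y <= A * exp (r * y)" "!!y. WY y <= A * exp (r * y)" "!!y. 0 <= y ==> Z y <= A * exp (r * y)"
proof -
 define r where "r = max \<Phi> \<phi> + 1"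
 have th: "\<Phi> < r" "\<phi> < r" "0 <= r" using SX.a_nonneg by (auto simp: r_def)
 have i1: "integrable lborel (%x. exp (- (r * x)) * W x)"
  using SX.W_transform[OF th(1)] SX.W_nonneg by (intro integrableI_nonneg) auto
 have i2: "integrable lborel (%x. exp (- (r * x)) * WY x)"
  using SY.W_transform[OF th(2)] SY.W_nonneg by (intro integrableI_nonneg) auto
 obtain A1 where A1: "0 <= A1" "!!y. W y <= A1 * exp (r * y)" "!!y. 0 <= y ==> Z y <= A1 * exp ((r + 1) * y)"
  using CX.exponential_bound[OF q i1 th(3)] by metis
 obtain A2 where A2: "0 <= A2" "!!y. WY y <= A2 * exp (r * y)"
  using CY.exponential_bound[OF q i2 th(3)] by metis
 define A where "A = max A1 A2"
 have le: "A1 * exp (r * y) <= A * exp ((r + 1) * y)" "A2 * exp (r * y) <= A * exp ((r + 1) * y)" "A1 * exp ((r + 1) * y) <= A * exp ((r + 1) * y)" if "0 <= y" for y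
  using that A1(1) A2(1) th(3) by (auto simp: A_def intro!: mult_mono mult_right_mono)
 have "W y <= A * exp ((r + 1) * y)" for y
  using le(1)[of y] A1(2)[of y] CX.W_neg[of y] A1(1) by (cases "0 <= y") (auto simp: A_def)
 moreover have "WY y <= A * exp ((r + 1) * y)" for y
  using le(2)[of y] A2(2)[of y] CY.W_neg[of y] A1(1) by (cases "0 <= y") (auto simp: A_def)
 moreover have "Z y <= A * exp ((r + 1) * y)" if "0 <= y" for y
  by (rule order_trans[OF A1(3)[OF that] le(3)[OF that]])
 ultimately show ?thesis using that[of A "r + 1"] th A1(1) by (auto simp: A_def)
qed

lemma slope_exp:
 obtains A r where "0 <= A" "\<Phi> < r" "\<phi> < r" "0 <= r" "!!y. 0 <= y ==> \<bar>slope C y\<bar> <= A * exp (r * y)"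
proof -
 obtain A r where A: "0 <= A" "\<Phi> < r" "\<phi> < r" "0 <= r" "!!y. W y <= A * exp (r * y)" "!!y. 0 <= y ==> Z y <= A * exp (r * y)"
  using W_exp by metis
 have "\<bar>slope C y\<bar> <= (\<bar>C\<bar> * q * A + A) * exp (r * y)" if "0 <= y" for y
 proof -
  have "Z y >= 0" using CX.IW_ge0[of y] q by (simp add: CX.Z_eq)
  hence "\<bar>slope C y\<bar> <= \<bar>C\<bar> * q * W y + Z y"
   unfolding slope_def using SX.W_nonneg[of y] q abs_triangle_ineq4[of "C * q * W y" "Z y"] by (simp add: abs_mult)
  also have "... <= \<bar>C\<bar> * q * (A * exp (r * y)) + A * exp (r * y)"
   using A(5)[of y] A(6)[OF that] q by (intro add_mono mult_left_mono) auto
  finally show ?thesis by (simp add: algebra_simps)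
 qed
 thus ?thesis using that[of "\<bar>C\<bar> * q * A + A" r] A q by auto
qed

lemma slope_borel [measurable]: "slope C \<in> borel_measurable borel"
 unfolding slope_def using CX.Z_cont[of UNIV]
 by (intro borel_measurable_diff borel_measurable_times CX.W_borel borel_measurable_continuous_onI) auto

lemma slope_cont: "continuous_on {0..} (slope C)"
 unfolding slope_def by (intro continuous_intros CX.W_cont CX.Z_cont)

lemma dominated_slope_b: "SY.dominated (slope_b C)"
proof -
 obtain A r where A: "0 <= A" "\<Phi> < r" "\<phi> < r" "0 <= r" "!!y. 0 <= y ==> \<bar>slope C y\<bar> <= A * exp (r * y)"
  using slope_exp by metis
 have "\<bar>slope_b C z\<bar> <= A * exp (r * z)" for z
  using A(5)[of z] A(1) b by (auto simp: slope_b_def indicator_def)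
 moreover have "slope_b C \<in> borel_measurable borel" unfolding slope_b_def by measurable
 ultimately show ?thesis unfolding SY.dominated_def using A(3) by blast
qed

lemma zone_bounds: "0 <= zone \<epsilon> z" "zone \<epsilon> z <= 2"
 by (auto simp: zone_def indicator_def)

lemma zone_borel [measurable]: "zone \<epsilon> \<in> borel_measurable borel"
 unfolding zone_def by measurable

lemma dominated_zone: "SY.dominated (zone \<epsilon>)"
proof -
 define r where "r = \<phi> + 1"
 have th: "r > 0" using SY.a_nonneg by (simp add: r_def)
 have "\<bar>zone \<epsilon> z\<bar> <= (2 * exp (r * (\<bar>b\<bar> + 3 * \<bar>\<epsilon>\<bar>))) * exp (r * z)" for z
 proof (cases "zone \<epsilon> z = 0")
  case False
  hence "- (\<bar>b\<bar> + 3 * \<bar>\<epsilon>\<bar>) <= z" unfolding zone_def by (auto split: split_indicator_asm)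
  hence "0 <= r * ((\<bar>b\<bar> + 3 * \<bar>\<epsilon>\<bar>) + z)" using th by simp
  hence "1 <= exp (r * (\<bar>b\<bar> + 3 * \<bar>\<epsilon>\<bar>)) * exp (r * z)" by (simp add: mult_exp_exp distrib_left)
  thus ?thesis using zone_bounds[of \<epsilon> z] by simp
 qed simp
 moreover have "\<phi> < r" by (simp add: r_def)
 ultimately show ?thesis unfolding SY.dominated_def using zone_borel by blast
qed

lemma dominated_ramp: "SX.dominated (%z. q * (C - z) * indicator {0<..} z)"
proof -
 define r where "r = \<Phi> + 1"
 have th: "r >= 1" using SX.a_nonneg by (simp add: r_def)
 have "\<bar>q * (C - z) * indicator {0<..} z\<bar> <= (q * (\<bar>C\<bar> + 1)) * exp (r * z)" for z
 proof (cases "0 < z")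
  case True
  hence "0 <= r * z" "z <= r * z" using th by auto
  hence 1: "z <= exp (r * z)" "1 <= exp (r * z)" using exp_ge_add_one_self[of "r * z"] by linarith+
  have "\<bar>C - z\<bar> <= \<bar>C\<bar> + z" using True by simp
  also have "... <= \<bar>C\<bar> * exp (r * z) + exp (r * z)" using 1 mult_left_mono[OF 1(2), of "\<bar>C\<bar>"] by simp
  finally have "q * \<bar>C - z\<bar> <= q * (\<bar>C\<bar> * exp (r * z) + exp (r * z))" using q by (intro mult_left_mono) auto
  moreover have "\<bar>q * (C - z) * indicator {0<..} z\<bar> = q * \<bar>C - z\<bar>" using True q by (simp add: abs_mult)
  ultimately show ?thesis by (simp only: distrib_left distrib_right mult.assoc mult_1_left)
 qed (use q in simp)
 moreover have "(%z. q * (C - z) * indicator {0<..} z) \<in> borel_measurable borel" by measurable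
 moreover have "\<Phi> < r" by (simp add: r_def)
 ultimately show ?thesis unfolding SX.dominated_def by blast
qed

text \<open>\<open>base\<close> grows linearly at minus infinity, so it is not the potential of a
  dominated function. The affine part is evaluated through the mean of \<open>X\<close>, the
  remainder through the resolvent identity.\<close>

lemma base_pot: "base C y = - y - m / q + C + SX.pot (%z. q * (C - z) * indicator {0<..} z) y"
proof -
 have i1: "integrable lborel (%z. W (y - z) * (q * indicator {0<..} z))"
 proof -
  have "SX.dominated (%z. q * (1 - z) * indicator {0<..} z)" "SX.dominated (%z. q * (0 - z) * indicator {0<..} z)"
   by (rule dominated_ramp)+
  from Bochner_Integration.integrable_diff[OF this[THEN SX.pot_integrable, of y]]
  show ?thesis by (simp add: algebra_simps)
 qed
 have i2: "integrable lborel (%z. W (y - z) * (- q * (z * indicator {0<..} z)))"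
  using SX.pot_integrable[OF dominated_ramp[of 0], of y] by (simp add: mult.assoc)
 have "SX.pot (%z. q * (C - z) * indicator {0<..} z) y = (LBINT z. C * (W (y - z) * (q * indicator {0<..} z)) + W (y - z) * (- q * (z * indicator {0<..} z)))"
  unfolding SX.pot_def by (intro Bochner_Integration.integral_cong) (auto simp: algebra_simps)
 also have "... = (LBINT z. C * (W (y - z) * (q * indicator {0<..} z))) + (LBINT z. W (y - z) * (- q * (z * indicator {0<..} z)))"
  using i1 i2 by (intro Bochner_Integration.integral_add) auto
 also have "(LBINT z. C * (W (y - z) * (q * indicator {0<..} z))) = (LBINT z. (C * q) * (W (y - z) * indicator {0<..} z))"
  by (intro Bochner_Integration.integral_cong) auto
 also have "... = C * q * CX.IW y" by (simp add: CX.conv_one)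
 also have "(LBINT z. W (y - z) * (- q * (z * indicator {0<..} z))) = (LBINT z. (- q) * (W (y - z) * (z * indicator {0<..} z)))"
  by (intro Bochner_Integration.integral_cong) auto
 also have "... = - q * (LBINT z. W (y - z) * (z * indicator {0<..} z))"
  by (rule integral_mult_right_zero)
 finally show ?thesis unfolding base_def CX.Zb_eq[of y] CX.Z_eq by (simp add: algebra_simps)
qed

lemma base_identity:
 assumes t: "0 <= t"
 shows "integrable M (%w. base C (y + X t w))"
  and "set_integrable lborel {0..t} (%s. exp (- (q * s)) * (\<E> w. kap C (y + X s w)))"
  and "exp (- (q * t)) * (\<E> w. base C (y + X t w)) =
   base C y + (LBINT s:{0..t}. exp (- (q * s)) * (\<E> w. kap C (y + X s w)))"
proof -
 let ?\<rho> = "%z. q * (C - z) * indicator {0<..} z :: real"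
 note P = SX.pot_identity[OF dominated_ramp[of C] t, of y]
 have kap: "kap C z = ?\<rho> z + q * (z - C)" for z by (auto simp: kap_def indicator_def algebra_simps)
 have X1: "integrable M (%w. q * (y + X s w - C))" if "0 <= s" for s
  using LX.X_integrable[OF that] by auto
 have Ekap: "(\<E> w. kap C (y + X s w)) = (\<E> w. ?\<rho> (y + X s w)) + q * (y + m * s - C)" if "0 <= s" for s
 proof -
  have "(\<E> w. kap C (y + X s w)) = (\<E> w. ?\<rho> (y + X s w) + q * (y + X s w - C))"
   unfolding kap ..
  also have "... = (\<E> w. ?\<rho> (y + X s w)) + (\<E> w. q * (y + X s w - C))"
   by (intro Bochner_Integration.integral_add SX.expect_integrable dominated_ramp that X1)
  also have "(\<E> w. q * (y + X s w - C)) = q * (y + m * s - C)"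
   using LX.X_integrable[OF that] LX.X_mean[OF that] by (simp add: LX.prob_space)
  finally show ?thesis .
 qed
 have cont: "continuous_on {0..t} (%s. exp (- (q * s)) * (q * (y + m * s - C)))" by (intro continuous_intros)
 hence I1: "set_integrable lborel {0..t} (%s. exp (- (q * s)) * (q * (y + m * s - C)))"
  by (intro borel_integrable_atLeastAtMost')
 have D: "set_integrable lborel {0..t} (%s. exp (- (q * s)) * (\<E> w. ?\<rho> (y + X s w)) + exp (- (q * s)) * (q * (y + m * s - C)))"
  by (intro set_integral_add P I1)
 show B: "set_integrable lborel {0..t} (%s. exp (- (q * s)) * (\<E> w. kap C (y + X s w)))"
  by (rule iffD1[OF set_integrable_cong[OF refl refl] D]) (auto simp: Ekap algebra_simps)
 have X2: "integrable M (%w. - (y + X t w) - m / q + C)" using LX.X_integrable[OF t] by auto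
 show "integrable M (%w. base C (y + X t w))"
  unfolding base_pot using X2 P(1) by (rule Bochner_Integration.integrable_add)
 have "(\<E> w. base C (y + X t w)) = (\<E> w. - (y + X t w) - m / q + C) + (\<E> w. SX.pot ?\<rho> (y + X t w))"
  unfolding base_pot using X2 P(1) by (rule Bochner_Integration.integral_add)
 also have "(\<E> w. - (y + X t w) - m / q + C) = - (y + m * t) - m / q + C"
  using LX.X_integrable[OF t] LX.X_mean[OF t] by (simp add: LX.prob_space)
 finally have E1: "(\<E> w. base C (y + X t w)) = - (y + m * t) - m / q + C + (\<E> w. SX.pot ?\<rho> (y + X t w))" .
 \<comment> \<open>This is where the constant \<open>m / q\<close> comes from: with it the
   discounted affine part changes over a step by exactly this integral.\<close>
 have lin: "(LBINT s:{0..t}. exp (- (q * s)) * (q * (y + m * s - C))) = - exp (- (q * t)) * (y + m * t - C + m / q) + (y - C + m / q)"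
 proof -
  have "((%s. exp (- (q * s)) * (q * (y + m * s - C))) has_integral
   (- exp (- (q * t)) * (y + m * t - C + m / q) - (- exp (- (q * 0)) * (y + m * 0 - C + m / q)))) {0..t}"
   using q t by (intro fundamental_theorem_of_calculus)
    (auto intro!: derivative_eq_intros simp: field_simps simp flip: has_real_derivative_iff_has_vector_derivative)
  thus ?thesis using set_borel_integral_eq_integral(2)[OF I1] by (simp add: integral_unique)
 qed
 have "(LBINT s:{0..t}. exp (- (q * s)) * (\<E> w. kap C (y + X s w))) =
   (LBINT s:{0..t}. exp (- (q * s)) * (\<E> w. ?\<rho> (y + X s w)) + exp (- (q * s)) * (q * (y + m * s - C)))"
  by (intro set_lebesgue_integral_cong) (auto simp: Ekap algebra_simps)
 also have "... = (LBINT s:{0..t}. exp (- (q * s)) * (\<E> w. ?\<rho> (y + X s w))) + (LBINT s:{0..t}. exp (- (q * s)) * (q * (y + m * s - C)))"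
  by (intro set_integral_add P I1)
 finally show "exp (- (q * t)) * (\<E> w. base C (y + X t w)) =
   base C y + (LBINT s:{0..t}. exp (- (q * s)) * (\<E> w. kap C (y + X s w)))"
  unfolding E1 base_pot[of C y] lin using P(3) by (simp add: algebra_simps)
qed

end

section \<open>One-step errors near 0, below \<open>b\<close>, above \<open>b\<close> and near
  \<open>b\<close>\<close>

context refraction
begin

lemma expectation_abs_le:
 fixes f h :: "'a => real"
 assumes "integrable M h" "!!w. \<bar>f w\<bar> <= h w"
 shows "\<bar>LX.expectation f\<bar> <= LX.expectation h"
proof -
 have "\<bar>LX.expectation f\<bar> <= (\<E> w. \<bar>f w\<bar>)" by (rule integral_abs_bound)
 also have "... <= LX.expectation h"
  using assms by (intro integral_mono') (auto intro: order_trans[OF abs_ge_zero])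
 finally show ?thesis .
qed

text \<open>One-step errors of order t are charged to this discounted time that \<open>Y\<close>,
  started at \<open>g\<close>, spends in the zone.\<close>

definition occ :: "real => real => real => real" where
 "occ \<epsilon> g t = (LBINT s:{0..t}. exp (- (q * s)) * (\<E> w. zone \<epsilon> (g + Y s w)))"

lemma zone_integrable: "0 <= s ==> integrable M (%w. zone \<epsilon> (g + Y s w))"
 by (rule SY.expect_integrable[OF dominated_zone])

lemma occ_integrable: "0 <= t ==> set_integrable lborel {0..t} (%s. exp (- (q * s)) * (\<E> w. zone \<epsilon> (g + Y s w)))"
 by (rule SY.pot_identity(2)[OF dominated_zone])

lemma occ_nonneg: "0 <= occ \<epsilon> g t"
 unfolding occ_def set_lebesgue_integral_def
 by (intro integral_nonneg_AE AE_I2) (auto simp: indicator_def intro!: mult_nonneg_nonneg integral_nonneg_AE zone_bounds)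

abbreviation tail :: "real => real => real => 'a => real" where
 "tail r \<epsilon> s w \<equiv> (1 + \<bar>X s w\<bar> + exp (r * X s w)) * indicator {w. \<epsilon> <= \<bar>X s w\<bar>} w"

lemma exp_q_le: "0 <= s ==> exp (- (q * s)) <= 1" and exp_q_ge: "exp (- (q * s)) >= 1 - q * s"
 using q exp_ge_add_one_self[of "- (q * s)"] by auto

lemma linear_integral:
 fixes B :: real
 assumes "0 <= t"
 shows "set_integrable lborel {0..t} (%s. B * s)" "(LBINT s:{0..t}. B * s) = B * t\<^sup>2 / 2"
proof -
 have c: "continuous_on {0..t} (%s. B * s)" by (intro continuous_intros)
 thus I: "set_integrable lborel {0..t} (%s. B * s)" by (rule borel_integrable_atLeastAtMost')
 have "((%s. B * s) has_integral (B * t\<^sup>2 / 2 - B * 0\<^sup>2 / 2)) {0..t}"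
  using assms by (intro fundamental_theorem_of_calculus) (auto intro!: derivative_eq_intros simp flip: has_real_derivative_iff_has_vector_derivative)
 thus "(LBINT s:{0..t}. B * s) = B * t\<^sup>2 / 2"
  unfolding set_borel_integral_eq_integral(2)[OF I] by (simp only: integral_unique power_zero_numeral mult_zero_right div_0 diff_zero)
qed

text \<open>\<open>kap\<close> vanishes above 0. From \<open>u >= 0\<close> the path can be at or
  below 0 either after a small increment, and then the drifted path lies in the zone at 0, or after
  an increment of size at least \<open>\<epsilon>/2\<close>, whose expected contribution at time
  \<open>s\<close> is O(s) and integrates to a multiple of \<open>t\<^sup>2\<close>.\<close>

lemma kap_term:
 assumes e: "0 < \<epsilon>" "\<epsilon> <= 1"
 obtains B where "0 <= B" "!!t u. 0 <= t ==> t <= 1 ==> \<delta> * t < \<epsilon>/2 ==> 0 <= u ==> u <= N ==>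
  \<bar>LBINT s:{0..t}. exp (- (q * s)) * (\<E> w. kap C (u + X s w))\<bar> <= q * (\<bar>C\<bar> + 1) * occ \<epsilon> (u + \<delta> * t) t + B * t\<^sup>2"
proof -
 obtain B where B: "0 <= B" "!!s. 0 <= s ==> s <= 1 ==> LX.expectation (tail 0 (\<epsilon>/2) s) <= B * s"
  "!!s. 0 <= s ==> integrable M (tail 0 (\<epsilon>/2) s)"
  using LX.tail_bound[of 0 "\<epsilon>/2"] e by auto
 define D where "D = q * (\<bar>C\<bar> + \<bar>N\<bar> + 1)"
 have D: "D >= 0" using q by (simp add: D_def)
 have "\<bar>LBINT s:{0..t}. exp (- (q * s)) * (\<E> w. kap C (u + X s w))\<bar> <= q * (\<bar>C\<bar> + 1) * occ \<epsilon> (u + \<delta> * t) t + (D * B) * t\<^sup>2"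
  if t: "0 <= t" "t <= 1" "\<delta> * t < \<epsilon>/2" and u: "0 <= u" "u <= N" for t u
 proof -
  have pw: "\<bar>kap C (u + X s w)\<bar> <= q * (\<bar>C\<bar> + 1) * zone \<epsilon> (u + \<delta> * t + Y s w) + D * tail 0 (\<epsilon>/2) s w" if s: "s \<in> {0..t}" for s w
  proof -
   let ?x = "X s w"
   have ds: "0 <= \<delta> * t - \<delta> * s" "\<delta> * t - \<delta> * s <= \<delta> * t" using s delta by (auto simp: mult_left_mono)
   have zn: "0 <= q * (\<bar>C\<bar> + 1) * zone \<epsilon> (u + \<delta> * t + (?x - \<delta> * s))" using q zone_bounds by auto
   have tn: "0 <= D * tail 0 (\<epsilon>/2) s w" using D by (auto simp: indicator_def)
   consider "u + ?x > 0" | "u + ?x <= 0" "\<bar>?x\<bar> < \<epsilon>/2" | "u + ?x <= 0" "\<bar>?x\<bar> >= \<epsilon>/2" by linarith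
   thus ?thesis
   proof cases
    case 1 thus ?thesis using zn tn by (simp add: kap_def)
   next
    case 2
    have "zone \<epsilon> (u + \<delta> * t + (?x - \<delta> * s)) >= 1"
     using 2 ds t u by (auto simp: zone_def indicator_def)
    hence "q * (\<bar>C\<bar> + 1) * 1 <= q * (\<bar>C\<bar> + 1) * zone \<epsilon> (u + \<delta> * t + (?x - \<delta> * s))"
     using q by (intro mult_left_mono) auto
    moreover have "\<bar>kap C (u + ?x)\<bar> <= q * (\<bar>C\<bar> + 1)"
     using 2 u e q by (auto simp: kap_def abs_mult intro!: mult_left_mono)
    ultimately show ?thesis using tn by linarith
   next
    case 3
    have "\<bar>u + ?x - C\<bar> <= (\<bar>C\<bar> + \<bar>N\<bar> + 1) * (1 + \<bar>?x\<bar> + 1)"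
    proof -
     have "\<bar>u + ?x - C\<bar> <= \<bar>C\<bar> + \<bar>N\<bar> + \<bar>?x\<bar>" using u by linarith
     also have "... <= (\<bar>C\<bar> + \<bar>N\<bar> + 1) * (1 + \<bar>?x\<bar> + 1)"
      by (simp add: algebra_simps)
     finally show ?thesis .
    qed
    hence "\<bar>kap C (u + ?x)\<bar> <= D * tail 0 (\<epsilon>/2) s w"
     using 3 q by (auto simp: kap_def abs_mult D_def mult.assoc intro!: mult_left_mono)
    thus ?thesis using zn by linarith
   qed
  qed
  have Eb: "\<bar>exp (- (q * s)) * (\<E> w. kap C (u + X s w))\<bar>
    <= q * (\<bar>C\<bar> + 1) * (exp (- (q * s)) * (\<E> w. zone \<epsilon> (u + \<delta> * t + Y s w))) + D * B * s" if s: "s \<in> {0..t}" for s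
  proof -
   have s': "0 <= s" "s <= 1" using s t by auto
   have "\<bar>(\<E> w. kap C (u + X s w))\<bar> <= (\<E> w. q * (\<bar>C\<bar> + 1) * zone \<epsilon> (u + \<delta> * t + Y s w) + D * tail 0 (\<epsilon>/2) s w)"
    using zone_integrable[OF s'(1)] B(3)[OF s'(1)]
    by (intro expectation_abs_le pw[OF s] Bochner_Integration.integrable_add integrable_mult_right) auto
   also have "... = q * (\<bar>C\<bar> + 1) * (\<E> w. zone \<epsilon> (u + \<delta> * t + Y s w)) + D * LX.expectation (tail 0 (\<epsilon>/2) s)"
    using zone_integrable[OF s'(1)] B(3)[OF s'(1)] by (subst Bochner_Integration.integral_add) auto
   also have "... <= q * (\<bar>C\<bar> + 1) * (\<E> w. zone \<epsilon> (u + \<delta> * t + Y s w)) + D * (B * s)"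
    using B(2)[OF s'] D by (simp add: mult_left_mono)
   finally have "exp (- (q * s)) * \<bar>(\<E> w. kap C (u + X s w))\<bar> <=
    exp (- (q * s)) * (q * (\<bar>C\<bar> + 1) * (\<E> w. zone \<epsilon> (u + \<delta> * t + Y s w)) + D * (B * s))"
    by (intro mult_left_mono) auto
   also have "... <= q * (\<bar>C\<bar> + 1) * (exp (- (q * s)) * (\<E> w. zone \<epsilon> (u + \<delta> * t + Y s w))) + 1 * (D * B * s)"
   proof -
    have "exp (- (q * s)) * (D * (B * s)) <= 1 * (D * (B * s))"
     using exp_q_le[OF s'(1)] D B(1) s' by (intro mult_right_mono) auto
    thus ?thesis by (simp add: algebra_simps)
   qed
   finally show ?thesis by (simp add: abs_mult)
  qed
  have I: "set_integrable lborel {0..t} (%s. q * (\<bar>C\<bar> + 1) * (exp (- (q * s)) * (\<E> w. zone \<epsilon> (u + \<delta> * t + Y s w))))"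
   by (intro set_integrable_mult_right occ_integrable t)
  have "\<bar>LBINT s:{0..t}. exp (- (q * s)) * (\<E> w. kap C (u + X s w))\<bar> <=
    (LBINT s:{0..t}. q * (\<bar>C\<bar> + 1) * (exp (- (q * s)) * (\<E> w. zone \<epsilon> (u + \<delta> * t + Y s w))) + D * B * s)"
   by (rule set_integral_indicator_bound[OF set_integral_add(1)[OF I linear_integral(1)[OF t(1)]] Eb])
  also have "... = q * (\<bar>C\<bar> + 1) * occ \<epsilon> (u + \<delta> * t) t + D * B * t\<^sup>2 / 2"
   unfolding set_integral_add(2)[OF I linear_integral(1)[OF t(1)]]
   using linear_integral(2)[OF t(1), of "D * B"] by (simp add: occ_def)
  finally show ?thesis using mult_nonneg_nonneg[OF mult_nonneg_nonneg[OF D B(1)] zero_le_power2[of t]] by linarith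
 qed
 thus ?thesis using that[of "D * B"] D B(1) by auto
qed

text \<open>To exceed \<open>b\<close> from at most \<open>b - 2 * \<epsilon>\<close> within the
  step, the increment of \<open>X\<close> has to be at least \<open>\<epsilon>\<close>; at time
  \<open>s\<close> this contributes O(s).\<close>

lemma below_term:
 assumes e: "0 < \<epsilon>"
 obtains B where "0 <= B" "!!t v. 0 <= t ==> t <= 1 ==> \<delta> * t < \<epsilon> ==> v <= b - 2 * \<epsilon> ==>
  \<bar>LBINT s:{0..t}. exp (- (q * s)) * (\<E> w. slope_b C (v + \<delta> * t + Y s w))\<bar> <= B * t\<^sup>2"
proof -
 obtain A r where A: "0 <= A" "0 <= r" "!!y. 0 <= y ==> \<bar>slope C y\<bar> <= A * exp (r * y)"
  using slope_exp by metis
 obtain B where B: "0 <= B" "!!s. 0 <= s ==> s <= 1 ==> LX.expectation (tail r \<epsilon> s) <= B * s"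
  "!!s. 0 <= s ==> integrable M (tail r \<epsilon> s)"
  using LX.tail_bound[of r \<epsilon>] e A(2) by auto
 define D where "D = A * exp (r * b)"
 have D: "D >= 0" using A by (simp add: D_def)
 have "\<bar>LBINT s:{0..t}. exp (- (q * s)) * (\<E> w. slope_b C (v + \<delta> * t + Y s w))\<bar> <= (D * B) * t\<^sup>2"
  if t: "0 <= t" "t <= 1" "\<delta> * t < \<epsilon>" and v: "v <= b - 2 * \<epsilon>" for t v
 proof -
  have pw: "\<bar>slope_b C (v + \<delta> * t + Y s w)\<bar> <= D * tail r \<epsilon> s w" if s: "s \<in> {0..t}" for s w
  proof -
   let ?x = "X s w" let ?z = "v + \<delta> * t + (?x - \<delta> * s)"
   have ds: "0 <= \<delta> * s" using s delta by auto
   have tn: "0 <= D * tail r \<epsilon> s w" using D by (auto simp: indicator_def)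
   show ?thesis
   proof (cases "b < ?z")
    case True
    have x: "\<epsilon> <= ?x" using True t v ds by linarith
    have "\<bar>slope_b C ?z\<bar> <= A * exp (r * ?z)" using A(3)[of ?z] True b by (simp add: slope_b_def)
    also have "r * ?z <= r * (b + ?x)" using t v ds A(2) e by (intro mult_left_mono) auto
    hence "A * exp (r * ?z) <= A * exp (r * (b + ?x))" using A(1) by (simp add: mult_left_mono)
    also have "... = D * exp (r * ?x)" by (simp add: D_def distrib_left exp_add)
    also have "... <= D * (1 + \<bar>?x\<bar> + exp (r * ?x))" using D by (intro mult_left_mono) auto
    finally show ?thesis using x by simp
   qed (use tn in \<open>simp add: slope_b_def\<close>)
  qed
  have Eb: "\<bar>exp (- (q * s)) * (\<E> w. slope_b C (v + \<delta> * t + Y s w))\<bar> <= D * B * s" if s: "s \<in> {0..t}" for s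
  proof -
   have s': "0 <= s" "s <= 1" using s t by auto
   have "\<bar>(\<E> w. slope_b C (v + \<delta> * t + Y s w))\<bar> <= (\<E> w. D * tail r \<epsilon> s w)"
    using B(3)[OF s'(1)] by (intro expectation_abs_le pw[OF s] integrable_mult_right) auto
   also have "... <= D * (B * s)" using B(2)[OF s'] D by (simp add: mult_left_mono)
   finally have "\<bar>(\<E> w. slope_b C (v + \<delta> * t + Y s w))\<bar> <= D * B * s" by (simp add: mult.assoc)
   moreover have "exp (- (q * s)) * \<bar>(\<E> w. slope_b C (v + \<delta> * t + Y s w))\<bar> <= 1 * \<bar>(\<E> w. slope_b C (v + \<delta> * t + Y s w))\<bar>"
    using exp_q_le[OF s'(1)] by (intro mult_right_mono) auto
   ultimately show ?thesis by (simp add: abs_mult)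
  qed
  have "\<bar>LBINT s:{0..t}. exp (- (q * s)) * (\<E> w. slope_b C (v + \<delta> * t + Y s w))\<bar> <= (LBINT s:{0..t}. D * B * s)"
   by (rule set_integral_indicator_bound[OF linear_integral(1)[OF t(1)] Eb])
  also have "... = D * B * t\<^sup>2 / 2" by (rule linear_integral(2)[OF t(1)])
  finally show ?thesis using mult_nonneg_nonneg[OF mult_nonneg_nonneg[OF D B(1)] zero_le_power2[of t]] by linarith
 qed
 thus ?thesis using that[of "D * B"] D B(1) by auto
qed

end

context refraction
begin

lemma slope_nonneg_bound:
 obtains S where "0 <= S" "!!y. 0 <= y ==> y <= N ==> \<bar>slope C y\<bar> <= S"
proof -
 obtain A r where A: "0 <= A" "0 <= r" "!!y. 0 <= y ==> \<bar>slope C y\<bar> <= A * exp (r * y)"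
  using slope_exp by metis
 have "\<bar>slope C y\<bar> <= A * exp (r * N)" if "0 <= y" "y <= N" for y
  using A(3)[OF that(1)] mult_left_mono[OF _ A(1), of "exp (r * y)" "exp (r * N)"] mult_left_mono[OF that(2) A(2)] by simp
 thus ?thesis using that[of "A * exp (r * N)"] A(1) by auto
qed

lemma base_deriv: "0 <= x ==> x <= T ==> (base C has_real_derivative slope C x) (at x within {0..T})"
 unfolding base_def[abs_def] slope_def by (auto intro!: derivative_eq_intros CX.Z_deriv CX.Zb_deriv)

lemma base_linear_approx:
 assumes "0 <= x" "x <= y" and le: "!!z. x <= z ==> z <= y ==> \<bar>slope C z - k\<bar> <= B"
 shows "\<bar>base C x - base C y + k * (y - x)\<bar> <= B * (y - x)"
proof -
 have "norm ((base C x - k * x) - (base C y - k * y)) <= B * norm (x - y)"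
 proof (rule field_differentiable_bound[where S="{x..y}"])
  fix z assume z: "z \<in> {x..y}"
  have "(base C has_real_derivative slope C z) (at z within {x..y})"
   using z assms(1) by (intro has_field_derivative_subset[OF base_deriv[of z y]]) auto
  thus "((%z. base C z - k * z) has_real_derivative slope C z - k) (at z within {x..y})"
   by (auto intro!: derivative_eq_intros)
  show "norm (slope C z - k) <= B" using le z by simp
 qed (use assms in auto)
 thus ?thesis using assms by (simp add: algebra_simps)
qed

text \<open>\<open>WY\<close> is increasing, so the difference of the two kernels has one sign and
  integrates to a difference of \<open>CY.IW\<close>, whose slope is at most
  \<open>WY\<close>.\<close>

lemma pot_Y_lipschitz:
 obtains L where "0 <= L" "!!x y. x <= y ==> y <= N ==> \<bar>SY.pot (slope_b C) y - SY.pot (slope_b C) x\<bar> <= L * (y - x)"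
proof -
 obtain S where S: "0 <= S" "!!y. 0 <= y ==> y <= N ==> \<bar>slope C y\<bar> <= S" using slope_nonneg_bound by metis
 define L where "L = S * WY (max 0 (N - b))"
 have "\<bar>SY.pot (slope_b C) y - SY.pot (slope_b C) x\<bar> <= L * (y - x)" if xy: "x <= y" "y <= N" for x y
 proof -
  have d: "SY.pot (slope_b C) y - SY.pot (slope_b C) x = (LBINT z. WY (y - z) * slope_b C z - WY (x - z) * slope_b C z)"
   unfolding SY.pot_def by (intro Bochner_Integration.integral_diff[symmetric] SY.pot_integrable dominated_slope_b)
  have J: "integrable lborel (%z. WY (y - z) * indicator {b<..} z - WY (x - z) * indicator {b<..} z)"
  proof -
   have "SY.dominated (%z. indicator {b<..} z)"
   proof -
    have "\<bar>indicator {b<..} z :: real\<bar> <= 1 * exp ((\<phi> + 1) * z)" for z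
     using b SY.a_nonneg by (auto simp: indicator_def)
    moreover have "(%z. indicator {b<..} z :: real) \<in> borel_measurable borel" by measurable
    ultimately show ?thesis unfolding SY.dominated_def by (meson less_add_one)
   qed
   thus ?thesis by (intro Bochner_Integration.integrable_diff SY.pot_integrable)
  qed
  have "\<bar>\<integral>z. WY (y - z) * slope_b C z - WY (x - z) * slope_b C z \<partial>lborel\<bar>
    <= (LBINT z. S * (WY (y - z) * indicator {b<..} z - WY (x - z) * indicator {b<..} z))"
  proof (rule order_trans[OF integral_abs_bound integral_mono'])
   show "integrable lborel (%z. S * (WY (y - z) * indicator {b<..} z - WY (x - z) * indicator {b<..} z))" using J by auto
   fix z
   have m: "0 <= WY (y - z) - WY (x - z)" using CY.W_mono[of "x - z" "y - z"] xy by simp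
   thus "0 <= S * (WY (y - z) * indicator {b<..} z - WY (x - z) * indicator {b<..} z)" using S(1) by (simp add: indicator_def)
   show "\<bar>WY (y - z) * slope_b C z - WY (x - z) * slope_b C z\<bar> <= S * (WY (y - z) * indicator {b<..} z - WY (x - z) * indicator {b<..} z)"
   proof (cases "b < z & z <= y")
    case True
    hence "\<bar>slope C z\<bar> <= S" using S(2)[of z] b xy by auto
    hence "(WY (y - z) - WY (x - z)) * \<bar>slope C z\<bar> <= (WY (y - z) - WY (x - z)) * S" using m by (intro mult_left_mono) auto
    thus ?thesis using True m by (simp add: slope_b_def abs_mult left_diff_distrib[symmetric] mult.commute)
   next
    case False
    thus ?thesis using xy CY.W_neg[of "y - z"] CY.W_neg[of "x - z"] by (auto simp: slope_b_def)
   qed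
  qed
  also have "... = S * (LBINT z. WY (y - z) * indicator {b<..} z - WY (x - z) * indicator {b<..} z)" by simp
  also have "(LBINT z. WY (y - z) * indicator {b<..} z - WY (x - z) * indicator {b<..} z) = CY.IW (y - b) - CY.IW (x - b)"
  proof -
   have "(LBINT z. WY (y - z) * indicator {b<..} z) = CY.IW (y - b)" for y
    by (subst CY.conv_one[symmetric], subst lborel_integral_real_affine[where c=1 and t=b]) (auto simp: indicator_def algebra_simps)
   moreover have "integrable lborel (%z. WY (y - z) * indicator {b<..} z)" for y
   proof -
    have "\<bar>indicator {b<..} z :: real\<bar> <= 1 * exp ((\<phi> + 1) * z)" for z
     using b SY.a_nonneg by (auto simp: indicator_def)
    moreover have "(%z. indicator {b<..} z :: real) \<in> borel_measurable borel" by measurable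
    ultimately have "SY.dominated (%z. indicator {b<..} z)" unfolding SY.dominated_def by (meson less_add_one)
    thus ?thesis by (rule SY.pot_integrable)
   qed
   ultimately show ?thesis by (simp add: Bochner_Integration.integral_diff)
  qed
  also have "CY.IW (y - b) - CY.IW (x - b) <= WY (max 0 (N - b)) * (y - x)"
  proof -
   have *: "CY.IW v - CY.IW u <= WY v * (v - u)" if "0 <= u" "u <= v" for u v
   proof -
    have "norm (CY.IW v - CY.IW u) <= WY v * norm (v - u)"
    proof (rule field_differentiable_bound[where S="{u..v}"])
     fix z assume z: "z \<in> {u..v}"
     show "(CY.IW has_real_derivative WY z) (at z within {u..v})"
      using z that by (intro has_field_derivative_subset[OF CY.IW_deriv[of z v]]) auto
     show "norm (WY z) <= WY v" using z CY.W_mono CY.W_ge0 by auto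
    qed (use that in auto)
    thus ?thesis using that by simp
   qed
   have "CY.IW (y - b) - CY.IW (x - b) <= WY (max 0 (y - b)) * (max 0 (y - b) - max 0 (x - b))"
    using *[of "max 0 (x - b)" "max 0 (y - b)"] xy CY.IW_nonpos[of "y - b"] CY.IW_nonpos[of "x - b"] CY.IW_nonpos[of 0]
    by (auto simp: max_def split: if_splits)
   also have "... <= WY (max 0 (N - b)) * (y - x)"
    using xy by (intro mult_mono CY.W_mono CY.W_ge0) auto
   finally show ?thesis .
  qed
  finally show ?thesis using S(1) d by (simp add: L_def mult_left_mono mult.assoc)
 qed
 thus ?thesis using that[of L] S(1) CY.W_ge0 by (auto simp: L_def)
qed

lemma slope_b_time_integrable:
 "0 <= t ==> set_integrable lborel {0..t} (%s. exp (- (q * s)) * (\<E> w. slope_b C (g + Y s w)))"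
 by (rule SY.pot_identity(2)[OF dominated_slope_b])

lemma const_integral:
 fixes k :: real
 assumes "0 <= t"
 shows "set_integrable lborel {0..t} (%s. k)" "(LBINT s:{0..t}. k) = k * t"
 using assms by (auto simp: set_integrable_def set_lebesgue_integral_def)

text \<open>Taking off the drift changes \<open>base\<close> by about
  \<open>- \<delta> * t * slope C v\<close>, and the time integral of \<open>slope_b\<close> is
  about \<open>t * slope C v\<close>, so the two cancel up to o(t). Continuity of the slope controls
  small increments, the tail bound large ones.\<close>

lemma above_term:
 assumes e: "0 < \<epsilon>" "\<epsilon> <= 1" and \<eta>: "0 < \<eta>"
 obtains t0 where "0 < t0" "!!t v. 0 <= t ==> t <= t0 ==> b + 2 * \<epsilon> <= v ==> v <= N ==>
  \<bar>base C (v - \<delta> * t) - base C v + \<delta> * (LBINT s:{0..t}. exp (- (q * s)) * (\<E> w. slope_b C (v + Y s w)))\<bar> <= \<eta> * t"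
proof -
 obtain A r where A: "0 <= A" "0 <= r" "!!y. 0 <= y ==> \<bar>slope C y\<bar> <= A * exp (r * y)"
  using slope_exp by metis
 obtain S where S: "0 <= S" "!!y. 0 <= y ==> y <= N ==> \<bar>slope C y\<bar> <= S" using slope_nonneg_bound by metis
 define \<eta>1 where "\<eta>1 = \<eta> / (4 * (\<delta> + 1))"
 have \<eta>1: "\<eta>1 > 0" using \<eta> delta by (simp add: \<eta>1_def)
 \<comment> \<open>The compact set reaches one unit beyond \<open>N\<close> because
   \<open>slope C v\<close> is compared with values at points within
   \<open>2 * \<epsilon>1 <= \<epsilon> <= 1\<close> of \<open>v\<close>.\<close>
 have "uniformly_continuous_on {b..N+1} (slope C)"
  using b by (intro compact_uniformly_continuous continuous_on_subset[OF slope_cont]) auto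
 then obtain d0 where d0: "d0 > 0" "!!x y. x \<in> {b..N+1} ==> y \<in> {b..N+1} ==> dist y x < d0 ==> dist (slope C y) (slope C x) < \<eta>1"
  unfolding uniformly_continuous_on_def using \<eta>1 by metis
 define \<epsilon>1 where "\<epsilon>1 = min d0 \<epsilon> / 2"
 have e1: "\<epsilon>1 > 0" "2 * \<epsilon>1 <= d0" "2 * \<epsilon>1 <= \<epsilon>" using d0 e by (auto simp: \<epsilon>1_def)
 obtain B where B: "0 <= B" "!!s. 0 <= s ==> s <= 1 ==> LX.expectation (tail r \<epsilon>1 s) <= B * s"
  "!!s. 0 <= s ==> integrable M (tail r \<epsilon>1 s)"
  using LX.tail_bound[of r \<epsilon>1] e1 A(2) by auto
 define D where "D = A * exp (r * N) + S"
 have D: "D >= 0" using A S by (simp add: D_def)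
 define F where "F = D * B + q * S"
 have F: "F >= 0" using D B S q by (simp add: F_def)
 define t0 where "t0 = min 1 (min (\<epsilon>1 / (\<delta> + 1)) (\<eta> / (2 * (\<delta> * F + 1))))"
 have t0: "0 < t0" using e1 \<eta> delta F by (auto simp: t0_def intro!: divide_pos_pos add_nonneg_pos)
 have "\<bar>base C (v - \<delta> * t) - base C v + \<delta> * (LBINT s:{0..t}. exp (- (q * s)) * (\<E> w. slope_b C (v + Y s w)))\<bar> <= \<eta> * t"
  if t: "0 <= t" "t <= t0" and v: "b + 2 * \<epsilon> <= v" "v <= N" for t v
 proof -
  have t1: "t <= 1" using t by (simp add: t0_def)
  have dt: "\<delta> * t <= \<epsilon>1"
  proof -
   have "\<delta> * t <= (\<delta> + 1) * (\<epsilon>1 / (\<delta> + 1))"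
    using t delta by (intro mult_mono) (auto simp: t0_def)
   thus ?thesis using delta by simp
  qed
  have close: "\<bar>slope C z - slope C v\<bar> <= \<eta>1" if "\<bar>z - v\<bar> < 2 * \<epsilon>1" for z
  proof -
   have "b <= z" "z <= N + 1" "b <= v" "v <= N + 1" "\<bar>z - v\<bar> < d0" using that e1 e v unfolding abs_less_iff by linarith+
   thus ?thesis using d0(2)[of v z] by (auto simp: dist_real_def)
  qed
  have pw: "\<bar>slope_b C (v + Y s w) - slope C v\<bar> <= \<eta>1 + D * tail r \<epsilon>1 s w" if s: "s \<in> {0..t}" for s w
  proof -
   let ?x = "X s w" let ?z = "v + (?x - \<delta> * s)"
   have ds: "0 <= \<delta> * s" "\<delta> * s <= \<epsilon>1" using s delta mult_left_mono[of s t \<delta>] dt by auto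
   show ?thesis
   proof (cases "\<bar>?x\<bar> < \<epsilon>1")
    case True
    hence "\<bar>?z - v\<bar> < 2 * \<epsilon>1" "b < ?z" using ds v e1 e by auto
    thus ?thesis using close[of ?z] True by (simp add: slope_b_def)
   next
    case False
    have "\<bar>slope_b C ?z\<bar> <= A * exp (r * ?z)" using A(1) A(3)[of ?z] b by (auto simp: slope_b_def indicator_def)
    also have "r * ?z <= r * (N + ?x)" using v ds A(2) by (intro mult_left_mono) auto
    hence "A * exp (r * ?z) <= A * exp (r * (N + ?x))" using A(1) by (simp add: mult_left_mono)
    also have "... = A * exp (r * N) * exp (r * ?x)" by (simp add: distrib_left exp_add)
    finally have 1: "\<bar>slope_b C ?z\<bar> <= A * exp (r * N) * exp (r * ?x)" .
    have 2: "\<bar>slope C v\<bar> <= S" using S(2)[of v] v b e by auto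
    have "A * exp (r * N) * exp (r * ?x) + S <= D * (1 + \<bar>?x\<bar> + exp (r * ?x))"
    proof -
     have "A * exp (r * N) * exp (r * ?x) <= A * exp (r * N) * (1 + \<bar>?x\<bar> + exp (r * ?x))"
      using A(1) by (intro mult_left_mono) auto
     moreover have "S * 1 <= S * (1 + \<bar>?x\<bar> + exp (r * ?x))" using S(1) by (intro mult_left_mono) auto
     ultimately show ?thesis by (simp add: D_def distrib_right)
    qed
    thus ?thesis using 1 2 False \<eta>1 abs_triangle_ineq4[of "slope_b C ?z" "slope C v"] by simp
   qed
  qed
  have Eb: "\<bar>exp (- (q * s)) * (\<E> w. slope_b C (v + Y s w)) - slope C v\<bar> <= \<eta>1 + F * s" if s: "s \<in> {0..t}" for s
  proof -
   have s': "0 <= s" "s <= 1" using s t1 by auto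
   let ?E = "(\<E> w. slope_b C (v + Y s w))"
   have "?E - slope C v = (\<E> w. slope_b C (v + Y s w) - slope C v)"
    using SY.expect_integrable[OF dominated_slope_b s'(1)] by (subst Bochner_Integration.integral_diff) (auto simp: LX.prob_space)
   hence "\<bar>?E - slope C v\<bar> <= (\<E> w. \<eta>1 + D * tail r \<epsilon>1 s w)"
    using B(3)[OF s'(1)] expectation_abs_le[of "%w. \<eta>1 + D * tail r \<epsilon>1 s w", OF _ pw[OF s]] by auto
   also have "... = \<eta>1 + D * LX.expectation (tail r \<epsilon>1 s)"
    using B(3)[OF s'(1)] by (subst Bochner_Integration.integral_add) (auto simp: LX.prob_space)
   also have "... <= \<eta>1 + D * (B * s)" using B(2)[OF s'] D by (simp add: mult_left_mono)
   finally have 1: "\<bar>?E - slope C v\<bar> <= \<eta>1 + D * (B * s)" .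
   have "exp (- (q * s)) * ?E - slope C v = exp (- (q * s)) * (?E - slope C v) - (1 - exp (- (q * s))) * slope C v"
    by (simp add: algebra_simps)
   hence "\<bar>exp (- (q * s)) * ?E - slope C v\<bar> <= \<bar>exp (- (q * s)) * (?E - slope C v)\<bar> + \<bar>(1 - exp (- (q * s))) * slope C v\<bar>"
    by (metis abs_triangle_ineq4)
   also have "\<bar>exp (- (q * s)) * (?E - slope C v)\<bar> <= 1 * \<bar>?E - slope C v\<bar>"
    unfolding abs_mult using exp_q_le[OF s'(1)] by (intro mult_right_mono) auto
   also have "\<bar>(1 - exp (- (q * s))) * slope C v\<bar> <= (q * s) * S"
    unfolding abs_mult using exp_q_le[OF s'(1)] exp_q_ge[of s] S(2)[of v] v b e q s' by (intro mult_mono) auto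
   finally show ?thesis using 1 by (simp add: F_def algebra_simps)
  qed
  let ?I = "LBINT s:{0..t}. exp (- (q * s)) * (\<E> w. slope_b C (v + Y s w))"
  have Ieq: "?I - slope C v * t = (LBINT s:{0..t}. exp (- (q * s)) * (\<E> w. slope_b C (v + Y s w)) - slope C v)"
   unfolding set_integral_diff(2)[OF slope_b_time_integrable[OF t(1)] const_integral(1)[OF t(1)]] const_integral(2)[OF t(1)] ..
  have "\<bar>?I - slope C v * t\<bar> <= (LBINT s:{0..t}. \<eta>1 + F * s)"
   unfolding Ieq by (rule set_integral_indicator_bound[OF set_integral_add(1)[OF const_integral(1)[OF t(1)] linear_integral(1)[OF t(1)]] Eb])
  also have "... = \<eta>1 * t + F * t\<^sup>2 / 2"
   unfolding set_integral_add(2)[OF const_integral(1)[OF t(1)] linear_integral(1)[OF t(1)]]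
   using const_integral(2)[OF t(1), of \<eta>1] linear_integral(2)[OF t(1), of F] by linarith
  finally have I: "\<bar>?I - slope C v * t\<bar> <= \<eta>1 * t + F * t\<^sup>2 / 2" .
  have "\<bar>base C (v - \<delta> * t) - base C v + slope C v * (v - (v - \<delta> * t))\<bar> <= \<eta>1 * (v - (v - \<delta> * t))"
  proof (rule base_linear_approx)
   show "0 <= v - \<delta> * t" using v dt e1 b e by linarith
   show "v - \<delta> * t <= v" using delta t by simp
   show "\<bar>slope C z - slope C v\<bar> <= \<eta>1" if "v - \<delta> * t <= z" "z <= v" for z
    using that dt e1 by (intro close) auto
  qed
  hence base: "\<bar>base C (v - \<delta> * t) - base C v + slope C v * (\<delta> * t)\<bar> <= \<eta>1 * (\<delta> * t)" by simp
  have "base C (v - \<delta> * t) - base C v + \<delta> * ?I = (base C (v - \<delta> * t) - base C v + slope C v * (\<delta> * t)) + \<delta> * (?I - slope C v * t)"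
   by (simp add: algebra_simps)
  hence "\<bar>base C (v - \<delta> * t) - base C v + \<delta> * ?I\<bar> <= \<eta>1 * (\<delta> * t) + \<delta> * (\<eta>1 * t + F * t\<^sup>2 / 2)"
   using base mult_left_mono[OF I delta] delta abs_triangle_ineq[of "base C (v - \<delta> * t) - base C v + slope C v * (\<delta> * t)" "\<delta> * (?I - slope C v * t)"]
   by (simp add: abs_mult)
  also have "... = (2 * \<delta> * \<eta>1 + \<delta> * F * t / 2) * t" by (simp add: power2_eq_square algebra_simps)
  also have "... <= \<eta> * t"
  proof (rule mult_right_mono[OF _ t(1)])
   have "2 * \<delta> * \<eta>1 <= \<eta> / 2" unfolding \<eta>1_def using delta \<eta> by (simp add: field_simps)
   moreover have "\<delta> * F * t / 2 <= \<eta> / 2"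
   proof -
    have "\<delta> * F * t <= (\<delta> * F + 1) * (\<eta> / (2 * (\<delta> * F + 1)))"
     using t delta F by (intro mult_mono) (auto simp: t0_def)
    also have "... = \<eta> / 2" using mult_nonneg_nonneg[OF delta F] by (simp add: field_simps)
    finally show ?thesis using \<eta> by simp
   qed
   ultimately show "2 * \<delta> * \<eta>1 + \<delta> * F * t / 2 <= \<eta>" by linarith
  qed
  finally show ?thesis .
 qed
 thus ?thesis using that t0 by blast
qed

end

lemma (in scaled_process) pot_growth:
 assumes "dominated k"
 obtains A r where "0 <= A" "0 <= r" "!!y. \<bar>pot k y\<bar> <= A * exp (r * y)"
proof -
 obtain A r where A: "a < r" "0 <= A" "!!z. \<bar>k z\<bar> <= A * exp (r * z)" using dominated_E[OF assms] by metis
 have "\<bar>pot k y\<bar> <= A / (\<psi> r - q) * exp (r * y)" for y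
 proof -
  have I: "integrable lborel (%z. W (y - z) * exp (r * z))"
   using W_transform_shift[OF A(1), of y]
   by (intro integrableI_bounded) (auto simp: abs_mult W_nonneg ennreal_mult)
  have v: "(LBINT z. W (y - z) * exp (r * z)) = exp (r * y) / (\<psi> r - q)"
   using W_transform_shift[OF A(1), of y] psi_gt[OF A(1)]
   by (subst integral_eq_nn_integral) (auto simp: W_nonneg ennreal_mult)
  have "\<bar>pot k y\<bar> <= (LBINT z. A * (W (y - z) * exp (r * z)))"
   unfolding pot_def
  proof (rule order_trans[OF integral_abs_bound integral_mono'])
   show "\<bar>W (y - z) * k z\<bar> <= A * (W (y - z) * exp (r * z))" for z
    using mult_left_mono[OF A(3)[of z] W_nonneg[of "y - z"]] by (simp add: abs_mult W_nonneg mult.left_commute)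
  qed (use I A W_nonneg in auto)
  thus ?thesis using v by simp
 qed
 note main = this
 have "0 <= A / (\<psi> r - q)" "0 <= r" using A a_nonneg psi_gt[OF A(1)] by auto
 thus ?thesis by (rule that[OF _ _ main])
qed

lemma (in scaled_process) pot_borel [measurable (raw)]:
 assumes [measurable]: "k \<in> borel_measurable borel"
 shows "pot k \<in> borel_measurable borel"
 unfolding pot_def[abs_def] by measurable

context refraction
begin

text \<open>Near \<open>b\<close> nothing cancels and only O(t) can be had. The constant must not
  depend on \<open>\<epsilon>\<close>, because it will multiply a potential of the zone that is
  small only of order \<open>\<epsilon>\<close>.\<close>

lemma near_term:
 obtains K0 where "0 <= K0" "!!t u v g. 0 <= t ==> t <= 1 ==> 0 <= u ==> u <= v ==> v <= N ==> v - u <= \<delta> * t ==>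
   v <= g ==> g - v <= \<delta> * t ==>
   \<bar>base C u - base C v + \<delta> * (SY.pot (slope_b C) g - SY.pot (slope_b C) v)
    + \<delta> * (LBINT s:{0..t}. exp (- (q * s)) * (\<E> w. slope_b C (g + Y s w)))\<bar> <= K0 * t"
proof -
 obtain A r where A: "0 <= A" "0 <= r" "!!y. 0 <= y ==> \<bar>slope C y\<bar> <= A * exp (r * y)"
  using slope_exp by metis
 obtain S where S: "0 <= S" "!!y. 0 <= y ==> y <= N ==> \<bar>slope C y\<bar> <= S" using slope_nonneg_bound by metis
 obtain L where L: "0 <= L" "!!x y. x <= y ==> y <= N + \<delta> ==> \<bar>SY.pot (slope_b C) y - SY.pot (slope_b C) x\<bar> <= L * (y - x)"
  using pot_Y_lipschitz[of "N + \<delta>" C] by metis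
 define D where "D = A * exp (r * (N + \<delta>)) * exp \<bar>\<psi> r\<bar>"
 have D: "0 <= D" using A by (simp add: D_def)
 define K0 where "K0 = S * \<delta> + \<delta> * (L * \<delta>) + \<delta> * D"
 have "\<bar>base C u - base C v + \<delta> * (SY.pot (slope_b C) g - SY.pot (slope_b C) v)
    + \<delta> * (LBINT s:{0..t}. exp (- (q * s)) * (\<E> w. slope_b C (g + Y s w)))\<bar> <= K0 * t"
  if t: "0 <= t" "t <= 1" and u: "0 <= u" "u <= v" "v <= N" "v - u <= \<delta> * t" and g: "v <= g" "g - v <= \<delta> * t" for t u v g
 proof -
  have dt: "\<delta> * t <= \<delta>" using delta t by (simp add: mult_left_le)
  have "\<bar>base C u - base C v + 0 * (v - u)\<bar> <= S * (v - u)"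
   using u S(2) by (intro base_linear_approx) auto
  also have "... <= S * (\<delta> * t)" using u S by (intro mult_left_mono) auto
  finally have 1: "\<bar>base C u - base C v\<bar> <= S * (\<delta> * t)" by simp
  have "\<bar>SY.pot (slope_b C) g - SY.pot (slope_b C) v\<bar> <= L * (g - v)" using g u dt by (intro L(2)) auto
  also have "... <= L * (\<delta> * t)" using g L by (intro mult_left_mono) auto
  finally have 2: "\<delta> * \<bar>SY.pot (slope_b C) g - SY.pot (slope_b C) v\<bar> <= \<delta> * (L * (\<delta> * t))"
   using delta by (intro mult_left_mono) auto
  have Eb: "\<bar>exp (- (q * s)) * (\<E> w. slope_b C (g + Y s w))\<bar> <= D" if s: "s \<in> {0..t}" for s
  proof -
   have s': "0 <= s" "s <= 1" using s t by auto
   have "\<bar>(\<E> w. slope_b C (g + Y s w))\<bar> <= (\<E> w. A * exp (r * (N + \<delta>)) * exp (r * X s w))"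
   proof (rule expectation_abs_le)
    show "integrable M (%w. A * exp (r * (N + \<delta>)) * exp (r * X s w))"
     using LX.exp_integrable[OF s'(1) A(2)] by auto
    fix w
    let ?z = "g + Y s w"
    have "\<bar>slope_b C ?z\<bar> <= A * exp (r * ?z)" using A(1) A(3)[of ?z] b by (auto simp: slope_b_def indicator_def)
    moreover have "r * ?z <= r * (N + \<delta> + X s w)"
    proof (rule mult_left_mono[OF _ A(2)])
     show "?z <= N + \<delta> + X s w" using g u dt mult_nonneg_nonneg[OF delta s'(1)] by linarith
    qed
    hence "A * exp (r * ?z) <= A * exp (r * (N + \<delta> + X s w))" using A(1) by (simp add: mult_left_mono)
    moreover have "A * exp (r * (N + \<delta> + X s w)) = A * exp (r * (N + \<delta>)) * exp (r * X s w)"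
     by (simp add: distrib_left exp_add)
    ultimately show "\<bar>slope_b C ?z\<bar> <= A * exp (r * (N + \<delta>)) * exp (r * X s w)" by linarith
   qed
   also have "... = A * exp (r * (N + \<delta>)) * exp (s * \<psi> r)"
    using LX.exp_expectation[OF s'(1) A(2)] by simp
   also have "... <= D"
   proof -
    have "s * \<psi> r <= \<bar>s * \<psi> r\<bar>" by simp
    also have "... <= \<bar>\<psi> r\<bar>" using s' by (simp add: abs_mult mult_left_le_one_le)
    finally show ?thesis unfolding D_def using A(1) by (intro mult_left_mono) auto
   qed
   finally have "\<bar>(\<E> w. slope_b C (g + Y s w))\<bar> <= D" .
   moreover have "exp (- (q * s)) * \<bar>(\<E> w. slope_b C (g + Y s w))\<bar> <= 1 * \<bar>(\<E> w. slope_b C (g + Y s w))\<bar>"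
    using exp_q_le[OF s'(1)] by (intro mult_right_mono) auto
   ultimately show ?thesis by (simp add: abs_mult)
  qed
  let ?I = "LBINT s:{0..t}. exp (- (q * s)) * (\<E> w. slope_b C (g + Y s w))"
  have "\<bar>?I\<bar> <= (LBINT s:{0..t}. D)"
   by (rule set_integral_indicator_bound[OF const_integral(1)[OF t(1)] Eb])
  hence 3: "\<delta> * \<bar>?I\<bar> <= \<delta> * (D * t)"
   unfolding const_integral(2)[OF t(1)] using delta by (rule mult_left_mono)
  have "\<bar>base C u - base C v + \<delta> * (SY.pot (slope_b C) g - SY.pot (slope_b C) v) + \<delta> * ?I\<bar>
   <= \<bar>base C u - base C v\<bar> + \<delta> * \<bar>SY.pot (slope_b C) g - SY.pot (slope_b C) v\<bar> + \<delta> * \<bar>?I\<bar>"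
  proof -
   have "\<delta> * \<bar>?I\<bar> = \<bar>\<delta> * ?I\<bar>" "\<delta> * \<bar>SY.pot (slope_b C) g - SY.pot (slope_b C) v\<bar> = \<bar>\<delta> * (SY.pot (slope_b C) g - SY.pot (slope_b C) v)\<bar>"
    using delta by (simp_all add: abs_mult)
   thus ?thesis by linarith
  qed
  thus ?thesis using 1 2 3 unfolding K0_def by (simp add: algebra_simps)
 qed
 note main = this
 have "0 <= K0" using S L D delta by (simp add: K0_def)
 thus ?thesis by (rule that[OF _ main])
qed

text \<open>Pays for the O(t) errors near \<open>b\<close>: during a short step most paths stay in
  the zone, so its expected discounted occupation time is at least half of the step.\<close>

lemma near_occ:
 assumes e: "0 < \<epsilon>"
 obtains t0 where "0 < t0" "!!t v g. 0 <= t ==> t <= t0 ==> \<bar>v - b\<bar> < 2 * \<epsilon> ==> v <= g ==> g - v <= \<delta> * t ==> t / 2 <= occ \<epsilon> g t"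
proof -
 obtain B where B: "0 <= B" "!!s. 0 <= s ==> s <= 1 ==> LX.expectation (tail 0 (\<epsilon>/2) s) <= B * s"
  "!!s. 0 <= s ==> integrable M (tail 0 (\<epsilon>/2) s)"
  using LX.tail_bound[of 0 "\<epsilon>/2"] e by auto
 define t0 where "t0 = min 1 (min (1 / (B + q)) (\<epsilon> / (4 * (\<delta> + 1))))"
 have t0: "0 < t0" using B(1) q e delta by (auto simp: t0_def add_nonneg_pos)
 have "t / 2 <= occ \<epsilon> g t" if t: "0 <= t" "t <= t0" and v: "\<bar>v - b\<bar> < 2 * \<epsilon>" and g: "v <= g" "g - v <= \<delta> * t" for t v g
 proof -
  have t1: "t <= 1" and tB: "(B + q) * t <= 1"
   using t B(1) q by (auto simp: t0_def field_simps)
  have dt: "\<delta> * t < \<epsilon> / 2"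
  proof -
   have "\<delta> * t <= (\<delta> + 1) * (\<epsilon> / (4 * (\<delta> + 1)))"
    using t delta by (intro mult_mono) (auto simp: t0_def)
   also have "... = \<epsilon> / 4" using delta by (simp add: field_simps)
   finally show ?thesis using e by simp
  qed
  have Eb: "1 - (B + q) * s <= exp (- (q * s)) * (\<E> w. zone \<epsilon> (g + Y s w))" if s: "s \<in> {0..t}" for s
  proof -
   have s': "0 <= s" "s <= 1" using s t1 by auto
   have ds: "0 <= \<delta> * s" "\<delta> * s <= \<delta> * t" using s delta by (auto intro: mult_left_mono)
   have "1 - LX.expectation (tail 0 (\<epsilon>/2) s) = (\<E> w. 1 - tail 0 (\<epsilon>/2) s w)"
    using B(3)[OF s'(1)] by (subst Bochner_Integration.integral_diff) (auto simp: LX.prob_space)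
   also have "... <= (\<E> w. zone \<epsilon> (g + Y s w))"
   proof (intro integral_mono zone_integrable s' Bochner_Integration.integrable_diff B(3))
    fix w
    show "1 - tail 0 (\<epsilon>/2) s w <= zone \<epsilon> (g + Y s w)"
    proof (cases "\<bar>X s w\<bar> < \<epsilon>/2")
     case True
     have "b - 3 * \<epsilon> < g + Y s w" "g + Y s w < b + 3 * \<epsilon>"
      using True v g ds dt by (auto simp: abs_less_iff)
     hence "1 <= zone \<epsilon> (g + Y s w)" by (simp add: zone_def indicator_def)
     thus ?thesis using True by (simp add: not_le)
    next
     case False
     thus ?thesis using zone_bounds(1)[of \<epsilon> "g + Y s w"] by (simp add: not_less)
    qed
   qed auto
   finally have E: "1 - B * s <= (\<E> w. zone \<epsilon> (g + Y s w))" using B(2)[OF s'] by linarith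
   have Bs: "0 <= 1 - B * s"
   proof -
    have "B * s <= (B + q) * t" using s B(1) q by (intro mult_mono) auto
    thus ?thesis using tB by simp
   qed
   have "1 - (B + q) * s <= (1 - q * s) * (1 - B * s)"
    using B(1) q s'(1) by (simp add: algebra_simps)
   also have "... <= exp (- (q * s)) * (1 - B * s)" using exp_q_ge[of s] Bs by (rule mult_right_mono)
   also have "... <= exp (- (q * s)) * (\<E> w. zone \<epsilon> (g + Y s w))"
    using E by (rule mult_left_mono) auto
   finally show ?thesis .
  qed
  have "(LBINT s:{0..t}. 1 - (B + q) * s) <= occ \<epsilon> g t"
   unfolding occ_def using Eb
   by (intro set_integral_mono occ_integrable t set_integral_diff(1) const_integral(1) linear_integral(1)) auto
  moreover have "(LBINT s:{0..t}. 1 - (B + q) * s) = t - (B + q) * t\<^sup>2 / 2"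
   unfolding set_integral_diff(2)[OF const_integral(1)[OF t(1)] linear_integral(1)[OF t(1)]]
   using const_integral(2)[OF t(1), of 1] linear_integral(2)[OF t(1), of "B + q"] by linarith
  moreover have "(B + q) * t\<^sup>2 <= t" using mult_right_mono[OF tB t(1)] by (simp add: power2_eq_square mult.assoc)
  ultimately show ?thesis by linarith
 qed
 note main = this
 show ?thesis by (rule that[OF t0 main])
qed

text \<open>The potential for \<open>Y\<close> is started at \<open>u + \<delta> * t\<close>, so
  that its end point \<open>u + \<delta> * t + Y t w\<close> coincides with the end point
  \<open>u + X t w\<close> of the \<open>X\<close> part.\<close>

lemma gfun_step_identity:
 assumes t: "0 <= t"
 shows "integrable M (%w. gfun C (u + X t w))"
  and "exp (- (q * t)) * (\<E> w. gfun C (u + X t w)) =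
   base C u + (LBINT s:{0..t}. exp (- (q * s)) * (\<E> w. kap C (u + X s w)))
   + \<delta> * (SY.pot (slope_b C) (u + \<delta> * t) + (LBINT s:{0..t}. exp (- (q * s)) * (\<E> w. slope_b C (u + \<delta> * t + Y s w))))"
proof -
 have eq: "u + \<delta> * t + (X t w - \<delta> * t) = u + X t w" for w by simp
 note P = SY.pot_identity[OF dominated_slope_b[of C] t, of "u + \<delta> * t"]
 have P1: "integrable M (%w. SY.pot (slope_b C) (u + X t w))" using P(1) unfolding eq .
 show "integrable M (%w. gfun C (u + X t w))"
  unfolding gfun_def using P1 base_identity(1)[OF t] by auto
 have E: "(\<E> w. gfun C (u + X t w)) = (\<E> w. base C (u + X t w)) + \<delta> * (\<E> w. SY.pot (slope_b C) (u + X t w))"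
  unfolding gfun_def using P1 base_identity(1)[OF t] by (subst Bochner_Integration.integral_add) auto
 have alg: "e * (x + \<delta> * y) = e * x + \<delta> * (e * y)" for e x y :: real by (simp add: algebra_simps)
 show "exp (- (q * t)) * (\<E> w. gfun C (u + X t w)) =
   base C u + (LBINT s:{0..t}. exp (- (q * s)) * (\<E> w. kap C (u + X s w)))
   + \<delta> * (SY.pot (slope_b C) (u + \<delta> * t) + (LBINT s:{0..t}. exp (- (q * s)) * (\<E> w. slope_b C (u + \<delta> * t + Y s w))))"
  unfolding E alg base_identity(3)[OF t] P(3)[unfolded eq] ..
qed

lemma one_step_g:
 obtains \<kappa> where "0 <= \<kappa>"
  "!!\<eta> \<epsilon>. 0 < \<eta> ==> 0 < \<epsilon> ==> \<epsilon> <= 1 ==> 8 * \<epsilon> < b ==> EX t0>0. ALL t v c. 0 <= t --> t <= t0 --> 0 <= v --> v <= N -->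
   (v <= b - 2 * \<epsilon> --> \<not> c) --> (b + 2 * \<epsilon> <= v --> c) -->
   \<bar>exp (- (q * t)) * (\<E> w. gfun C ((v - (if c then \<delta> * t else 0)) + X t w)) - gfun C v\<bar>
    <= \<kappa> * occ \<epsilon> (v - (if c then \<delta> * t else 0) + \<delta> * t) t + \<eta> * t"
proof -
 obtain K0 where K0: "0 <= K0" "!!t u v g. 0 <= t ==> t <= 1 ==> 0 <= u ==> u <= v ==> v <= N ==> v - u <= \<delta> * t ==>
   v <= g ==> g - v <= \<delta> * t ==>
   \<bar>base C u - base C v + \<delta> * (SY.pot (slope_b C) g - SY.pot (slope_b C) v)
    + \<delta> * (LBINT s:{0..t}. exp (- (q * s)) * (\<E> w. slope_b C (g + Y s w)))\<bar> <= K0 * t"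
  by (rule near_term[where N=N and C=C], rule that)
 \<comment> \<open>The first summand comes from the visits to the negative half line, the second
   from \<open>K0 * t <= K0 * (2 * occ \<epsilon> g t)\<close>.\<close>
 define \<kappa> where "\<kappa> = q * (\<bar>C\<bar> + 1) + 2 * K0"
 have "EX t0>0. ALL t v c. 0 <= t --> t <= t0 --> 0 <= v --> v <= N -->
   (v <= b - 2 * \<epsilon> --> \<not> c) --> (b + 2 * \<epsilon> <= v --> c) -->
   \<bar>exp (- (q * t)) * (\<E> w. gfun C ((v - (if c then \<delta> * t else 0)) + X t w)) - gfun C v\<bar>
    <= \<kappa> * occ \<epsilon> (v - (if c then \<delta> * t else 0) + \<delta> * t) t + \<eta> * t"
  if \<eta>: "0 < \<eta>" and e: "0 < \<epsilon>" "\<epsilon> <= 1" "8 * \<epsilon> < b" for \<eta> \<epsilon>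
 proof -
  obtain B1 where B1: "0 <= B1" "!!t u. 0 <= t ==> t <= 1 ==> \<delta> * t < \<epsilon>/2 ==> 0 <= u ==> u <= N ==>
   \<bar>LBINT s:{0..t}. exp (- (q * s)) * (\<E> w. kap C (u + X s w))\<bar> <= q * (\<bar>C\<bar> + 1) * occ \<epsilon> (u + \<delta> * t) t + B1 * t\<^sup>2"
   by (rule kap_term[OF e(1,2), where N=N and C=C], rule that)
  obtain B2 where B2: "0 <= B2" "!!t v. 0 <= t ==> t <= 1 ==> \<delta> * t < \<epsilon> ==> v <= b - 2 * \<epsilon> ==>
   \<bar>LBINT s:{0..t}. exp (- (q * s)) * (\<E> w. slope_b C (v + \<delta> * t + Y s w))\<bar> <= B2 * t\<^sup>2"
   by (rule below_term[OF e(1), where C=C], rule that)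
  have \<eta>2: "0 < \<eta> / 2" using \<eta> by simp
  obtain t1 where t1: "0 < t1" "!!t v. 0 <= t ==> t <= t1 ==> b + 2 * \<epsilon> <= v ==> v <= N ==>
   \<bar>base C (v - \<delta> * t) - base C v + \<delta> * (LBINT s:{0..t}. exp (- (q * s)) * (\<E> w. slope_b C (v + Y s w)))\<bar> <= \<eta> / 2 * t"
   by (rule above_term[OF e(1,2) \<eta>2, where N=N and C=C], rule that)
  obtain t2 where t2: "0 < t2" "!!t v g. 0 <= t ==> t <= t2 ==> \<bar>v - b\<bar> < 2 * \<epsilon> ==> v <= g ==> g - v <= \<delta> * t ==> t / 2 <= occ \<epsilon> g t"
   by (rule near_occ[OF e(1)], rule that)
  define t0 where "t0 = min (min 1 (min t1 t2)) (min (\<epsilon> / (4 * (\<delta> + 1))) (\<eta> / (2 * (B1 + \<delta> * B2 + 1))))"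
  have Bn: "0 <= B1 + \<delta> * B2" using B1(1) B2(1) delta by simp
  have t0: "0 < t0" using t1 t2 e \<eta> delta Bn by (auto simp: t0_def intro!: divide_pos_pos add_nonneg_pos)
  have "\<bar>exp (- (q * t)) * (\<E> w. gfun C ((v - (if c then \<delta> * t else 0)) + X t w)) - gfun C v\<bar>
    <= \<kappa> * occ \<epsilon> (v - (if c then \<delta> * t else 0) + \<delta> * t) t + \<eta> * t"
   if t: "0 <= t" "t <= t0" and v: "0 <= v" "v <= N" and c: "v <= b - 2 * \<epsilon> --> \<not> c" "b + 2 * \<epsilon> <= v --> c" for t v c
  proof -
   have tt: "t <= 1" "t <= t1" "t <= t2" using t by (auto simp: t0_def)
   have dt: "\<delta> * t < \<epsilon> / 2"
   proof -
    have "\<delta> * t <= (\<delta> + 1) * (\<epsilon> / (4 * (\<delta> + 1)))"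
     using t delta by (intro mult_mono) (auto simp: t0_def)
    also have "... = \<epsilon> / 4" using delta by (simp add: field_simps)
    finally show ?thesis using e by simp
   qed
   have tB: "(B1 + \<delta> * B2) * t\<^sup>2 <= \<eta> / 2 * t"
   proof -
    have "(B1 + \<delta> * B2) * t <= (B1 + \<delta> * B2 + 1) * (\<eta> / (2 * (B1 + \<delta> * B2 + 1)))"
     using t Bn by (intro mult_mono) (auto simp: t0_def)
    also have "... = \<eta> / 2"
    proof -
     have "x * (\<eta> / (2 * x)) = \<eta> / 2" if "0 < x" for x using that by simp
     thus ?thesis using Bn by (metis add_nonneg_pos zero_less_one)
    qed
    finally have "(B1 + \<delta> * B2) * t * t <= \<eta> / 2 * t" by (rule mult_right_mono[OF _ t(1)])
    thus ?thesis by (simp only: power2_eq_square mult.assoc)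
   qed
   define u where "u = v - (if c then \<delta> * t else 0)"
   define g where "g = u + \<delta> * t"
   have dt0: "0 <= \<delta> * t" using delta t by simp
   have u: "0 <= u" "u <= v" "u <= N" "v - u <= \<delta> * t" using v c dt dt0 e unfolding u_def by (cases c; simp; linarith)+
   have g: "v <= g" "g - v <= \<delta> * t" using dt0 by (auto simp: g_def u_def)
   let ?k = "LBINT s:{0..t}. exp (- (q * s)) * (\<E> w. kap C (u + X s w))"
   let ?I = "LBINT s:{0..t}. exp (- (q * s)) * (\<E> w. slope_b C (g + Y s w))"
   let ?P = "SY.pot (slope_b C)"
   let ?R = "base C u - base C v + \<delta> * (?P g - ?P v) + \<delta> * ?I"
   have id: "exp (- (q * t)) * (\<E> w. gfun C (u + X t w)) - gfun C v = ?k + ?R"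
    unfolding gfun_step_identity(2)[OF t(1)] g_def[symmetric] gfun_def[of C v] right_diff_distrib distrib_left by linarith
   have k: "\<bar>?k\<bar> <= q * (\<bar>C\<bar> + 1) * occ \<epsilon> g t + B1 * t\<^sup>2"
    using B1(2)[OF t(1) tt(1) dt u(1) u(3)] by (simp add: g_def)
   have B1t: "B1 * t\<^sup>2 <= \<eta> / 2 * t" using tB mult_nonneg_nonneg[OF mult_nonneg_nonneg[OF delta B2(1)] zero_le_power2[of t]] by (simp add: distrib_right)
   consider "v <= b - 2 * \<epsilon>" | "b + 2 * \<epsilon> <= v" | "\<bar>v - b\<bar> < 2 * \<epsilon>" by linarith
   hence "\<bar>?k + ?R\<bar> <= \<kappa> * occ \<epsilon> g t + \<eta> * t"
   proof cases
    case 1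
    hence "\<not> c" using c by simp
    hence uv: "u = v" "g = v + \<delta> * t" by (auto simp: u_def g_def)
    have z: "?P y = 0" if "y <= b" for y
    proof -
     have "(%z. WY (y - z) * slope_b C z) = (%z. 0)"
      using that by (auto simp: fun_eq_iff slope_b_def indicator_def intro!: CY.W_neg)
     thus ?thesis by (simp add: SY.pot_def)
    qed
    have "?P v = 0" "?P g = 0" using 1 dt e by (auto intro!: z simp: uv)
    hence "\<bar>?R\<bar> = \<delta> * \<bar>?I\<bar>" using delta uv by (simp add: abs_mult)
    also have "... <= \<delta> * (B2 * t\<^sup>2)"
     using B2(2)[OF t(1) tt(1) _ 1] dt e delta by (intro mult_left_mono) (auto simp: uv)
    finally have "\<bar>?k + ?R\<bar> <= q * (\<bar>C\<bar> + 1) * occ \<epsilon> g t + (B1 + \<delta> * B2) * t\<^sup>2"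
     using k abs_triangle_ineq[of ?k ?R] by (simp add: algebra_simps)
    also have "... <= \<kappa> * occ \<epsilon> g t + \<eta> * t"
     using tB \<eta>2 t(1) mult_nonneg_nonneg[OF K0(1) occ_nonneg[of \<epsilon> g t]] mult_nonneg_nonneg[OF less_imp_le[OF \<eta>] t(1)]
     unfolding \<kappa>_def distrib_right by linarith
    finally show ?thesis .
   next
    case 2
    hence c using c by simp
    hence uv: "u = v - \<delta> * t" "g = v" by (auto simp: u_def g_def)
    have "\<bar>?R\<bar> <= \<eta> / 2 * t" using t1(2)[OF t(1) tt(2) 2 v(2)] by (simp add: uv)
    hence "\<bar>?k + ?R\<bar> <= q * (\<bar>C\<bar> + 1) * occ \<epsilon> g t + B1 * t\<^sup>2 + \<eta> / 2 * t"
     using k abs_triangle_ineq[of ?k ?R] by linarith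
    also have "... <= \<kappa> * occ \<epsilon> g t + \<eta> * t"
     using B1t mult_nonneg_nonneg[OF K0(1) occ_nonneg[of \<epsilon> g t]]
     unfolding \<kappa>_def distrib_right by linarith
    finally show ?thesis .
   next
    case 3
    have "\<bar>?R\<bar> <= K0 * t" using K0(2)[OF t(1) tt(1) u(1,2) v(2) u(4) g] .
    also have "... <= K0 * (2 * occ \<epsilon> g t)"
     using t2(2)[OF t(1) tt(3) 3 g] K0(1) by (intro mult_left_mono) auto
    finally have "\<bar>?k + ?R\<bar> <= q * (\<bar>C\<bar> + 1) * occ \<epsilon> g t + B1 * t\<^sup>2 + K0 * (2 * occ \<epsilon> g t)"
     using k abs_triangle_ineq[of ?k ?R] by linarith
    also have "... <= \<kappa> * occ \<epsilon> g t + \<eta> * t"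
     using B1t mult_nonneg_nonneg[OF less_imp_le[OF \<eta>] t(1)]
     unfolding \<kappa>_def distrib_right by (simp add: mult.assoc)
    finally show ?thesis .
   qed
   thus ?thesis using id by (simp add: u_def g_def)
  qed
  note main = this
  show ?thesis by (rule exI[of _ t0], rule conjI[OF t0], intro allI impI, rule main, assumption+)
 qed
 note main = this
 have "0 <= \<kappa>" using K0(1) q by (simp add: \<kappa>_def)
 thus ?thesis by (rule that[OF _ main])
qed

end

section \<open>Bounded test functions obtained by truncation\<close>

context refraction
begin

text \<open>By the resolvent identity for \<open>Y\<close> its discounted expectation grows over a
  step by exactly the occupation time of the zone. Adding \<open>\<kappa> * hfun \<epsilon>\<close>
  to the test function therefore absorbs all errors of order t.\<close>

definition hfun :: "real => real => real" where "hfun \<epsilon> y = SY.pot (zone \<epsilon>) y"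

lemma hfun_nonneg: "0 <= hfun \<epsilon> y"
 unfolding hfun_def SY.pot_def by (intro integral_nonneg_AE AE_I2 mult_nonneg_nonneg SY.W_nonneg zone_bounds)

lemma hfun_mono: "x <= y ==> hfun \<epsilon> x <= hfun \<epsilon> y"
 unfolding hfun_def SY.pot_def
 by (intro integral_mono SY.pot_integrable dominated_zone mult_right_mono CY.W_mono zone_bounds) auto

text \<open>The zone has total length \<open>8 * \<epsilon>\<close> and lies to the right of -1,
  where the kernel is at most \<open>WY (y + 1)\<close>.\<close>

lemma hfun_small:
 assumes e: "0 < \<epsilon>" "\<epsilon> <= 1" "8 * \<epsilon> < b"
 shows "hfun \<epsilon> y <= 8 * \<epsilon> * WY (y + 1)"
proof -
 have i: "integrable lborel (%z. WY (y + 1) * zone \<epsilon> z)"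
  unfolding zone_def using e by (intro integrable_mult_right Bochner_Integration.integrable_add integrable_real_indicator) auto
 have "hfun \<epsilon> y <= (LBINT z. WY (y + 1) * zone \<epsilon> z)"
  unfolding hfun_def SY.pot_def
 proof (rule integral_mono[OF SY.pot_integrable[OF dominated_zone] i])
  fix z
  show "WY (y - z) * zone \<epsilon> z <= WY (y + 1) * zone \<epsilon> z"
  proof (cases "-1 <= z")
   case True
   thus ?thesis by (intro mult_right_mono CY.W_mono zone_bounds) auto
  next
   case False
   hence "zone \<epsilon> z = 0" using e unfolding zone_def by (auto split: split_indicator)
   thus ?thesis by simp
  qed
 qed
 also have "... = WY (y + 1) * (8 * \<epsilon>)"
 proof -
  have "(LBINT z. zone \<epsilon> z) = (LBINT z. indicator {- \<epsilon><..<\<epsilon>} z) + (LBINT z. indicator {b - 3*\<epsilon><..<b + 3*\<epsilon>} z)"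
   unfolding zone_def using e by (intro Bochner_Integration.integral_add integrable_real_indicator) auto
  also have "... = 8 * \<epsilon>" using e by simp
  finally show ?thesis by simp
 qed
 finally show ?thesis by (simp add: mult_ac)
qed

lemma pot_slope_below: "y <= b ==> SY.pot (slope_b C) y = 0"
proof -
 assume y: "y <= b"
 have "(%z. WY (y - z) * slope_b C z) = (%z. 0)"
  using y by (auto simp: fun_eq_iff slope_b_def indicator_def intro!: CY.W_neg)
 thus ?thesis by (simp add: SY.pot_def)
qed

text \<open>Slope -1 below 0: a push lowers \<open>gfun\<close> by exactly the amount pushed, which
  is how the pushes enter the balance.\<close>

lemma gfun_neg: "y <= 0 ==> gfun C y = gfun C 0 - y"
 using b by (simp add: gfun_def base_def pot_slope_below CX.Zb_nonpos CX.Z_nonpos)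

lemma slope_b_borel [measurable]: "slope_b C \<in> borel_measurable borel"
 unfolding slope_b_def by measurable

lemma gfun_borel [measurable]: "gfun C \<in> borel_measurable borel"
 unfolding gfun_def base_pot by measurable

lemma hfun_borel [measurable]: "hfun \<epsilon> \<in> borel_measurable borel"
 unfolding hfun_def[abs_def] by measurable

lemma gfun_cont: "continuous_on {0..T} (gfun C)"
proof -
 have "continuous_on {0..T} (base C)"
  unfolding continuous_on_eq_continuous_within by (auto intro: base_deriv[THEN DERIV_continuous])
 moreover have "continuous_on {0..T} (SY.pot (slope_b C))"
 proof -
  obtain L where L: "0 <= L" "!!x y. x <= y ==> y <= T ==> \<bar>SY.pot (slope_b C) y - SY.pot (slope_b C) x\<bar> <= L * (y - x)"
   by (rule pot_Y_lipschitz[where N=T and C=C], rule that)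
  have "L-lipschitz_on {0..T} (SY.pot (slope_b C))"
  proof (rule lipschitz_onI[OF _ L(1)])
   fix x y assume "x \<in> {0..T}" "y \<in> {0..T}"
   thus "dist (SY.pot (slope_b C) x) (SY.pot (slope_b C) y) <= L * dist x y"
    using L(2)[of x y] L(2)[of y x] by (cases "x <= y") (auto simp: dist_real_def abs_minus_commute)
  qed
  thus ?thesis by (rule lipschitz_on_continuous_on)
 qed
 ultimately show ?thesis unfolding gfun_def[abs_def] by (intro continuous_intros)
qed

lemma gfun_growth:
 obtains A r where "0 <= A" "0 <= r" "!!y. 0 <= y ==> \<bar>gfun C y\<bar> <= A * exp (r * y)"
proof -
 obtain A1 r1 where A1: "0 <= A1" "0 <= r1" "!!y. 0 <= y ==> \<bar>slope C y\<bar> <= A1 * exp (r1 * y)"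
  using slope_exp by metis
 obtain A2 r2 where A2: "0 <= A2" "0 <= r2" "!!y. \<bar>SY.pot (slope_b C) y\<bar> <= A2 * exp (r2 * y)"
  by (rule SY.pot_growth[OF dominated_slope_b[of C]], rule that)
 define r where "r = r1 + r2 + 1"
 define A where "A = \<bar>base C 0\<bar> + A1 + \<delta> * A2"
 have "\<bar>gfun C y\<bar> <= A * exp (r * y)" if y: "0 <= y" for y
 proof -
  have "\<bar>base C 0 - base C y + 0 * (y - 0)\<bar> <= (A1 * exp (r1 * y)) * (y - 0)"
  proof (rule base_linear_approx)
   fix z assume z: "0 <= z" "z <= y"
   have "exp (r1 * z) <= exp (r1 * y)" using z A1(2) by (simp add: mult_left_mono)
   thus "\<bar>slope C z - 0\<bar> <= A1 * exp (r1 * y)"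
    using A1(3)[OF z(1)] mult_left_mono[of "exp (r1 * z)" "exp (r1 * y)" A1] A1(1) by simp
  qed (use y in auto)
  hence 1: "\<bar>base C y\<bar> <= \<bar>base C 0\<bar> + A1 * (exp (r1 * y) * y)" by (simp add: mult.assoc)
  have "y <= exp y" using exp_ge_add_one_self[of y] by linarith
  hence "exp (r1 * y) * y <= exp (r1 * y) * exp y" by (intro mult_left_mono) auto
  also have "... <= exp (r * y)" using A2(2) y by (simp add: mult_exp_exp r_def distrib_right)
  finally have 2: "A1 * (exp (r1 * y) * y) <= A1 * exp (r * y)" using A1(1) by (rule mult_left_mono)
  have 3: "\<bar>base C 0\<bar> * 1 <= \<bar>base C 0\<bar> * exp (r * y)"
   using y A1(2) A2(2) by (intro mult_left_mono) (auto simp: r_def)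
  have "exp (r2 * y) <= exp (r * y)" using y A1(2) by (simp add: r_def mult_right_mono)
  hence "A2 * exp (r2 * y) <= A2 * exp (r * y)" using A2(1) by (rule mult_left_mono)
  hence "\<delta> * \<bar>SY.pot (slope_b C) y\<bar> <= \<delta> * (A2 * exp (r * y))"
   using A2(3)[of y] delta by (intro mult_left_mono) auto
  moreover have "\<bar>gfun C y\<bar> <= \<bar>base C y\<bar> + \<delta> * \<bar>SY.pot (slope_b C) y\<bar>"
   unfolding gfun_def using delta abs_triangle_ineq[of "base C y" "\<delta> * SY.pot (slope_b C) y"] by (simp add: abs_mult)
  ultimately show ?thesis using 1 2 3 unfolding A_def distrib_right mult.assoc by linarith
 qed
 note main = this
 show ?thesis by (rule that[OF _ _ main]) (use A1 A2 delta in \<open>auto simp: A_def r_def\<close>)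
qed

text \<open>From height at least 1 a push requires a downward move of size at least 1, which is O(t)
  in expectation.\<close>

lemma floor_step:
 obtains K' where "0 <= K'" "!!t u. 0 <= t ==> t <= 1 ==> 1 <= u ==> (\<E> w. max (- (u + X t w)) 0) <= K' * t"
proof -
 obtain B where B: "0 <= B" "!!s. 0 <= s ==> s <= 1 ==> LX.expectation (tail 0 1 s) <= B * s"
  "!!s. 0 <= s ==> integrable M (tail 0 1 s)"
  using LX.tail_bound[of 0 1] by auto
 have "(\<E> w. max (- (u + X t w)) 0) <= B * t" if t: "0 <= t" "t <= 1" "1 <= u" for t u
 proof -
  have "\<bar>(\<E> w. max (- (u + X t w)) 0)\<bar> <= LX.expectation (tail 0 1 t)"
  proof (rule expectation_abs_le[OF B(3)[OF t(1)]])
   fix w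
   show "\<bar>max (- (u + X t w)) 0\<bar> <= tail 0 1 t w"
   proof (cases "1 <= \<bar>X t w\<bar>")
    case False thus ?thesis using t by (simp add: max_def abs_less_iff not_le)
   next
    case True
    hence "indicat_real {w. 1 <= \<bar>X t w\<bar>} w = 1" by simp
    thus ?thesis using t by (simp add: max_def)
   qed
  qed
  thus ?thesis using B(2)[OF t(1,2)] by linarith
 qed
 note main = this
 show ?thesis by (rule that[OF B(1) main])
qed

definition start :: "bool => real => real => real" where
 "start c t v = v - (if c then \<delta> * t else 0)"

text \<open>The freedom within \<open>2 * \<epsilon>\<close> of \<open>b\<close> lets one estimate
  serve every chain whose refraction level differs from \<open>b\<close> by at most
  \<open>\<epsilon>\<close>.\<close>

definition refracted_ok :: "real => real => bool => bool" where
 "refracted_ok \<epsilon> v c \<longleftrightarrow> (v <= b - 2 * \<epsilon> --> \<not> c) & (b + 2 * \<epsilon> <= v --> c)"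

text \<open>\<open>s\<close> is 1 for lower and -1 for upper bounds. The function \<open>g\<close>
  is \<open>s * gfun C + \<kappa> * hfun \<epsilon>\<close>, cut off from below at \<open>a\<close>
  and set to \<open>a\<close> beyond \<open>N1\<close>. The cut from below only raises the value at
  the end of a step; the jump to \<open>a\<close> could lower it. On the interval from
  \<open>N1\<close> to \<open>N2\<close> the margin \<open>\<mu>\<close> keeps the uncut function at
  most \<open>a\<close>, and passing beyond \<open>N2\<close> in one step costs o(t) by the
  overshoot bound. The inequality is claimed only where \<open>g\<close> exceeds \<open>a\<close>,
  since there it equals the uncut function.\<close>

lemma trunc_step:
 assumes s: "\<bar>s\<bar> = 1" and N: "0 <= N1" "N1 < N2" and \<mu>: "0 < \<mu>"
  and margin: "!!y. N1 <= y ==> y <= N2 ==> s * gfun C y <= a - \<mu>" and \<eta>: "0 < \<eta>"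
 shows "EX \<epsilon>1>0. ALL \<epsilon>. 0 < \<epsilon> --> \<epsilon> < \<epsilon>1 --> (EX g t0 B. 0 < t0 & g \<in> borel_measurable borel & (ALL y. a <= g y & g y <= B) &
   (ALL v. 0 <= v --> v <= N1 --> s * gfun C v <= g v & g v <= max (s * gfun C v + \<eta>) a) & (ALL v>N1. g v = a) &
   (ALL t v c. 0 <= t --> t <= t0 --> 0 <= v --> v <= N1 --> refracted_ok \<epsilon> v c --> a < g v -->
    g v - \<eta> * t <= exp (- (q * t)) * (\<E> w. g (max (start c t v + X t w) 0) + s * max (- (start c t v + X t w)) 0)))"
proof -
 obtain \<kappa> where \<kappa>: "0 <= \<kappa>"
  "!!\<eta> \<epsilon>. 0 < \<eta> ==> 0 < \<epsilon> ==> \<epsilon> <= 1 ==> 8 * \<epsilon> < b ==> EX t0>0. ALL t v c. 0 <= t --> t <= t0 --> 0 <= v --> v <= N1 -->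
   (v <= b - 2 * \<epsilon> --> \<not> c) --> (b + 2 * \<epsilon> <= v --> c) -->
   \<bar>exp (- (q * t)) * (\<E> w. gfun C ((v - (if c then \<delta> * t else 0)) + X t w)) - gfun C v\<bar>
    <= \<kappa> * occ \<epsilon> (v - (if c then \<delta> * t else 0) + \<delta> * t) t + \<eta> * t"
  by (rule one_step_g[where N=N1 and C=C], rule that)
 \<comment> \<open>Makes \<open>\<kappa> * hfun \<epsilon>\<close> at most
   \<open>min \<mu> \<eta>\<close> everywhere up to \<open>N2\<close>; the summand 1 keeps the
   denominator positive.\<close>
 define \<epsilon>1 where "\<epsilon>1 = min (min 1 (b / 8)) (min \<mu> \<eta> / (8 * (\<kappa> * WY (N2 + 1)) + 1))"
 have kw: "0 <= \<kappa> * WY (N2 + 1)" using \<kappa>(1) SY.W_nonneg by simp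
 have e1: "0 < \<epsilon>1" using b \<mu> \<eta> kw by (auto simp: \<epsilon>1_def intro!: divide_pos_pos)
 show ?thesis
 proof (intro exI[of _ \<epsilon>1] conjI e1 allI impI)
  fix \<epsilon> assume e: "0 < \<epsilon>" "\<epsilon> < \<epsilon>1"
  have ee: "\<epsilon> <= 1" "8 * \<epsilon> < b" using e by (auto simp: \<epsilon>1_def)
  have hs: "\<kappa> * hfun \<epsilon> y <= min \<mu> \<eta>" if "y <= N2" for y
  proof -
   have "hfun \<epsilon> y <= 8 * \<epsilon> * WY (N2 + 1)"
   proof (rule order_trans[OF hfun_small[OF e(1) ee, of y] mult_left_mono])
    show "WY (y + 1) <= WY (N2 + 1)" using that by (intro CY.W_mono) simp
   qed (use e in simp)
   hence "\<kappa> * hfun \<epsilon> y <= \<epsilon> * (8 * (\<kappa> * WY (N2 + 1)))"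
    using mult_left_mono[OF _ \<kappa>(1), of "hfun \<epsilon> y" "8 * \<epsilon> * WY (N2 + 1)"] by (simp only: mult_ac)
   also have "... <= \<epsilon> * (8 * (\<kappa> * WY (N2 + 1)) + 1)" using e by (intro mult_left_mono) auto
   also have "... <= (min \<mu> \<eta> / (8 * (\<kappa> * WY (N2 + 1)) + 1)) * (8 * (\<kappa> * WY (N2 + 1)) + 1)"
    using e kw by (intro mult_right_mono) (auto simp: \<epsilon>1_def)
   also have "... = min \<mu> \<eta>" using kw by simp
   finally show ?thesis .
  qed
  define G where "G y = s * gfun C y + \<kappa> * hfun \<epsilon> y" for y
  have [measurable]: "G \<in> borel_measurable borel" unfolding G_def[abs_def] by measurable
  define g where "g y = (if y <= N1 then max (if 0 <= y then G y else a) a else a)" for y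
  have wmeas [measurable]: "g \<in> borel_measurable borel" unfolding g_def[abs_def] by measurable
  obtain A1 r1 where A1: "0 <= A1" "0 <= r1" "!!y. 0 <= y ==> \<bar>gfun C y\<bar> <= A1 * exp (r1 * y)"
   by (rule gfun_growth[where C=C], rule that)
  obtain A2 r2 where A2': "0 <= A2" "0 <= r2" "!!y. \<bar>SY.pot (zone \<epsilon>) y\<bar> <= A2 * exp (r2 * y)"
   by (rule SY.pot_growth[OF dominated_zone[of \<epsilon>]], rule that)
  note A2 = A2'[folded hfun_def]
  define r where "r = r1 + r2"
  define A where "A = A1 + \<kappa> * A2 + \<bar>a\<bar>"
  have th: "0 <= r" and A0: "0 <= A" using A1 A2 \<kappa>(1) by (auto simp: r_def A_def)
  have Gb: "\<bar>G y\<bar> + \<bar>a\<bar> <= A * exp (r * y)" if y: "0 <= y" for y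
  proof -
   have "exp (r1 * y) <= exp (r * y)" "exp (r2 * y) <= exp (r * y)" "1 <= exp (r * y)"
    using y A1 A2 by (auto simp: r_def mult_right_mono)
   hence "A1 * exp (r1 * y) <= A1 * exp (r * y)" "A2 * exp (r2 * y) <= A2 * exp (r * y)" "\<bar>a\<bar> * 1 <= \<bar>a\<bar> * exp (r * y)"
    using A1(1) A2(1) abs_ge_zero[of a] by (blast intro: mult_left_mono)+
   moreover hence "\<kappa> * \<bar>hfun \<epsilon> y\<bar> <= \<kappa> * (A2 * exp (r * y))" using A2(3)[of y] \<kappa>(1) by (intro mult_left_mono) auto
   moreover have "\<bar>G y\<bar> <= \<bar>gfun C y\<bar> + \<kappa> * \<bar>hfun \<epsilon> y\<bar>"
    unfolding G_def using s \<kappa>(1) abs_triangle_ineq[of "s * gfun C y" "\<kappa> * hfun \<epsilon> y"] by (simp add: abs_mult)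
   ultimately show ?thesis using A1(3)[OF y] unfolding A_def distrib_right mult.assoc by linarith
  qed
  define B where "B = A * exp (r * N1) + \<bar>a\<bar>"
  have B0: "\<bar>a\<bar> <= B" using A0 by (simp add: B_def)
  have wB: "a <= g y & g y <= B" for y
  proof -
   have "G y <= B" if "0 <= y" "y <= N1"
   proof -
    have "A * exp (r * y) <= A * exp (r * N1)" using that th A0 by (intro mult_left_mono) (auto intro: mult_left_mono)
    thus ?thesis using Gb[OF that(1)] by (simp add: B_def)
   qed
   thus ?thesis using B0 by (auto simp: g_def max_def)
  qed
  have d: "0 < N2 - N1" using N by simp
  have pos: "0 < \<eta> / (2 * (A * exp (r * N1) + 1))" using \<eta> A0 by (intro divide_pos_pos) (auto simp: add_nonneg_pos)
  obtain t1 where t1: "0 < t1" "!!t. 0 <= t ==> t <= t1 ==>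
   (\<E> w. exp (r * X t w) * indicator {w. N2 - N1 <= X t w} w) <= \<eta> / (2 * (A * exp (r * N1) + 1)) * t"
   by (rule LX.overshoot_bound[OF th d pos], rule that)
  have \<eta>2: "0 < \<eta> / 2" using \<eta> by simp
  obtain t2 where t2: "0 < t2" "!!t v c. 0 <= t ==> t <= t2 ==> 0 <= v ==> v <= N1 ==> refracted_ok \<epsilon> v c ==>
   \<bar>exp (- (q * t)) * (\<E> w. gfun C (start c t v + X t w)) - gfun C v\<bar> <= \<kappa> * occ \<epsilon> (start c t v + \<delta> * t) t + \<eta> / 2 * t"
   using \<kappa>(2)[OF \<eta>2 e(1) ee] unfolding start_def refracted_ok_def by blast
  define t0 where "t0 = min t1 t2"
  have step: "g v - \<eta> * t <= exp (- (q * t)) * (\<E> w. g (max (start c t v + X t w) 0) + s * max (- (start c t v + X t w)) 0)"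
   if t: "0 <= t" "t <= t0" and v: "0 <= v" "v <= N1" and c: "refracted_ok \<epsilon> v c" and wa: "a < g v" for t v c
  proof -
   define u where "u = start c t v"
   have uv: "u <= v" "v <= u + \<delta> * t" using delta t by (auto simp: u_def start_def)
   have tt: "t <= t1" "t <= t2" using t by (auto simp: t0_def)
   have wG: "g v = G v" using wa v by (auto simp: g_def max_def split: if_splits)
   note P = SY.pot_identity[OF dominated_zone[of \<epsilon>] t(1), of "u + \<delta> * t"]
   have eq: "u + \<delta> * t + (X t w - \<delta> * t) = u + X t w" for w by simp
   have h1: "integrable M (%w. hfun \<epsilon> (u + X t w))" using P(1) unfolding eq hfun_def .
   have h2: "exp (- (q * t)) * (\<E> w. hfun \<epsilon> (u + X t w)) = hfun \<epsilon> (u + \<delta> * t) + occ \<epsilon> (u + \<delta> * t) t"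
    using P(3) unfolding eq hfun_def occ_def .
   have h3: "hfun \<epsilon> v + occ \<epsilon> (u + \<delta> * t) t <= exp (- (q * t)) * (\<E> w. hfun \<epsilon> (u + X t w))"
    unfolding h2 using hfun_mono[OF uv(2), of \<epsilon>] by simp
   note g1 = gfun_step_identity(1)[OF t(1), of C u]
   have GI: "integrable M (%w. G (u + X t w))" unfolding G_def using g1 h1 by auto
   have GE: "(\<E> w. G (u + X t w)) = s * (\<E> w. gfun C (u + X t w)) + \<kappa> * (\<E> w. hfun \<epsilon> (u + X t w))"
    unfolding G_def using g1 h1 by (subst Bochner_Integration.integral_add) auto
   have Gstep: "G v - \<eta> / 2 * t <= exp (- (q * t)) * (\<E> w. G (u + X t w))"
   proof -
    let ?D = "exp (- (q * t)) * (\<E> w. gfun C (u + X t w)) - gfun C v"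
    have "\<bar>s * ?D\<bar> <= \<kappa> * occ \<epsilon> (u + \<delta> * t) t + \<eta> / 2 * t"
     using t2(2)[OF t(1) tt(2) v c] s unfolding u_def[symmetric] abs_mult by simp
    moreover have "\<kappa> * (hfun \<epsilon> v + occ \<epsilon> (u + \<delta> * t) t) <= \<kappa> * (exp (- (q * t)) * (\<E> w. hfun \<epsilon> (u + X t w)))"
     using h3 \<kappa>(1) by (rule mult_left_mono)
    moreover have "exp (- (q * t)) * (\<E> w. G (u + X t w)) = s * ?D + s * gfun C v + \<kappa> * (exp (- (q * t)) * (\<E> w. hfun \<epsilon> (u + X t w)))"
     unfolding GE by (simp add: distrib_left right_diff_distrib mult.left_commute)
    moreover have "G v = s * gfun C v + \<kappa> * hfun \<epsilon> v" by (simp add: G_def)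
    ultimately show ?thesis unfolding distrib_left by linarith
   qed
   \<comment> \<open>Below 0 the linear part of \<open>gfun\<close> is the push itself, and
     \<open>hfun\<close> is monotone; between \<open>N1\<close> and \<open>N2\<close> the margin
     applies; the subtracted term is there for values beyond \<open>N2\<close>, which force an
     increment of at least \<open>N2 - N1\<close>.\<close>
   have pw: "G (u + X t w) - A * exp (r * N1) * (exp (r * X t w) * indicator {w. N2 - N1 <= X t w} w)
     <= g (max (u + X t w) 0) + s * max (- (u + X t w)) 0" for w
   proof -
    let ?U = "u + X t w"
    have ov: "0 <= A * exp (r * N1) * (exp (r * X t w) * indicator {w. N2 - N1 <= X t w} w)" using A0 by simp
    consider "?U < 0" | "0 <= ?U" "?U <= N1" | "N1 < ?U" "?U <= N2" | "N2 < ?U" by linarith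
    thus ?thesis
    proof cases
     case 1
     have "G ?U = s * gfun C 0 + s * (- ?U) + \<kappa> * hfun \<epsilon> ?U"
      unfolding G_def gfun_neg[OF less_imp_le[OF 1]] by (simp add: algebra_simps)
     also have "\<kappa> * hfun \<epsilon> ?U <= \<kappa> * hfun \<epsilon> 0" using 1 \<kappa>(1) by (intro mult_left_mono hfun_mono) auto
     finally have "G ?U <= G 0 + s * (- ?U)" by (simp add: G_def)
     moreover have "G 0 <= g 0" using N by (simp add: g_def)
     ultimately show ?thesis using 1 ov by (simp add: max_def)
    next
     case 2
     hence "G ?U <= g ?U" by (simp add: g_def)
     thus ?thesis using 2 ov by (simp add: max_def)
    next
     case 3
     have "G ?U <= a" using margin[of ?U] hs[of ?U] 3 by (simp add: G_def)
     thus ?thesis using 3 ov N by (simp add: max_def g_def)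
    next
     case 4
     hence x: "N2 - N1 <= X t w" using uv v by linarith
     have "r * ?U <= r * (N1 + X t w)" using uv v th by (intro mult_left_mono) auto
     hence "A * exp (r * ?U) <= A * exp (r * (N1 + X t w))" using A0 by (simp add: mult_left_mono)
     also have "... = A * exp (r * N1) * exp (r * X t w)" by (simp add: distrib_left exp_add)
     finally have "\<bar>G ?U\<bar> + \<bar>a\<bar> <= A * exp (r * N1) * exp (r * X t w)" using Gb[of ?U] 4 N by simp
     thus ?thesis using 4 N x by (simp add: max_def g_def)
    qed
   qed
   have oI: "integrable M (%w. exp (r * X t w) * indicator {w. N2 - N1 <= X t w} w)"
    by (rule Bochner_Integration.integrable_bound[OF LX.exp_integrable[OF t(1) th]]) (auto simp: indicator_def)
   have wI: "integrable M (%w. g (max (u + X t w) 0))"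
   proof (rule LX.integrable_const_bound[where B="\<bar>a\<bar> + \<bar>B\<bar>"])
    have "\<bar>g y\<bar> <= \<bar>a\<bar> + \<bar>B\<bar>" for y using wB[of y] by linarith
    thus "AE x in M. norm (g (max (u + X t x) 0)) <= \<bar>a\<bar> + \<bar>B\<bar>" by simp
   qed measurable
   have mI: "integrable M (%w. s * max (- (u + X t w)) 0)"
    using LX.X_integrable[OF t(1)] by (intro integrable_mult_right integrable_max) auto
   have "(\<E> w. G (u + X t w)) - A * exp (r * N1) * (\<E> w. exp (r * X t w) * indicator {w. N2 - N1 <= X t w} w)
     = (\<E> w. G (u + X t w) - A * exp (r * N1) * (exp (r * X t w) * indicator {w. N2 - N1 <= X t w} w))"
    using GI oI by (subst Bochner_Integration.integral_diff) auto
   also have "... <= (\<E> w. g (max (u + X t w) 0) + s * max (- (u + X t w)) 0)"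
    using GI oI wI mI by (intro integral_mono pw Bochner_Integration.integrable_diff Bochner_Integration.integrable_add integrable_mult_right) auto
   finally have le: "(\<E> w. G (u + X t w)) - A * exp (r * N1) * (\<E> w. exp (r * X t w) * indicator {w. N2 - N1 <= X t w} w)
     <= (\<E> w. g (max (u + X t w) 0) + s * max (- (u + X t w)) 0)" .
   have over: "A * exp (r * N1) * (\<E> w. exp (r * X t w) * indicator {w. N2 - N1 <= X t w} w) <= \<eta> / 2 * t"
   proof -
    define D where "D = A * exp (r * N1)"
    have D: "0 <= D" using A0 by (simp add: D_def)
    have "D * (\<E> w. exp (r * X t w) * indicator {w. N2 - N1 <= X t w} w) <= D * (\<eta> / (2 * (D + 1)) * t)"
     using t1(2)[OF t(1) tt(1)] D unfolding D_def[symmetric] by (intro mult_left_mono) auto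
    also have "... <= (D + 1) * (\<eta> / (2 * (D + 1)) * t)"
     using D \<eta> t(1) by (intro mult_right_mono mult_nonneg_nonneg) auto
    also have "... = \<eta> / 2 * t"
    proof -
     have "x * (\<eta> / (2 * x) * t) = \<eta> / 2 * t" if "0 < x" for x using that by simp
     thus ?thesis using D by (metis add_nonneg_pos zero_less_one)
    qed
    finally show ?thesis by (simp add: D_def)
   qed
   have "exp (- (q * t)) * ((\<E> w. G (u + X t w)) - A * exp (r * N1) * (\<E> w. exp (r * X t w) * indicator {w. N2 - N1 <= X t w} w))
    <= exp (- (q * t)) * (\<E> w. g (max (u + X t w) 0) + s * max (- (u + X t w)) 0)"
    using le by (rule mult_left_mono) simp
   moreover have "exp (- (q * t)) * (A * exp (r * N1) * (\<E> w. exp (r * X t w) * indicator {w. N2 - N1 <= X t w} w)) <= 1 * (\<eta> / 2 * t)"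
   proof (rule mult_mono[OF exp_q_le[OF t(1)] over])
    show "0 <= A * exp (r * N1) * (\<E> w. exp (r * X t w) * indicator {w. N2 - N1 <= X t w} w)"
     using A0 by (intro mult_nonneg_nonneg integral_nonneg_AE) auto
   qed auto
   ultimately show ?thesis using Gstep unfolding wG u_def[symmetric] right_diff_distrib by linarith
  qed
  have t0: "0 < t0" using t1 t2 by (simp add: t0_def)
  have w1: "s * gfun C v <= g v & g v <= max (s * gfun C v + \<eta>) a" if "0 <= v" "v <= N1" for v
   using that hs[of v] N mult_nonneg_nonneg[OF \<kappa>(1) hfun_nonneg[of \<epsilon> v]] by (auto simp: g_def G_def max_def)
  show "EX g t0 B. 0 < t0 & g \<in> borel_measurable borel & (ALL y. a <= g y & g y <= B) &
   (ALL v. 0 <= v --> v <= N1 --> s * gfun C v <= g v & g v <= max (s * gfun C v + \<eta>) a) & (ALL v>N1. g v = a) &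
   (ALL t v c. 0 <= t --> t <= t0 --> 0 <= v --> v <= N1 --> refracted_ok \<epsilon> v c --> a < g v -->
    g v - \<eta> * t <= exp (- (q * t)) * (\<E> w. g (max (start c t v + X t w) 0) + s * max (- (start c t v + X t w)) 0))"
  proof (rule exI[of _ g], rule exI[of _ t0], rule exI[of _ B], intro conjI)
   show "ALL y. a <= g y & g y <= B" using wB by (rule allI)
   show "ALL v. 0 <= v --> v <= N1 --> s * gfun C v <= g v & g v <= max (s * gfun C v + \<eta>) a" by (intro allI impI w1)
   show "ALL v>N1. g v = a" by (auto simp: g_def)
   show "ALL t v c. 0 <= t --> t <= t0 --> 0 <= v --> v <= N1 --> refracted_ok \<epsilon> v c --> a < g v -->
    g v - \<eta> * t <= exp (- (q * t)) * (\<E> w. g (max (start c t v + X t w) 0) + s * max (- (start c t v + X t w)) 0)"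
    by (intro allI impI step)
  qed (rule t0, rule wmeas)
 qed
qed

end

text \<open>An Euler scheme driven by the increments \<open>z\<close>: whether the drift
  \<open>d\<close> is removed over a step is decided by the value at its start.\<close>

fun chain :: "real => real => real => (nat => real) => nat => real" where
 "chain d b' v z 0 = v"
| "chain d b' v z (Suc i) = max (chain d b' v z i - (if b' < chain d b' v z i then d else 0) + z i) 0"

definition chain_push :: "real => real => real => (nat => real) => nat => real" where
 "chain_push d b' v z i = max (- (chain d b' v z i - (if b' < chain d b' v z i then d else 0) + z i)) 0"

lemma chain_nonneg: "0 <= v ==> 0 <= chain d b' v z i"
 by (cases i) auto

section \<open>Discounted pushes of the sampled chain\<close>

lemma chain_cong: "(!!j. j < i ==> z j = z' j) ==> chain d b' v z i = chain d b' v z' i"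
 by (induction i) auto

lemma chain_measurable: "{..<i} \<subseteq> I ==> (%z. chain d b' v z i) \<in> borel_measurable (PiM I (%_. borel))"
proof (induction i)
 case (Suc i)
 have [measurable]: "(%z. chain d b' v z i) \<in> borel_measurable (PiM I (%_. borel))" "i \<in> I"
  using Suc.IH Suc.prems by (auto simp: lessThan_Suc)
 show ?case by simp
qed simp

locale levy_refraction = refraction M X \<psi> m K q \<Phi> W \<delta> \<phi> WY b
 for M :: "'a measure" and X \<psi> m K q \<Phi> W \<delta> \<phi> WY b +
 assumes indep: "!!n N. 0 < n ==> LX.indep_vars (%_. borel) (%i w. X (real (Suc i) / real n) w - X (real i / real n) w) {..<N}"
  and stationary: "!!n i. 0 < n ==> distr M borel (%w. X (real (Suc i) / real n) w - X (real i / real n) w) = distr M borel (X (1 / real n))"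
begin

definition incr :: "nat => 'a => nat => real" where
 "incr n w i = X (real (Suc i) / real n) w - X (real i / real n) w"

lemma incr_meas [measurable]: "(%w. incr n w i) \<in> borel_measurable M"
 unfolding incr_def by measurable

lemma chain_incr_meas [measurable]: "(%w. chain d b' v (incr n w) i) \<in> borel_measurable M"
proof (induction i)
 case (Suc i)
 note Suc[measurable]
 show ?case by simp
qed simp

lemma push_meas [measurable]: "(%w. chain_push d b' v (incr n w) i) \<in> borel_measurable M"
 unfolding chain_push_def by measurable

lemma incr_integrable: "0 < n ==> integrable M (%w. incr n w i)"
 unfolding incr_def using LX.X_integrable by (intro Bochner_Integration.integrable_diff) auto

lemma push_integrable:
 assumes n: "0 < n" and d: "0 <= d" and v: "0 <= v"
 shows "integrable M (%w. chain_push d b' v (incr n w) i)"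
proof (rule Bochner_Integration.integrable_bound)
 show "integrable M (%w. d + \<bar>incr n w i\<bar>)" using incr_integrable[OF n] by auto
 show "AE w in M. norm (chain_push d b' v (incr n w) i) <= norm (d + \<bar>incr n w i\<bar>)"
  using chain_nonneg[OF v] d by (intro AE_I2) (simp add: chain_push_def max_def abs_if, smt (verit))
qed measurable

lemma chain_indep:
 assumes n: "0 < n"
 shows "LX.indep_var borel (%w. chain d b' v (incr n w) i) borel (%w. incr n w i)"
proof -
 have I: "LX.indep_vars (%_. borel) (%i w. incr n w i) {..<Suc i}" unfolding incr_def by (rule indep[OF n])
 have "LX.indep_var (PiM {..<i} (%_. borel)) (%w. restrict (%i. incr n w i) {..<i}) (PiM {i} (%_. borel)) (%w. restrict (%i. incr n w i) {i})"
  by (rule LX.indep_var_restrict[OF I]) auto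
 hence "LX.indep_var borel ((%z. chain d b' v z i) \<circ> (%w. restrict (%i. incr n w i) {..<i})) borel ((%z. z i) \<circ> (%w. restrict (%i. incr n w i) {i}))"
  by (rule LX.indep_var_compose) (auto intro!: chain_measurable)
 moreover have "(%z. chain d b' v z i) \<circ> (%w. restrict (%i. incr n w i) {..<i}) = (%w. chain d b' v (incr n w) i)"
  by (auto simp: fun_eq_iff intro!: chain_cong)
 moreover have "(%z. z i) \<circ> (%w. restrict (%i. incr n w i) {i}) = (%w. incr n w i)" by (auto simp: fun_eq_iff)
 ultimately show ?thesis by simp
qed

text \<open>Markov property of the chain: its value after \<open>i\<close> steps is independent of
  the next increment, so their joint law is a product and Fubini applies.\<close>

lemma chain_step_expectation:
 assumes n: "0 < n" and v: "0 <= v" and g[measurable]: "g \<in> borel_measurable borel" and wB: "!!y. \<bar>g y\<bar> <= B"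
 defines "t \<equiv> 1 / real n"
 shows "integrable M (%w. g (chain (\<delta> * t) b' v (incr n w) (Suc i)) + s * chain_push (\<delta> * t) b' v (incr n w) i)"
  and "integrable M (%w. (%y. (\<E> w. g (max (start (b' < y) t y + X t w) 0) + s * max (- (start (b' < y) t y + X t w)) 0)) (chain (\<delta> * t) b' v (incr n w) i))"
  and "(\<E> w. g (chain (\<delta> * t) b' v (incr n w) (Suc i)) + s * chain_push (\<delta> * t) b' v (incr n w) i) =
   (\<E> w. (%y. (\<E> w. g (max (start (b' < y) t y + X t w) 0) + s * max (- (start (b' < y) t y + X t w)) 0)) (chain (\<delta> * t) b' v (incr n w) i))"
proof -
 let ?V = "%w. chain (\<delta> * t) b' v (incr n w) i"
 have t0: "0 <= t" "0 <= \<delta> * t" using delta by (auto simp: t_def)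
 define F where "F = (%(y, z). g (max (start (b' < y) t y + z) 0) + s * max (- (start (b' < y) t y + z)) 0)"
 have Fm: "F \<in> borel_measurable (borel \<Otimes>\<^sub>M borel)" unfolding F_def start_def by measurable
 have D: "distr M borel ?V \<Otimes>\<^sub>M distr M borel (X t) = distr M (borel \<Otimes>\<^sub>M borel) (%w. (?V w, incr n w i))"
 proof -
  have "distr M borel (%w. incr n w i) = distr M borel (X t)" unfolding incr_def t_def by (rule stationary[OF n])
  thus ?thesis using chain_indep[OF n, of "\<delta> * t" b' v i] unfolding LX.indep_var_distribution_eq by simp
 qed
 have eq: "F (?V w, incr n w i) = g (chain (\<delta> * t) b' v (incr n w) (Suc i)) + s * chain_push (\<delta> * t) b' v (incr n w) i" for w
  by (simp add: F_def start_def chain_push_def)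
 have I1: "integrable M (%w. g (chain (\<delta> * t) b' v (incr n w) (Suc i)))"
  by (rule LX.integrable_const_bound[where B=B]) (auto simp: wB simp del: chain.simps)
 thus I: "integrable M (%w. g (chain (\<delta> * t) b' v (incr n w) (Suc i)) + s * chain_push (\<delta> * t) b' v (incr n w) i)"
  using push_integrable[OF n t0(2) v] by (intro Bochner_Integration.integrable_add integrable_mult_right)
 have J: "integrable (distr M borel ?V \<Otimes>\<^sub>M distr M borel (X t)) F"
  unfolding D using I Fm by (subst integrable_distr_eq) (auto simp: eq simp del: chain.simps)
 interpret P: pair_prob_space "distr M borel ?V" "distr M borel (X t)"
  unfolding pair_prob_space_def pair_sigma_finite_def
  by (auto intro!: LX.prob_space_distr prob_space_imp_sigma_finite)
 have inner: "(\<integral>z. F (y, z) \<partial>distr M borel (X t)) = (\<E> w. g (max (start (b' < y) t y + X t w) 0) + s * max (- (start (b' < y) t y + X t w)) 0)" for y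
  by (subst integral_distr) (auto simp: F_def)
 have mm: "(%y. \<integral>z. F (y, z) \<partial>distr M borel (X t)) \<in> borel_measurable borel"
  using Fm by measurable
 have "integrable (distr M borel ?V) (%y. \<integral>z. F (y, z) \<partial>distr M borel (X t))"
  by (rule P.integrable_fst'[OF J])
 thus I2: "integrable M (%w. (%y. (\<E> w. g (max (start (b' < y) t y + X t w) 0) + s * max (- (start (b' < y) t y + X t w)) 0)) (?V w))"
  using mm by (subst (asm) integrable_distr_eq) (auto simp: inner)
 have "(\<E> w. F (?V w, incr n w i)) = (\<integral>p. F p \<partial>(distr M borel ?V \<Otimes>\<^sub>M distr M borel (X t)))"
  unfolding D using Fm by (subst integral_distr) auto
 also have "... = (\<integral>y. (\<integral>z. F (y, z) \<partial>distr M borel (X t)) \<partial>distr M borel ?V)"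
  by (rule P.integral_fst'[OF J, symmetric])
 also have "... = (\<E> w. (%y. \<integral>z. F (y, z) \<partial>distr M borel (X t)) (?V w))"
  using mm by (subst integral_distr) auto
 finally show "(\<E> w. g (chain (\<delta> * t) b' v (incr n w) (Suc i)) + s * chain_push (\<delta> * t) b' v (incr n w) i) =
   (\<E> w. (%y. (\<E> w. g (max (start (b' < y) t y + X t w) 0) + s * max (- (start (b' < y) t y + X t w)) 0)) (?V w))"
  unfolding eq inner .
qed

text \<open>The push of step \<open>i\<close> is discounted from the end of the step, matching a
  jump of the sampled reflection at that time.\<close>

definition push_sum :: "nat => real => real => nat => 'a => real" where
 "push_sum n b' v N w = (\<Sum>i<N. exp (- (q * (real (Suc i) / real n))) * chain_push (\<delta> * (1 / real n)) b' v (incr n w) i)"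

lemma push_sum_integrable: "0 < n ==> 0 <= v ==> integrable M (push_sum n b' v N)"
 unfolding push_sum_def[abs_def] using delta
 by (intro Bochner_Integration.integrable_sum integrable_mult_right push_integrable) auto

lemma chain_telescope:
 assumes n: "0 < n" and v: "0 <= v" and g[measurable]: "g \<in> borel_measurable borel" and wB: "!!y. \<bar>g y\<bar> <= B"
  and step: "!!y. 0 <= y ==> g y - \<eta> * (1 / real n) <= exp (- (q * (1 / real n))) *
    (\<E> w. g (max (start (b' < y) (1 / real n) y + X (1 / real n) w) 0) + s * max (- (start (b' < y) (1 / real n) y + X (1 / real n) w)) 0)"
  and \<eta>: "0 <= \<eta>"
 shows "g v - \<eta> * (1 / real n) * (\<Sum>i<N. exp (- (q * (real i / real n))))
  <= s * LX.expectation (push_sum n b' v N) + exp (- (q * (real N / real n))) * (\<E> w. g (chain (\<delta> * (1 / real n)) b' v (incr n w) N))"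
proof (induction N)
 case 0
 show ?case by (simp add: push_sum_def LX.prob_space)
next
 case (Suc N)
 let ?t = "1 / real n"
 let ?V = "%i w. chain (\<delta> * ?t) b' v (incr n w) i"
 let ?P = "%w. chain_push (\<delta> * ?t) b' v (incr n w) N"
 let ?E = "%y. (\<E> w. g (max (start (b' < y) ?t y + X ?t w) 0) + s * max (- (start (b' < y) ?t y + X ?t w)) 0)"
 let ?eN = "exp (- (q * (real N / real n)))"
 note CS = chain_step_expectation[OF n v g wB, of b' N s]
 have wI: "integrable M (%w. g (?V i w))" for i
  by (rule LX.integrable_const_bound[where B=B]) (auto simp: wB)
 have dn: "0 <= \<delta> * ?t" using delta by simp
 have PI: "integrable M ?P" by (rule push_integrable[OF n dn v])
 have "(\<E> w. g (?V N w)) - \<eta> * ?t = (\<E> w. g (?V N w) - \<eta> * ?t)"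
  using wI by (subst Bochner_Integration.integral_diff) (auto simp: LX.prob_space)
 also have "... <= (\<E> w. exp (- (q * ?t)) * ?E (?V N w))"
  using wI CS(2) chain_nonneg[OF v] by (intro integral_mono Bochner_Integration.integrable_diff integrable_mult_right step) auto
 also have "... = exp (- (q * ?t)) * (\<E> w. ?E (?V N w))" by (rule integral_mult_right_zero)
 also have "(\<E> w. ?E (?V N w)) = (\<E> w. g (?V (Suc N) w) + s * ?P w)"
  by (rule CS(3)[symmetric])
 also have "... = (\<E> w. g (?V (Suc N) w)) + s * LX.expectation ?P"
  using wI[of "Suc N"] PI by (subst Bochner_Integration.integral_add) auto
 finally have 1: "(\<E> w. g (?V N w)) - \<eta> * ?t <= exp (- (q * ?t)) * ((\<E> w. g (?V (Suc N) w)) + s * LX.expectation ?P)" .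
 have "?eN * ((\<E> w. g (?V N w)) - \<eta> * ?t) <= ?eN * (exp (- (q * ?t)) * ((\<E> w. g (?V (Suc N) w)) + s * LX.expectation ?P))"
  using 1 by (rule mult_left_mono) simp
 also have "... = exp (- (q * (real (Suc N) / real n))) * ((\<E> w. g (?V (Suc N) w)) + s * LX.expectation ?P)"
  unfolding mult.assoc[symmetric] mult_exp_exp by (simp add: add_divide_distrib distrib_left add.commute)
 finally have 2: "?eN * (\<E> w. g (?V N w)) - \<eta> * ?t * ?eN <=
  exp (- (q * (real (Suc N) / real n))) * (\<E> w. g (?V (Suc N) w)) + s * (exp (- (q * (real (Suc N) / real n))) * LX.expectation ?P)"
  unfolding right_diff_distrib distrib_left by (simp only: mult_ac)
 have 3: "LX.expectation (push_sum n b' v (Suc N)) = LX.expectation (push_sum n b' v N) + exp (- (q * (real (Suc N) / real n))) * LX.expectation ?P"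
 proof -
  have "push_sum n b' v (Suc N) = (%w. push_sum n b' v N w + exp (- (q * (real (Suc N) / real n))) * ?P w)"
   by (simp add: push_sum_def fun_eq_iff)
  thus ?thesis using push_sum_integrable[OF n v] PI by (simp add: Bochner_Integration.integral_add)
 qed
 show ?case unfolding 3 sum.lessThan_Suc distrib_left using Suc.IH 2 by linarith
qed

text \<open>A left Riemann sum of the decreasing function exp (- (q * s)): at most its integral
  \<open>1 / q\<close> plus one mesh width. It bounds the accumulated one-step errors independently
  of the number of steps.\<close>

lemma geometric_bound:
 assumes n: "0 < n"
 shows "1 / real n * (\<Sum>i<N. exp (- (q * (real i / real n)))) <= 1 / q + 1 / real n"
proof -
 let ?y = "q / real n" let ?r = "exp (- ?y)"
 have y: "0 < ?y" using q n by simp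
 have r: "?r < 1" "0 < ?r" using y by auto
 have "(\<Sum>i<N. exp (- (q * (real i / real n)))) = (\<Sum>i<N. ?r ^ i)"
 proof (rule sum.cong[OF refl])
  fix i
  have "exp (- (q * (real i / real n))) = exp (real i * (- ?y))" by simp
  also have "... = ?r ^ i" by (rule exp_of_nat_mult)
  finally show "exp (- (q * (real i / real n))) = ?r ^ i" .
 qed
 also have "... <= 1 / (1 - ?r)"
 proof -
  have "(\<Sum>i<N. r ^ i) <= 1 / (1 - r)" if "0 < r" "r < 1" for r :: real
   using that by (simp add: sum_gp_strict divide_right_mono)
  thus ?thesis using r by blast
 qed
 also have "... <= (1 + ?y) / ?y"
 proof -
  have "1 + ?y <= exp ?y" by (rule exp_ge_add_one_self)
  hence "?r * (1 + ?y) <= ?r * exp ?y" using r by (intro mult_left_mono) auto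
  hence "?r * (1 + ?y) <= 1" by (simp add: mult_exp_exp)
  hence "?y <= (1 + ?y) * (1 - ?r)" by (simp add: algebra_simps)
  moreover have "1 / (1 - r) <= (1 + y) / y" if "0 < y" "r < 1" "y <= (1 + y) * (1 - r)" for r y :: real
   using that by (simp add: field_simps)
  ultimately show ?thesis using r y by blast
 qed
 finally have "1 / real n * (\<Sum>i<N. exp (- (q * (real i / real n)))) <= 1 / real n * ((1 + ?y) / ?y)"
  by (intro mult_left_mono) auto
 also have "... = 1 / q + 1 / real n" using q n by (simp add: field_simps)
 finally show ?thesis .
qed

end

section \<open>Comparison principle and two-sided bounds for the expected pushes\<close>

context refraction
begin

lemma gfun_near_pos:
 assumes N: "0 <= N" and pos: "0 < s * gfun C N"
 obtains N2 where "N < N2" "!!y. N <= y ==> y <= N2 ==> s * gfun C N / 2 <= s * gfun C y"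
proof -
 have "continuous_on {0..N+1} (%y. s * gfun C y)" by (intro continuous_intros gfun_cont)
 hence "EX d>0. \<forall>y\<in>{0..N+1}. dist y N < d --> dist (s * gfun C y) (s * gfun C N) < s * gfun C N / 2"
  unfolding continuous_on_iff using N pos by (metis atLeastAtMost_iff half_gt_zero less_add_one less_eq_real_def)
 then obtain d where d: "d > 0" "!!y. y \<in> {0..N+1} ==> dist y N < d ==> dist (s * gfun C y) (s * gfun C N) < s * gfun C N / 2"
  by blast
 define N2 where "N2 = N + min 1 d / 2"
 have "s * gfun C N / 2 <= s * gfun C y" if "N <= y" "y <= N2" for y
 proof -
  have "y \<in> {0..N+1}" "dist y N < d" using that d(1) N by (auto simp: N2_def dist_real_def min_def split: if_splits)
  from d(2)[OF this] show ?thesis unfolding dist_real_def by linarith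
 qed
 moreover have "N < N2" using d(1) by (simp add: N2_def)
 ultimately show ?thesis using that by metis
qed

lemma refracted_okI: "\<bar>b' - b\<bar> <= \<epsilon> ==> 0 < \<epsilon> ==> refracted_ok \<epsilon> y (b' < y)"
 unfolding refracted_ok_def abs_le_iff by auto

lemma bounded_integrable:
 fixes g :: "real => real"
 assumes "g \<in> borel_measurable borel" "!!y. \<bar>g y\<bar> <= B"
 shows "integrable M (%w. g (max (u + X t w) 0))"
proof (rule LX.integrable_const_bound[where B=B])
 show "(%w. g (max (u + X t w) 0)) \<in> borel_measurable M" using assms(1) by measurable
qed (use assms(2) in auto)

lemma negpart_integrable: "0 <= t ==> integrable M (%w. max (- (u + X t w)) 0)"
 using LX.X_integrable[of t] by (intro integrable_max) auto

theorem gfun_comparison: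
 assumes N: "0 <= v" "v <= N" and pos: "0 < gfun C N"
 shows "0 <= gfun C v"
proof -
 have N0: "0 <= N" using N by simp
 have pos': "0 < 1 * gfun C N" using pos by simp
 obtain N2 where N2: "N < N2" "!!y. N <= y ==> y <= N2 ==> 1 * gfun C N / 2 <= 1 * gfun C y"
  by (rule gfun_near_pos[OF N0 pos'], rule that)
 have margin: "-1 * gfun C y <= 0 - gfun C N / 2" if "N <= y" "y <= N2" for y using N2(2)[OF that] by simp
 have half: "0 < gfun C N / 2" using pos by simp
 have "- gfun C v <= 2 * \<eta> / q" if \<eta>: "0 < \<eta>" for \<eta>
 proof -
  have m1: "\<bar>-1::real\<bar> = 1" by simp
  obtain \<epsilon>1 where e1: "0 < \<epsilon>1" and E: "!!\<epsilon>. 0 < \<epsilon> ==> \<epsilon> < \<epsilon>1 ==> (EX g t0 B. 0 < t0 & g \<in> borel_measurable borel & (ALL y. 0 <= g y & g y <= B) &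
   (ALL v. 0 <= v --> v <= N --> -1 * gfun C v <= g v & g v <= max (-1 * gfun C v + \<eta>) 0) & (ALL v>N. g v = 0) &
   (ALL t v c. 0 <= t --> t <= t0 --> 0 <= v --> v <= N --> refracted_ok \<epsilon> v c --> 0 < g v -->
    g v - \<eta> * t <= exp (- (q * t)) * (\<E> w. g (max (start c t v + X t w) 0) + (-1) * max (- (start c t v + X t w)) 0)))"
   using trunc_step[OF m1 N0 N2(1) half margin \<eta>] by blast
  have e: "0 < \<epsilon>1 / 2" "\<epsilon>1 / 2 < \<epsilon>1" using e1 by auto
  obtain g t0 B where t0: "0 < t0" and wm[measurable]: "g \<in> borel_measurable borel" and wB: "!!y. 0 <= g y & g y <= B"
   and wg: "!!v. 0 <= v ==> v <= N ==> -1 * gfun C v <= g v" and w0: "!!v. N < v ==> g v = 0"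
   and step: "!!t v c. 0 <= t ==> t <= t0 ==> 0 <= v ==> v <= N ==> refracted_ok (\<epsilon>1 / 2) v c ==> 0 < g v ==>
    g v - \<eta> * t <= exp (- (q * t)) * (\<E> w. g (max (start c t v + X t w) 0) + (-1) * max (- (start c t v + X t w)) 0)"
   using E[OF e] by blast
  \<comment> \<open>\<open>q * t <= 1\<close> ensures that \<open>1 - exp (- (q * t))\<close> is at
    least \<open>q * t / 2\<close>.\<close>
  define t where "t = min t0 (1 / q)"
  have t: "0 < t" "t <= t0" "q * t <= 1" using t0 q by (auto simp: t_def min_def field_simps)
  define S where "S = (SUP y\<in>{0..}. g y)"
  have bdd: "bdd_above (g ` {0..})" using wB by (auto intro!: bdd_aboveI)
  have wS: "g y <= S" if "0 <= y" for y unfolding S_def using that bdd by (intro cSUP_upper) auto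
  have S0: "0 <= S" using wS[of 0] wB[of 0] by simp
  have wabs: "\<bar>g y\<bar> <= B" for y using wB[of y] by simp
  have "g y <= exp (- (q * t)) * S + \<eta> * t" if y: "0 <= y" for y
  proof (cases "0 < g y")
   case True
   hence yN: "y <= N" using w0[of y] by (cases "y <= N") auto
   let ?u = "start (b < y) t y"
   have "(\<E> w. g (max (?u + X t w) 0) + (-1) * max (- (?u + X t w)) 0) <= (\<E> w. S)"
   proof (rule integral_mono)
    show "integrable M (%w. g (max (?u + X t w) 0) + (-1) * max (- (?u + X t w)) 0)"
     using t(1) by (intro Bochner_Integration.integrable_add bounded_integrable[OF wm wabs] integrable_mult_right negpart_integrable) simp
    show "g (max (?u + X t w) 0) + (-1) * max (- (?u + X t w)) 0 <= S" for w
     using wS[of "max (?u + X t w) 0"] by simp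
   qed simp
   hence "exp (- (q * t)) * (\<E> w. g (max (?u + X t w) 0) + (-1) * max (- (?u + X t w)) 0) <= exp (- (q * t)) * S"
    by (simp add: LX.prob_space)
   moreover have "refracted_ok (\<epsilon>1 / 2) y (b < y)" using refracted_okI[of b "\<epsilon>1/2" y] e by simp
   ultimately show ?thesis using step[OF less_imp_le[OF t(1)] t(2) y yN _ True, of "b < y"] by linarith
  next
   case False
   thus ?thesis using S0 \<eta> t by (simp add: not_less add_nonneg_nonneg order_trans)
  qed
  hence "S <= exp (- (q * t)) * S + \<eta> * t" unfolding S_def by (intro cSUP_least) auto
  hence "S * (1 - exp (- (q * t))) <= \<eta> * t" by (simp add: algebra_simps)
  moreover have "q * t / 2 <= 1 - exp (- (q * t))"
  proof -
   have "exp (- (q * t)) * (1 + q * t) <= exp (- (q * t)) * exp (q * t)" by (intro mult_left_mono exp_ge_add_one_self) auto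
   hence "exp (- (q * t)) * (1 + q * t) <= 1" by (simp add: mult_exp_exp)
   moreover have "0 <= q * t" using q t by simp
   moreover have "(1 - q * t / 2) * (1 + q * t) >= 1"
   proof -
    have "0 <= (q * t) * (1 - q * t)" using mult_nonneg_nonneg[OF \<open>0 <= q * t\<close>, of "1 - q * t"] t(3) by simp
    thus ?thesis by (simp add: algebra_simps)
   qed
   ultimately have "exp (- (q * t)) * (1 + q * t) <= (1 - q * t / 2) * (1 + q * t)" by linarith
   thus ?thesis using mult_right_le_imp_le[of "exp (- (q * t))" "1 + q * t" "1 - q * t / 2"] \<open>0 <= q * t\<close> by simp
  qed
  ultimately have "S * (q * t / 2) <= \<eta> * t" using S0 by (meson mult_left_mono order_trans)
  hence "(S * q) * t <= (2 * \<eta>) * t" by (simp add: mult_ac)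
  hence "S * q <= 2 * \<eta>" using t(1) by (rule mult_right_le_imp_le)
  hence "S <= 2 * \<eta> / q" using q by (simp add: pos_le_divide_eq)
  thus ?thesis using wg[OF N] wS[OF N(1)] by linarith
 qed
 note bound = this
 show ?thesis
 proof (rule ccontr)
  assume "\<not> 0 <= gfun C v"
  hence "0 < - gfun C v * q / 4" using q by (simp add: mult_neg_pos)
  from bound[OF this] \<open>\<not> 0 <= gfun C v\<close> q show False by (simp add: field_simps)
 qed
qed

end

context levy_refraction
begin

lemma push_sum_mono: "M1 <= M2 ==> push_sum n b' v M1 w <= push_sum n b' v M2 w"
 unfolding push_sum_def by (intro sum_mono2) (auto simp: chain_push_def)

text \<open>In the factor \<open>1 / q + 2\<close> the errors of all steps account for
  \<open>1 / q + 1\<close>; one more \<open>\<eta>\<close> covers the discounted terminal value,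
  which tends to 0 because \<open>g\<close> is bounded.\<close>

lemma telescope_limit:
 assumes n: "0 < n" and v: "0 <= v" and g[measurable]: "g \<in> borel_measurable borel" and wB: "!!y. \<bar>g y\<bar> <= B"
  and step: "!!y. 0 <= y ==> g y - \<eta> * (1 / real n) <= exp (- (q * (1 / real n))) *
    (\<E> w. g (max (start (b' < y) (1 / real n) y + X (1 / real n) w) 0) + s * max (- (start (b' < y) (1 / real n) y + X (1 / real n) w)) 0)"
  and \<eta>: "0 < \<eta>"
 shows "EX M0. ALL N>=M0. g v - \<eta> * (1 / q + 2) <= s * LX.expectation (push_sum n b' v N)"
proof -
 have "(%N. exp (- (q / real n * real N)) * B) \<longlonglongrightarrow> 0"
  using q n by real_asymp
 hence "\<forall>\<^sub>F N in sequentially. exp (- (q / real n * real N)) * B < \<eta>"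
  using \<eta> by (rule order_tendstoD(2))
 then obtain M0 where M0: "!!N. M0 <= N ==> exp (- (q / real n * real N)) * B < \<eta>"
  by (auto simp: eventually_sequentially)
 have "g v - \<eta> * (1 / q + 2) <= s * LX.expectation (push_sum n b' v N)" if N: "M0 <= N" for N
 proof -
  have "(\<E> w. g (chain (\<delta> * (1 / real n)) b' v (incr n w) N)) <= (\<E> w. B)"
  proof (rule integral_mono)
   show "integrable M (%w. g (chain (\<delta> * (1 / real n)) b' v (incr n w) N))"
    by (rule LX.integrable_const_bound[where B=B]) (auto simp: wB)
   show "g (chain (\<delta> * (1 / real n)) b' v (incr n w) N) <= B" for w
    using wB[of "chain (\<delta> * (1 / real n)) b' v (incr n w) N"] by linarith
  qed simp
  hence "exp (- (q * (real N / real n))) * (\<E> w. g (chain (\<delta> * (1 / real n)) b' v (incr n w) N)) <= exp (- (q * (real N / real n))) * B"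
   by (intro mult_left_mono) (auto simp: LX.prob_space)
  also have "... < \<eta>" using M0[OF N] by simp
  finally have 1: "exp (- (q * (real N / real n))) * (\<E> w. g (chain (\<delta> * (1 / real n)) b' v (incr n w) N)) < \<eta>" .
  have "1 / real n <= 1" using n by simp
  hence "\<eta> * (1 / real n * (\<Sum>i<N. exp (- (q * (real i / real n))))) <= \<eta> * (1 / q + 1)"
   using geometric_bound[OF n, of N] \<eta> by (intro mult_left_mono) auto
  thus ?thesis
   using chain_telescope[OF n v g wB step less_imp_le[OF \<eta>], of N] 1 unfolding distrib_left mult.assoc by linarith
 qed
 thus ?thesis by blast
qed

text \<open>\<open>gfun C\<close> is negative on a whole interval starting at \<open>N\<close>,
  which is the margin for cutting at level 0. Where the truncated function is 0 the step inequality
  is trivial, since pushes are nonnegative.\<close>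

theorem push_lower_bound:
 assumes v: "0 <= v" "v <= N" and neg: "gfun C N < 0" and \<eta>: "0 < \<eta>"
 shows "EX \<epsilon>1>0. ALL \<epsilon>. 0 < \<epsilon> --> \<epsilon> < \<epsilon>1 --> (EX n0>0. ALL n>=n0. ALL b'. \<bar>b' - b\<bar> <= \<epsilon> -->
   (EX M0. ALL k>=M0. gfun C v - \<eta> <= LX.expectation (push_sum n b' v k)))"
proof -
 have N0: "0 <= N" using v by simp
 have pos': "0 < -1 * gfun C N" using neg by simp
 obtain N2 where N2: "N < N2" "!!y. N <= y ==> y <= N2 ==> -1 * gfun C N / 2 <= -1 * gfun C y"
  by (rule gfun_near_pos[OF N0 pos'], rule that)
 have margin: "1 * gfun C y <= 0 - (- gfun C N / 2)" if "N <= y" "y <= N2" for y using N2(2)[OF that] by simp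
 have half: "0 < - gfun C N / 2" using neg by simp
 define \<eta>1 where "\<eta>1 = \<eta> / (1 / q + 2)"
 have pq: "0 < 1 / q + 2" using q by (simp add: add_pos_pos)
 have \<eta>1: "0 < \<eta>1" "\<eta>1 * (1 / q + 2) = \<eta>" using \<eta> pq by (auto simp: \<eta>1_def)
 have m1: "\<bar>1::real\<bar> = 1" by simp
 obtain \<epsilon>1 where e1: "0 < \<epsilon>1" and E: "!!\<epsilon>. 0 < \<epsilon> ==> \<epsilon> < \<epsilon>1 ==> (EX g t0 B. 0 < t0 & g \<in> borel_measurable borel & (ALL y. 0 <= g y & g y <= B) &
   (ALL v. 0 <= v --> v <= N --> 1 * gfun C v <= g v & g v <= max (1 * gfun C v + \<eta>1) 0) & (ALL v>N. g v = 0) &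
   (ALL t v c. 0 <= t --> t <= t0 --> 0 <= v --> v <= N --> refracted_ok \<epsilon> v c --> 0 < g v -->
    g v - \<eta>1 * t <= exp (- (q * t)) * (\<E> w. g (max (start c t v + X t w) 0) + 1 * max (- (start c t v + X t w)) 0)))"
  using trunc_step[OF m1 N0 N2(1) half margin \<eta>1(1)] by blast
 show ?thesis
 proof (rule exI[of _ \<epsilon>1], intro conjI e1 allI impI)
  fix \<epsilon> assume e: "0 < \<epsilon>" "\<epsilon> < \<epsilon>1"
  obtain g t0 B where t0: "0 < t0" and wm[measurable]: "g \<in> borel_measurable borel" and wB: "!!y. 0 <= g y & g y <= B"
   and wg: "!!v. 0 <= v ==> v <= N ==> 1 * gfun C v <= g v" and w0: "!!v. N < v ==> g v = 0"
   and step: "!!t v c. 0 <= t ==> t <= t0 ==> 0 <= v ==> v <= N ==> refracted_ok \<epsilon> v c ==> 0 < g v ==>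
    g v - \<eta>1 * t <= exp (- (q * t)) * (\<E> w. g (max (start c t v + X t w) 0) + 1 * max (- (start c t v + X t w)) 0)"
   using E[OF e] by blast
  have wabs: "\<bar>g y\<bar> <= B" for y using wB[of y] by simp
  obtain n0 :: nat where n0: "1 / t0 < real n0" using reals_Archimedean2 by blast
  have n0p: "0 < n0" using n0 t0 by (metis divide_pos_pos less_trans of_nat_0_less_iff zero_less_one)
  show "EX n0>0. ALL n>=n0. ALL b'. \<bar>b' - b\<bar> <= \<epsilon> -->
   (EX M0. ALL k>=M0. gfun C v - \<eta> <= LX.expectation (push_sum n b' v k))"
  proof (rule exI[of _ n0], intro conjI n0p allI impI)
   fix n b' assume n: "n0 <= n" and b': "\<bar>b' - b\<bar> <= \<epsilon>"
   have np: "0 < n" using n n0p by simp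
   let ?t = "1 / real n"
   have t: "0 <= ?t" "?t <= t0"
   proof -
    have "1 / t0 <= real n" using n0 n by (meson less_le_trans less_imp_le of_nat_le_iff order_trans)
    thus "?t <= t0" using t0 np by (simp add: field_simps)
   qed simp
   have st: "g y - \<eta>1 * ?t <= exp (- (q * ?t)) * (\<E> w. g (max (start (b' < y) ?t y + X ?t w) 0) + 1 * max (- (start (b' < y) ?t y + X ?t w)) 0)"
    if y: "0 <= y" for y
   proof (cases "0 < g y")
    case True
    hence "y <= N" using w0[of y] by (cases "y <= N") auto
    thus ?thesis using step[OF t y _ refracted_okI[OF b' e(1)] True] by simp
   next
    case False
    hence "g y = 0" using wB[of y] by simp
    moreover have E0: "0 <= (\<E> w. g (max (start (b' < y) ?t y + X ?t w) 0) + 1 * max (- (start (b' < y) ?t y + X ?t w)) 0)"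
     using wB by (intro integral_nonneg_AE AE_I2 add_nonneg_nonneg) auto
    moreover have "0 <= \<eta>1 * ?t" using \<eta>1(1) by simp
    ultimately show ?thesis using mult_nonneg_nonneg[OF exp_ge_zero[of "- (q * ?t)"] E0] by linarith
   qed
   obtain M0 where M0: "!!k. M0 <= k ==> g v - \<eta>1 * (1 / q + 2) <= 1 * LX.expectation (push_sum n b' v k)"
    using telescope_limit[OF np v(1) wm wabs st \<eta>1(1)] by metis
   have "gfun C v - \<eta> <= LX.expectation (push_sum n b' v k)" if "M0 <= k" for k
    using M0[OF that] wg[OF v] unfolding \<eta>1(2) by simp
   thus "EX M0. ALL k>=M0. gfun C v - \<eta> <= LX.expectation (push_sum n b' v k)" by blast
  qed
 qed
qed

text \<open>Now pushes count with a minus sign, so the step inequality is not automatic where the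
  truncated function equals its floor. The floor is placed so low that it is attained only far above
  0, where the expected push is small, and discounting the floor itself pays for that push.\<close>

theorem push_upper_bound:
 assumes v: "0 <= v" and lim: "!!A. EX N0. ALL y>=N0. A <= gfun C y" and \<eta>: "0 < \<eta>"
 shows "EX \<epsilon>1>0. ALL \<epsilon>. 0 < \<epsilon> --> \<epsilon> < \<epsilon>1 --> (EX n0>0. ALL n>=n0. ALL b'. \<bar>b' - b\<bar> <= \<epsilon> -->
   (ALL k. LX.expectation (push_sum n b' v k) <= gfun C v + \<eta>))"
proof -
 obtain K' where K': "0 <= K'" "!!t u. 0 <= t ==> t <= 1 ==> 1 <= u ==> (\<E> w. max (- (u + X t w)) 0) <= K' * t"
  by (rule floor_step, rule that)
 obtain A1 where A1: "!!y. 0 <= y ==> y <= b + 1 ==> gfun C y <= A1"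
 proof -
  have "compact (gfun C ` {0..b+1})" by (intro compact_continuous_image gfun_cont) auto
  hence "bdd_above (gfun C ` {0..b+1})" by (intro bounded_imp_bdd_above compact_imp_bounded)
  thus ?thesis using that by (meson bdd_above.unfold imageI atLeastAtMost_iff)
 qed
 \<comment> \<open>Above \<open>A1\<close>, so that the floor \<open>- A0\<close> is attained only
   beyond \<open>b + 1\<close>; at least \<open>K' / q\<close>, so that discounting
   \<open>- A0\<close> over a step of length t gains enough to cover the expected push
   \<open>K' * t\<close>.\<close>
 define A0 where "A0 = max (A1 + 1) (K' / q)"
 have "K' / q <= A0" by (simp add: A0_def)
 hence A0: "K' <= A0 * q" "0 <= A0" using q order_trans[of 0 "K' / q" A0] K'(1) by (auto simp: pos_divide_le_eq)
 obtain N0 where N0: "!!y. N0 <= y ==> A0 + 1 <= gfun C y" using lim by blast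
 define N where "N = max N0 (max (b + 1) v)"
 have N: "0 <= N" "N < N + 1" "v <= N" "b + 1 <= N" using b v by (auto simp: N_def)
 have margin: "-1 * gfun C y <= (- A0) - 1" if "N <= y" "y <= N + 1" for y using N0[of y] that by (simp add: N_def)
 define \<eta>1 where "\<eta>1 = \<eta> / (1 / q + 2)"
 have pq: "0 < 1 / q + 2" using q by (simp add: add_pos_pos)
 have \<eta>1: "0 < \<eta>1" "\<eta>1 * (1 / q + 2) = \<eta>" using \<eta> pq by (auto simp: \<eta>1_def)
 have m1: "\<bar>-1::real\<bar> = 1" by simp
 obtain \<epsilon>1 where e1: "0 < \<epsilon>1" and E: "!!\<epsilon>. 0 < \<epsilon> ==> \<epsilon> < \<epsilon>1 ==> (EX g t0 B. 0 < t0 & g \<in> borel_measurable borel & (ALL y. - A0 <= g y & g y <= B) &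
   (ALL v. 0 <= v --> v <= N --> -1 * gfun C v <= g v & g v <= max (-1 * gfun C v + \<eta>1) (- A0)) & (ALL v>N. g v = - A0) &
   (ALL t v c. 0 <= t --> t <= t0 --> 0 <= v --> v <= N --> refracted_ok \<epsilon> v c --> - A0 < g v -->
    g v - \<eta>1 * t <= exp (- (q * t)) * (\<E> w. g (max (start c t v + X t w) 0) + (-1) * max (- (start c t v + X t w)) 0)))"
  using trunc_step[OF m1 N(1,2) zero_less_one margin \<eta>1(1)] by blast
 show ?thesis
 proof (rule exI[of _ \<epsilon>1], intro conjI e1 allI impI)
  fix \<epsilon> assume e: "0 < \<epsilon>" "\<epsilon> < \<epsilon>1"
  obtain g t0 B where t0: "0 < t0" and wm[measurable]: "g \<in> borel_measurable borel" and wB: "!!y. - A0 <= g y & g y <= B"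
   and wg: "!!v. 0 <= v ==> v <= N ==> -1 * gfun C v <= g v" and w0: "!!v. N < v ==> g v = - A0"
   and step: "!!t v c. 0 <= t ==> t <= t0 ==> 0 <= v ==> v <= N ==> refracted_ok \<epsilon> v c ==> - A0 < g v ==>
    g v - \<eta>1 * t <= exp (- (q * t)) * (\<E> w. g (max (start c t v + X t w) 0) + (-1) * max (- (start c t v + X t w)) 0)"
   using E[OF e] by blast
  have wabs: "\<bar>g y\<bar> <= A0 + \<bar>B\<bar>" for y using wB[of y] A0(2) by (auto simp: abs_le_iff)
  \<comment> \<open>With \<open>\<delta> * t <= b\<close>, a step from beyond \<open>b + 1\<close>
    starts at height at least 1 even after the drift is taken off, as the bound on pushes
    requires.\<close>
  define t1 where "t1 = min t0 (min 1 (b / (\<delta> + 1)))"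
  have t1: "0 < t1" using t0 b delta by (simp add: t1_def)
  obtain n0 :: nat where n0: "1 / t1 < real n0" using reals_Archimedean2 by blast
  have n0p: "0 < n0" using n0 t1 by (metis divide_pos_pos less_trans of_nat_0_less_iff zero_less_one)
  show "EX n0>0. ALL n>=n0. ALL b'. \<bar>b' - b\<bar> <= \<epsilon> --> (ALL k. LX.expectation (push_sum n b' v k) <= gfun C v + \<eta>)"
  proof (rule exI[of _ n0], intro conjI n0p allI impI)
   fix n b' k assume n: "n0 <= n" and b': "\<bar>b' - b\<bar> <= \<epsilon>"
   have np: "0 < n" using n n0p by simp
   let ?t = "1 / real n"
   have tt: "0 <= ?t" "?t <= t1"
   proof -
    have "1 / t1 <= real n" using n0 n by (meson less_le_trans less_imp_le of_nat_le_iff order_trans)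
    thus "?t <= t1" using t1 np by (simp add: field_simps)
   qed simp
   have t: "0 <= ?t" "?t <= t0" "?t <= 1" using tt by (auto simp: t1_def)
   have dt: "\<delta> * ?t <= b"
   proof -
    have "\<delta> * ?t <= (\<delta> + 1) * (b / (\<delta> + 1))" using tt delta by (intro mult_mono) (auto simp: t1_def)
    thus ?thesis using delta by simp
   qed
   have st: "g y - \<eta>1 * ?t <= exp (- (q * ?t)) * (\<E> w. g (max (start (b' < y) ?t y + X ?t w) 0) + (-1) * max (- (start (b' < y) ?t y + X ?t w)) 0)"
    if y: "0 <= y" for y
   proof (cases "- A0 < g y")
    case True
    hence "y <= N" using w0[of y] by (cases "y <= N") auto
    thus ?thesis using step[OF t(1,2) y _ refracted_okI[OF b' e(1)] True] by simp
   next
    case False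
    hence wy: "g y = - A0" using wB[of y] by simp
    have yb: "b + 1 < y"
    proof (rule ccontr)
     assume "\<not> b + 1 < y"
     hence "gfun C y <= A1" "- gfun C y <= g y" using A1[OF y] wg[OF y] N(4) by auto
     thus False using wy by (simp add: A0_def)
    qed
    let ?u = "start (b' < y) ?t y"
    have u: "1 <= ?u" using yb dt b by (simp add: start_def)
    have "- A0 - K' * ?t <= (\<E> w. g (max (?u + X ?t w) 0)) - (\<E> w. max (- (?u + X ?t w)) 0)"
    proof -
     have "(\<E> w. - A0) <= (\<E> w. g (max (?u + X ?t w) 0))"
      using wB by (intro integral_mono bounded_integrable[OF wm wabs]) auto
     thus ?thesis using K'(2)[OF t(1,3) u] by (simp add: LX.prob_space)
    qed
    also have "... = (\<E> w. g (max (?u + X ?t w) 0) + (-1) * max (- (?u + X ?t w)) 0)"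
     using bounded_integrable[OF wm wabs] negpart_integrable[OF t(1)] by (subst Bochner_Integration.integral_add) auto
    finally have "exp (- (q * ?t)) * (- A0 - K' * ?t) <= exp (- (q * ?t)) * (\<E> w. g (max (?u + X ?t w) 0) + (-1) * max (- (?u + X ?t w)) 0)"
     by (intro mult_left_mono) auto
    moreover have "exp (- (q * ?t)) * (A0 + K' * ?t) <= A0"
    proof -
     have "K' * ?t <= A0 * (q * ?t)" using mult_right_mono[OF A0(1) t(1)] by (simp add: mult.assoc)
     hence "A0 + K' * ?t <= A0 * (1 + q * ?t)" by (simp add: distrib_left)
     also have "... <= A0 * exp (q * ?t)" using A0(2) by (intro mult_left_mono exp_ge_add_one_self)
     finally have "exp (- (q * ?t)) * (A0 + K' * ?t) <= exp (- (q * ?t)) * (A0 * exp (q * ?t))" by (intro mult_left_mono) auto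
     also have "... = A0" by (simp add: exp_minus)
     finally show ?thesis .
    qed
    moreover have "0 <= \<eta>1 * ?t" using \<eta>1(1) by simp
    moreover have "exp (- (q * ?t)) * (- A0 - K' * ?t) = - (exp (- (q * ?t)) * (A0 + K' * ?t))" by (simp add: algebra_simps)
    ultimately show ?thesis using wy by linarith
   qed
   obtain M0 where M0: "!!k. M0 <= k ==> g v - \<eta>1 * (1 / q + 2) <= -1 * LX.expectation (push_sum n b' v k)"
    using telescope_limit[OF np v wm wabs st \<eta>1(1)] by metis
   have "LX.expectation (push_sum n b' v k) <= LX.expectation (push_sum n b' v (max k M0))"
    by (intro integral_mono push_sum_integrable np v push_sum_mono) auto
   thus "LX.expectation (push_sum n b' v k) <= gfun C v + \<eta>"
    using M0[of "max k M0"] wg[OF v N(3)] unfolding \<eta>1(2) by simp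
  qed
 qed
qed

end

section \<open>The critical constant\<close>

lemma laplace_one:
 assumes "0 < (r::real)"
 shows "integrable lborel (%z. exp (- (r * z)) * indicator {0<..} z)" "(LBINT z. exp (- (r * z)) * indicator {0<..} z) = 1 / r"
proof -
 have "(\<integral>\<^sup>+z. ennreal (exp (- (r * z))) * indicator {0..} z \<partial>lborel) = ennreal (0 - (- exp (- (r * 0)) / r))"
 proof (rule nn_integral_FTC_atLeast)
  show "((%z. - exp (- (r * z)) / r) \<longlongrightarrow> 0) at_top" using assms by real_asymp
  show "((%z. - exp (- (r * z)) / r) has_real_derivative exp (- (r * z))) (at z)" for z
   using assms by (auto intro!: derivative_eq_intros)
 qed auto
 moreover have "(\<integral>\<^sup>+z. ennreal (exp (- (r * z)) * indicator {0<..} z) \<partial>lborel) = (\<integral>\<^sup>+z. ennreal (exp (- (r * z))) * indicator {0..} z \<partial>lborel)"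
  by (rule nn_integral_cong_AE) (use AE_lborel_singleton[of 0] in \<open>eventually_elim, auto simp: indicator_def\<close>)
 ultimately have *: "(\<integral>\<^sup>+z. ennreal (exp (- (r * z)) * indicator {0<..} z) \<partial>lborel) = ennreal (1 / r)" by simp
 thus "integrable lborel (%z. exp (- (r * z)) * indicator {0<..} z)" by (intro integrableI_nonneg) auto
 thus "(LBINT z. exp (- (r * z)) * indicator {0<..} z) = 1 / r"
  using * assms by (subst integral_eq_nn_integral) auto
qed

lemma laplace_id:
 assumes "0 < (r::real)"
 shows "integrable lborel (%z. exp (- (r * z)) * (z * indicator {0<..} z))" "(LBINT z. exp (- (r * z)) * (z * indicator {0<..} z)) = 1 / r\<^sup>2"
proof -
 have "(\<integral>\<^sup>+z. ennreal (exp (- (r * z)) * z) * indicator {0..} z \<partial>lborel) = ennreal (0 - (- exp (- (r * 0)) * (0 / r + 1 / r\<^sup>2)))"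
 proof (rule nn_integral_FTC_atLeast)
  show "((%z. - exp (- (r * z)) * (z / r + 1 / r\<^sup>2)) \<longlongrightarrow> 0) at_top"
   using assms by real_asymp
  show "((%z. - exp (- (r * z)) * (z / r + 1 / r\<^sup>2)) has_real_derivative exp (- (r * z)) * z) (at z)" for z
   using assms by (auto intro!: derivative_eq_intros simp: field_simps power2_eq_square)
 qed auto
 moreover have "(\<integral>\<^sup>+z. ennreal (exp (- (r * z)) * (z * indicator {0<..} z)) \<partial>lborel) = (\<integral>\<^sup>+z. ennreal (exp (- (r * z)) * z) * indicator {0..} z \<partial>lborel)"
  by (rule nn_integral_cong) (auto simp: indicator_def)
 ultimately have *: "(\<integral>\<^sup>+z. ennreal (exp (- (r * z)) * (z * indicator {0<..} z)) \<partial>lborel) = ennreal (1 / r\<^sup>2)" by simp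
 thus "integrable lborel (%z. exp (- (r * z)) * (z * indicator {0<..} z))" by (intro integrableI_nonneg) (auto simp: indicator_def)
 thus "(LBINT z. exp (- (r * z)) * (z * indicator {0<..} z)) = 1 / r\<^sup>2"
  using * assms by (subst integral_eq_nn_integral) (auto simp: indicator_def)
qed

context scaled_process
begin

lemma pot_transform_nonneg:
 assumes k: "dominated k" and k0: "!!z. 0 <= k z" and th: "a < r" and int: "integrable lborel (%z. exp (- (r * z)) * k z)"
 shows "integrable lborel (%y. exp (- (r * y)) * pot k y)"
  and "(LBINT y. exp (- (r * y)) * pot k y) = (LBINT z. exp (- (r * z)) * k z) / (\<psi> r - q)"
proof -
 have [measurable]: "k \<in> borel_measurable borel" using k by (simp add: dominated_def)
 have [measurable]: "pot k \<in> borel_measurable borel" unfolding pot_def[abs_def] by measurable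
 have nnpot: "ennreal (pot k y) = (\<integral>\<^sup>+z. ennreal (W (y - z)) * ennreal (k z) \<partial>lborel)" for y
  using pot_integrable[OF k, of y] k0 W_nonneg unfolding pot_def
  by (subst nn_integral_eq_integral[symmetric]) (auto simp: ennreal_mult)
 have pot0: "0 <= pot k y" for y
  unfolding pot_def using k0 W_nonneg by (intro integral_nonneg_AE) auto
 have "(\<integral>\<^sup>+y. ennreal (exp (- (r * y)) * pot k y) \<partial>lborel) = (\<integral>\<^sup>+y. (\<integral>\<^sup>+z. ennreal (exp (- (r * y))) * (ennreal (W (y - z)) * ennreal (k z)) \<partial>lborel) \<partial>lborel)"
  by (intro nn_integral_cong) (simp add: ennreal_mult pot0 nnpot nn_integral_cmult)
 also have "... = (\<integral>\<^sup>+z. (\<integral>\<^sup>+y. ennreal (exp (- (r * y))) * (ennreal (W (y - z)) * ennreal (k z)) \<partial>lborel) \<partial>lborel)"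
  by (rule lborel_pair.Fubini') measurable
 also have "... = (\<integral>\<^sup>+z. ennreal (exp (- (r * z)) * k z) * ennreal (1 / (\<psi> r - q)) \<partial>lborel)"
 proof (rule nn_integral_cong)
  fix z :: real
  have "(\<integral>\<^sup>+y. ennreal (exp (- (r * y))) * (ennreal (W (y - z)) * ennreal (k z)) \<partial>lborel)
   = (\<integral>\<^sup>+x. ennreal (exp (- (r * (z + x)))) * (ennreal (W x) * ennreal (k z)) \<partial>lborel)"
   by (subst nn_integral_real_affine[where c=1 and t=z]) auto
  also have "... = (\<integral>\<^sup>+x. ennreal (exp (- (r * z)) * k z) * ennreal (exp (- (r * x)) * W x) \<partial>lborel)"
  proof (rule nn_integral_cong)
   fix x
   have "exp (- (r * (z + x))) = exp (- (r * z)) * exp (- (r * x))" by (simp add: mult_exp_exp algebra_simps)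
   thus "ennreal (exp (- (r * (z + x)))) * (ennreal (W x) * ennreal (k z)) = ennreal (exp (- (r * z)) * k z) * ennreal (exp (- (r * x)) * W x)"
    by (simp add: ennreal_mult[symmetric] W_nonneg k0 mult_ac)
  qed
  also have "... = ennreal (exp (- (r * z)) * k z) * ennreal (1 / (\<psi> r - q))"
   by (subst nn_integral_cmult) (auto simp: W_transform[OF th])
  finally show "(\<integral>\<^sup>+y. ennreal (exp (- (r * y))) * (ennreal (W (y - z)) * ennreal (k z)) \<partial>lborel) = ennreal (exp (- (r * z)) * k z) * ennreal (1 / (\<psi> r - q))" .
 qed
 also have "... = ennreal ((LBINT z. exp (- (r * z)) * k z) / (\<psi> r - q))"
  using int k0 psi_gt[OF th] integral_nonneg_AE[of "%z. exp (- (r * z)) * k z" lborel]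
  by (subst nn_integral_multc) (auto simp: nn_integral_eq_integral ennreal_mult[symmetric])
 finally have *: "(\<integral>\<^sup>+y. ennreal (exp (- (r * y)) * pot k y) \<partial>lborel) = ennreal ((LBINT z. exp (- (r * z)) * k z) / (\<psi> r - q))" .
 thus "integrable lborel (%y. exp (- (r * y)) * pot k y)"
  using pot0 by (intro integrableI_nonneg) auto
 have "0 <= (LBINT z. exp (- (r * z)) * k z)" using k0 by (intro integral_nonneg_AE) auto
 thus "(LBINT y. exp (- (r * y)) * pot k y) = (LBINT z. exp (- (r * z)) * k z) / (\<psi> r - q)"
  using * pot0 psi_gt[OF th] by (subst integral_eq_nn_integral) auto
qed

lemma pot_transform:
 assumes k: "dominated k" and th: "a < r" and int: "integrable lborel (%z. exp (- (r * z)) * k z)"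
 shows "integrable lborel (%y. exp (- (r * y)) * pot k y)"
  and "(LBINT y. exp (- (r * y)) * pot k y) = (LBINT z. exp (- (r * z)) * k z) / (\<psi> r - q)"
proof -
 let ?p = "%z. max 0 (k z)" and ?n = "%z. max 0 (- k z)"
 have p: "dominated ?p" and n: "dominated ?n" using k dominated_pos_part dominated_neg_part by auto
 have km [measurable]: "k \<in> borel_measurable borel" using k by (simp add: dominated_def)
 have ip: "integrable lborel (%z. exp (- (r * z)) * ?p z)" and i_n: "integrable lborel (%z. exp (- (r * z)) * ?n z)"
  by (rule Bochner_Integration.integrable_bound[OF int], measurable, auto simp: abs_mult max_def)+
 note P = pot_transform_nonneg[OF p _ th ip] and N = pot_transform_nonneg[OF n _ th i_n]
 show "integrable lborel (%y. exp (- (r * y)) * pot k y)"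
  unfolding pot_split[OF k] right_diff_distrib using P(1) N(1) by (intro Bochner_Integration.integrable_diff) auto
 have "(LBINT y. exp (- (r * y)) * pot k y) = (LBINT y. exp (- (r * y)) * pot ?p y) - (LBINT y. exp (- (r * y)) * pot ?n y)"
  unfolding pot_split[OF k] right_diff_distrib using P(1) N(1) by (intro Bochner_Integration.integral_diff) auto
 also have "... = ((LBINT z. exp (- (r * z)) * ?p z) - (LBINT z. exp (- (r * z)) * ?n z)) / (\<psi> r - q)"
  using P(2) N(2) by (simp add: diff_divide_distrib)
 also have "(LBINT z. exp (- (r * z)) * ?p z) - (LBINT z. exp (- (r * z)) * ?n z) = (LBINT z. exp (- (r * z)) * ?p z - exp (- (r * z)) * ?n z)"
  using ip i_n by (intro Bochner_Integration.integral_diff[symmetric])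
 also have "... = (LBINT z. exp (- (r * z)) * k z)"
  by (intro arg_cong[where f="integral\<^sup>L lborel"]) (auto simp: fun_eq_iff max_def)
 finally show "(LBINT y. exp (- (r * y)) * pot k y) = (LBINT z. exp (- (r * z)) * k z) / (\<psi> r - q)" .
qed

end

context refraction
begin

lemma W_int: "\<Phi> < r ==> integrable lborel (%x. exp (- (r * x)) * W x)"
 using SX.W_transform[of r] SX.W_nonneg by (intro integrableI_nonneg) auto

lemma Z_transform_b:
 assumes "\<Phi> < r"
 shows "integrable lborel (%z. exp (- (r * z)) * (Z z * indicator {b<..} z))"
proof -
 have th: "0 < r" using assms SX.a_nonneg by simp
 have dom: "SX.dominated (%z. indicator {0<..} z)"
 proof -
  have "\<bar>indicator {0<..} z :: real\<bar> <= 1 * exp ((\<Phi> + 1) * z)" for z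
   using SX.a_nonneg by (auto simp: indicator_def)
  moreover have "(%z::real. indicator {0<..} z :: real) \<in> borel_measurable borel" by measurable
  ultimately show ?thesis unfolding SX.dominated_def by (meson less_add_one)
 qed
 have I: "integrable lborel (%y. exp (- (r * y)) * CX.IW y)"
  using SX.pot_transform(1)[OF dom assms laplace_one(1)[OF th]] unfolding SX.pot_def CX.conv_one .
 have zm: "Z \<in> borel_measurable borel" by (intro borel_measurable_continuous_onI CX.Z_cont)
 have "integrable lborel (%z. exp (- (r * z)) * indicator {0<..} z + q * (exp (- (r * z)) * CX.IW z))"
  using I laplace_one(1)[OF th] by auto
 thus ?thesis
 proof (rule Bochner_Integration.integrable_bound)
  show "(%z. exp (- (r * z)) * (Z z * indicator {b<..} z)) \<in> borel_measurable lborel" using zm by measurable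
  show "AE z in lborel. norm (exp (- (r * z)) * (Z z * indicator {b<..} z)) <= norm (exp (- (r * z)) * indicator {0<..} z + q * (exp (- (r * z)) * CX.IW z))"
  proof (rule AE_I2)
   fix z
   show "norm (exp (- (r * z)) * (Z z * indicator {b<..} z)) <= norm (exp (- (r * z)) * indicator {0<..} z + q * (exp (- (r * z)) * CX.IW z))"
    using b q CX.IW_ge0[of z] by (cases "b < z") (auto simp: CX.Z_eq abs_mult algebra_simps)
  qed
 qed
qed

lemma slope_b_transform:
 assumes "\<Phi> < r"
 shows "integrable lborel (%z. exp (- (r * z)) * slope_b C z)"
  and "(LBINT z. exp (- (r * z)) * slope_b C z) = C * q * (LBINT z. exp (- (r * z)) * (W z * indicator {b<..} z)) - (LBINT z. exp (- (r * z)) * (Z z * indicator {b<..} z))"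
  and "integrable lborel (%z. exp (- (r * z)) * (W z * indicator {b<..} z))"
proof -
 show w: "integrable lborel (%z. exp (- (r * z)) * (W z * indicator {b<..} z))"
  by (rule Bochner_Integration.integrable_bound[OF W_int[OF assms]]) (auto simp: abs_mult indicator_def SX.W_nonneg)
 have eq: "(%z. exp (- (r * z)) * slope_b C z) = (%z. C * q * (exp (- (r * z)) * (W z * indicator {b<..} z)) - exp (- (r * z)) * (Z z * indicator {b<..} z))"
  by (auto simp: fun_eq_iff slope_b_def slope_def algebra_simps)
 show "integrable lborel (%z. exp (- (r * z)) * slope_b C z)"
  unfolding eq using w Z_transform_b[OF assms] by auto
 show "(LBINT z. exp (- (r * z)) * slope_b C z) = C * q * (LBINT z. exp (- (r * z)) * (W z * indicator {b<..} z)) - (LBINT z. exp (- (r * z)) * (Z z * indicator {b<..} z))"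
  unfolding eq using w Z_transform_b[OF assms] by (subst Bochner_Integration.integral_diff) auto
qed

lemma ramp_split: "(%z. exp (- (r * z)) * (q * (C - z) * indicator {0<..} z)) =
  (%z. q * C * (exp (- (r * z)) * indicator {0<..} z) - q * (exp (- (r * z)) * (z * indicator {0<..} z)))"
 by (auto simp: fun_eq_iff algebra_simps)

lemma gfun_transform:
 assumes th: "\<Phi> < r" "\<phi> < r"
 shows "integrable lborel (%y. exp (- (r * y)) * (gfun C y * indicator {0<..} y))"
  and "(LBINT y. exp (- (r * y)) * (gfun C y * indicator {0<..} y)) =
   (C - m / q) / r - 1 / r\<^sup>2 + q * (C / r - 1 / r\<^sup>2) / (\<psi> r - q)
   + \<delta> * ((LBINT z. exp (- (r * z)) * slope_b C z) / (\<psi> r - \<delta> * r - q))"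
proof -
 have t0: "0 < r" using th SX.a_nonneg by simp
 let ?\<rho> = "%z. q * (C - z) * indicator {0<..} z"
 note o = laplace_one[OF t0] and l = laplace_id[OF t0]
 have ri: "integrable lborel (%z. exp (- (r * z)) * ?\<rho> z)" unfolding ramp_split using o(1) l(1) by auto
 have rv: "(LBINT z. exp (- (r * z)) * ?\<rho> z) = q * (C / r - 1 / r\<^sup>2)"
  unfolding ramp_split Bochner_Integration.integral_diff[OF integrable_mult_right[OF o(1)] integrable_mult_right[OF l(1)]] integral_mult_right_zero o(2) l(2)
  by (simp add: algebra_simps)
 note P = SX.pot_transform[OF dominated_ramp[of C] th(1) ri]
 note Q = SY.pot_transform[OF dominated_slope_b[of C] th(2) slope_b_transform(1)[OF th(1)]]
 have p0: "SX.pot ?\<rho> y = 0" if "y <= 0" for y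
 proof -
  have "(%z. W (y - z) * ?\<rho> z) = (%z. 0)"
   using that by (auto simp: fun_eq_iff indicator_def intro!: CX.W_neg)
  thus ?thesis by (simp add: SX.pot_def)
 qed
 have eq: "(%y. exp (- (r * y)) * (gfun C y * indicator {0<..} y)) =
  (%y. (C - m / q) * (exp (- (r * y)) * indicator {0<..} y) - exp (- (r * y)) * (y * indicator {0<..} y)
    + exp (- (r * y)) * SX.pot ?\<rho> y + \<delta> * (exp (- (r * y)) * SY.pot (slope_b C) y))"
 proof
  fix y
  show "exp (- (r * y)) * (gfun C y * indicator {0<..} y) = (C - m / q) * (exp (- (r * y)) * indicator {0<..} y) - exp (- (r * y)) * (y * indicator {0<..} y)
    + exp (- (r * y)) * SX.pot ?\<rho> y + \<delta> * (exp (- (r * y)) * SY.pot (slope_b C) y)"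
  proof (cases "0 < y")
   case True
   thus ?thesis unfolding gfun_def base_pot by (simp add: algebra_simps)
  next
   case False
   thus ?thesis using p0[of y] pot_slope_below[of y C] b by simp
  qed
 qed
 show "integrable lborel (%y. exp (- (r * y)) * (gfun C y * indicator {0<..} y))"
  unfolding eq using o(1) l(1) P(1) Q(1) by (intro Bochner_Integration.integrable_add Bochner_Integration.integrable_diff integrable_mult_right)
 show "(LBINT y. exp (- (r * y)) * (gfun C y * indicator {0<..} y)) =
   (C - m / q) / r - 1 / r\<^sup>2 + q * (C / r - 1 / r\<^sup>2) / (\<psi> r - q)
   + \<delta> * ((LBINT z. exp (- (r * z)) * slope_b C z) / (\<psi> r - \<delta> * r - q))"
 proof -
  have i1: "integrable lborel (%y. (C - m / q) * (exp (- (r * y)) * indicator {0<..} y))" using o(1) by (rule integrable_mult_right)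
  have i4: "integrable lborel (%y. \<delta> * (exp (- (r * y)) * SY.pot (slope_b C) y))" using Q(1) by (rule integrable_mult_right)
  have i12: "integrable lborel (%y. (C - m / q) * (exp (- (r * y)) * indicator {0<..} y) - exp (- (r * y)) * (y * indicator {0<..} y))"
   using i1 l(1) by (rule Bochner_Integration.integrable_diff)
  have i123: "integrable lborel (%y. (C - m / q) * (exp (- (r * y)) * indicator {0<..} y) - exp (- (r * y)) * (y * indicator {0<..} y) + exp (- (r * y)) * SX.pot ?\<rho> y)"
   using i12 P(1) by (rule Bochner_Integration.integrable_add)
  show ?thesis
   unfolding eq Bochner_Integration.integral_add[OF i123 i4] Bochner_Integration.integral_add[OF i12 P(1)] Bochner_Integration.integral_diff[OF i1 l(1)]
    integral_mult_right_zero o(2) l(2) P(2) Q(2) rv by simp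
 qed
qed

text \<open>If \<open>s * gfun C\<close> is nonnegative beyond \<open>N0\<close>, then
  \<open>s\<close> times the transform is bounded below uniformly in \<open>n\<close>. After
  multiplication by a nonnegative factor tending to 0, the limit can only be nonnegative.\<close>

lemma abelian_limit:
 assumes th: "!!n. \<Phi> < r n" "!!n. \<phi> < r n" and lim: "(%n. \<psi> (r n) - \<delta> * r n) \<longlonglongrightarrow> q" and limr: "r \<longlonglongrightarrow> \<phi>"
  and ev: "!!y. N0 <= y ==> 0 <= s * gfun C y" and N0: "0 <= N0"
  and L: "(%n. (\<psi> (r n) - \<delta> * r n - q) * (LBINT y. exp (- (r n * y)) * (gfun C y * indicator {0<..} y))) \<longlonglongrightarrow> L"
 shows "0 <= s * L"
proof -
 obtain A1 where A1: "!!y. 0 <= y ==> y <= N0 ==> \<bar>gfun C y\<bar> <= A1"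
 proof -
  have "bounded (gfun C ` {0..N0})" by (intro compact_imp_bounded compact_continuous_image gfun_cont) auto
  thus ?thesis using that unfolding bounded_iff by (metis atLeastAtMost_iff image_eqI real_norm_def)
 qed
 have A0: "0 <= A1" using A1[of 0] N0 by simp
 have low: "- (\<bar>s\<bar> * A1 * N0) <= s * (LBINT y. exp (- (r n * y)) * (gfun C y * indicator {0<..} y))" for n
 proof -
  have t0: "0 < r n" using th(1)[of n] SX.a_nonneg by simp
  have "(LBINT y. - (\<bar>s\<bar> * A1) * indicator {0..N0} y) <= (LBINT y. s * (exp (- (r n * y)) * (gfun C y * indicator {0<..} y)))"
  proof (rule integral_mono)
   show "integrable lborel (%y. s * (exp (- (r n * y)) * (gfun C y * indicator {0<..} y)))"
    using gfun_transform(1)[OF th(1)[of n] th(2)[of n], of C] by simp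
   fix y
   consider "y <= 0" | "0 < y" "y <= N0" | "N0 < y" by linarith
   thus "- (\<bar>s\<bar> * A1) * indicator {0..N0} y <= s * (exp (- (r n * y)) * (gfun C y * indicator {0<..} y))"
   proof cases
    case 1 thus ?thesis using A0 by (simp add: indicator_def)
   next
    case 2
    have "\<bar>s * (exp (- (r n * y)) * gfun C y)\<bar> <= \<bar>s\<bar> * (1 * A1)"
     unfolding abs_mult using A1[of y] 2 t0 by (intro mult_left_mono mult_mono) auto
    thus ?thesis using 2 by simp
   next
    case 3
    thus ?thesis using mult_nonneg_nonneg[OF exp_ge_zero[of "- (r n * y)"] ev[of y]] N0 by (simp add: mult.left_commute)
   qed
  qed (use N0 in auto)
  thus ?thesis using N0 by simp
 qed
 let ?p = "%n. \<psi> (r n) - \<delta> * r n - q"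
 have p0: "0 <= ?p n" for n using SY.psi_gt[OF th(2)[of n]] by simp
 have "(%n. ?p n * (- (\<bar>s\<bar> * A1 * N0))) \<longlonglongrightarrow> (q - q) * (- (\<bar>s\<bar> * A1 * N0))"
  by (intro tendsto_intros lim)
 hence 1: "(%n. ?p n * (- (\<bar>s\<bar> * A1 * N0))) \<longlonglongrightarrow> 0" by simp
 have 2: "(%n. s * (?p n * (LBINT y. exp (- (r n * y)) * (gfun C y * indicator {0<..} y)))) \<longlonglongrightarrow> s * L"
  by (intro tendsto_intros L)
 show ?thesis
 proof (rule LIMSEQ_le[OF 1 2])
  have "?p n * (- (\<bar>s\<bar> * A1 * N0)) <= s * (?p n * (LBINT y. exp (- (r n * y)) * (gfun C y * indicator {0<..} y)))" for n
   using mult_left_mono[OF low[of n] p0[of n]] by (simp only: mult.left_commute)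
  thus "EX N. ALL n>=N. ?p n * (- (\<bar>s\<bar> * A1 * N0)) <= s * (?p n * (LBINT y. exp (- (r n * y)) * (gfun C y * indicator {0<..} y)))" by blast
 qed
qed

text \<open>The constant for which the transform of \<open>gfun C\<close> loses its pole at
  \<open>\<phi>\<close>. For \<open>\<delta> = 0\<close> the two integrals diverge, and the
  coefficient of the pole is proportional to \<open>C / \<phi> - 1 / \<phi>\<^sup>2\<close>
  instead.\<close>

definition critical :: real where
 "critical = (if \<delta> = 0 then 1 / \<phi> else
   (LBINT z. exp (- (\<phi> * z)) * (Z z * indicator {b<..} z)) / (q * (LBINT z. exp (- (\<phi> * z)) * (W z * indicator {b<..} z))))"

text \<open>The transform is multiplied by \<psi> r - \<delta> * r - q, which tends to 0 as
  \<open>r\<close> decreases to \<open>\<phi>\<close>. For \<open>\<delta> > 0\<close> the root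
  \<open>\<Phi>\<close> lies to the left of \<open>\<phi>\<close>, so the \<open>X\<close> part
  stays finite and only \<open>\<delta>\<close> times the transform of \<open>slope_b C\<close>
  survives. For \<open>\<delta> = 0\<close> the roots coincide and the term from the
  \<open>X\<close> potential survives. In both cases the limit is a positive multiple of
  \<open>C - critical\<close>.\<close>

lemma critical_sign:
 assumes cont: "!!r. r \<longlonglongrightarrow> \<phi> ==> (!!n. \<phi> <= r n) ==> (%n. \<psi> (r n)) \<longlonglongrightarrow> \<psi> \<phi>"
  and root: "\<psi> \<phi> - \<delta> * \<phi> = q" and phi: "0 < \<phi>"
  and order: "0 < \<delta> ==> \<Phi> < \<phi>" "\<delta> = 0 ==> \<Phi> = \<phi>"
  and Wpos: "!!y. 0 < y ==> 0 < W y"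
  and ev: "!!y. N0 <= y ==> 0 <= s * gfun C y" and N0: "0 <= N0"
 shows "0 <= s * (C - critical)"
proof -
 define r where "r n = \<phi> + 1 / real (Suc n)" for n
 have limr: "r \<longlonglongrightarrow> \<phi>" unfolding r_def by real_asymp
 have gt: "\<phi> < r n" for n by (simp add: r_def)
 have gt': "\<Phi> < r n" for n using order delta gt[of n] by (cases "\<delta> = 0") (auto intro: less_trans)
 have tpos: "0 < r n" for n using gt[of n] phi by simp
 have lim\<psi>: "(%n. \<psi> (r n)) \<longlonglongrightarrow> \<psi> \<phi>" using gt by (intro cont limr) (auto intro: less_imp_le)
 have "(%n. \<psi> (r n) - \<delta> * r n) \<longlonglongrightarrow> \<psi> \<phi> - \<delta> * \<phi>" by (intro tendsto_intros lim\<psi> limr)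
 hence lim: "(%n. \<psi> (r n) - \<delta> * r n) \<longlonglongrightarrow> q" using root by simp
 let ?p = "%n. \<psi> (r n) - \<delta> * r n - q"
 have lim0: "?p \<longlonglongrightarrow> 0" using tendsto_diff[OF lim tendsto_const[of q]] by simp
 have ppos: "0 < ?p n" for n using SY.psi_gt[OF gt[of n]] by simp
 have xpos: "0 < \<psi> (r n) - q" for n using SX.psi_gt[OF gt'[of n]] by simp
 let ?A = "%n. (C - m / q) / r n - 1 / (r n)\<^sup>2"
 let ?B = "%n. q * (C / r n - 1 / (r n)\<^sup>2)"
 let ?S = "%t. \<integral>z. exp (- (t * z)) * slope_b C z \<partial>lborel"
 \<comment> \<open>Clears the pole of the last summand; the limit of the remaining quotient
   \<open>?p n / (\<psi> (r n) - q)\<close> is what distinguishes the two cases: 1 for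
   \<open>\<delta> = 0\<close>, and 0 otherwise.\<close>
 have id: "?p n * (LBINT y. exp (- (r n * y)) * (gfun C y * indicator {0<..} y)) = ?p n * ?A n + ?B n * (?p n / (\<psi> (r n) - q)) + \<delta> * ?S (r n)" for n
 proof -
  have "p * (a - c + B / x + \<delta> * (S / p)) = p * (a - c) + B * (p / x) + \<delta> * S" if "0 < p" for p a c B x S :: real
   using that by (simp add: field_simps)
  thus ?thesis unfolding gfun_transform(2)[OF gt' gt] using ppos[of n] by blast
 qed
 have A: "(%n. ?p n * ?A n) \<longlonglongrightarrow> 0 * ((C - m / q) / \<phi> - 1 / \<phi>\<^sup>2)"
  using phi by (intro tendsto_intros lim0 limr) auto
 have B: "?B \<longlonglongrightarrow> q * (C / \<phi> - 1 / \<phi>\<^sup>2)" using phi by (intro tendsto_intros limr) auto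
 show ?thesis
 proof (cases "\<delta> = 0")
  case True
  have r1: "?p n / (\<psi> (r n) - q) = 1" for n using True xpos[of n] by simp
  have "(%n. ?p n * (LBINT y. exp (- (r n * y)) * (gfun C y * indicator {0<..} y))) \<longlonglongrightarrow> 0 * ((C - m / q) / \<phi> - 1 / \<phi>\<^sup>2) + q * (C / \<phi> - 1 / \<phi>\<^sup>2)"
  proof -
   have "\<delta> * ?S (r n) = 0" for n by (simp add: True)
   thus ?thesis unfolding id r1 mult_1_right by (simp only: add_0_right tendsto_add[OF A B])
  qed
  from abelian_limit[OF gt' gt lim limr ev N0 this] have "0 <= s * (q * (C / \<phi> - 1 / \<phi>\<^sup>2))" by simp
  moreover have cr: "critical = 1 / \<phi>" unfolding critical_def by (rule if_P[OF True])
  have "s * (q * (C / \<phi> - 1 / \<phi>\<^sup>2)) = (q / \<phi>) * (s * (C - critical))"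
   using phi unfolding cr by (simp add: field_simps power2_eq_square)
  ultimately show ?thesis using mult_le_cancel_left_pos[of "q / \<phi>" 0 "s * (C - critical)"] q phi by simp
 next
  case False
  hence d: "0 < \<delta>" using delta by simp
  have p\<Phi>: "\<Phi> < \<phi>" using order d by simp
  have xl: "(%n. \<psi> (r n) - q) \<longlonglongrightarrow> \<delta> * \<phi>" using tendsto_diff[OF lim\<psi> tendsto_const[of q]] root by (simp add: algebra_simps)
  have "(%n. ?B n * (?p n / (\<psi> (r n) - q))) \<longlonglongrightarrow> (q * (C / \<phi> - 1 / \<phi>\<^sup>2)) * (0 / (\<delta> * \<phi>))"
   using d phi by (intro tendsto_mult B tendsto_divide lim0 xl) auto
  hence BB: "(%n. ?B n * (?p n / (\<psi> (r n) - q))) \<longlonglongrightarrow> 0" by simp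
  have SS: "(%n. ?S (r n)) \<longlonglongrightarrow> ?S \<phi>"
  proof (rule integral_dominated_convergence)
   show "integrable lborel (%z. \<bar>exp (- (\<phi> * z)) * slope_b C z\<bar>)" using slope_b_transform(1)[OF p\<Phi>] by (rule integrable_abs)
   show "AE x in lborel. (%n. exp (- (r n * x)) * slope_b C x) \<longlonglongrightarrow> exp (- (\<phi> * x)) * slope_b C x"
    by (intro AE_I2 tendsto_intros limr)
   show "AE x in lborel. norm (exp (- (r n * x)) * slope_b C x) <= \<bar>exp (- (\<phi> * x)) * slope_b C x\<bar>" for n
   proof (rule AE_I2)
    fix x
    show "norm (exp (- (r n * x)) * slope_b C x) <= \<bar>exp (- (\<phi> * x)) * slope_b C x\<bar>"
    proof (cases "b < x")
     case True
     hence "\<phi> * x <= r n * x" using gt[of n] b by (intro mult_right_mono) auto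
     thus ?thesis by (simp add: abs_mult mult_right_mono)
    qed (simp add: slope_b_def)
   qed
  qed measurable
  have "(%n. ?p n * (LBINT y. exp (- (r n * y)) * (gfun C y * indicator {0<..} y))) \<longlonglongrightarrow> 0 * ((C - m / q) / \<phi> - 1 / \<phi>\<^sup>2) + 0 + \<delta> * ?S \<phi>"
   unfolding id by (intro tendsto_add A BB tendsto_mult SS tendsto_const)
  from abelian_limit[OF gt' gt lim limr ev N0 this] have S0: "0 <= s * (\<delta> * ?S \<phi>)" by simp
  let ?IW = "\<integral>z. exp (- (\<phi> * z)) * (W z * indicator {b<..} z) \<partial>lborel"
  let ?IZ = "\<integral>z. exp (- (\<phi> * z)) * (Z z * indicator {b<..} z) \<partial>lborel"
  have IW: "0 < ?IW"
  proof -
   have "0 < exp (- (\<phi> * (b + 1))) * W b" using Wpos[OF b] by simp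
   also have "... = (LBINT z. exp (- (\<phi> * (b + 1))) * W b * indicator {b<..b+1} z)" by simp
   also have "... <= ?IW"
   proof (rule integral_mono[OF _ slope_b_transform(3)[OF p\<Phi>]])
    fix z
    show "exp (- (\<phi> * (b + 1))) * W b * indicator {b<..b+1} z <= exp (- (\<phi> * z)) * (W z * indicator {b<..} z)"
    proof (cases "z \<in> {b<..b+1}")
     case True
     have "\<phi> * z <= \<phi> * (b + 1)" using True phi by (intro mult_left_mono) auto
     hence "exp (- (\<phi> * (b + 1))) * W b <= exp (- (\<phi> * z)) * W z"
      using CX.W_mono[of b z] SX.W_nonneg True by (intro mult_mono) auto
     thus ?thesis using True by simp
    qed (simp add: SX.W_nonneg)
   qed simp
   finally show ?thesis .
  qed
  have cr: "critical = ?IZ / (q * ?IW)" unfolding critical_def by (rule if_not_P[OF False])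
  have "s * (\<delta> * (C * q * u - v)) = (\<delta> * q * u) * (s * (C - v / (q * u)))" if "0 < u" for u v
   using that q by (simp add: field_simps)
  hence E: "s * (\<delta> * ?S \<phi>) = (\<delta> * q * ?IW) * (s * (C - critical))"
   unfolding slope_b_transform(2)[OF p\<Phi>] cr using IW by blast
  have pos: "0 < \<delta> * q * ?IW" using d q IW by simp
  show ?thesis using S0 mult_le_cancel_left_pos[OF pos, of 0 "s * (C - critical)"] unfolding E mult_zero_right by blast
 qed
qed

end

section \<open>The Skorokhod equation of a refracted-reflected path\<close>

text \<open>Compactness. The centres of the covering intervals separate left from right
  neighbourhoods, and their right end points keep an interval that avoids \<open>F\<close> inside
  the piece covering its left end. The intervals are open at \<open>x\<close> and closed at
  \<open>y\<close>, because a jump at \<open>y\<close> counts for \<open>f y - f x\<close> and a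
  jump at \<open>x\<close> does not.\<close>

lemma cadlag_partition:
 fixes f :: "real => real"
 assumes f: "cadlag f" and \<eta>: "0 < \<eta>"
 obtains F where "finite F" "!!x y. 0 <= x ==> x <= y ==> y <= T ==> F \<inter> {x<..y} = {} ==> \<bar>f y - f x\<bar> < \<eta>"
proof -
 have "EX e>0. (\<forall>y\<in>{t..<t+e}. \<bar>f y - f t\<bar> < \<eta> / 2) & (ALL x y. 0 <= x --> x \<in> {t-e<..<t} --> y \<in> {t-e<..<t} --> \<bar>f y - f x\<bar> < \<eta>)" if t: "0 <= t" for t
 proof -
  have "(f \<longlongrightarrow> f t) (at_right t)" using f t by (simp add: cadlag_def continuous_within)
  hence "\<forall>\<^sub>F y in at_right t. dist (f y) (f t) < \<eta> / 2" using \<eta> by (intro tendstoD) auto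
  then obtain r where r: "t < r" "!!y. t < y ==> y < r ==> \<bar>f y - f t\<bar> < \<eta> / 2"
   by (auto simp: eventually_at_right_field dist_real_def)
  obtain l where l: "l < t" "!!x y. 0 <= x ==> l < x ==> x < t ==> l < y ==> y < t ==> \<bar>f y - f x\<bar> < \<eta>"
  proof (cases "t = 0")
   case True thus ?thesis using that[of "-1"] by auto
  next
   case False
   hence "0 < t" using t by simp
   then obtain c where c: "(f \<longlongrightarrow> c) (at_left t)" using f unfolding cadlag_def by blast
   hence "\<forall>\<^sub>F y in at_left t. dist (f y) c < \<eta> / 2" using \<eta> by (intro tendstoD) auto
   then obtain l where l: "l < t" "!!y. l < y ==> y < t ==> \<bar>f y - c\<bar> < \<eta> / 2"
    by (auto simp: eventually_at_left_field dist_real_def)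
   have "\<bar>f y - f x\<bar> < \<eta>" if "l < x" "x < t" "l < y" "y < t" for x y
    using l(2)[OF that(1,2)] l(2)[OF that(3,4)] by linarith
   thus ?thesis using that l(1) by blast
  qed
  have "\<bar>f y - f t\<bar> < \<eta> / 2" if "y \<in> {t..<t + min (r - t) (t - l)}" for y
   using r(2)[of y] that \<eta> by (cases "y = t") auto
  moreover have "\<bar>f y - f x\<bar> < \<eta>" if "0 <= x" "x \<in> {t - min (r - t) (t - l)<..<t}" "y \<in> {t - min (r - t) (t - l)<..<t}" for x y
   using l(2)[OF that(1)] that by auto
  ultimately show ?thesis using r(1) l(1) by (intro exI[of _ "min (r - t) (t - l)"]) auto
 qed
 then obtain e where e: "!!t. 0 <= t ==> 0 < e t" "!!t y. 0 <= t ==> y \<in> {t..<t+e t} ==> \<bar>f y - f t\<bar> < \<eta> / 2"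
  "!!t x y. 0 <= t ==> 0 <= x ==> x \<in> {t-e t<..<t} ==> y \<in> {t-e t<..<t} ==> \<bar>f y - f x\<bar> < \<eta>"
  by metis
 have "\<exists>C\<subseteq>{0..T}. finite C & {0..T} \<subseteq> (\<Union>t\<in>C. {t-e t<..<t+e t})"
 proof (rule compactE_image[of "{0..T}" "{0..T}" "%t. {t-e t<..<t+e t}"])
  show "{0..T} \<subseteq> (\<Union>t\<in>{0..T}. {t-e t<..<t+e t})" using e(1) by force
 qed auto
 then obtain C where C: "C \<subseteq> {0..T}" "finite C" "{0..T} \<subseteq> (\<Union>t\<in>C. {t-e t<..<t+e t})" by blast
 define F where "F = C \<union> (%t. t + e t) ` C"
 have "\<bar>f y - f x\<bar> < \<eta>" if xy: "0 <= x" "x <= y" "y <= T" and F: "F \<inter> {x<..y} = {}" for x y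
 proof -
  obtain t where t: "t \<in> C" "x \<in> {t-e t<..<t+e t}" using C(3) xy by fastforce
  have t0: "0 <= t" using t C by auto
  have "t \<in> F" "t + e t \<in> F" using t by (auto simp: F_def)
  hence n: "\<not> (x < t & t <= y)" "\<not> (x < t + e t & t + e t <= y)" using F by auto
  have y: "y < t + e t" using n t by auto
  show ?thesis
  proof (cases "x < t")
   case True
   thus ?thesis using e(3)[OF t0 xy(1) , of y] n t xy by auto
  next
   case False
   hence "\<bar>f x - f t\<bar> < \<eta> / 2" "\<bar>f y - f t\<bar> < \<eta> / 2" using e(2)[OF t0, of x] e(2)[OF t0, of y] t xy y by simp_all
   thus ?thesis by linarith
  qed
 qed
 note main = this
 have "finite F" using C by (simp add: F_def)
 thus ?thesis by (rule that[OF _ main])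
qed

lemma cadlag_bounded:
 fixes f :: "real => real"
 assumes f: "cadlag f"
 obtains B where "!!t. 0 <= t ==> t <= T ==> \<bar>f t\<bar> <= B"
proof -
 obtain F where F: "finite F" "!!x y. 0 <= x ==> x <= y ==> y <= T ==> F \<inter> {x<..y} = {} ==> \<bar>f y - f x\<bar> < 1"
  using cadlag_partition[OF f zero_less_one, of T] by metis
 define G where "G = insert 0 F"
 have G: "finite G" using F by (simp add: G_def)
 have "\<bar>f t\<bar> <= (\<Sum>s\<in>G. \<bar>f s\<bar>) + 1" if t: "0 <= t" "t <= T" for t
 proof -
  define s where "s = Max (G \<inter> {0..t})"
  have fin: "finite (G \<inter> {0..t})" "G \<inter> {0..t} ~= {}" using G t by (auto simp: G_def)
  have s: "s \<in> G" "0 <= s" "s <= t" using Max_in[OF fin] by (auto simp: s_def)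
  have "F \<inter> {s<..t} = {}"
  proof (rule ccontr)
   assume "F \<inter> {s<..t} ~= {}"
   then obtain u where u: "u \<in> F" "s < u" "u <= t" by auto
   hence "u \<in> G \<inter> {0..t}" using s by (auto simp: G_def)
   hence "u <= s" unfolding s_def using fin by (intro Max_ge) auto
   thus False using u by simp
  qed
  hence "\<bar>f t - f s\<bar> < 1" using F(2) s t by auto
  moreover have "\<bar>f s\<bar> <= (\<Sum>s\<in>G. \<bar>f s\<bar>)" using G s by (intro member_le_sum) auto
  ultimately show ?thesis by linarith
 qed
 thus ?thesis by (rule that)
qed

locale rr_path =
 fixes \<delta> b :: real and f v :: "real => real"
 assumes cadlag: "cadlag f" and npj: "no_positive_jumps f"
  and rr: "refracted_reflected_path \<delta> b f v" and b: "0 < b" and delta: "0 <= \<delta>"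
begin

abbreviation ind where "ind u \<equiv> indicat_real {b<..} (v u)"
abbreviation L where "L \<equiv> cumulative_refraction \<delta> b v"
text \<open>The regulator of the one-sided Skorokhod problem for \<open>f - L\<close>.\<close>

definition N where "N t = (SUP u\<in>{0..t}. max (L u - f u) 0)"

text \<open>The equation is claimed on a half-open interval because the value of \<open>v\<close> at
  the end of one step of the construction is fixed only by the next step.\<close>

definition good :: "real => bool" where
 "good s \<longleftrightarrow> 0 <= s & set_integrable lborel {0..<s} ind & (ALL t. 0 <= t --> t < s --> v t = f t - L t + N t)"

lemma integrable_closed:
 assumes "set_integrable lborel {a..<s} g" "a <= s"
 shows "set_integrable lborel {a..s} (g :: real => real)" "(LBINT u:{a..s}. g u) = (LBINT u:{a..<s}. g u)"
proof -
 have eq: "{a..s} = {a..<s} \<union> {s}" using assms(2) by auto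
 have eqf: "(%x. indicat_real {s} x *\<^sub>R g x) = (%x. g s * indicat_real {s} x)" by (auto simp: fun_eq_iff indicator_def)
 have s: "set_integrable lborel {s} g" unfolding set_integrable_def eqf by (intro integrable_mult_right) auto
 show "set_integrable lborel {a..s} g" unfolding eq by (intro set_integrable_Un assms s) auto
 have "(LBINT u:{s}. g u) = 0" unfolding set_lebesgue_integral_def eqf by simp
 thus "(LBINT u:{a..s}. g u) = (LBINT u:{a..<s}. g u)"
  unfolding eq by (subst set_integral_Un[OF _ assms(1) s]) auto
qed

lemma set_integral_bounds:
 assumes "set_integrable lborel A (%u. indicat_real {b<..} (w u))" "A = {a..c} \<or> A = {a..<c}" "a <= c"
 shows "0 <= (LBINT u:A. indicat_real {b<..} (w u))" "(LBINT u:A. indicat_real {b<..} (w u)) <= c - a"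
proof -
 show "0 <= (LBINT u:A. indicat_real {b<..} (w u))"
  unfolding set_lebesgue_integral_def by (intro integral_nonneg_AE) auto
 have one: "set_integrable lborel A (%u. 1::real)" unfolding set_integrable_def
  using assms(2,3) by (auto intro!: integrable_real_indicator)
 have "(LBINT u:A. indicat_real {b<..} (w u)) <= (LBINT u:A. 1)"
  by (intro set_integral_mono assms(1) one) auto
 also have "... = c - a" using assms(2,3) by (auto simp: set_lebesgue_integral_def)
 finally show "(LBINT u:A. indicat_real {b<..} (w u)) <= c - a" .
qed

lemma bdd_N:
 assumes "set_integrable lborel {0..t} ind"
 shows "bdd_above ((%u. max (L u - f u) 0) ` {0..t})"
proof -
 obtain B where B: "!!u. 0 <= u ==> u <= t ==> \<bar>f u\<bar> <= B" using cadlag_bounded[OF cadlag, of t] by metis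
 have "L u <= \<delta> * \<bar>t\<bar>" if "0 <= u" "u <= t" for u
 proof -
  have "set_integrable lborel {0..u} ind" by (rule set_integrable_subset[OF assms]) (use that in auto)
  hence "(LBINT s:{0..u}. ind s) <= u - 0" using that by (intro set_integral_bounds(2)) auto
  thus ?thesis unfolding cumulative_refraction_def using delta that by (intro mult_left_mono) auto
 qed
 hence "max (L u - f u) 0 <= \<delta> * \<bar>t\<bar> + \<bar>B\<bar>" if "0 <= u" "u <= t" for u
  using B[OF that] that delta by (smt (verit) mult_nonneg_nonneg)
 thus ?thesis by (intro bdd_aboveI[where M="\<delta> * \<bar>t\<bar> + \<bar>B\<bar>"]) auto
qed

lemma good_integrable: "good s ==> set_integrable lborel {0..s} ind"
 unfolding good_def using integrable_closed(1) by blast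

lemma N_upper: "good s ==> 0 <= u ==> u <= t ==> t <= s ==> L u - f u <= N t"
 and N_nonneg: "good s ==> 0 <= t ==> t <= s ==> 0 <= N t"
proof -
 have *: "max (L u - f u) 0 <= N t" if "good s" "0 <= u" "u <= t" "t <= s" for u t
  unfolding N_def
 proof (rule cSUP_upper)
  have "set_integrable lborel {0..t} ind"
   by (rule set_integrable_subset[OF good_integrable[OF that(1)]]) (use that in auto)
  thus "bdd_above ((%u. max (L u - f u) 0) ` {0..t})" by (rule bdd_N)
 qed (use that in auto)
 show "good s ==> 0 <= u ==> u <= t ==> t <= s ==> L u - f u <= N t" using *[of u t] by auto
 show "good s ==> 0 <= t ==> t <= s ==> 0 <= N t" using *[of t t] by auto
qed

lemma N_least: "0 <= t ==> 0 <= x ==> (!!u. 0 <= u ==> u <= t ==> L u - f u <= x) ==> N t <= x"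
 unfolding N_def by (intro cSUP_least) auto

lemma first_time_less: "ereal t < first_time_after s P ==> s < t ==> \<not> P t"
 unfolding first_time_after_def using not_le[of "Inf (ereal ` {t. s < t & P t})" "ereal t"] by (auto intro: Inf_lower)

lemma first_time_approx:
 assumes "first_time_after s P = ereal s'" "0 < e"
 obtains t where "s' <= t" "t < s' + e" "s < t" "P t"
proof -
 have "Inf (ereal ` {t. s < t & P t}) < ereal (s' + e)" using assms unfolding first_time_after_def by simp
 then obtain t where t: "s < t" "P t" "t < s' + e" unfolding Inf_less_iff by auto
 moreover have "s' <= t"
  using t assms(1) Inf_lower[of "ereal t" "ereal ` {t. s < t & P t}"] unfolding first_time_after_def by auto
 ultimately show ?thesis using that by blast
qed

lemma first_time_ge: "ereal s <= first_time_after s P"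
 unfolding first_time_after_def by (intro Inf_greatest) auto

lemma right_cont: "0 <= t ==> 0 < \<eta> ==> EX e>0. ALL y. t <= y --> y < t + e --> \<bar>f y - f t\<bar> < \<eta>"
proof -
 assume t: "0 <= t" "0 < \<eta>"
 have "(f \<longlongrightarrow> f t) (at_right t)" using cadlag t by (simp add: cadlag_def continuous_within)
 hence "\<forall>\<^sub>F y in at_right t. dist (f y) (f t) < \<eta>" using t by (intro tendstoD) auto
 then obtain r where r: "t < r" "!!y. t < y ==> y < r ==> \<bar>f y - f t\<bar> < \<eta>"
  by (auto simp: eventually_at_right_field dist_real_def)
 have "\<bar>f y - f t\<bar> < \<eta>" if "t <= y" "y < t + (r - t)" for y using r(2)[of y] that t by (cases "y = t") auto
 thus ?thesis using r(1) by (intro exI[of _ "r - t"]) auto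
qed

text \<open>During Step 1, \<open>f - L\<close> equals \<open>A - N s\<close> with
  \<open>A >= 0\<close>, so the running supremum stands still. On exit \<open>A\<close> may be
  negative, and the supremum then jumps by just the amount that brings the solution to 0, where Step
  2 starts.\<close>

lemma step1:
 assumes g: "good s" and st: "step1_start \<delta> b f s a" and a: "0 <= a" "a = f s - L s + N s"
 shows "(ALL T>s. good T) \<or> (EX s'. s <= s' & (ALL T. s <= T --> T <= s' --> good T) & step2_start \<delta> b f s' & 0 = f s' - L s' + N s')"
proof -
 from rr st obtain A where A: "refracted_path \<delta> b f s a A"
  and vA: "!!t. s <= t ==> ereal t < first_time_after s (%u. A u < 0) ==> v t = A t"
  unfolding refracted_reflected_path_def by metis
 let ?\<tau> = "first_time_after s (%u. A u < 0)"
 have s0: "0 <= s" using g by (simp add: good_def)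
 have Ai: "set_integrable lborel {s..t} (%u. indicat_real {b<..} (A u))" if "s <= t" for t
  using A that by (simp add: refracted_path_def)
 have At: "A t = a + (f t - f s) - \<delta> * (LBINT u:{s..t}. indicat_real {b<..} (A u))" if "s <= t" for t
  using A that by (simp add: refracted_path_def)
 have As: "A s = a" using At[of s] integrable_closed(2)[of s s "%u. indicat_real {b<..} (A u)"] by (simp add: set_integrable_def set_lebesgue_integral_def)
 have Apos: "0 <= A t" if "s <= t" "ereal t < ?\<tau>" for t
  using first_time_less[OF that(2)] that As a by (cases "t = s") auto
 have gi: "set_integrable lborel {0..<s} ind" using g by (simp add: good_def)
 have Ls: "L s = \<delta> * (LBINT u:{0..<s}. ind u)" unfolding cumulative_refraction_def using integrable_closed(2)[OF gi s0] by simp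
 have key: "set_integrable lborel {0..<t} ind & L t = L s + \<delta> * (LBINT u:{s..t}. indicat_real {b<..} (A u))"
  if t: "s <= t" "!!u. s <= u ==> u < t ==> v u = A u" for t
 proof -
  have i1: "set_integrable lborel {s..<t} (%u. indicat_real {b<..} (A u))"
   by (rule set_integrable_subset[OF Ai[OF t(1)]]) auto
  have i2: "set_integrable lborel {s..<t} ind"
   by (rule iffD1[OF set_integrable_cong[OF refl refl] i1]) (use t(2) in auto)
  have un: "{0..<t} = {0..<s} \<union> {s..<t}" using s0 t(1) by auto
  have i3: "set_integrable lborel {0..<t} ind" unfolding un by (intro set_integrable_Un gi i2) auto
  have "(LBINT u:{0..t}. ind u) = (LBINT u:{0..<t}. ind u)" using integrable_closed(2)[OF i3] s0 t(1) by simp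
  also have "... = (LBINT u:{0..<s}. ind u) + (LBINT u:{s..<t}. ind u)"
   unfolding un by (intro set_integral_Un gi i2) auto
  also have "(LBINT u:{s..<t}. ind u) = (LBINT u:{s..<t}. indicat_real {b<..} (A u))"
   by (intro set_lebesgue_integral_cong) (use t(2) in auto)
  also have "... = (LBINT u:{s..t}. indicat_real {b<..} (A u))" using integrable_closed(2)[OF i1 t(1)] by simp
  finally have "\<delta> * (LBINT u:{0..t}. ind u) = \<delta> * (LBINT u:{0..<s}. ind u) + \<delta> * (LBINT u:{s..t}. indicat_real {b<..} (A u))"
   by (simp only: distrib_left)
  thus ?thesis using i3 Ls by (simp only: cumulative_refraction_def)
 qed
 have fL: "f t - L t = A t - N s" if t: "s <= t" "!!u. s <= u ==> u < t ==> v u = A u" for t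
  using key[OF t] At[OF t(1)] a by simp
 have vA': "v u = A u" if "s <= u" "u < t" "ereal t <= ?\<tau>" for u t
 proof -
  have "ereal u < ?\<tau>" using that by (meson ereal_less_le less_ereal.simps(1) less_le_trans)
  thus ?thesis using vA that by simp
 qed
 have goodT: "good T" if T: "s <= T" "ereal T <= ?\<tau>" for T
 proof -
  have kT: "set_integrable lborel {0..<T} ind" using key[OF T(1)] vA'[OF _ _ T(2)] by blast
  have N1: "N t = N s" if t: "s <= t" "t < T" for t
  proof (rule antisym)
   have itt: "set_integrable lborel {0..t} ind" by (rule set_integrable_subset[OF kT]) (use t s0 in auto)
   show "N t <= N s"
   proof (rule N_least)
    fix u assume u: "0 <= u" "u <= t"
    show "L u - f u <= N s"
    proof (cases "u <= s")
     case True thus ?thesis using N_upper[OF g u(1)] by simp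
    next
     case False
     hence "ereal u < ?\<tau>" using u t T by (meson ereal_less_le le_less_trans less_ereal.simps(1) less_le_trans)
     hence "0 <= A u" using Apos False by simp
     moreover have "f u - L u = A u - N s" using False u t T by (intro fL vA'[OF _ _ T(2)]) auto
     ultimately show ?thesis by simp
    qed
   qed (use t s0 N_nonneg[OF g] in auto)
   show "N s <= N t" unfolding N_def by (intro cSUP_subset_mono bdd_N itt) (use t s0 in auto)
  qed
  show ?thesis unfolding good_def
  proof (intro conjI allI impI kT)
   fix t assume t: "0 <= t" "t < T"
   show "v t = f t - L t + N t"
   proof (cases "t < s")
    case True thus ?thesis using g t by (simp add: good_def)
   next
    case False
    have "f t - L t = A t - N s" using False t by (intro fL vA'[OF _ _ T(2)]) auto
    thus ?thesis using N1[of t] vA'[OF _ t(2) T(2)] False t by simp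
   qed
  qed (use s0 T in simp)
 qed
 show ?thesis
 proof (cases "?\<tau>")
  case (real s')
  have ss: "s <= s'" using first_time_ge[of s "%u. A u < 0"] real by simp
  have s2: "step2_start \<delta> b f s'" using st A real by (rule step1_start_step2_start.down)
  have gs': "good s'" by (rule goodT[OF ss]) (simp add: real)
  \<comment> \<open>The exit time is an infimum. Were \<open>A s'\<close> positive, right continuity
    of \<open>f\<close> and the bounded rate of the drift would keep \<open>A\<close> positive for a
    while after \<open>s'\<close>.\<close>
  have "A s' <= 0"
  proof (rule ccontr)
   assume "\<not> A s' <= 0"
   hence pos: "0 < A s'" by simp
   obtain e1 where e1: "0 < e1" "!!y. s' <= y ==> y < s' + e1 ==> \<bar>f y - f s'\<bar> < A s' / 2"
    using right_cont[of s' "A s' / 2"] pos ss s0 by auto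
   define e where "e = min e1 (A s' / (2 * (\<delta> + 1)))"
   have e: "0 < e" using e1 pos delta by (simp add: e_def)
   obtain t where t: "s' <= t" "t < s' + e" "A t < 0" using first_time_approx[OF real e] by metis
   have st': "s <= t" using ss t by simp
   have sub: "set_integrable lborel {s'..t} (%u. indicat_real {b<..} (A u))"
    by (rule set_integrable_subset[OF Ai[OF st']]) (use ss in auto)
   have sub2: "set_integrable lborel {s..<s'} (%u. indicat_real {b<..} (A u))"
    by (rule set_integrable_subset[OF Ai[OF ss]]) auto
   have un: "{s..t} = {s..<s'} \<union> {s'..t}" using ss t by auto
   have "(LBINT u:{s..t}. indicat_real {b<..} (A u)) = (LBINT u:{s..<s'}. indicat_real {b<..} (A u)) + (LBINT u:{s'..t}. indicat_real {b<..} (A u))"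
    unfolding un by (intro set_integral_Un sub sub2) auto
   also have "(LBINT u:{s..<s'}. indicat_real {b<..} (A u)) = (LBINT u:{s..s'}. indicat_real {b<..} (A u))"
    using integrable_closed(2)[OF sub2 ss] by simp
   finally have "A t - A s' = f t - f s' - \<delta> * (LBINT u:{s'..t}. indicat_real {b<..} (A u))"
    using At[OF st'] At[OF ss] by (simp add: algebra_simps)
   moreover have "\<delta> * (LBINT u:{s'..t}. indicat_real {b<..} (A u)) <= \<delta> * e"
    using set_integral_bounds(2)[OF sub, of s' t] t delta by (intro mult_left_mono) auto
   moreover have "\<delta> * e <= A s' / 2"
   proof -
    have "\<delta> * e <= (\<delta> + 1) * (A s' / (2 * (\<delta> + 1)))" using delta e by (intro mult_mono) (auto simp: e_def)
    also have "... = A s' / 2" using delta by (simp add: field_simps)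
    finally show ?thesis .
   qed
   moreover have "\<bar>f t - f s'\<bar> < A s' / 2" using e1(2) t by (simp add: e_def)
   ultimately show False using t(3) by linarith
  qed
  have fs': "f s' - L s' = A s' - N s" using real by (intro fL ss vA') auto
  have "N s' = N s - A s'"
  proof (rule antisym)
   show "N s' <= N s - A s'"
   proof (rule N_least)
    fix u assume u: "0 <= u" "u <= s'"
    show "L u - f u <= N s - A s'"
    proof (cases "u = s'")
     case True thus ?thesis using fs' by simp
    next
     case False
     hence us: "u < s'" using u by simp
     have "L u - f u <= N s"
     proof (cases "u <= s")
      case True thus ?thesis using N_upper[OF g u(1)] by simp
     next
      case F: False
      have "ereal u < ?\<tau>" using us real by simp
      hence "0 <= A u" using Apos F by simp
      moreover have "f u - L u = A u - N s" using F us real by (intro fL vA'[of _ u]) auto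
      ultimately show ?thesis by simp
     qed
     thus ?thesis using \<open>A s' <= 0\<close> by linarith
    qed
   next
    show "0 <= s'" using ss s0 by linarith
    show "0 <= N s - A s'" using N_nonneg[OF g s0 order_refl] \<open>A s' <= 0\<close> by linarith
   qed
   have "0 <= s'" using ss s0 by linarith
   from N_upper[OF gs' this order_refl order_refl] show "N s - A s' <= N s'" using fs' by linarith
  qed
  hence "0 = f s' - L s' + N s'" using fs' by linarith
  moreover have "ALL T. s <= T --> T <= s' --> good T" using goodT unfolding real by simp
  ultimately show ?thesis using ss s2 by blast
 next
  case PInf
  have "ALL T>s. good T" using goodT unfolding PInf by simp
  thus ?thesis by blast
 next
  case MInf
  thus ?thesis using first_time_ge[of s "%u. A u < 0"] by simp
 qed
qed

definition P where "P s t = (SUP u\<in>{s..t}. max (- (f u - f s)) 0)"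

lemma P_bdd: "0 <= s ==> bdd_above ((%u. max (- (f u - f s)) 0) ` {s..t})"
proof -
 assume s: "0 <= s"
 obtain B where B: "!!u. 0 <= u ==> u <= max s t ==> \<bar>f u\<bar> <= B" using cadlag_bounded[OF cadlag, of "max s t"] by metis
 have "max (- (f u - f s)) 0 <= 2 * \<bar>B\<bar>" if "u \<in> {s..t}" for u
 proof -
  have "\<bar>f u\<bar> <= B" "\<bar>f s\<bar> <= B" using that s by (auto intro!: B)
  thus ?thesis by linarith
 qed
 thus ?thesis by (intro bdd_aboveI[where M="2 * \<bar>B\<bar>"]) auto
qed

lemma P_upper: "0 <= s ==> s <= u ==> u <= t ==> f s - f u <= P s t"
 using cSUP_upper[OF _ P_bdd[of s t], of u] unfolding P_def by auto

lemma P_nonneg: "0 <= s ==> s <= t ==> 0 <= P s t"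
 using P_upper[of s s t] by simp

lemma P_least: "s <= t ==> 0 <= x ==> (!!u. s <= u ==> u <= t ==> f s - f u <= x) ==> P s t <= x"
 unfolding P_def by (intro cSUP_least) auto

lemma refl_eq: "reflected_path f s t = f t - f s + P s t"
 unfolding reflected_path_def P_def ..

text \<open>During Step 2 the solution stays at or below \<open>b\<close>, so \<open>L\<close>
  stands still and the regulator grows by the running supremum \<open>P\<close>. On exit the value
  is exactly \<open>b\<close>: at least \<open>b\<close> by right continuity, at most
  \<open>b\<close> because there are no positive jumps. The rise of \<open>f\<close> by more than
  \<open>b / 2\<close> is recorded so that rounds can be shown not to accumulate.\<close>

lemma step2:
 assumes g: "good s" and st: "step2_start \<delta> b f s" and z: "0 = f s - L s + N s"
 shows "(ALL T>s. good T) \<or> (EX s' u. s <= u & u <= s' & b / 2 < f s' - f u & (ALL T. s <= T --> T <= s' --> good T) & step1_start \<delta> b f s' b & b = f s' - L s' + N s')"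
proof -
 let ?U = "reflected_path f s"
 let ?\<tau> = "first_time_after s (%u. ?U u > b)"
 from rr st have vU: "!!t. s <= t ==> ereal t < ?\<tau> ==> v t = ?U t"
  unfolding refracted_reflected_path_def by metis
 have s0: "0 <= s" using g by (simp add: good_def)
 have Us: "?U s = 0" unfolding refl_eq P_def by simp
 have Ub: "?U t <= b" if "s <= t" "ereal t < ?\<tau>" for t
  using first_time_less[OF that(2)] that Us b by (cases "t = s") auto
 have gi: "set_integrable lborel {0..<s} ind" using g by (simp add: good_def)
 have Ls: "L s = \<delta> * (LBINT u:{0..<s}. ind u)" unfolding cumulative_refraction_def using integrable_closed(2)[OF gi s0] by simp
 have lt: "ereal u < ?\<tau>" if "u < t" "ereal t <= ?\<tau>" for u t
  using that by (meson ereal_less_le less_ereal.simps(1) less_le_trans)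
 have key: "set_integrable lborel {0..<t} ind & L t = L s" if t: "s <= t" "ereal t <= ?\<tau>" for t
 proof -
  have ind0: "ind u = 0" if "u \<in> {s..<t}" for u
   using Ub[of u] vU[of u] lt[OF _ t(2), of u] that by auto
  have i2: "set_integrable lborel {s..<t} ind"
  proof -
   have "set_integrable lborel {s..<t} (%u. 0 :: real)" by (simp add: set_integrable_def)
   thus ?thesis by (rule iffD1[OF set_integrable_cong[OF refl refl], rotated]) (simp add: ind0)
  qed
  have un: "{0..<t} = {0..<s} \<union> {s..<t}" using s0 t(1) by auto
  have i3: "set_integrable lborel {0..<t} ind" unfolding un by (intro set_integrable_Un gi i2) auto
  have "(LBINT u:{0..t}. ind u) = (LBINT u:{0..<t}. ind u)" using integrable_closed(2)[OF i3] s0 t(1) by simp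
  also have "... = (LBINT u:{0..<s}. ind u) + (LBINT u:{s..<t}. ind u)"
   unfolding un by (intro set_integral_Un gi i2) auto
  also have "(LBINT u:{s..<t}. ind u) = (LBINT u:{s..<t}. 0)"
   by (intro set_lebesgue_integral_cong) (use ind0 in auto)
  finally have "L t = L s" unfolding Ls unfolding cumulative_refraction_def by simp
  thus ?thesis using i3 by simp
 qed
 have NP: "N t = N s + P s t" if t: "s <= t" "ereal t <= ?\<tau>" for t
 proof (rule antisym)
  have it: "set_integrable lborel {0..t} ind" using key[OF t] integrable_closed(1)[of 0 t] s0 t by auto
  have up: "L u - f u <= N t" if "0 <= u" "u <= t" for u
   using cSUP_upper[OF _ bdd_N[OF it], of u] that unfolding N_def by auto
  show "N t <= N s + P s t"
  proof (rule N_least)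
   fix u assume u: "0 <= u" "u <= t"
   show "L u - f u <= N s + P s t"
   proof (cases "u <= s")
    case True thus ?thesis using N_upper[OF g u(1)] P_nonneg[OF s0 t(1)] by fastforce
   next
    case False
    have "ereal u <= ?\<tau>" using u t(2) by (meson ereal_less_eq(3) order_trans)
    hence "L u = L s" using key False by simp
    thus ?thesis using P_upper[OF s0, of u t] False u z by simp
   qed
  qed (use t s0 N_nonneg[OF g] P_nonneg[OF s0] in auto)
  have Nst: "N s <= N t" unfolding N_def by (intro cSUP_subset_mono bdd_N it) (use t s0 in auto)
  have "P s t <= N t - N s"
  proof (rule P_least[OF t(1)])
   fix u assume u: "s <= u" "u <= t"
   have "ereal u <= ?\<tau>" using u t(2) by (meson ereal_less_eq(3) order_trans)
   hence "L u = L s" using key u by simp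
   thus "f s - f u <= N t - N s" using up[of u] u s0 z by simp
  qed (use Nst in simp)
  thus "N s + P s t <= N t" by simp
 qed
 have UN: "?U t = f t - L t + N t" if t: "s <= t" "ereal t <= ?\<tau>" for t
  using NP[OF t] key[OF t] z by (simp add: refl_eq)
 have goodT: "good T" if T: "s <= T" "ereal T <= ?\<tau>" for T
  unfolding good_def
 proof (intro conjI allI impI)
  show "set_integrable lborel {0..<T} ind" using key[OF T] by simp
  fix t assume t: "0 <= t" "t < T"
  show "v t = f t - L t + N t"
  proof (cases "t < s")
   case True thus ?thesis using g t by (simp add: good_def)
  next
   case False
   thus ?thesis using UN[of t] vU[of t] lt[OF t(2) T(2)] by (simp add: less_imp_le)
  qed
 qed (use s0 T in simp)
 show ?thesis
 proof (cases "?\<tau>")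
  case (real s')
  have ss: "s <= s'" using first_time_ge[of s "%u. ?U u > b"] real by simp
  have s1: "step1_start \<delta> b f s' b" using st real by (rule step1_start_step2_start.up)
  have ge: "b <= ?U s'"
  proof (rule ccontr)
   assume "\<not> b <= ?U s'"
   hence pos: "0 < (b - ?U s') / 2" by simp
   obtain e where e: "0 < e" "!!y. s' <= y ==> y < s' + e ==> \<bar>f y - f s'\<bar> < (b - ?U s') / 2"
    using right_cont[of s' "(b - ?U s') / 2"] pos ss s0 by auto
   obtain t where t: "s' <= t" "t < s' + e" "b < ?U t" using first_time_approx[OF real e(1)] by metis
   have "P s t <= P s s' + (b - ?U s') / 2"
   proof (rule P_least)
    fix u assume u: "s <= u" "u <= t"
    show "f s - f u <= P s s' + (b - ?U s') / 2"
    proof (cases "u <= s'")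
     case True thus ?thesis using P_upper[OF s0 u(1) True] pos by linarith
    next
     case False
     hence "\<bar>f u - f s'\<bar> < (b - ?U s') / 2" using u t by (intro e(2)) auto
     thus ?thesis using P_upper[OF s0 ss order_refl] by linarith
    qed
   next
    show "s <= t" using ss t by linarith
    show "0 <= P s s' + (b - ?U s') / 2" using pos P_nonneg[OF s0 ss] by linarith
   qed
   moreover have "f t - f s' < (b - ?U s') / 2" using e(2)[OF t(1,2)] unfolding abs_less_iff by (rule conjunct1)
   moreover have "?U t = f t - f s + P s t" "?U s' = f s' - f s + P s s'" by (rule refl_eq)+
   ultimately have "2 * ?U t < 2 * b" by argo
   thus False using t by simp
  qed
  have "s ~= s'" using ge Us b by auto
  hence ss': "s < s'" using ss by simp
  have le: "?U s' <= b"
  proof -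
   have s'0: "0 < s'" using ss' s0 by simp
   obtain l where l: "(f \<longlongrightarrow> l) (at_left s')" using cadlag s'0 by (auto simp: cadlag_def)
   have fl: "f s' <= l" using npj s'0 l by (auto simp: no_positive_jumps_def)
   have "f s' - f u <= b" if u: "s <= u" "u < s'" for u
   proof -
    have "\<forall>\<^sub>F t in at_left s'. f t <= b + f u"
     unfolding eventually_at_left_field
    proof (intro exI[of _ u] conjI allI impI)
     fix t assume t: "u < t" "t < s'"
     have "f s - f u <= P s t" using P_upper[OF s0 u(1)] t by simp
     moreover have "?U t <= b" using Ub[of t] t u real by simp
     ultimately show "f t <= b + f u" unfolding refl_eq by simp
    qed (use u in simp)
    hence "l <= b + f u" using l by (intro tendsto_upperbound[OF l]) auto
    thus ?thesis using fl by simp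
   qed
   note below = this
   have "P s s' <= b - (f s' - f s)"
   proof (rule P_least)
    show "0 <= b - (f s' - f s)" using below[of s] ss' by simp
    fix u assume "s <= u" "u <= s'"
    thus "f s - f u <= b - (f s' - f s)" using below[of u] b by (cases "u = s'") auto
   qed (use ss in simp)
   thus ?thesis unfolding refl_eq by simp
  qed
  have eq: "b = f s' - L s' + N s'" using UN[of s'] ge le ss real by simp
  \<comment> \<open>Otherwise the rise of \<open>f\<close> from \<open>s\<close> and from every
    later time up to \<open>s'\<close> is at most \<open>b / 2\<close>, and the reflected path, the
    larger of these rises, could not have reached \<open>b\<close>.\<close>
  have "EX u. s <= u & u <= s' & b / 2 < f s' - f u"
  proof (rule ccontr)
   assume n: "\<not> ?thesis"
   have "P s s' <= max 0 (b / 2 - (f s' - f s))"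
   proof (rule P_least)
    fix u assume "s <= u" "u <= s'"
    hence "f s' - f u <= b / 2" using n by (meson not_le)
    thus "f s - f u <= max 0 (b / 2 - (f s' - f s))" by simp
   qed (use ss in auto)
   moreover have "f s' - f s <= b / 2" using n ss by (meson not_le order_refl)
   moreover have "b <= f s' - f s + P s s'" using ge unfolding refl_eq .
   ultimately show False using b by linarith
  qed
  then obtain u where u: "s <= u" "u <= s'" "b / 2 < f s' - f u" by blast
  have gT: "ALL T. s <= T --> T <= s' --> good T" using goodT unfolding real by simp
  show ?thesis by (rule disjI2, rule exI[of _ s'], rule exI[of _ u]) (intro conjI u gT s1 eq)
 next
  case PInf
  have "ALL T>s. good T" using goodT unfolding PInf by simp
  thus ?thesis by (rule disjI1)
 next
  case MInf
  thus ?thesis using first_time_ge[of s "%u. ?U u > b"] by simp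
 qed
qed

text \<open>Each completed passage through Step 2 contains an oscillation of \<open>f\<close> by
  more than \<open>b / 2\<close> and hence a point of the finite set \<open>F\<close>. Induction on
  the number of points of \<open>F\<close> still ahead shows that finitely many rounds lead past
  \<open>T\<close>.\<close>

lemma all_good: "0 <= T ==> good T"
proof -
 assume T: "0 <= T"
 obtain F where F: "finite F" "!!x y. 0 <= x ==> x <= y ==> y <= T ==> F \<inter> {x<..y} = {} ==> \<bar>f y - f x\<bar> < b / 2"
  using cadlag_partition[OF cadlag, of "b/2" T] b by (metis half_gt_zero)
 have from2: "good T" if "good s" "step2_start \<delta> b f s" "0 = f s - L s + N s" "s <= T" for s
  using that
 proof (induction "card (F \<inter> {s<..T})" arbitrary: s rule: less_induct)
  case less
  consider "ALL T>s. good T" | s' u where "s <= u" "u <= s'" "b / 2 < f s' - f u" "ALL T. s <= T --> T <= s' --> good T" "step1_start \<delta> b f s' b" "b = f s' - L s' + N s'"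
   using step2[OF less.prems(1-3)] by blast
  thus ?case
  proof cases
   case 1 thus ?thesis using less.prems by (cases "s = T") auto
  next
   case 2
   show ?thesis
   proof (cases "T <= s'")
    case True thus ?thesis using 2(4) less.prems(4) by simp
   next
    case False
    have s0: "0 <= s" using less.prems(1) by (simp add: good_def)
    have "F \<inter> {u<..s'} ~= {}"
    proof
     assume "F \<inter> {u<..s'} = {}"
     hence "\<bar>f s' - f u\<bar> < b / 2" using 2(1,2) s0 False by (intro F(2)) auto
     thus False using 2(3) by linarith
    qed
    then obtain p where p: "p \<in> F" "u < p" "p <= s'" by auto
    have gs': "good s'" using 2 by simp
    consider "ALL T>s'. good T" | s'' where "s' <= s''" "ALL T. s' <= T --> T <= s'' --> good T" "step2_start \<delta> b f s''" "0 = f s'' - L s'' + N s''"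
     using step1[OF gs' 2(5) less_imp_le[OF b] 2(6)] by blast
    thus ?thesis
    proof cases
     case 1 thus ?thesis using False by simp
    next
     case (2 s'')
     show ?thesis
     proof (cases "T <= s''")
      case True thus ?thesis using 2(2) \<open>\<not> T <= s'\<close> by simp
     next
      case False
      \<comment> \<open>The point \<open>p\<close> met during the last rise now lies behind, so
        strictly fewer points remain.\<close>
      have sub: "F \<inter> {s''<..T} \<subset> F \<inter> {s<..T}"
      proof -
       have "s < p" "p <= T" "p <= s''" using p \<open>s <= u\<close> \<open>\<not> T <= s'\<close> 2(1) by auto
       hence "p \<in> F \<inter> {s<..T}" "p \<notin> F \<inter> {s''<..T}" "F \<inter> {s''<..T} \<subseteq> F \<inter> {s<..T}" using p(1) by auto
        thus ?thesis by blast
      qed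
      have "card (F \<inter> {s''<..T}) < card (F \<inter> {s<..T})" using F(1) by (intro psubset_card_mono sub) auto
      thus ?thesis by (rule less.hyps) (use 2 False in auto)
     qed
    qed
   qed
  qed
 qed
 have g0: "good 0" by (simp add: good_def set_integrable_def)
 have L0: "L 0 = 0" using integrable_closed(2)[of 0 0 ind] by (simp add: cumulative_refraction_def set_integrable_def set_lebesgue_integral_def)
 have N0: "N 0 = max (- f 0) 0" unfolding N_def by (simp add: L0)
 show ?thesis
 proof (cases "0 <= f 0")
  case True
  have s1: "step1_start \<delta> b f 0 (f 0)" using True by (rule step1_start_step2_start.start_nonneg)
  have "f 0 = f 0 - L 0 + N 0" using L0 N0 True by simp
  from step1[OF g0 s1 True this] show ?thesis
  proof (elim disjE exE conjE)
   assume "ALL T>0. good T" thus ?thesis using T g0 by (cases "T = 0") auto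
  next
   fix s' assume "0 <= s'" "ALL T. 0 <= T --> T <= s' --> good T" "step2_start \<delta> b f s'" "0 = f s' - L s' + N s'"
   thus ?thesis using from2[of s'] T by (cases "T <= s'") auto
  qed
 next
  case False
  hence s2: "step2_start \<delta> b f 0" by (intro step1_start_step2_start.start_neg) simp
  have "0 = f 0 - L 0 + N 0" using L0 N0 False by simp
  thus ?thesis using from2[OF g0 s2 _ T] by simp
 qed
qed

lemma skorokhod_equation:
 assumes "0 <= t"
 shows "v t = f t - L t + N t"
proof -
 have "good (t + 1)" using assms by (intro all_good) simp
 thus ?thesis using assms by (simp add: good_def)
qed

end

section \<open>Pathwise comparison with the sampled chain\<close>

definition grid_increment :: "(nat => real) => nat => real" where
 "grid_increment g i = g (Suc i) - g i"

definition grid_chain :: "real => real => (nat => real) => nat => real" where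
 "grid_chain d b' g = chain d b' (max (g 0) 0) (grid_increment g)"

definition grid_refraction :: "real => real => (nat => real) => nat => real" where
 "grid_refraction d b' g i = (\<Sum>j<i. if b' < grid_chain d b' g j then d else 0)"

definition grid_reflection :: "real => real => (nat => real) => nat => real" where
 "grid_reflection d b' g i = max (- g 0) 0 + (\<Sum>j<i. chain_push d b' (max (g 0) 0) (grid_increment g) j)"

lemma chain_push_nonneg: "0 <= chain_push d b' v z i"
 by (simp add: chain_push_def)

lemma grid_chain_eq: "grid_chain d b' g i = g i - grid_refraction d b' g i + grid_reflection d b' g i"
proof (induction i)
 case 0 thus ?case by (simp add: grid_chain_def grid_refraction_def grid_reflection_def max_def)
next
 case (Suc i)
 have "grid_chain d b' g (Suc i) = grid_chain d b' g i - (if b' < grid_chain d b' g i then d else 0) + grid_increment g i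
   + chain_push d b' (max (g 0) 0) (grid_increment g) i"
  by (simp add: grid_chain_def chain_push_def max_def)
 thus ?case using Suc by (simp add: grid_refraction_def grid_reflection_def grid_increment_def)
qed

text \<open>Discrete Skorokhod lemma: the pushes of the chain add up to a running maximum, the
  counterpart of \<open>N\<close> on the grid.\<close>

lemma grid_reflection_Suc: "grid_reflection d b' g (Suc i) = max (grid_reflection d b' g i) (grid_refraction d b' g (Suc i) - g (Suc i))"
proof -
 have "grid_reflection d b' g (Suc i) = grid_reflection d b' g i
   + max (- (grid_chain d b' g i - (if b' < grid_chain d b' g i then d else 0) + grid_increment g i)) 0"
  by (simp add: grid_reflection_def chain_push_def grid_chain_def)
 also have "... = grid_reflection d b' g i
   + max (- (g i - grid_refraction d b' g i + grid_reflection d b' g i - (if b' < grid_chain d b' g i then d else 0) + (g (Suc i) - g i))) 0"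
  by (subst (1) grid_chain_eq) (simp add: grid_increment_def)
 also have "... = max (grid_reflection d b' g i) (grid_refraction d b' g (Suc i) - g (Suc i))"
  by (simp add: grid_refraction_def max_def)
 finally show ?thesis .
qed

lemma grid_reflection_nonneg: "0 <= grid_reflection d b' g i"
 by (simp add: grid_reflection_def chain_push_nonneg sum_nonneg)

lemma grid_reflection_mono: "i <= j ==> grid_reflection d b' g i <= grid_reflection d b' g j"
 by (rule lift_Suc_mono_le[of "grid_reflection d b' g"]) (simp add: grid_reflection_Suc)

lemma grid_reflection_upper: "j <= i ==> grid_refraction d b' g j - g j <= grid_reflection d b' g i"
proof -
 assume ji: "j <= i"
 have "grid_refraction d b' g j - g j <= grid_reflection d b' g j"
  by (cases j) (auto simp: grid_reflection_Suc, simp add: grid_refraction_def grid_reflection_def)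
 thus ?thesis using grid_reflection_mono[OF ji, of d b' g] by linarith
qed

lemma grid_reflection_least:
 "0 <= x ==> (!!j. j <= i ==> grid_refraction d b' g j - g j <= x) ==> grid_reflection d b' g i <= x"
proof (induction i)
 case 0 thus ?case using "0.prems"(2)[of 0] by (simp add: grid_refraction_def grid_reflection_def)
qed (simp add: grid_reflection_Suc)

text \<open>Every point of large oscillation may put the refraction of the chain and
  \<open>L\<close> out of step by one unit of drift; this counts the units to be allowed
  for.\<close>

definition grid_count :: "real set => nat => nat => nat" where
 "grid_count F n i = card (F \<inter> {0<..real i / real n})"

lemma grid_count_mono: "finite F ==> i <= j ==> grid_count F n i <= grid_count F n j"
proof -
 assume F: "finite F" and ij: "i <= j"
 have "real i / real n <= real j / real n" using ij by (simp add: divide_right_mono)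
 hence "F \<inter> {0<..real i / real n} \<subseteq> F \<inter> {0<..real j / real n}" by auto
 thus ?thesis unfolding grid_count_def using F by (intro card_mono) auto
qed

lemma grid_count_Suc:
 assumes F: "finite F" and ne: "F \<inter> {real i / real n<..real (Suc i) / real n} ~= {}" and d: "0 <= (d :: real)"
 shows "d * grid_count F n i + d <= d * grid_count F n (Suc i)"
proof -
 obtain p where p: "p \<in> F" "real i / real n < p" "p <= real (Suc i) / real n" using ne by auto
 have "0 <= real i / real n" by simp
 hence p0: "0 < p" using p(2) by linarith
 have "insert p (F \<inter> {0<..real i / real n}) \<subseteq> F \<inter> {0<..real (Suc i) / real n}" using p p0 by auto
 hence "card (insert p (F \<inter> {0<..real i / real n})) <= grid_count F n (Suc i)" unfolding grid_count_def using F by (intro card_mono) auto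
 moreover have "card (insert p (F \<inter> {0<..real i / real n})) = Suc (grid_count F n i)"
  unfolding grid_count_def using F p by (subst card_insert_disjoint) auto
 ultimately have "real (grid_count F n i) + 1 <= real (grid_count F n (Suc i))" by linarith
 from mult_left_mono[OF this d] show ?thesis by (simp add: distrib_left)
qed

context rr_path
begin

lemma L_0: "L 0 = 0"
 using integrable_closed(2)[of 0 0 ind] by (simp add: cumulative_refraction_def set_integrable_def set_lebesgue_integral_def)

lemma L_diff:
 assumes "0 <= s" "s <= u"
 shows "set_integrable lborel {s..<u} ind" "L u - L s = \<delta> * (LBINT r:{s..<u}. ind r)"
proof -
 have i: "set_integrable lborel {0..<s} ind" "set_integrable lborel {0..<u} ind"
  using all_good[of s] all_good[of u] assms unfolding good_def by auto
 show j: "set_integrable lborel {s..<u} ind" by (rule set_integrable_subset[OF i(2)]) (use assms in auto)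
 have un: "{0..<u} = {0..<s} \<union> {s..<u}" using assms by auto
 have "(LBINT r:{0..<u}. ind r) = (LBINT r:{0..<s}. ind r) + (LBINT r:{s..<u}. ind r)"
  unfolding un by (intro set_integral_Un i j) auto
 thus "L u - L s = \<delta> * (LBINT r:{s..<u}. ind r)"
  unfolding cumulative_refraction_def using integrable_closed(2)[OF i(1)] integrable_closed(2)[OF i(2)] assms by (simp add: distrib_left)
qed

lemma L_mono: "0 <= s ==> s <= u ==> L s <= L u"
 and L_diff_le: "0 <= s ==> s <= u ==> L u - L s <= \<delta> * (u - s)"
proof -
 have "0 <= L u - L s & L u - L s <= \<delta> * (u - s)" if "0 <= s" "s <= u" for s u
  unfolding L_diff(2)[OF that] using set_integral_bounds[OF L_diff(1)[OF that]] that delta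
  by (auto intro!: mult_left_mono mult_nonneg_nonneg)
 thus "0 <= s ==> s <= u ==> L s <= L u" "0 <= s ==> s <= u ==> L u - L s <= \<delta> * (u - s)" by auto
qed

lemma L_const:
 assumes "0 <= s" "s <= u" "!!r. s <= r ==> r < u ==> v r <= b"
 shows "L u = L s"
proof -
 have "(LBINT r:{s..<u}. ind r) = (LBINT r:{s..<u}. 0)" by (intro set_lebesgue_integral_cong) (use assms(3) in force)+
 thus ?thesis using L_diff(2)[OF assms(1,2)] by simp
qed

lemma L_full:
 assumes "0 <= s" "s <= u" "!!r. s <= r ==> r < u ==> b < v r"
 shows "L u - L s = \<delta> * (u - s)"
proof -
 have "(LBINT r:{s..<u}. ind r) = (LBINT r:{s..<u}. 1)" by (intro set_lebesgue_integral_cong) (use assms(3) in force)+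
 thus ?thesis using L_diff(2)[OF assms(1,2)] assms(2) by (simp add: set_lebesgue_integral_def)
qed

lemma L_le_N: "0 <= u ==> u <= t ==> L u - f u <= N t"
 using N_upper[of t u t] all_good[of t] by simp

lemma N_nn: "0 <= t ==> 0 <= N t"
 using N_nonneg[of t t] all_good[of t] by simp

lemma N_mono: "0 <= s ==> s <= t ==> N s <= N t"
 by (rule N_least) (auto intro: L_le_N N_nn)

text \<open>Suppose the chain overtakes \<open>L\<close> in a step that avoids \<open>F\<close>.
  Then it is above \<open>b + \<epsilon>\<close> at the start of the step, and the earlier
  inequalities place \<open>v\<close> above \<open>b + \<epsilon> - \<delta> / real n\<close> there.
  Yet \<open>L\<close> misses part of its full growth, so \<open>v\<close> is at most
  \<open>b\<close> somewhere in the step, which takes a larger oscillation of \<open>f\<close> than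
  a step without points of \<open>F\<close> permits.\<close>

lemma grid_above:
 assumes n: "0 < n" and F: "finite F" "!!x y. 0 <= x ==> x <= y ==> y <= T ==> F \<inter> {x<..y} = {} ==> \<bar>f y - f x\<bar> < \<epsilon> / 2"
  and d: "4 * (\<delta> / real n) <= \<epsilon>"
 defines "D \<equiv> grid_refraction (\<delta> / real n) (b + \<epsilon>) (%i. f (real i / real n))"
 shows "real i / real n <= T ==> D i <= L (real i / real n) + \<delta> / real n * grid_count F n i"
proof (induction i rule: less_induct)
 case (less i)
 let ?g = "%i. f (real i / real n)" and ?d = "\<delta> / real n" and ?c = "%i. \<delta> / real n * grid_count F n i"
 have d0: "0 <= ?d" using delta by simp
 show ?case
 proof (cases i)
  case 0 thus ?thesis using delta by (simp add: D_def grid_refraction_def L_0)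
 next
  case (Suc j)
  let ?s = "real j / real n" and ?t = "real i / real n"
  have st: "0 <= ?s" "?s <= ?t" "?t - ?s = 1 / real n" using Suc n by (auto simp: divide_simps diff_divide_distrib)
  have c_mono: "?c k <= ?c l" if "k <= l" for k l
   using grid_count_mono[OF F(1) that] d0 by (intro mult_left_mono) auto
  have Dj: "D i = D j + (if b + \<epsilon> < grid_chain ?d (b + \<epsilon>) ?g j then ?d else 0)"
   by (simp add: D_def grid_refraction_def Suc)
  have IH: "D k <= L (real k / real n) + ?c j" if "k <= j" for k
   using less.IH[of k] c_mono[OF that] that Suc less.prems order_trans[OF divide_right_mono[of "real k" "real i" "real n"] less.prems] by simp
  show ?thesis
  proof (cases "F \<inter> {?s<..?t} = {}")
   case False
   have "?c j + ?d <= ?c i" using grid_count_Suc[OF F(1) _ d0, of j n] False unfolding Suc by simp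
   thus ?thesis using Dj IH[of j] L_mono[OF st(1,2)] d0 by (auto split: if_splits)
  next
   case True
   show ?thesis
   proof (rule ccontr)
    assume "\<not> ?thesis"
    hence big: "L ?t + ?c j < D i" using c_mono[of j i] Suc by simp
    hence up: "b + \<epsilon> < grid_chain ?d (b + \<epsilon>) ?g j" and Di: "D i = D j + ?d"
     using Dj IH[of j] L_mono[OF st(1,2)] by (auto split: if_splits)
    have "\<not> (ALL r. ?s <= r --> r < ?t --> b < v r)"
    proof
     assume "ALL r. ?s <= r --> r < ?t --> b < v r"
     hence "L ?t - L ?s = \<delta> * (?t - ?s)" by (intro L_full st) auto
     thus False using big Di IH[of j] st(3) by simp
    qed
    then obtain r where r: "?s <= r" "r < ?t" "v r <= b" by force
    have r0: "0 <= r" using r(1) st(1) by linarith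
    have "grid_reflection ?d (b + \<epsilon>) ?g j <= N ?s + ?c j"
    proof (rule grid_reflection_least)
     show "0 <= N ?s + ?c j" using N_nn[OF st(1)] delta by simp
     fix k assume k: "k <= j"
     have "L (real k / real n) - f (real k / real n) <= N ?s" using k by (intro L_le_N) (auto simp: divide_right_mono)
     thus "grid_refraction ?d (b + \<epsilon>) ?g k - f (real k / real n) <= N ?s + ?c j" using IH[OF k] by (simp add: D_def)
    qed
    hence "b + \<epsilon> < f ?s - D j + N ?s + ?c j" using up by (simp add: grid_chain_eq D_def)
    hence vs: "b + \<epsilon> - ?d < v ?s" using skorokhod_equation[OF st(1)] big Di L_mono[OF st(1,2)] by linarith
    have "v r = f r - L r + N r" using r0 by (rule skorokhod_equation)
    moreover have "N ?s <= N r" using r st by (intro N_mono) auto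
    moreover have "L r - L ?s <= ?d"
    proof -
     have "L r - L ?s <= \<delta> * (r - ?s)" by (intro L_diff_le st r)
     also have "... <= \<delta> * (?t - ?s)" using r delta by (intro mult_left_mono) auto
     finally show ?thesis using st(3) by simp
    qed
    moreover have "\<bar>f r - f ?s\<bar> < \<epsilon> / 2" using True r st less.prems by (intro F(2)) auto
    ultimately show False using vs r(3) skorokhod_equation[OF st(1)] d by linarith
   qed
  qed
 qed
qed

text \<open>The opposite comparison, with one more difficulty: \<open>N\<close> is a supremum over
  all times, whereas the chain sees grid times only. If a step contains at most one point of
  \<open>F\<close>, every time inside it is joined to one of the two neighbouring grid times without
  meeting \<open>F\<close>, so the supremum is seen up to \<open>\<eta>\<close> and one unit of
  drift.\<close>

lemma grid_below:
 assumes n: "0 < n" and F: "finite F" "!!x y. 0 <= x ==> x <= y ==> y <= T ==> F \<inter> {x<..y} = {} ==> \<bar>f y - f x\<bar> < \<eta>"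
  and single: "!!i p p'. p \<in> F ==> p' \<in> F ==> real i / real n < p ==> p < p' ==> p' <= real (Suc i) / real n ==> False"
  and d: "8 * (\<delta> / real n) <= \<epsilon>" and \<eta>: "8 * \<eta> <= \<epsilon>" "0 < \<eta>"
 defines "D \<equiv> grid_refraction (\<delta> / real n) (b - \<epsilon>) (%i. f (real i / real n))"
  and "R \<equiv> grid_reflection (\<delta> / real n) (b - \<epsilon>) (%i. f (real i / real n))"
  and "c \<equiv> %i. \<delta> / real n * grid_count F n i"
 shows "real i / real n <= T ==> N (real i / real n) <= R i + c i + \<delta> / real n + \<eta>"
proof -
 let ?g = "%i. f (real i / real n)" and ?d = "\<delta> / real n"
 have d0: "0 <= ?d" using delta by simp
 have c0: "0 <= c i" for i using delta unfolding c_def by simp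
 have c_mono: "c k <= c l" if "k <= l" for k l
  unfolding c_def using grid_count_mono[OF F(1) that] d0 by (intro mult_left_mono) auto
 have grid_sup: "N (real l / real n) <= R l + c l + ?d + \<eta>"
  if T: "real l / real n <= T" and Ll: "!!k. k <= l ==> L (real k / real n) <= D k + c k" for l
 proof (rule N_least)
  have grid: "L (real k / real n) - ?g k <= R l + c l" if "k <= l" for k
   using Ll[OF that] c_mono[OF that] grid_reflection_upper[OF that, of ?d "b - \<epsilon>" ?g] by (simp add: D_def R_def)
  fix u assume u: "0 <= u" "u <= real l / real n"
  show "L u - f u <= R l + c l + ?d + \<eta>"
  proof (cases "u = real l / real n")
   case True thus ?thesis using grid[of l] d0 \<eta> by simp
  next
   case False
   define i where "i = nat \<lfloor>real n * u\<rfloor>"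
   have i: "real i <= real n * u" "real n * u < real i + 1" using u n by (auto simp: i_def)
   have iu: "real i / real n <= u" "u < real (Suc i) / real n" using i n by (auto simp: field_simps)
   have "real n * u < real l" using u False n by (simp add: field_simps)
   hence il: "Suc i <= l" using i by linarith
   have SiT: "real (Suc i) / real n <= T" using il T n by (meson divide_right_mono of_nat_0_le_iff of_nat_mono order_trans)
   consider "F \<inter> {real i / real n<..u} = {}" | "F \<inter> {u<..real (Suc i) / real n} = {}"
    using single[of _ _ i] by fastforce
   thus ?thesis
   proof cases
    case 1
    have "\<bar>f u - f (real i / real n)\<bar> < \<eta>" using 1 iu SiT by (intro F(2)) auto
    moreover have "L u - L (real i / real n) <= ?d"
    proof -
     have "L u - L (real i / real n) <= \<delta> * (u - real i / real n)" using iu by (intro L_diff_le) auto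
     also have "... <= \<delta> * (1 / real n)" using iu delta by (intro mult_left_mono) (auto simp: add_divide_distrib)
     finally show ?thesis by simp
    qed
    ultimately show ?thesis using grid[of i] il by linarith
   next
    case 2
    have "\<bar>f (real (Suc i) / real n) - f u\<bar> < \<eta>" using 2 iu SiT u by (intro F(2)) auto
    moreover have "L u <= L (real (Suc i) / real n)" using iu u by (intro L_mono) auto
    ultimately show ?thesis using grid[OF il] d0 by linarith
   qed
  qed
 qed (use c0[of l] d0 \<eta> grid_reflection_nonneg[of ?d "b - \<epsilon>" ?g l] in \<open>auto simp: R_def\<close>)
 have LD: "L (real i / real n) <= D i + c i" if "real i / real n <= T" for i
  using that
 proof (induction i rule: less_induct)
  case (less i)
  show ?case
  proof (cases i)
   case 0 thus ?thesis using c0[of 0] by (simp add: D_def grid_refraction_def L_0)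
  next
   case (Suc j)
   let ?s = "real j / real n" and ?t = "real i / real n"
   have st: "0 <= ?s" "?s <= ?t" "?t - ?s = 1 / real n" using Suc n by (auto simp: divide_simps diff_divide_distrib)
   have Dj: "D i = D j + (if b - \<epsilon> < grid_chain ?d (b - \<epsilon>) ?g j then ?d else 0)"
    by (simp add: D_def grid_refraction_def Suc)
   have Lt: "L ?t - L ?s <= ?d" using L_diff_le[OF st(1,2)] st(3) by simp
   have IH: "L (real k / real n) <= D k + c k" if "k <= j" for k
    using less.IH[of k] that Suc order_trans[OF divide_right_mono[of "real k" "real i" "real n"] less.prems] by simp
   show ?thesis
   proof (cases "F \<inter> {?s<..?t} = {}")
    case False
    have "c j + ?d <= c i" unfolding c_def using grid_count_Suc[OF F(1) _ d0, of j n] False unfolding Suc by simp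
    thus ?thesis using Dj IH[of j] Lt d0 by (auto split: if_splits)
   next
    case True
    show ?thesis
    proof (rule ccontr)
     assume "\<not> ?thesis"
     hence big: "D i + c j < L ?t" using c_mono[of j i] Suc by simp
     hence low: "grid_chain ?d (b - \<epsilon>) ?g j <= b - \<epsilon>" and Di: "D i = D j"
      using Dj IH[of j] Lt by (auto split: if_splits)
     have "\<not> (ALL r. ?s <= r --> r < ?t --> v r <= b)"
     proof
      assume "ALL r. ?s <= r --> r < ?t --> v r <= b"
      hence "L ?t = L ?s" by (intro L_const st) auto
      thus False using big Di IH[of j] by simp
     qed
     then obtain r where r: "?s <= r" "r < ?t" "b < v r" by force
     have r0: "0 <= r" using r(1) st(1) by linarith
     have osc: "\<bar>f u - f ?s\<bar> < \<eta>" if "?s <= u" "u <= r" for u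
      using True that r st less.prems by (intro F(2)) auto
     have Ld: "L u - L ?s <= ?d" if "?s <= u" "u <= r" for u
     proof -
      have "L u <= L ?t" using that r by (intro L_mono order_trans[OF st(1) that(1)]) linarith
      thus ?thesis using Lt by simp
     qed
     \<comment> \<open>The grid estimate of \<open>N\<close> is needed inside the induction: it
       turns the position of the chain, which lies at or below \<open>b - \<epsilon>\<close>, into
       an upper bound for \<open>v\<close>.\<close>
     have "N ?s <= R j + c j + ?d + \<eta>" using IH order_trans[OF st(2) less.prems] by (intro grid_sup) auto
     hence vs: "v ?s <= b - \<epsilon> + 2 * ?d + \<eta>"
      using low big Di Lt skorokhod_equation[OF st(1)] by (simp add: grid_chain_eq D_def R_def)
     have "N r <= N ?s + ?d + \<eta>"
     proof (rule N_least)
      fix u assume u: "0 <= u" "u <= r"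
      show "L u - f u <= N ?s + ?d + \<eta>"
      proof (cases "u <= ?s")
       case True thus ?thesis using L_le_N[OF u(1) True] d0 \<eta> by simp
      next
       case False
       thus ?thesis using osc[of u] Ld[of u] L_le_N[of ?s ?s] u st by auto
      qed
     qed (use r0 N_nn[OF st(1)] d0 \<eta> in auto)
     moreover have "v r = f r - L r + N r" using r0 by (rule skorokhod_equation)
     moreover have "L ?s <= L r" using r st by (intro L_mono) auto
     ultimately have "v r <= v ?s + ?d + 2 * \<eta>" using osc[of r] r skorokhod_equation[OF st(1)] by auto
     thus False using vs r(3) d \<eta> by linarith
    qed
   qed
  qed
 qed
 show "real i / real n <= T ==> N (real i / real n) <= R i + c i + ?d + \<eta>"
 proof (rule grid_sup)
  fix k assume "real i / real n <= T" "k <= i"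
  thus "L (real k / real n) <= D k + c k" using order_trans[OF divide_right_mono[of "real k" "real i" "real n"]] by (intro LD) auto
 qed
qed

end

section \<open>Discounted Stieltjes integrals and convergence of the sampled reflection\<close>

lemma exponential_tail_nn_integral:
 assumes q: "0 < (q::real)"
 shows "(\<integral>\<^sup>+s. ennreal (q * exp (- (q * s))) * indicator {t..} s \<partial>lborel) = ennreal (exp (- (q * t)))"
proof -
 have "(\<integral>\<^sup>+s. ennreal (q * exp (- (q * s))) * indicator {t..} s \<partial>lborel) = ennreal (0 - (- exp (- (q * t))))"
 proof (rule nn_integral_FTC_atLeast)
  show "((%s. - exp (- (q * s))) \<longlongrightarrow> 0) at_top" using q by real_asymp
 qed (use q in \<open>auto intro!: derivative_eq_intros\<close>)
 thus ?thesis by simp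
qed

text \<open>Fubini, with \<open>exp (- (q * t))\<close> written as the integral of
  \<open>q * exp (- (q * s))\<close> over s >= t. The measure of \<open>{0..s}\<close> is all of
  \<open>F s\<close>, the atom at 0 included, because \<open>F\<close> vanishes on the negative
  axis.\<close>

lemma nn_integral_interval_measure_exp:
 assumes q: "0 < q" and F0: "!!t. t < 0 ==> F t = 0" and mono: "mono F" and rc: "!!a. continuous (at_right a) F"
 shows "(\<integral>\<^sup>+t\<in>{0..}. ennreal (exp (- (q * t))) \<partial>interval_measure F) =
  (\<integral>\<^sup>+s. ennreal (q * exp (- (q * s)) * F s) * indicator {0..} s \<partial>lborel)"
proof -
 let ?I = "interval_measure F"
 interpret I: sigma_finite_measure ?I by (rule sigma_finite_interval_measure) (use mono rc in \<open>auto dest: monoD\<close>)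
 interpret P: pair_sigma_finite ?I lborel ..
 have F_nn: "0 <= F s" for s using F0[of "min s (-1)"] monoD[OF mono, of "min s (-1)" s] by simp
 have Ioc: "emeasure ?I {a<..c} = ennreal (F c - F a)" if "a <= c" for a c
  by (rule emeasure_interval_measure_Ioc) (use that mono rc in \<open>auto dest: monoD\<close>)
 \<comment> \<open>The measure is given on intervals that are open on the left. Discarding the part
   between -1 and 0 is what leaves a closed interval at 0, together with its atom.\<close>
 have neg: "emeasure ?I {-1<..<0} = 0"
 proof -
  have "{-1<..<0} \<subseteq> (\<Union>n. {-1<..- (1 / real (Suc n))})"
  proof
   fix x :: real assume x: "x \<in> {-1<..<0}"
   then obtain n where "1 / real (Suc n) < - x" using reals_Archimedean[of "- x"] by (auto simp: inverse_eq_divide)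
   thus "x \<in> (\<Union>n. {-1<..- (1 / real (Suc n))})" using x by (intro UN_I[of n]) auto
  qed
  moreover have "emeasure ?I (\<Union>n. {-1<..- (1 / real (Suc n))}) = 0"
  proof (rule emeasure_UN_eq_0)
   fix n show "emeasure ?I {-1<..- (1 / real (Suc n))} = 0"
    by (subst Ioc) (auto simp: F0)
  qed auto
  ultimately show ?thesis using emeasure_mono[of "{-1<..<0}" "\<Union>n. {-1<..- (1 / real (Suc n))}" ?I] by simp
 qed
 have Icc: "emeasure ?I {0..s} = ennreal (F s)" if "0 <= s" for s
 proof -
  have "{-1<..s} = {-1<..<0} \<union> {0..s}" using that by auto
  moreover have "emeasure ?I {-1<..<0} + emeasure ?I {0..s} = emeasure ?I ({-1<..<0} \<union> {0..s})"
   by (rule plus_emeasure) auto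
  ultimately have "emeasure ?I {-1<..s} = emeasure ?I {-1<..<0} + emeasure ?I {0..s}" by simp
  thus ?thesis using neg Ioc[of "-1" s] that F0[of "-1"] by simp
 qed
 have "(\<integral>\<^sup>+t\<in>{0..}. ennreal (exp (- (q * t))) \<partial>?I) =
   (\<integral>\<^sup>+t. (\<integral>\<^sup>+s. ennreal (q * exp (- (q * s))) * indicator {t..} s * indicator {0..} t \<partial>lborel) \<partial>?I)"
  by (intro nn_integral_cong) (simp add: nn_integral_multc exponential_tail_nn_integral[OF q])
 also have "... = (\<integral>\<^sup>+s. (\<integral>\<^sup>+t. ennreal (q * exp (- (q * s))) * indicator {t..} s * indicator {0..} t \<partial>?I) \<partial>lborel)"
 proof (rule P.Fubini'[symmetric])
  have "(%x. ennreal (q * exp (- (q * snd x))) * (indicator {x. fst x <= snd x} x * indicator {0..} (fst x))) \<in> borel_measurable (borel \<Otimes>\<^sub>M borel :: (real \<times> real) measure)"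
   by measurable
  moreover have "(%x. ennreal (q * exp (- (q * snd x))) * (indicator {x. fst x <= snd x} x * indicator {0..} (fst x))) =
    (%(t, s). ennreal (q * exp (- (q * s))) * indicator {t..} s * indicator {0..} t)"
   by (auto simp: fun_eq_iff indicator_def)
  ultimately show "(%(t, s). ennreal (q * exp (- (q * s))) * indicator {t..} s * indicator {0..} t) \<in> borel_measurable (?I \<Otimes>\<^sub>M lborel)"
   by (simp cong: measurable_cong_sets sets_pair_measure_cong)
 qed
 also have "... = (\<integral>\<^sup>+s. ennreal (q * exp (- (q * s)) * F s) * indicator {0..} s \<partial>lborel)"
 proof (intro nn_integral_cong)
  fix s :: real
  have "(\<integral>\<^sup>+t. ennreal (q * exp (- (q * s))) * indicator {t..} s * indicator {0..} t \<partial>?I) =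
    (\<integral>\<^sup>+t. ennreal (q * exp (- (q * s))) * indicator {0..s} t \<partial>?I)"
   by (intro nn_integral_cong) (auto simp: indicator_def)
  also have "... = ennreal (q * exp (- (q * s))) * emeasure ?I {0..s}" by (subst nn_integral_cmult_indicator) auto
  also have "... = ennreal (q * exp (- (q * s)) * F s) * indicator {0..} s"
   using q F_nn[of s] by (cases "0 <= s") (auto simp: Icc ennreal_mult'')
  finally show "(\<integral>\<^sup>+t. ennreal (q * exp (- (q * s))) * indicator {t..} s * indicator {0..} t \<partial>?I) =
    ennreal (q * exp (- (q * s)) * F s) * indicator {0..} s" .
 qed
 finally show ?thesis .
qed

text \<open>The same formula for a step function with atom \<open>r\<close> at 0 and jumps
  \<open>p i\<close> at time \<open>real (Suc i) / real n\<close>; it links the sampled reflection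
  to \<open>push_sum\<close>.\<close>

lemma nn_integral_step_exp:
 fixes p :: "nat => real"
 assumes q: "0 < (q::real)" and n: "0 < n" and p: "!!i. 0 <= p i" and r: "0 <= r"
 shows "(\<integral>\<^sup>+s. ennreal (q * exp (- (q * s)) * (r + (\<Sum>i<nat \<lfloor>real n * s\<rfloor>. p i))) * indicator {0..} s \<partial>lborel) =
  ennreal r + (\<Sum>i. ennreal (exp (- (q * (real (Suc i) / real n))) * p i))"
proof -
 have less: "i < nat \<lfloor>real n * s\<rfloor> \<longleftrightarrow> real (Suc i) / real n <= s" if "0 <= s" for s i
 proof -
  have "i < nat \<lfloor>real n * s\<rfloor> \<longleftrightarrow> int (Suc i) <= \<lfloor>real n * s\<rfloor>" by linarith
  also have "... \<longleftrightarrow> real (Suc i) <= real n * s" by (simp add: le_floor_iff)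
  also have "... \<longleftrightarrow> real (Suc i) / real n <= s" using n by (simp add: divide_le_eq mult.commute)
  finally show ?thesis .
 qed
 have eq: "ennreal (q * exp (- (q * s)) * (r + (\<Sum>i<nat \<lfloor>real n * s\<rfloor>. p i))) * indicator {0..} s =
   ennreal r * (ennreal (q * exp (- (q * s))) * indicator {0..} s)
   + (\<Sum>i. ennreal (p i) * (ennreal (q * exp (- (q * s))) * indicator {real (Suc i) / real n..} s))" for s
 proof (cases "0 <= s")
  case True
  have e: "0 <= q * exp (- (q * s))" using q by simp
  have "(\<Sum>i. ennreal (p i) * (ennreal (q * exp (- (q * s))) * indicator {real (Suc i) / real n..} s))
    = (\<Sum>i<nat \<lfloor>real n * s\<rfloor>. ennreal (p i) * (ennreal (q * exp (- (q * s))) * indicator {real (Suc i) / real n..} s))"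
   using less[OF True] by (intro suminf_finite) (auto simp: indicator_def)
  also have "... = (\<Sum>i<nat \<lfloor>real n * s\<rfloor>. ennreal (q * exp (- (q * s)) * p i))"
   using less[OF True] e p by (intro sum.cong) (auto simp: indicator_def ennreal_mult'' mult.commute)
  also have "... = ennreal (\<Sum>i<nat \<lfloor>real n * s\<rfloor>. q * exp (- (q * s)) * p i)" using e p by (intro sum_ennreal) simp
  finally show ?thesis using True e p r
   by (simp add: distrib_left sum_distrib_left ennreal_plus[symmetric] ennreal_mult''[symmetric] sum_nonneg mult.commute del: ennreal_plus)
 next
  case False
  have "s < real (Suc i) / real n" for i using False n by (meson divide_nonneg_nonneg le_less_trans not_le of_nat_0_le_iff order_trans)
  thus ?thesis using False by (auto simp: indicator_def not_le[symmetric])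
 qed
 have "(\<integral>\<^sup>+s. ennreal r * (ennreal (q * exp (- (q * s))) * indicator {0..} s)
   + (\<Sum>i. ennreal (p i) * (ennreal (q * exp (- (q * s))) * indicator {real (Suc i) / real n..} s)) \<partial>lborel)
  = ennreal r * ennreal (exp (- (q * 0))) + (\<Sum>i. ennreal (p i) * ennreal (exp (- (q * (real (Suc i) / real n)))))"
 proof -
  have c: "(\<integral>\<^sup>+s. c * (ennreal (q * exp (- (q * s))) * indicator {t..} s) \<partial>lborel) = c * ennreal (exp (- (q * t)))" for c t
   by (subst nn_integral_cmult) (auto simp: exponential_tail_nn_integral[OF q])
  show ?thesis by (subst nn_integral_add, measurable, subst nn_integral_suminf, measurable) (simp only: c)
 qed
 thus ?thesis unfolding eq using p by (simp add: ennreal_mult''[symmetric] mult.commute)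
qed

lemma floor_grid:
 assumes "0 < n" "0 <= s"
 shows "real (nat \<lfloor>real n * s\<rfloor>) / real n <= s" "s < real (Suc (nat \<lfloor>real n * s\<rfloor>)) / real n"
  "real (Suc (nat \<lfloor>real n * s\<rfloor>)) / real n <= s + 1 / real n"
proof -
 have i: "real (nat \<lfloor>real n * s\<rfloor>) <= real n * s" "real n * s < real (nat \<lfloor>real n * s\<rfloor>) + 1" using assms by auto
 thus "real (nat \<lfloor>real n * s\<rfloor>) / real n <= s" "s < real (Suc (nat \<lfloor>real n * s\<rfloor>)) / real n"
  using assms by (auto simp: field_simps)
 show "real (Suc (nat \<lfloor>real n * s\<rfloor>)) / real n <= s + 1 / real n"
  using i assms by (simp add: field_simps)
qed

context rr_path
begin

abbreviation grid where "grid n i \<equiv> f (real i / real n)"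

lemma grid_refraction_le: "grid_refraction (\<delta> / real n) b' g i <= \<delta> * (real i / real n)"
proof (induction i)
 case (Suc i)
 have "grid_refraction (\<delta> / real n) b' g (Suc i) <= grid_refraction (\<delta> / real n) b' g i + \<delta> / real n"
  using delta by (simp add: grid_refraction_def)
 thus ?case using Suc by (simp add: add_divide_distrib distrib_left)
qed (simp add: grid_refraction_def)

lemma L_nonneg: "0 <= t ==> 0 <= L t"
 using L_mono[of 0 t] L_0 by simp

text \<open>Bounds the excess of the sampled reflection over \<open>N\<close> by
  \<open>\<delta> * s\<close>, whatever the mesh and the refraction level; this is the dominating
  function for the limit.\<close>

lemma grid_reflection_le:
 assumes n: "0 < n" and s: "0 <= s"
 shows "grid_reflection (\<delta> / real n) b' (grid n) (nat \<lfloor>real n * s\<rfloor>) <= N s + \<delta> * s"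
proof (rule grid_reflection_least)
 show "0 <= N s + \<delta> * s" using N_nn[OF s] s delta by simp
 fix j assume j: "j <= nat \<lfloor>real n * s\<rfloor>"
 have js: "real j / real n <= s" using floor_grid(1)[OF n s] j by (meson divide_right_mono of_nat_0_le_iff of_nat_mono order_trans)
 have "L (real j / real n) - grid n j <= N s" using js by (intro L_le_N) auto
 moreover have "0 <= L (real j / real n)" by (rule L_nonneg) simp
 moreover have "grid_refraction (\<delta> / real n) b' (grid n) j <= \<delta> * s"
  using grid_refraction_le[of n b' "grid n" j] mult_left_mono[OF js delta] by linarith
 ultimately show "grid_refraction (\<delta> / real n) b' (grid n) j - grid n j <= N s + \<delta> * s" by linarith
qed

lemma grid_reflection_excess:
 assumes \<epsilon>: "0 < \<epsilon>" and s: "0 <= s"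
 shows "(%n. max (grid_reflection (\<delta> / real n) (b + \<epsilon>) (grid n) (nat \<lfloor>real n * s\<rfloor>) - N s) 0) \<longlonglongrightarrow> 0"
proof -
 obtain F where F: "finite F" "!!x y. 0 <= x ==> x <= y ==> y <= s ==> F \<inter> {x<..y} = {} ==> \<bar>f y - f x\<bar> < \<epsilon> / 2"
  by (rule cadlag_partition[OF cadlag half_gt_zero[OF \<epsilon>], where T=s]) (rule that)
 have ev: "\<forall>\<^sub>F n in sequentially. 4 * (\<delta> / real n) <= \<epsilon>" using \<epsilon> by real_asymp
 have "grid_reflection (\<delta> / real n) (b + \<epsilon>) (grid n) (nat \<lfloor>real n * s\<rfloor>) <= N s + \<delta> / real n * card F"
  if n: "0 < n" and d: "4 * (\<delta> / real n) <= \<epsilon>" for n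
 proof (rule grid_reflection_least)
  show "0 <= N s + \<delta> / real n * card F" using N_nn[OF s] delta by simp
  fix j assume j: "j <= nat \<lfloor>real n * s\<rfloor>"
  have js: "real j / real n <= s" using floor_grid(1)[OF n s] j by (meson divide_right_mono of_nat_0_le_iff of_nat_mono order_trans)
  have "grid_refraction (\<delta> / real n) (b + \<epsilon>) (grid n) j <= L (real j / real n) + \<delta> / real n * grid_count F n j"
   by (rule grid_above[OF n F d js])
  moreover have "\<delta> / real n * grid_count F n j <= \<delta> / real n * card F"
   using delta F(1) unfolding grid_count_def by (intro mult_left_mono of_nat_mono card_mono) auto
  moreover have "L (real j / real n) - grid n j <= N s" using js by (intro L_le_N) auto
  ultimately show "grid_refraction (\<delta> / real n) (b + \<epsilon>) (grid n) j - grid n j <= N s + \<delta> / real n * card F" by linarith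
 qed
 note bound = this
 have "\<forall>\<^sub>F n in sequentially. max (grid_reflection (\<delta> / real n) (b + \<epsilon>) (grid n) (nat \<lfloor>real n * s\<rfloor>) - N s) 0 <= \<delta> / real n * card F"
  using ev eventually_gt_at_top[of 0]
 proof eventually_elim
  case (elim n)
  have "0 <= \<delta> / real n * card F" using delta by simp
  thus ?case using bound[OF elim(2,1)] by linarith
 qed
 moreover have "(%n. \<delta> / real n * card F) \<longlonglongrightarrow> 0" by real_asymp
 ultimately show ?thesis by (rule tendsto_sandwich[OF _ _ tendsto_const[of 0], rotated]) simp
qed

text \<open>The first grid point after \<open>s\<close> is used because the chain feels what
  \<open>f\<close> does between the last grid time and \<open>s\<close> only there. For large
  \<open>n\<close> a step is shorter than every gap in \<open>F\<close> and so contains at most one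
  of its points.\<close>

lemma grid_reflection_catches_up:
 assumes \<epsilon>: "0 < \<epsilon>" and s: "0 <= s" and \<kappa>: "0 < \<kappa>"
 shows "\<forall>\<^sub>F n in sequentially. N s <= grid_reflection (\<delta> / real n) (b - \<epsilon>) (grid n) (Suc (nat \<lfloor>real n * s\<rfloor>)) + \<kappa>"
proof -
 define \<eta> where "\<eta> = min (\<epsilon> / 8) (\<kappa> / 2)"
 have \<eta>: "0 < \<eta>" "8 * \<eta> <= \<epsilon>" "2 * \<eta> <= \<kappa>" using \<epsilon> \<kappa> by (auto simp: \<eta>_def)
 obtain F where F: "finite F" "!!x y. 0 <= x ==> x <= y ==> y <= s + 1 ==> F \<inter> {x<..y} = {} ==> \<bar>f y - f x\<bar> < \<eta>"
  by (rule cadlag_partition[OF cadlag \<eta>(1), where T="s + 1"]) (rule that)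
 have "\<forall>\<^sub>F n in sequentially. \<forall>x\<in>F \<times> F. fst x < snd x --> 1 / real n < snd x - fst x"
 proof (intro eventually_ball_finite ballI)
  fix x :: "real \<times> real"
  show "\<forall>\<^sub>F n in sequentially. fst x < snd x --> 1 / real n < snd x - fst x"
  proof (cases "fst x < snd x")
   case True
   hence "0 < snd x - fst x" by simp
   moreover have "(%n. 1 / real n) \<longlonglongrightarrow> 0" by real_asymp
   ultimately show ?thesis by (auto elim: order_tendstoD(2) eventually_mono)
  qed simp
 qed (use F in simp)
 moreover have "\<forall>\<^sub>F n in sequentially. 8 * (\<delta> / real n) <= \<epsilon>" using \<epsilon> by real_asymp
 moreover have "\<forall>\<^sub>F n in sequentially. \<delta> / real n * card F + \<delta> / real n <= \<kappa> / 2" using \<kappa> by real_asymp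
 ultimately show ?thesis using eventually_gt_at_top[of 0]
 proof eventually_elim
  case (elim n)
  let ?i = "Suc (nat \<lfloor>real n * s\<rfloor>)"
  have i: "s < real ?i / real n" "real ?i / real n <= s + 1 / real n" using floor_grid(2,3)[OF elim(4) s] by auto
  have "1 / real n <= 1" using elim(4) by simp
  hence iT: "real ?i / real n <= s + 1" using i(2) by linarith
  have single: False if "p \<in> F" "p' \<in> F" "real i / real n < p" "p < p'" "p' <= real (Suc i) / real n" for i p p'
  proof -
   have "1 / real n < p' - p" using bspec[OF elim(1), of "(p, p')"] that by simp
   moreover have "real (Suc i) / real n = real i / real n + 1 / real n" by (simp add: add_divide_distrib)
   ultimately show False using that by linarith
  qed
  have "N s <= N (real ?i / real n)" using i s by (intro N_mono) auto
  also have "... <= grid_reflection (\<delta> / real n) (b - \<epsilon>) (grid n) ?i + \<delta> / real n * grid_count F n ?i + \<delta> / real n + \<eta>"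
   by (rule grid_below[OF elim(4) F single elim(2) \<eta>(2,1) iT])
  also have "\<delta> / real n * grid_count F n ?i <= \<delta> / real n * card F"
   using delta F(1) unfolding grid_count_def by (intro mult_left_mono of_nat_mono card_mono) auto
  finally show ?case using elim(3) \<eta>(3) by linarith
 qed
qed

lemma N_right_continuous: "0 <= t ==> continuous (at_right t) N"
proof -
 assume t: "0 <= t"
 have "\<forall>\<^sub>F u in at_right t. dist (N u) (N t) < e" if e: "0 < e" for e
 proof -
  obtain h where h: "0 < h" "!!y. t <= y ==> y < t + h ==> \<bar>f y - f t\<bar> < e / 2" using right_cont[OF t, of "e/2"] e by auto
  define k where "k = min h (e / (2 * (\<delta> + 1)))"
  have k: "0 < k" using h e delta by (simp add: k_def)
  have dk: "\<delta> * k < e / 2"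
  proof -
   have "\<delta> * k < (\<delta> + 1) * k" using k by simp
   also have "... <= (\<delta> + 1) * (e / (2 * (\<delta> + 1)))" using delta by (intro mult_left_mono) (auto simp: k_def)
   also have "... = e / 2" using delta by (simp add: field_simps)
   finally show ?thesis .
  qed
  have "dist (N u) (N t) < e" if u: "t < u" "u < t + k" for u
  proof -
   have "N u <= N t + (\<delta> * k + e / 2)"
   proof (rule N_least)
    fix r assume r: "0 <= r" "r <= u"
    show "L r - f r <= N t + (\<delta> * k + e / 2)"
    proof (cases "r <= t")
     case True
     have "0 <= \<delta> * k" using delta k by simp
     thus ?thesis using L_le_N[OF r(1) True] e by linarith
    next
     case False
     have "\<bar>f r - f t\<bar> < e / 2" using False r u by (intro h(2)) (auto simp: k_def)
     moreover have "L r - L t <= \<delta> * (r - t)" using False t by (intro L_diff_le) auto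
     moreover have "\<delta> * (r - t) <= \<delta> * k" using r u delta by (intro mult_left_mono) auto
     ultimately show ?thesis using L_le_N[OF t order_refl] by linarith
    qed
   qed (use t u N_nn[OF t] delta k e in auto)
   thus ?thesis using N_mono[OF t, of u] u dk by (simp add: dist_real_def)
  qed
  thus ?thesis unfolding eventually_at_right_field using k by (intro exI[of _ "t + k"]) auto
 qed
 thus ?thesis unfolding continuous_within by (rule tendstoI)
qed

lemma cumulative_reflection_eq: "cumulative_reflection \<delta> b f v t = (if t < 0 then 0 else N t)"
 using skorokhod_equation[of t] by (simp add: cumulative_reflection_def)

lemma reflection_integral:
 assumes q: "0 < q"
 shows "(\<integral>\<^sup>+t\<in>{0..}. ennreal (exp (- (q * t))) \<partial>interval_measure (cumulative_reflection \<delta> b f v)) =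
  (\<integral>\<^sup>+s. ennreal (q * exp (- (q * s)) * N s) * indicator {0..} s \<partial>lborel)"
proof -
 let ?R = "cumulative_reflection \<delta> b f v"
 have "(\<integral>\<^sup>+t\<in>{0..}. ennreal (exp (- (q * t))) \<partial>interval_measure ?R) =
  (\<integral>\<^sup>+s. ennreal (q * exp (- (q * s)) * ?R s) * indicator {0..} s \<partial>lborel)"
 proof (rule nn_integral_interval_measure_exp[OF q])
  show "mono ?R" by (intro monoI) (auto simp: cumulative_reflection_eq N_nn N_mono)
  fix a show "continuous (at_right a) ?R"
  proof (cases "a < 0")
   case True
   have "\<forall>\<^sub>F u in at_right a. ?R u = 0" unfolding eventually_at_right_field
    using True by (intro exI[of _ 0]) (auto simp: cumulative_reflection_eq)
   hence "(?R \<longlongrightarrow> 0) (at_right a)" by (rule tendsto_eventually)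
   thus ?thesis using True by (simp add: continuous_within cumulative_reflection_eq)
  next
   case False
   have "\<forall>\<^sub>F u in at_right a. N u = ?R u" unfolding eventually_at_right_field
    using False by (intro exI[of _ "a + 1"]) (auto simp: cumulative_reflection_eq)
   hence "(?R \<longlongrightarrow> N a) (at_right a)" using N_right_continuous[of a] False
    by (intro Lim_transform_eventually[where f=N and g="?R"]) (auto simp: continuous_within)
   thus ?thesis using False by (simp add: continuous_within cumulative_reflection_eq)
  qed
 qed (simp add: cumulative_reflection_eq)
 also have "... = (\<integral>\<^sup>+s. ennreal (q * exp (- (q * s)) * N s) * indicator {0..} s \<partial>lborel)"
  by (intro nn_integral_cong) (auto simp: cumulative_reflection_eq indicator_def)
 finally show ?thesis .
qed

end

section \<open>Spectrally negative Levy processes\<close>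

text \<open>For \<open>t >= 0\<close> it approximates \<open>t\<close> from strictly above, so that
  right continuity can be used along it.\<close>

definition upper_grid :: "nat => real => real" where
 "upper_grid n t = real (Suc (nat \<lfloor>real (Suc n) * t\<rfloor>)) / real (Suc n)"

lemma upper_grid_nonneg: "0 <= upper_grid n t"
 by (simp add: upper_grid_def)

lemma upper_grid_at_right:
 assumes t: "0 <= t"
 shows "filterlim (%n. upper_grid n t) (at_right t) sequentially"
proof -
 have g: "t < upper_grid n t" "upper_grid n t <= t + 1 / real (Suc n)" for n
  unfolding upper_grid_def using floor_grid(2,3)[OF zero_less_Suc t, of n] .
 have "(%n. t + 1 / real (Suc n)) \<longlonglongrightarrow> t" by real_asymp
 hence "(%n. upper_grid n t) \<longlonglongrightarrow> t"
  by (rule tendsto_sandwich[OF _ _ tendsto_const[of t], rotated 2]) (intro always_eventually allI less_imp_le g)+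
 thus ?thesis unfolding filterlim_at using g(1) by (intro conjI always_eventually allI) (auto simp: less_imp_neq[symmetric])
qed

lemma right_continuous_process_measurable:
 fixes Y :: "real => 'a => real"
 assumes Y: "!!t. 0 <= t ==> Y t \<in> borel_measurable M" and neg: "!!t w. t < 0 ==> Y t w = 0"
  and rc: "!!t w. w \<in> space M ==> 0 <= t ==> continuous (at_right t) (%t. Y t w)"
 shows "(%(t, w). Y t w) \<in> borel_measurable (borel \<Otimes>\<^sub>M M)"
proof (rule borel_measurable_LIMSEQ_real)
 define u where "u n = (%(t, w). if t < 0 then 0 else Y (upper_grid n t) w)" for n
 show "u n \<in> borel_measurable (borel \<Otimes>\<^sub>M M)" for n
 proof -
  have "(%x. Y (upper_grid n (fst x)) (snd x)) \<in> borel_measurable (borel \<Otimes>\<^sub>M M)"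
   unfolding upper_grid_def
  proof (rule measurable_compose_countable[where g="%x. nat \<lfloor>real (Suc n) * fst x\<rfloor>"])
   fix i :: nat
   have [measurable]: "Y (real (Suc i) / real (Suc n)) \<in> borel_measurable M" by (rule Y) simp
   show "(%x. Y (real (Suc i) / real (Suc n)) (snd x)) \<in> borel_measurable (borel \<Otimes>\<^sub>M M)" by measurable
  qed measurable
  thus ?thesis unfolding u_def case_prod_unfold by measurable
 qed
 fix x assume "x \<in> space ((borel :: real measure) \<Otimes>\<^sub>M M)"
 then obtain t w where x: "x = (t, w)" "w \<in> space M" by (auto simp: space_pair_measure)
 show "(%n. u n x) \<longlonglongrightarrow> (case x of (t, w) => Y t w)"
 proof (cases "t < 0")
  case True thus ?thesis by (simp add: u_def x neg)
 next
  case False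
  have "((%s. Y s w) \<longlongrightarrow> Y t w) (at_right t)" using rc[OF x(2), of t] False by (simp add: continuous_within)
  from filterlim_compose[OF this upper_grid_at_right[of t]] show ?thesis using False by (simp add: u_def x)
 qed
qed

lemma exp_difference_quotient_mono:
 assumes "0 < r" "r <= r'"
 shows "(exp (r * x) - 1) / r <= (exp (r' * x) - 1) / (r' :: real)"
proof -
 have "convex_on UNIV (exp :: real => real)" by (rule convex_on_realI[where f'=exp]) (auto intro: derivative_eq_intros)
 from convex_onD[OF this, of "r / r'" 0 "r' * x"] have "exp (r * x) <= (1 - r / r') + r / r' * exp (r' * x)"
  using assms by simp
 hence "exp (r * x) - 1 <= r * ((exp (r' * x) - 1) / r')" by (simp add: right_diff_distrib diff_divide_distrib)
 thus ?thesis using assms(1) by (simp add: pos_divide_le_eq mult.commute)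
qed

context spectrally_negative_levy
begin

abbreviation psi where "psi \<equiv> levy_khintchine \<gamma> \<sigma> \<nu>"

lemma increment_nn_expectation:
 assumes s: "0 <= s" and t: "0 <= t" and f: "f \<in> borel_measurable borel"
 shows "(\<integral>\<^sup>+w. f (X (s + t) w - X s w) \<partial>M) = (\<integral>\<^sup>+w. f (X t w) \<partial>M)"
proof -
 have [measurable]: "X t \<in> borel_measurable M" "X s \<in> borel_measurable M" "X (s + t) \<in> borel_measurable M" "f \<in> borel_measurable borel"
  using random_variable_X s t f by auto
 have "(\<integral>\<^sup>+w. f (X (s + t) w - X s w) \<partial>M) = (\<integral>\<^sup>+y. f y \<partial>distr M borel (%w. X (s + t) w - X s w))"
  by (simp add: nn_integral_distr)
 also have "... = (\<integral>\<^sup>+y. f y \<partial>distr M borel (X t))" by (simp add: stationary_increments[OF s t])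
 also have "... = (\<integral>\<^sup>+w. f (X t w) \<partial>M)" by (simp add: nn_integral_distr)
 finally show ?thesis .
qed

definition mgf :: "real => real => ennreal" where
 "mgf r t = (\<integral>\<^sup>+w. ennreal (exp (r * X t w)) \<partial>M)"

lemma mgf_add:
 assumes s: "0 <= s" and t: "0 <= t"
 shows "mgf r (s + t) = mgf r s * mgf r t"
proof -
 define ts where "ts = (%i::nat. if i = 0 then 0 else if i = 1 then s else s + t)"
 have "mono ts" unfolding ts_def mono_def using s t by auto
 have [measurable]: "X t \<in> borel_measurable M" "X s \<in> borel_measurable M" "X (s + t) \<in> borel_measurable M" "X 0 \<in> borel_measurable M"
  using random_variable_X s t by auto
 have "indep_vars (%_. borel) (%i w. ennreal (exp (r * (X (ts (Suc i)) w - X (ts i) w)))) {..<2}"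
  by (rule indep_vars_compose2[OF independent_increments[OF _ \<open>mono ts\<close>]]) (auto simp: ts_def)
 hence "(\<integral>\<^sup>+w. (\<Prod>i<2. ennreal (exp (r * (X (ts (Suc i)) w - X (ts i) w)))) \<partial>M) =
   (\<Prod>i<2. \<integral>\<^sup>+w. ennreal (exp (r * (X (ts (Suc i)) w - X (ts i) w))) \<partial>M)"
  by (intro indep_vars_nn_integral) auto
 moreover have "{..<2} = {0, 1::nat}" by auto
 ultimately have "(\<integral>\<^sup>+w. ennreal (exp (r * (X s w - X 0 w))) * ennreal (exp (r * (X (s + t) w - X s w))) \<partial>M) =
   (\<integral>\<^sup>+w. ennreal (exp (r * (X s w - X 0 w))) \<partial>M) * (\<integral>\<^sup>+w. ennreal (exp (r * (X (s + t) w - X s w))) \<partial>M)"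
  by (simp add: ts_def)
 moreover have "(\<integral>\<^sup>+w. ennreal (exp (r * (X s w - X 0 w))) * ennreal (exp (r * (X (s + t) w - X s w))) \<partial>M) = mgf r (s + t)"
  unfolding mgf_def using start_zero
  by (intro nn_integral_cong_AE) (auto elim!: eventually_mono simp: ennreal_mult''[symmetric] exp_add[symmetric] algebra_simps)
 moreover have "(\<integral>\<^sup>+w. ennreal (exp (r * (X s w - X 0 w))) \<partial>M) = mgf r s"
  unfolding mgf_def using start_zero by (intro nn_integral_cong_AE) (auto elim!: eventually_mono)
 moreover have "(\<integral>\<^sup>+w. ennreal (exp (r * (X (s + t) w - X s w))) \<partial>M) = mgf r t"
  unfolding mgf_def by (rule increment_nn_expectation[OF s t]) measurable
 ultimately show ?thesis by simp
qed

lemma mgf_nonzero: "0 <= t ==> mgf r t ~= 0"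
proof
 assume t: "0 <= t" and z: "mgf r t = 0"
 have [measurable]: "X t \<in> borel_measurable M" using random_variable_X t by auto
 from z have "AE w in M. ennreal (exp (r * X t w)) = 0" unfolding mgf_def by (subst (asm) nn_integral_0_iff_AE) auto
 hence "AE w in M. False" by eventually_elim (simp add: ennreal_eq_0_iff not_le)
 thus False by simp
qed

lemma mgf_1: "0 <= r ==> mgf r 1 = ennreal (exp (psi r))"
proof -
 assume th: "0 <= r"
 let ?E = "expectation (%w. exp (r * X 1 w))"
 have m: "mgf r 1 = ennreal ?E" unfolding mgf_def by (intro nn_integral_eq_integral exponential_moments th) auto
 hence "0 < ?E" using mgf_nonzero[of 1 r] by (auto simp: ennreal_eq_0_iff)
 thus ?thesis using m laplace_exponent[OF th] by (metis exp_ln)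
qed

text \<open>Multiplicativity gives the formula at rational times. At other times right continuity of
  the paths and Fatou's lemma give only the upper bound; since the values at \<open>t\<close> and at
  \<open>real n - t\<close> multiply to a known number, the upper bound for the second factor yields
  the lower bound for the first.\<close>

lemma mgf_eq:
 assumes th: "0 <= r" and t: "0 <= t"
 shows "mgf r t = ennreal (exp (t * psi r))"
proof -
 let ?c = "psi r"
 have int: "mgf r (real n) = ennreal (exp (real n * ?c))" for n
 proof (induction n)
  case 0
  have "mgf r 0 = (\<integral>\<^sup>+w. 1 \<partial>M)" unfolding mgf_def using start_zero by (intro nn_integral_cong_AE) (auto elim!: eventually_mono)
  thus ?case by (simp add: emeasure_space_1)
 next
  case (Suc n)
  have "mgf r (real n + 1) = ennreal (exp (real n * ?c)) * ennreal (exp ?c)"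
   using mgf_add[of "real n" 1 r] Suc mgf_1[OF th] by simp
  thus ?case by (simp add: ennreal_mult''[symmetric] exp_add[symmetric] algebra_simps)
 qed
 have fin: "mgf r s ~= \<top>" if s: "0 <= s" for s
 proof
  assume top: "mgf r s = \<top>"
  obtain n where n: "s <= real n" using real_arch_simple by blast
  have "mgf r s * mgf r (real n - s) = ennreal (exp (real n * ?c))" using mgf_add[of s "real n - s" r] s n int[of n] by simp
  thus False using top mgf_nonzero[of "real n - s" r] n by (simp add: ennreal_mult_eq_top_iff ennreal_top_mult)
 qed
 define p where "p s = enn2real (mgf r s)" for s
 have p: "mgf r s = ennreal (p s)" if "0 <= s" for s using fin[OF that] by (simp add: p_def less_top)
 have p0: "0 < p s" if "0 <= s" for s using p[OF that] mgf_nonzero[OF that, of r] by (metis ennreal_eq_0_iff not_le)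
 have p_add: "p (s + u) = p s * p u" if "0 <= s" "0 <= u" for s u
  unfolding p_def mgf_add[OF that] by (rule enn2real_mult)
 have p_int: "p (real n) = exp (real n * ?c)" for n by (simp add: p_def int)
 have p_mult: "p (real k * s) = p s ^ k" if "0 <= s" for k s
 proof (induction k)
  case 0 thus ?case using p_int[of 0] by simp
 next
  case (Suc k)
  have "p (real k * s + s) = p (real k * s) * p s" using that by (intro p_add) auto
  thus ?case using Suc by (simp add: algebra_simps)
 qed
 have p_rat: "p (real k / real (Suc n)) = exp (real k / real (Suc n) * ?c)" for k n
 proof (rule power_eq_imp_eq_base[of _ "Suc n"])
  have "p (real k / real (Suc n)) ^ Suc n = p (real (Suc n) * (real k / real (Suc n)))" by (rule p_mult[symmetric]) simp
  also have "... = exp (real k * ?c)" using p_int[of k] by simp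
  also have "... = exp (real k / real (Suc n) * ?c) ^ Suc n"
   unfolding exp_of_nat_mult[symmetric] by (simp add: field_simps del: of_nat_Suc)
  finally show "p (real k / real (Suc n)) ^ Suc n = exp (real k / real (Suc n) * ?c) ^ Suc n" .
 qed (use p0[of "real k / real (Suc n)"] in \<open>auto intro: less_imp_le\<close>)
 have le: "p s <= exp (s * ?c)" if s: "0 <= s" for s
 proof -
  let ?g = "%n. upper_grid n s"
  have g: "?g \<longlonglongrightarrow> s" using upper_grid_at_right[OF s] by (simp add: filterlim_at)
  have [measurable]: "X (?g n) \<in> borel_measurable M" for n by (rule random_variable_X[OF upper_grid_nonneg])
  have "mgf r s = (\<integral>\<^sup>+w. liminf (%n. ennreal (exp (r * X (?g n) w))) \<partial>M)"
   unfolding mgf_def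
  proof (intro nn_integral_cong_AE)
   show "AE w in M. ennreal (exp (r * X s w)) = liminf (%n. ennreal (exp (r * X (?g n) w)))"
    using cadlag_paths
   proof eventually_elim
    case (elim w)
    hence "((%t. X t w) \<longlongrightarrow> X s w) (at_right s)" using s by (simp add: cadlag_def continuous_within)
    from filterlim_compose[OF this upper_grid_at_right[OF s]] have "(%n. X (?g n) w) \<longlonglongrightarrow> X s w" .
    hence "(%n. ennreal (exp (r * X (?g n) w))) \<longlonglongrightarrow> ennreal (exp (r * X s w))"
     by (intro tendsto_ennrealI tendsto_intros)
    thus ?case by (intro lim_imp_Liminf[symmetric]) auto
   qed
  qed
  also have "... <= liminf (%n. mgf r (?g n))" unfolding mgf_def by (rule nn_integral_liminf) measurable
  also have "... = ennreal (exp (s * ?c))"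
  proof (rule lim_imp_Liminf)
   have "mgf r (?g n) = ennreal (exp (?g n * ?c))" for n using p[OF upper_grid_nonneg, of n s] p_rat[of "Suc (nat \<lfloor>real (Suc n) * s\<rfloor>)" n] by (simp only: upper_grid_def)
   moreover have "(%n. ennreal (exp (?g n * ?c))) \<longlonglongrightarrow> ennreal (exp (s * ?c))" by (intro tendsto_ennrealI tendsto_intros g)
   ultimately show "(%n. mgf r (?g n)) \<longlonglongrightarrow> ennreal (exp (s * ?c))" by simp
  qed simp
  finally show ?thesis using p[OF s] by simp
 qed
 obtain n where n: "t <= real n" using real_arch_simple by blast
 have "exp (t * ?c) * exp ((real n - t) * ?c) = p t * p (real n - t)"
  unfolding exp_add[symmetric] using p_add[of t "real n - t"] t n p_int[of n] by (simp add: left_diff_distrib)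
 also have "... <= p t * exp ((real n - t) * ?c)" using p0[OF t] le[of "real n - t"] n by simp
 finally have "exp (t * ?c) <= p t" by (rule mult_right_le_imp_le) simp
 thus ?thesis using le[OF t] p[OF t] by simp
qed

lemma exp_X:
 assumes "0 <= r" "0 <= t"
 shows "integrable M (%w. exp (r * X t w))" "expectation (%w. exp (r * X t w)) = exp (t * psi r)"
proof -
 have [measurable]: "X t \<in> borel_measurable M" using random_variable_X assms by auto
 have n: "(\<integral>\<^sup>+w. ennreal (exp (r * X t w)) \<partial>M) = ennreal (exp (t * psi r))" using mgf_eq[OF assms] by (simp add: mgf_def)
 thus "integrable M (%w. exp (r * X t w))" by (intro integrableI_nonneg) auto
 show "expectation (%w. exp (r * X t w)) = exp (t * psi r)" by (rule nn_integral_eq_integrable[THEN iffD1, OF _ _ _ n, THEN conjunct2]) auto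
qed

lemma psi_0: "psi 0 = 0"
 by (simp add: levy_khintchine_def set_lebesgue_integral_def)

text \<open>On the positive axis the moment generating function of \<open>X 1\<close> is the
  restriction of a holomorphic function, and \<open>psi\<close> is its logarithm.\<close>

lemma psi_has_derivative: "0 < r ==> (psi has_real_derivative deriv psi r) (at r)"
proof -
 assume th: "0 < r"
 have [measurable]: "X 1 \<in> borel_measurable M" by (rule random_variable_X) simp
 let ?\<mu> = "distr M borel (X 1)"
 let ?F = "%z. \<integral>x. exp (z * complex_of_real x) \<partial>?\<mu>"
 have "?F holomorphic_on {z. 0 < Re z}"
  by (rule holomorphic_exponential_integral) (auto simp: integrable_distr_eq intro!: exp_X(1)[of _ 1])
 moreover have "open {z. 0 < Re z}" by (rule open_halfspace_Re_gt)
 ultimately obtain D where "(?F has_field_derivative D) (at (complex_of_real r))"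
  using th unfolding holomorphic_on_def field_differentiable_def by (metis mem_Collect_eq Re_complex_of_real at_within_open)
 from has_vector_derivative_real_field[OF this, of UNIV] have "((%x. ?F (complex_of_real x)) has_vector_derivative D) (at r)" .
 from bounded_linear.has_vector_derivative[OF bounded_linear_Re this]
 have d: "((%x. Re (?F (complex_of_real x))) has_real_derivative Re D) (at r)"
  by (simp add: has_real_derivative_iff_has_vector_derivative)
 have F: "Re (?F (complex_of_real x)) = exp (psi x)" if "0 < x" for x
 proof -
  have "?F (complex_of_real x) = (\<integral>y. complex_of_real (exp (x * y)) \<partial>?\<mu>)"
   by (intro Bochner_Integration.integral_cong refl) (metis exp_of_real of_real_mult)
  also have "... = complex_of_real (\<integral>y. exp (x * y) \<partial>?\<mu>)" by (rule integral_complex_of_real)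
  also have "(\<integral>y. exp (x * y) \<partial>?\<mu>) = expectation (%w. exp (x * X 1 w))" by (simp add: integral_distr)
  finally show ?thesis using exp_X(2)[of x 1] that by simp
 qed
 have "((%x. exp (psi x)) has_real_derivative Re D) (at r)"
  by (rule has_field_derivative_transform_within_open[OF d, of "{0<..}"]) (use th F in auto)
 hence "((%x. ln (exp (psi x))) has_real_derivative (1 / exp (psi r)) * Re D) (at r)"
  by (intro DERIV_chain2[OF DERIV_ln_divide]) auto
 hence "(psi has_real_derivative (1 / exp (psi r)) * Re D) (at r)" by simp
 thus ?thesis using DERIV_imp_deriv by metis
qed

lemma psi_tendsto_0: "(psi \<longlongrightarrow> 0) (at_right 0)"
proof -
 have [measurable]: "X 1 \<in> borel_measurable M" by (rule random_variable_X) simp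
 have "((%r. exp (psi r)) \<longlongrightarrow> 1) (at_right 0)"
 proof (rule tendsto_at_right_sequentially[of 0 1])
  fix S :: "nat => real" assume S: "!!n. 0 < S n" "!!n. S n < 1" "decseq S" "S \<longlonglongrightarrow> 0"
  have "(%n. expectation (%w. exp (S n * X 1 w))) \<longlonglongrightarrow> expectation (%w. exp (0 * X 1 w))"
  proof (rule integral_dominated_convergence[where w="%w. 1 + exp (1 * X 1 w)"])
   show "integrable M (%w. 1 + exp (1 * X 1 w))" by (intro Bochner_Integration.integrable_add exp_X(1)) auto
   show "AE w in M. (%n. exp (S n * X 1 w)) \<longlonglongrightarrow> exp (0 * X 1 w)"
    by (intro AE_I2 tendsto_intros S)
   show "AE w in M. norm (exp (S n * X 1 w)) <= 1 + exp (1 * X 1 w)" for n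
   proof (intro AE_I2)
    fix w
    show "norm (exp (S n * X 1 w)) <= 1 + exp (1 * X 1 w)"
    proof (cases "0 <= X 1 w")
     case True
     hence "S n * X 1 w <= 1 * X 1 w" using S(2)[of n] by (intro mult_right_mono) auto
     thus ?thesis by (simp add: add_increasing)
    next
     case False
     hence "S n * X 1 w <= 0" using S(1)[of n] by (simp add: mult_nonneg_nonpos less_imp_le)
     thus ?thesis by (simp add: add_increasing2)
    qed
   qed
  qed measurable
  thus "(%n. exp (psi (S n))) \<longlonglongrightarrow> 1" using S(1) exp_X(2)[of _ 1] by (simp add: less_imp_le prob_space)
 qed simp
 hence "((%r. ln (exp (psi r))) \<longlongrightarrow> ln 1) (at_right 0)" by (intro tendsto_ln) auto
 thus ?thesis by simp
qed

lemma psi_continuous: "continuous_on {0..} psi"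
 unfolding continuous_on_def
proof
 fix r :: real assume th: "r \<in> {0..}"
 show "(psi \<longlongrightarrow> psi r) (at r within {0..})"
 proof (cases "r = 0")
  case True
  have "at (0::real) within {0..} = at_right 0" by (rule at_within_Ici_at_right)
  thus ?thesis using psi_tendsto_0 True by (simp add: psi_0)
 next
  case False
  hence "isCont psi r" using th by (intro DERIV_isCont[OF psi_has_derivative]) auto
  thus ?thesis unfolding isCont_def by (rule tendsto_within_subset) simp
 qed
qed

text \<open>By l'Hopital's rule the difference quotients of \<open>exp (t * psi r)\<close> at 0 tend
  to \<open>m * t\<close>. The pathwise quotients decrease to \<open>X t w\<close> as
  \<open>r\<close> decreases to 0, so monotone convergence yields integrability together with the
  mean.\<close>

lemma X_mean:
 assumes m: "(deriv psi \<longlongrightarrow> m) (at_right 0)" and t: "0 <= t"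
 shows "integrable M (X t)" "expectation (X t) = m * t"
proof -
 have [measurable]: "X t \<in> borel_measurable M" using random_variable_X t by auto
 have lim: "((%r. (exp (t * psi r) - 1) / r) \<longlongrightarrow> m * t) (at_right 0)"
 proof (rule lhopital_right_0[where f'="%r. exp (t * psi r) * (t * deriv psi r)" and g'="%_. 1"])
  have "((%r. exp (t * psi r) - 1) \<longlongrightarrow> exp (t * 0) - 1) (at_right 0)" by (intro tendsto_intros psi_tendsto_0)
  thus "((%r. exp (t * psi r) - 1) \<longlongrightarrow> 0) (at_right 0)" by simp
  have "((%r. exp (t * psi r) * (t * deriv psi r) / 1) \<longlongrightarrow> exp (t * 0) * (t * m) / 1) (at_right 0)"
   by (intro tendsto_intros psi_tendsto_0 m) auto
  thus "((%r. exp (t * psi r) * (t * deriv psi r) / 1) \<longlongrightarrow> m * t) (at_right 0)" by (simp add: mult.commute)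
  show "\<forall>\<^sub>F r in at_right 0. ((%r. exp (t * psi r) - 1) has_real_derivative exp (t * psi r) * (t * deriv psi r)) (at r)"
   using eventually_at_right_less[of 0] by eventually_elim (auto intro!: derivative_eq_intros psi_has_derivative)
  show "\<forall>\<^sub>F r in at_right 0. r ~= (0::real)" using eventually_at_right_less[of 0] by eventually_elim auto
 qed (auto intro!: derivative_eq_intros tendsto_eq_intros)
 define r where "r n = 1 / real (Suc n)" for n
 have th: "0 < r n" for n by (simp add: r_def)
 have th0: "filterlim r (at_right 0) sequentially" unfolding r_def by real_asymp
 define u where "u n w = - ((exp (r n * X t w) - 1) / r n)" for n w
 have u_int: "integrable M (u n)" for n
  unfolding u_def using exp_X(1)[of "r n" t] th[of n] t by (intro Bochner_Integration.integrable_minus integrable_divide Bochner_Integration.integrable_diff) (auto intro: less_imp_le)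
 have u_exp: "expectation (u n) = - ((exp (t * psi (r n)) - 1) / r n)" for n
  unfolding u_def using exp_X[of "r n" t] th[of n] t by (simp add: less_imp_le prob_space)
 have u_mono: "AE w in M. mono (%n. u n w)"
 proof (intro AE_I2 monoI)
  fix w and i j :: nat assume "i <= j"
  hence "r j <= r i" by (simp add: r_def frac_le)
  thus "u i w <= u j w" unfolding u_def using exp_difference_quotient_mono[OF th[of j]] by simp
 qed
 have u_lim: "AE w in M. (%n. u n w) \<longlonglongrightarrow> - X t w"
 proof (intro AE_I2)
  fix w
  have "((%h. exp (h * X t w)) has_real_derivative X t w) (at 0)" by (auto intro!: derivative_eq_intros)
  hence "((%h. (exp (h * X t w) - 1) / h) \<longlongrightarrow> X t w) (at 0)" by (simp add: has_field_derivative_iff)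
  hence "((%h. (exp (h * X t w) - 1) / h) \<longlongrightarrow> X t w) (at_right 0)" by (rule tendsto_within_subset) simp
  from filterlim_compose[OF this th0] show "(%n. u n w) \<longlonglongrightarrow> - X t w" unfolding u_def by (intro tendsto_minus)
 qed
 have e_lim: "(%n. expectation (u n)) \<longlonglongrightarrow> - (m * t)"
  unfolding u_exp by (intro tendsto_minus filterlim_compose[OF lim th0])
 have i: "integrable M (%w. - X t w)" by (rule integrable_monotone_convergence[OF u_int u_mono u_lim e_lim]) measurable
 thus "integrable M (X t)" using Bochner_Integration.integrable_minus[OF i] by simp
 have "expectation (%w. - X t w) = - (m * t)" by (rule integral_monotone_convergence[OF u_int u_mono u_lim e_lim]) measurable
 thus "expectation (X t) = m * t" by simp
qed

end

section \<open>Growth of the exponent and variation of the paths\<close>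

lemma exp_minus_quadratic_bound: "exp y - 1 - y <= y\<^sup>2" if "y <= 0" for y :: real
proof -
 have "exp y * (1 - y) <= exp y * exp (- y)" using exp_ge_add_one_self[of "- y"] by (intro mult_left_mono) auto
 also have "... = 1" by (simp add: exp_add[symmetric])
 also have "1 <= (1 + y + y\<^sup>2) * (1 - y)"
 proof -
  have "(1 + y + y\<^sup>2) * (1 - y) = 1 - y ^ 3" by algebra
  moreover have "y ^ 3 <= 0" using that by (simp add: power3_eq_cube mult_nonpos_nonneg mult_nonneg_nonpos zero_le_mult_iff mult_le_0_iff)
  ultimately show ?thesis by simp
 qed
 finally have "exp y * (1 - y) <= (1 + y + y\<^sup>2) * (1 - y)" .
 hence "exp y <= 1 + y + y\<^sup>2" by (rule mult_right_le_imp_le) (use that in simp)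
 thus ?thesis by simp
qed

context spectrally_negative_levy
begin

definition lk :: "real => real => real" where
 "lk \<theta> x = exp (\<theta> * x) - 1 - \<theta> * x * indicator {-1<..} x"

lemma lk_bounds:
 assumes x: "x < 0" and th: "1 <= \<theta>"
 shows "lk \<theta> x <= \<theta>\<^sup>2 * min 1 (x\<^sup>2)" "\<bar>lk \<theta> x\<bar> <= \<theta>\<^sup>2 * min 1 (x\<^sup>2)"
proof -
 have "\<bar>lk \<theta> x\<bar> <= \<theta>\<^sup>2 * min 1 (x\<^sup>2)"
 proof (cases "- 1 < x")
  case True
  have "\<bar>x\<bar> <= 1" using True x by simp
  hence "x\<^sup>2 <= 1" by (simp add: abs_square_le_1)
  moreover have "exp (\<theta> * x) - 1 - \<theta> * x <= (\<theta> * x)\<^sup>2"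
   using x th by (intro exp_minus_quadratic_bound) (simp add: mult_nonneg_nonpos)
  moreover have "1 + \<theta> * x <= exp (\<theta> * x)" by (rule exp_ge_add_one_self)
  ultimately have "\<bar>exp (\<theta> * x) - 1 - \<theta> * x\<bar> <= (\<theta> * x)\<^sup>2" by linarith
  thus ?thesis using True \<open>x\<^sup>2 <= 1\<close> by (simp add: lk_def power_mult_distrib)
 next
  case False
  hence "1 <= \<bar>x\<bar>" by simp
  hence "1 <= x\<^sup>2" by (simp add: one_le_power[of "\<bar>x\<bar>" 2, simplified])
  moreover have "exp (\<theta> * x) <= 1" using x th by (simp add: mult_nonneg_nonpos)
  moreover have "0 <= exp (\<theta> * x)" by simp
  ultimately have "\<bar>lk \<theta> x\<bar> <= 1 * 1" using False by (simp add: lk_def)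
  also have "... <= \<theta>\<^sup>2 * min 1 (x\<^sup>2)" using \<open>1 <= x\<^sup>2\<close> th by (simp add: one_le_power)
  finally show ?thesis .
 qed
 thus "lk \<theta> x <= \<theta>\<^sup>2 * min 1 (x\<^sup>2)" "\<bar>lk \<theta> x\<bar> <= \<theta>\<^sup>2 * min 1 (x\<^sup>2)" by auto
qed

lemma borel_nu [measurable_cong]: "sets \<nu> = sets borel"
 by (rule sets_nu)

lemma min_integrable: "integrable \<nu> (%x. min 1 (x\<^sup>2))"
 using nu_levy_measure by (intro integrableI_nonneg) auto

lemma lk_integrable:
 assumes "1 <= \<theta>" "A \<subseteq> {..<0}" "A \<in> sets borel"
 shows "set_integrable \<nu> A (lk \<theta>)"
 unfolding set_integrable_def
proof (rule Bochner_Integration.integrable_bound)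
 show "integrable \<nu> (%x. \<theta>\<^sup>2 * min 1 (x\<^sup>2))" using min_integrable by (rule integrable_mult_right)
 note assms(3)[measurable]
 show "(%x. indicat_real A x *\<^sub>R lk \<theta> x) \<in> borel_measurable \<nu>" unfolding lk_def by measurable
 show "AE x in \<nu>. norm (indicat_real A x *\<^sub>R lk \<theta> x) <= norm (\<theta>\<^sup>2 * min 1 (x\<^sup>2))"
  using lk_bounds(2)[OF _ assms(1)] assms(2) by (intro AE_I2) (auto simp: indicator_def subset_eq)
qed

lemma psi_lk: "psi \<theta> = \<gamma> * \<theta> + \<sigma>\<^sup>2 / 2 * \<theta>\<^sup>2 + (LINT x:{..<0}|\<nu>. lk \<theta> x)"
 by (simp add: levy_khintchine_def lk_def)

text \<open>On negative jumps the compensated exponential is at most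
  \<open>\<theta>\<^sup>2 * min 1 (x\<^sup>2)\<close>, which the Levy measure integrates.\<close>

lemma psi_growth: "EX K. ALL \<theta>>=1. psi \<theta> <= K * \<theta>\<^sup>2"
proof (intro exI allI impI)
 fix \<theta> :: real assume th: "1 <= \<theta>"
 have "(LINT x:{..<0}|\<nu>. lk \<theta> x) <= (\<integral>x. \<theta>\<^sup>2 * min 1 (x\<^sup>2) \<partial>\<nu>)"
  unfolding set_lebesgue_integral_def
 proof (rule integral_mono)
  show "integrable \<nu> (%x. indicat_real {..<0} x *\<^sub>R lk \<theta> x)" using lk_integrable[OF th, of "{..<0}"] by (simp add: set_integrable_def)
  show "integrable \<nu> (%x. \<theta>\<^sup>2 * min 1 (x\<^sup>2))" using min_integrable by (rule integrable_mult_right)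
  fix x show "indicat_real {..<0} x *\<^sub>R lk \<theta> x <= \<theta>\<^sup>2 * min 1 (x\<^sup>2)"
   using lk_bounds(1)[OF _ th] by (auto simp: indicator_def)
 qed
 moreover have "\<gamma> * \<theta> <= \<bar>\<gamma>\<bar> * \<theta>\<^sup>2"
 proof -
  have "\<gamma> * \<theta> <= \<bar>\<gamma>\<bar> * \<theta>" using th by (intro mult_right_mono) auto
  also have "... <= \<bar>\<gamma>\<bar> * \<theta>\<^sup>2" using th by (intro mult_left_mono) (auto simp: power2_eq_square)
  finally show ?thesis .
 qed
 ultimately show "psi \<theta> <= (\<bar>\<gamma>\<bar> + \<sigma>\<^sup>2 / 2 + (\<integral>x. min 1 (x\<^sup>2) \<partial>\<nu>)) * \<theta>\<^sup>2"
  unfolding psi_lk by (simp add: algebra_simps)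
qed

text \<open>On \<open>(-1, 0)\<close> the normalised Levy--Khintchine integrands increase to \<open>-x\<close>, so a linear upper
 bound on the exponent forces the jumps to be summable and bounds the drift.\<close>

lemma bv_drift_le:
 assumes le: "!!\<theta>. 1 <= \<theta> ==> psi \<theta> <= \<delta> * \<theta>"
 shows "bv_drift \<gamma> \<nu> <= \<delta>"
proof -
 let ?A = "{-1<..<0::real}"
 define u where "u n x = indicat_real ?A x *\<^sub>R (lk (real (Suc n)) x / real (Suc n))" for n x
 define c where "c = (\<integral>x. min 1 (x\<^sup>2) \<partial>\<nu>)"
 have int: "integrable \<nu> (u n)" for n
  using lk_integrable[of "real (Suc n)" ?A] unfolding u_def set_integrable_def by (simp add: subset_eq del: of_nat_Suc)
 \<comment> \<open>The Gaussian term is nonnegative and dropped; the jumps of size at least 1 cost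
   at most \<open>c\<close>, which division by \<open>real (Suc n)\<close> makes negligible in the
   limit.\<close>
 have le_n: "integral\<^sup>L \<nu> (u n) <= \<delta> - \<gamma> + c / real (Suc n)" for n
 proof -
  let ?t = "real (Suc n)"
  have t: "1 <= ?t" by simp
  have un: "{..<0::real} = {..-1} \<union> ?A" by auto
  have i: "set_integrable \<nu> {..-1} (lk ?t)" "set_integrable \<nu> ?A (lk ?t)" using lk_integrable[OF t] by (auto simp: subset_eq)
  have split: "(LINT x:{..<0}|\<nu>. lk ?t x) = (LINT x:{..-1}|\<nu>. lk ?t x) + (LINT x:?A|\<nu>. lk ?t x)"
   unfolding un by (intro set_integral_Un i) auto
  have "- c <= (LINT x:{..-1}|\<nu>. lk ?t x)"
  proof -
   have "- c = (\<integral>x. - min 1 (x\<^sup>2) \<partial>\<nu>)" by (simp add: c_def)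
   also have "... <= (LINT x:{..-1}|\<nu>. lk ?t x)" unfolding set_lebesgue_integral_def
   proof (rule integral_mono)
    fix x :: real
    show "- min 1 (x\<^sup>2) <= indicat_real {..-1} x *\<^sub>R lk ?t x"
    proof (cases "x <= -1")
     case True
     hence "1 <= \<bar>x\<bar>" by simp
     hence "1 <= x\<^sup>2" by (simp add: one_le_power[of "\<bar>x\<bar>" 2, simplified])
     moreover have "- 1 <= lk ?t x" using True by (simp add: lk_def)
     ultimately show ?thesis using True by simp
    qed simp
   qed (use min_integrable i(1) in \<open>auto simp: set_integrable_def\<close>)
   finally show ?thesis .
  qed
  moreover have "\<gamma> * ?t + (LINT x:{..<0}|\<nu>. lk ?t x) <= \<delta> * ?t" using le[OF t] unfolding psi_lk by (smt (verit) zero_le_mult_iff zero_le_power2 divide_nonneg_pos)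
  ultimately have "(LINT x:?A|\<nu>. lk ?t x) <= (\<delta> - \<gamma>) * ?t + c" using split by (simp add: algebra_simps)
  hence "(LINT x:?A|\<nu>. lk ?t x) / ?t <= \<delta> - \<gamma> + c / ?t" by (simp add: divide_le_eq distrib_right del: of_nat_Suc)
  moreover have "integral\<^sup>L \<nu> (u n) = (LINT x:?A|\<nu>. lk ?t x) / ?t"
  proof -
   have "u n = (%x. (indicat_real ?A x *\<^sub>R lk ?t x) / ?t)" by (simp add: u_def fun_eq_iff)
   thus ?thesis by (simp only: set_lebesgue_integral_def integral_divide_zero)
  qed
  ultimately show ?thesis by simp
 qed
 have mono: "AE x in \<nu>. mono (%n. u n x)"
 proof (intro AE_I2 monoI)
  fix x and i j :: nat assume ij: "i <= j"
  show "u i x <= u j x"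
  proof (cases "x \<in> ?A")
   case True
   have "(exp (real (Suc i) * x) - 1) / real (Suc i) <= (exp (real (Suc j) * x) - 1) / real (Suc j)"
    using ij by (intro exp_difference_quotient_mono[OF of_nat_0_less_iff[THEN iffD2] of_nat_mono]) auto
   moreover have "lk t x / t = (exp (t * x) - 1) / t - x" if "0 < t" for t using True that by (simp add: lk_def diff_divide_distrib)
   ultimately show ?thesis using True by (simp add: u_def del: of_nat_Suc)
  qed (simp add: u_def)
 qed
 have lim: "AE x in \<nu>. (%n. u n x) \<longlonglongrightarrow> indicat_real ?A x *\<^sub>R (- x)"
 proof (intro AE_I2)
  fix x
  show "(%n. u n x) \<longlonglongrightarrow> indicat_real ?A x *\<^sub>R (- x)"
  proof (cases "x \<in> ?A")
   case True
   hence "x < 0" by simp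
   hence "(%n. (exp (real (Suc n) * x) - 1 - real (Suc n) * x) / real (Suc n)) \<longlonglongrightarrow> - x" by real_asymp
   thus ?thesis using True by (simp add: u_def lk_def)
  qed (simp add: u_def)
 qed
 have inc: "incseq (%n. integral\<^sup>L \<nu> (u n))"
  by (intro incseq_SucI integral_mono_AE int) (use mono in \<open>auto elim!: eventually_mono dest: monoD[of _ n "Suc n" for n]\<close>)
 have c0: "0 <= c" unfolding c_def by (intro integral_nonneg_AE) auto
 have "integral\<^sup>L \<nu> (u n) <= \<delta> - \<gamma> + c" for n
 proof -
  have "c / real (Suc n) <= c" using c0 by (intro divide_left_mono[of 1 "real (Suc n)" c, simplified div_by_1]) auto
  thus ?thesis using le_n[of n] by linarith
 qed
 then obtain F where F: "(%n. integral\<^sup>L \<nu> (u n)) \<longlonglongrightarrow> F" using incseq_convergent[OF inc] by blast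
 have "(%n. \<delta> - \<gamma> + c / real (Suc n)) \<longlonglongrightarrow> \<delta> - \<gamma>" by real_asymp
 hence "F <= \<delta> - \<gamma>" by (rule LIMSEQ_le[OF F]) (use le_n in auto)
 moreover have "(\<integral>x. indicat_real ?A x *\<^sub>R (- x) \<partial>\<nu>) = F"
  by (rule integral_monotone_convergence[OF int mono lim F]) measurable
 moreover have "(\<integral>x. indicat_real ?A x *\<^sub>R (- x) \<partial>\<nu>) = - (LINT x:?A|\<nu>. x)"
  unfolding set_lebesgue_integral_def by (subst Bochner_Integration.integral_minus[symmetric]) (auto intro!: Bochner_Integration.integral_cong)
 ultimately show ?thesis by (simp add: bv_drift_def)
qed

text \<open>Stationarity gives the bound for each pair of times, countability for all grid times at
  once, and right continuity for all times.\<close>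

lemma increments_bounded:
 assumes le: "!!t. 0 <= t ==> AE w in M. X t w <= \<delta> * t"
 shows "AE w in M. ALL s t. 0 <= s --> s <= t --> X t w - X s w <= \<delta> * (t - s)"
proof -
 have inc: "AE w in M. X (s + t) w - X s w <= \<delta> * t" if s: "0 <= s" and t: "0 <= t" for s t
 proof -
  have [measurable]: "X t \<in> borel_measurable M" "X s \<in> borel_measurable M" "X (s + t) \<in> borel_measurable M"
   using random_variable_X s t by auto
  have "AE y in distr M borel (X t). y <= \<delta> * t" using le[OF t] by (subst AE_distr_iff) auto
  hence "AE y in distr M borel (%w. X (s + t) w - X s w). y <= \<delta> * t" unfolding stationary_increments[OF s t] .
  thus ?thesis by (rule AE_distrD[rotated]) measurable
 qed
 have "AE w in M. ALL n i j :: nat. X (real i / real (Suc n) + real j / real (Suc n)) w - X (real i / real (Suc n)) w <= \<delta> * (real j / real (Suc n))"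
  unfolding AE_all_countable by (intro allI inc) auto
 with cadlag_paths show ?thesis
 proof eventually_elim
  case (elim w)
  show ?case
  proof (intro allI impI)
   fix s t :: real assume s: "0 <= s" and st: "s <= t"
   have lim: "(%n. X (upper_grid n r) w) \<longlonglongrightarrow> X r w" if r: "0 <= r" for r
   proof -
    have "((%t. X t w) \<longlongrightarrow> X r w) (at_right r)" using elim(1) r by (simp add: cadlag_def continuous_within)
    from filterlim_compose[OF this upper_grid_at_right[OF r]] show ?thesis .
   qed
   have g: "(%n. upper_grid n r) \<longlonglongrightarrow> r" if "0 <= r" for r using upper_grid_at_right[OF that] by (simp add: filterlim_at)
   have le_n: "X (upper_grid n t) w - X (upper_grid n s) w <= \<delta> * (upper_grid n t - upper_grid n s)" for n
   proof -
    define i where "i = Suc (nat \<lfloor>real (Suc n) * s\<rfloor>)"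
    define j where "j = Suc (nat \<lfloor>real (Suc n) * t\<rfloor>) - i"
    have "nat \<lfloor>real (Suc n) * s\<rfloor> <= nat \<lfloor>real (Suc n) * t\<rfloor>" using st by (intro nat_mono floor_mono mult_left_mono) auto
    hence "i + j = Suc (nat \<lfloor>real (Suc n) * t\<rfloor>)" by (simp add: i_def j_def)
    hence "upper_grid n t = real i / real (Suc n) + real j / real (Suc n)"
     unfolding upper_grid_def add_divide_distrib[symmetric] of_nat_add[symmetric] by simp
    moreover have "upper_grid n s = real i / real (Suc n)" by (simp add: upper_grid_def i_def)
    ultimately show ?thesis using elim(2) by simp
   qed
   show "X t w - X s w <= \<delta> * (t - s)"
    by (rule LIMSEQ_le[OF tendsto_diff[OF lim lim] tendsto_mult[OF tendsto_const tendsto_diff[OF g g]]]) (use s st le_n in auto)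
  qed
 qed
qed

text \<open>If \<open>X\<close> never exceeded the line of slope \<open>\<delta>\<close>, then
  \<open>\<delta> * t - X t w\<close> would be nondecreasing in \<open>t\<close>. The paths would
  have bounded variation, so the drift would be larger than \<open>\<delta>\<close> by hypothesis,
  while the exponent would be at most \<open>\<delta> * \<theta>\<close>, which bounds the drift by
  \<open>\<delta>\<close>.\<close>

lemma positive_with_drift:
 assumes \<delta>: "0 <= \<delta>" and bv: "bounded_variation_paths M X ==> \<delta> < bv_drift \<gamma> \<nu>"
 shows "EX t>=0. \<not> (AE w in M. X t w <= \<delta> * t)"
proof (rule ccontr)
 assume "\<not> ?thesis"
 hence le: "AE w in M. X t w <= \<delta> * t" if "0 <= t" for t using that by auto
 have inc: "AE w in M. ALL s t. 0 <= s --> s <= t --> X t w - X s w <= \<delta> * (t - s)"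
  by (rule increments_bounded) (rule le)
 have BV: "bounded_variation_paths M X"
  unfolding bounded_variation_paths_def using inc
 proof eventually_elim
  case (elim w)
  show ?case
  proof (intro allI impI)
   fix T :: real assume T: "0 <= T"
   show "bounded_variation_upto (%t. X t w) T"
    unfolding bounded_variation_upto_def
   proof (intro exI allI impI)
    fix n and ts :: "nat => real" assume ts: "mono ts & range ts \<subseteq> {0..T}"
    have r: "0 <= ts i" "ts i <= T" for i using ts by (auto simp: image_subset_iff)
    \<comment> \<open>An increment that is at most \<open>\<delta>\<close> times the elapsed time
      has absolute value at most \<open>2 * \<delta>\<close> times that time minus the increment,
      and such terms telescope.\<close>
    have "(\<Sum>i<n. \<bar>X (ts (Suc i)) w - X (ts i) w\<bar>) <= (\<Sum>i<n. (2 * \<delta> * ts (Suc i) - X (ts (Suc i)) w) - (2 * \<delta> * ts i - X (ts i) w))"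
    proof (rule sum_mono)
     fix i
     have m: "ts i <= ts (Suc i)" using ts by (intro monoD[of ts]) auto
     hence "X (ts (Suc i)) w - X (ts i) w <= \<delta> * (ts (Suc i) - ts i)" using elim[rule_format, OF r(1) m] by simp
     moreover have "0 <= \<delta> * (ts (Suc i) - ts i)" using m \<delta> by simp
     ultimately show "\<bar>X (ts (Suc i)) w - X (ts i) w\<bar> <= (2 * \<delta> * ts (Suc i) - X (ts (Suc i)) w) - (2 * \<delta> * ts i - X (ts i) w)"
      unfolding abs_le_iff right_diff_distrib by linarith
    qed
    also have "... = (2 * \<delta> * ts n - X (ts n) w) - (2 * \<delta> * ts 0 - X (ts 0) w)" by (rule sum_lessThan_telescope)
    also have "... <= 4 * \<delta> * T + X 0 w - X T w"
    proof -
     have "X T w - X (ts n) w <= \<delta> * (T - ts n)" "X (ts 0) w - X 0 w <= \<delta> * (ts 0 - 0)"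
      using elim[rule_format, OF r(1) r(2)] elim[rule_format, OF order_refl r(1)] by auto
     moreover have "\<delta> * ts n <= \<delta> * T" "0 <= \<delta> * ts 0" "0 <= \<delta> * T" using r \<delta> T by (auto intro: mult_left_mono)
     ultimately show ?thesis by (simp add: algebra_simps)
    qed
    finally show "(\<Sum>i<n. \<bar>X (ts (Suc i)) w - X (ts i) w\<bar>) <= 4 * \<delta> * T + X 0 w - X T w" .
   qed
  qed
 qed
 have "psi \<theta> <= \<delta> * \<theta>" if th: "1 <= \<theta>" for \<theta>
 proof -
  have "exp (1 * psi \<theta>) <= expectation (%w. exp (\<delta> * \<theta>))"
   unfolding exp_X(2)[of \<theta> 1, symmetric, OF order_trans[OF zero_le_one th] zero_le_one]
  proof (rule integral_mono_AE)
   show "AE w in M. exp (\<theta> * X 1 w) <= exp (\<delta> * \<theta>)" using le[of 1]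
    by (auto elim!: eventually_mono) (use th in \<open>simp add: mult.commute mult_left_mono\<close>)
  qed (use exp_X(1)[of \<theta> 1] th in auto)
  thus ?thesis by (simp add: prob_space)
 qed
 hence "bv_drift \<gamma> \<nu> <= \<delta>" by (rule bv_drift_le)
 thus False using bv[OF BV] by linarith
qed

text \<open>The exponential Markov inequality read as a lower bound on the exponent:
  \<open>X t w - \<delta> * t\<close> is at least some \<open>a > 0\<close> with probability
  \<open>p > 0\<close>, so the exponent of \<open>Y\<close> is at least (ln p + \<theta> * a) /
  t.\<close>

lemma psi_large:
 assumes \<delta>: "0 <= \<delta>" and bv: "bounded_variation_paths M X ==> \<delta> < bv_drift \<gamma> \<nu>"
 shows "\<forall>\<^sub>F \<theta> in at_top. B < psi \<theta> - \<delta> * \<theta>"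
proof -
 have "EX t>=0. \<not> (AE w in M. X t w <= \<delta> * t)" by (rule positive_with_drift[OF \<delta>]) (erule bv)
 then obtain t where t: "0 <= t" and n: "\<not> (AE w in M. X t w <= \<delta> * t)" by (elim exE conjE)
 have [measurable]: "X t \<in> borel_measurable M" using random_variable_X t by auto
 have "t ~= 0"
 proof
  assume "t = 0"
  have "AE w in M. X t w <= \<delta> * t" using start_zero by eventually_elim (simp add: \<open>t = 0\<close>)
  thus False using n by simp
 qed
 hence t0: "0 < t" using t by simp
 have "EX k::nat. \<not> (AE w in M. X t w - \<delta> * t < 1 / real (Suc k))"
 proof (rule ccontr)
  assume "\<not> ?thesis"
  hence "AE w in M. ALL k::nat. X t w - \<delta> * t < 1 / real (Suc k)" unfolding AE_all_countable not_ex not_not .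
  hence "AE w in M. X t w <= \<delta> * t"
  proof eventually_elim
   case (elim w)
   show ?case
   proof (rule ccontr)
    assume "\<not> ?thesis"
    then obtain k where "1 / real (Suc k) < X t w - \<delta> * t" using reals_Archimedean[of "X t w - \<delta> * t"] unfolding inverse_eq_divide by auto
    thus False using elim[rule_format, of k] by linarith
   qed
  qed
  thus False using n by simp
 qed
 then obtain k where k: "\<not> (AE w in M. X t w - \<delta> * t < 1 / real (Suc k))" ..
 define a where "a = 1 / real (Suc k)"
 have a: "0 < a" by (simp add: a_def)
 define p where "p = prob {w \<in> space M. a <= X t w - \<delta> * t}"
 have "p ~= 0"
 proof
  assume "p = 0"
  hence "AE w in M. \<not> (a <= X t w - \<delta> * t)" unfolding p_def
   by (subst AE_iff_measurable[of "{w \<in> space M. a <= X t w - \<delta> * t}"]) (auto simp: emeasure_eq_measure)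
  thus False using k by (simp add: a_def not_le)
 qed
 hence p: "0 < p" by (simp add: p_def zero_less_measure_iff)
 have ge: "(ln p + \<theta> * a) / t <= psi \<theta> - \<delta> * \<theta>" if th: "0 <= \<theta>" for \<theta>
 proof -
  have "p * exp (\<theta> * (a + \<delta> * t)) = (\<integral>w. exp (\<theta> * (a + \<delta> * t)) * indicator {w \<in> space M. a <= X t w - \<delta> * t} w \<partial>M)"
   by (simp add: p_def)
  also have "... <= expectation (%w. exp (\<theta> * X t w))"
  proof (rule integral_mono)
   fix w show "exp (\<theta> * (a + \<delta> * t)) * indicator {w \<in> space M. a <= X t w - \<delta> * t} w <= exp (\<theta> * X t w)"
    using th by (auto simp: indicator_def intro!: mult_left_mono)
   have "{w \<in> space M. a <= X t w - \<delta> * t} \<in> sets M" by measurable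
   thus "integrable M (%w. exp (\<theta> * (a + \<delta> * t)) * indicator {w \<in> space M. a <= X t w - \<delta> * t} w)"
    by (intro integrable_mult_right integrable_real_indicator) (auto simp: emeasure_eq_measure)
  qed (rule exp_X(1)[OF th t])
  also have "... = exp (t * psi \<theta>)" by (rule exp_X(2)[OF th t])
  finally have "exp (ln p + \<theta> * (a + \<delta> * t)) <= exp (t * psi \<theta>)" using p by (simp add: exp_add)
  hence "ln p + \<theta> * a <= t * (psi \<theta> - \<delta> * \<theta>)" by (simp add: algebra_simps)
  thus ?thesis using t0 by (simp add: divide_le_eq mult.commute)
 qed
 have "filterlim (%\<theta>. (ln p + \<theta> * a) / t) at_top at_top" using a t0 by real_asymp
 hence "\<forall>\<^sub>F \<theta> in at_top. B < (ln p + \<theta> * a) / t" by (simp add: filterlim_at_top_dense)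
 thus ?thesis using eventually_ge_at_top[of 0] by eventually_elim (use ge in force)
qed

end

section \<open>Largest roots of the exponents and positivity of scale functions\<close>

lemma right_inverse_facts:
 fixes \<psi> :: "real => real"
 assumes cont: "continuous_on {0..} \<psi>" and zero: "\<psi> 0 = 0" and q: "0 < q" and large: "!!B. \<forall>\<^sub>F \<theta> in at_top. B < \<psi> \<theta>"
 shows "0 < right_inverse \<psi> q" "\<psi> (right_inverse \<psi> q) = q" "!!\<theta>. right_inverse \<psi> q < \<theta> ==> q < \<psi> \<theta>"
proof -
 let ?S = "{l. 0 <= l & \<psi> l = q}" and ?P = "right_inverse \<psi> q"
 obtain N where N: "!!\<theta>. N <= \<theta> ==> q < \<psi> \<theta>" using large[of q] unfolding eventually_at_top_linorder by auto
 \<comment> \<open>Intermediate values: since \<open>\<psi>\<close> tends to infinity, a point with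
   value at most \<open>q\<close> has a root at or to the right of it. Beyond the largest root no
   such point can exist.\<close>
 have root: "EX l. s <= l & \<psi> l = q" if s: "0 <= s" "\<psi> s <= q" for s
 proof -
  have "EX x. s <= x & x <= max s N & \<psi> x = q"
   using s N[of "max s N"] by (intro IVT' continuous_on_subset[OF cont]) auto
  thus ?thesis by auto
 qed
 have ne: "?S ~= {}" using root[of 0] zero q by auto
 have bdd: "bdd_above ?S"
 proof (rule bdd_aboveI[of _ N])
  fix x assume "x \<in> ?S"
  thus "x <= N" using N[of x] by (cases "x <= N") auto
 qed
 have "closed ?S"
 proof -
  have "closedin (top_of_set {0..}) ({0..} \<inter> \<psi> -` {q})" by (rule continuous_closedin_preimage[OF cont]) auto
  hence "closed ({0..} \<inter> \<psi> -` {q})" by (rule closedin_closed_trans) auto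
  moreover have "{0..} \<inter> \<psi> -` {q} = ?S" by auto
  ultimately show ?thesis by simp
 qed
 hence mem: "?P \<in> ?S" unfolding right_inverse_def by (rule closed_contains_Sup[OF ne bdd])
 thus "\<psi> ?P = q" by simp
 thus pos: "0 < ?P" using mem zero q by (cases "?P = 0") auto
 fix \<theta> assume th: "?P < \<theta>"
 show "q < \<psi> \<theta>"
 proof (rule ccontr)
  assume "\<not> q < \<psi> \<theta>"
  then obtain l where l: "\<theta> <= l" "\<psi> l = q" using root[of \<theta>] th pos by auto
  hence "l <= ?P" unfolding right_inverse_def by (intro cSup_upper bdd) (use th pos in auto)
  thus False using l th by simp
 qed
qed

text \<open>A scale function that is negative at 0 has a zero \<open>x1 > 0\<close>; its transform then decays at least
 like \<open>exp (- \<theta> x1)\<close>, against the quadratic growth of the exponent.\<close>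

lemma scale_function_facts:
 fixes \<psi> :: "real => real"
 assumes W: "scale_function \<psi> q W" and gt: "!!\<theta>. right_inverse \<psi> q < \<theta> ==> q < \<psi> \<theta>"
  and P: "0 < right_inverse \<psi> q" and growth: "!!\<theta>. 1 <= \<theta> ==> \<psi> \<theta> <= K * \<theta>\<^sup>2" and q: "0 < q"
 shows "scale_calculus W" "W \<in> borel_measurable borel" "!!x. 0 < x ==> 0 < W x"
  "!!\<theta>. right_inverse \<psi> q < \<theta> ==> (\<integral>\<^sup>+x. ennreal (exp (- (\<theta> * x)) * W x) \<partial>lborel) = ennreal (1 / (\<psi> \<theta> - q))"
proof -
 let ?P = "right_inverse \<psi> q"
 have neg: "!!x. x < 0 ==> W x = 0" and cont: "continuous_on {0..} W" and mono: "strict_mono_on {0..} W"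
  and int: "!!\<theta>. ?P < \<theta> ==> set_integrable lborel {0..} (%x. exp (- (\<theta> * x)) * W x)"
  and eq: "!!\<theta>. ?P < \<theta> ==> (LBINT x:{0..}. exp (- (\<theta> * x)) * W x) = 1 / (\<psi> \<theta> - q)"
  using W unfolding scale_function_def by auto
 have mono': "W x <= W y" if "0 <= x" "x <= y" for x y
  using strict_mono_onD[OF mono, of x y] that by (cases "x = y") (auto intro: less_imp_le)
 have W0: "0 <= W 0"
 proof (rule ccontr)
  assume n: "\<not> 0 <= W 0"
  define \<theta>1 where "\<theta>1 = ?P + 1"
  have th1: "?P < \<theta>1" by (simp add: \<theta>1_def)
  have "EX y>=0. 0 <= W y"
  proof (rule ccontr)
   assume n: "\<not> ?thesis"
   have "(LBINT x:{0..}. exp (- (\<theta>1 * x)) * W x) <= (LBINT x:{0::real..}. 0)"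
   proof (rule set_integral_mono[OF int[OF th1]])
    show "set_integrable lborel {0..} (%x::real. 0 :: real)" by (simp add: set_integrable_def)
    fix x :: real assume "x \<in> {0..}"
    hence "W x <= 0" using n by (meson atLeast_iff linear)
    thus "exp (- (\<theta>1 * x)) * W x <= 0" by (simp add: mult_le_0_iff)
   qed
   thus False using eq[OF th1] gt[OF th1] by simp
  qed
  then obtain y where y: "0 <= y" "0 <= W y" by (elim exE conjE)
  have "EX x>=0. x <= y & W x = 0"
   by (rule IVT') (use n y continuous_on_subset[OF cont, of "{0..y}"] in \<open>simp_all add: subset_eq\<close>)
  then obtain x1 where x1: "0 <= x1" "W x1 = 0" by (elim exE conjE)
  hence x1p: "0 < x1" using n by (cases "x1 = 0") simp_all
  \<comment> \<open>\<open>exp (- ((\<theta> - \<theta>1) * x))\<close> passes through its value at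
    \<open>x1\<close> exactly where \<open>W\<close> changes sign, so replacing it by that value can
    only increase the integral.\<close>
  have le: "1 / (\<psi> \<theta> - q) <= exp (- ((\<theta> - \<theta>1) * x1)) * (1 / (\<psi> \<theta>1 - q))" if th: "\<theta>1 < \<theta>" for \<theta>
  proof -
   have "(LBINT x:{0..}. exp (- (\<theta> * x)) * W x) <= (LBINT x:{0..}. exp (- ((\<theta> - \<theta>1) * x1)) * (exp (- (\<theta>1 * x)) * W x))"
   proof (intro set_integral_mono int set_integrable_mult_right th1)
    show "?P < \<theta>" using th1 th by simp
    fix x :: real assume x: "x \<in> {0..}"
    have e: "exp (- (\<theta> * x)) = exp (- ((\<theta> - \<theta>1) * x)) * exp (- (\<theta>1 * x))" by (simp add: exp_add[symmetric] algebra_simps)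
    have "exp (- ((\<theta> - \<theta>1) * x)) * W x <= exp (- ((\<theta> - \<theta>1) * x1)) * W x"
    proof (cases "x <= x1")
     case True
     hence "W x <= 0" using mono'[of x x1] x x1 by simp
     moreover have "exp (- ((\<theta> - \<theta>1) * x1)) <= exp (- ((\<theta> - \<theta>1) * x))" using True th by simp
     ultimately show ?thesis by (rule mult_right_mono_neg[rotated])
    next
     case False
     hence "0 <= W x" using mono'[of x1 x] x1 by simp
     moreover have "exp (- ((\<theta> - \<theta>1) * x)) <= exp (- ((\<theta> - \<theta>1) * x1))" using False th by simp
     ultimately show ?thesis by (intro mult_right_mono)
    qed
    hence "exp (- (\<theta>1 * x)) * (exp (- ((\<theta> - \<theta>1) * x)) * W x) <= exp (- (\<theta>1 * x)) * (exp (- ((\<theta> - \<theta>1) * x1)) * W x)"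
     by (rule mult_left_mono) simp
    thus "exp (- (\<theta> * x)) * W x <= exp (- ((\<theta> - \<theta>1) * x1)) * (exp (- (\<theta>1 * x)) * W x)"
     unfolding e by (simp only: mult.assoc mult.left_commute)
   qed
   thus ?thesis using eq[of \<theta>] eq[OF th1] th th1 by simp
  qed
  define c where "c = \<psi> \<theta>1 - q"
  have c: "0 < c" using gt[OF th1] by (simp add: c_def)
  have "\<forall>\<^sub>F \<theta> in at_top. \<bar>K\<bar> * \<theta>\<^sup>2 < c * exp ((\<theta> - \<theta>1) * x1)" using c x1p by real_asymp
  hence "\<forall>\<^sub>F \<theta>::real in at_top. False"
   using eventually_gt_at_top[of \<theta>1] eventually_ge_at_top[of 1]
  proof eventually_elim
   case (elim \<theta>)
   have g: "0 < \<psi> \<theta> - q" using gt[of \<theta>] elim th1 by simp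
   have "1 / (\<psi> \<theta> - q) * (c * exp ((\<theta> - \<theta>1) * x1)) <= exp (- ((\<theta> - \<theta>1) * x1)) * (1 / c) * (c * exp ((\<theta> - \<theta>1) * x1))"
    using le[OF elim(2)] c by (intro mult_right_mono) (auto simp: c_def)
   also have "... = 1" using c by (simp add: exp_minus)
   finally have "c * exp ((\<theta> - \<theta>1) * x1) <= \<psi> \<theta> - q" using g by (simp add: field_simps)
   moreover have "K * \<theta>\<^sup>2 <= \<bar>K\<bar> * \<theta>\<^sup>2" by (intro mult_right_mono) auto
   ultimately show False using elim(1) growth[OF elim(3)] q by linarith
  qed
  thus False by simp
 qed
 have ge0: "0 <= W x" for x using neg[of x] mono'[of 0 x] W0 by (cases "x < 0") auto
 show sc: "scale_calculus W" by unfold_locales (auto intro: neg cont mono' ge0)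
 interpret scale_calculus W q by (rule sc)
 show [measurable]: "W \<in> borel_measurable borel" by (rule W_borel)
 show "0 < W x" if "0 < x" for x using strict_mono_onD[OF mono, of 0 x] that W0 by auto
 fix \<theta> assume th: "?P < \<theta>"
 have e: "indicat_real {0..} x *\<^sub>R (exp (- (\<theta> * x)) * W x) = exp (- (\<theta> * x)) * W x" for x using neg[of x] by (auto simp: indicator_def)
 show "(\<integral>\<^sup>+x. ennreal (exp (- (\<theta> * x)) * W x) \<partial>lborel) = ennreal (1 / (\<psi> \<theta> - q))"
  using int[OF th] eq[OF th] unfolding set_integrable_def set_lebesgue_integral_def e
  by (subst nn_integral_eq_integral) (auto intro!: mult_nonneg_nonneg ge0)
qed

section \<open>The expected discounted reflection\<close>

lemma le_liminf_ennreal: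
 assumes ev: "!!\<kappa>. 0 < \<kappa> ==> \<forall>\<^sub>F n in sequentially. x <= y n + \<kappa>"
 shows "ennreal x <= liminf (%n. ennreal (y n))"
 unfolding le_Liminf_iff
proof (intro allI impI)
 fix z assume z: "z < ennreal x"
 then obtain r where r: "z = ennreal r" "0 <= r" by (cases z) auto
 hence "r < x" using z by (simp add: ennreal_less_iff)
 hence "0 < (x - r) / 2" by simp
 from ev[OF this] show "\<forall>\<^sub>F n in sequentially. z < ennreal (y n)"
 proof eventually_elim
  case (elim n)
  hence "r < y n" using \<open>r < x\<close> by (simp add: field_simps)
  thus ?case using r by (simp add: ennreal_less_iff)
 qed
qed

lemma nn_integral_exp_linear_finite:
 assumes q: "0 < (q::real)" and d: "0 <= d"
 shows "(\<integral>\<^sup>+s. ennreal (q * exp (- (q * s)) * (d * s)) * indicator {0..} s \<partial>lborel) < \<infinity>"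
proof -
 have "(\<integral>\<^sup>+s. ennreal (q * exp (- (q * s)) * (d * s)) * indicator {0..} s \<partial>lborel) = ennreal (0 - (- (d * exp (- (q * 0)) * (0 + 1 / q))))"
 proof (rule nn_integral_FTC_atLeast)
  show "((%s. - (d * exp (- (q * s)) * (s + 1 / q))) \<longlongrightarrow> 0) at_top" using q by real_asymp
  show "0 <= q * exp (- (q * s)) * (d * s)" if "0 <= s" for s using that q d by simp
  show "DERIV (%s. - (d * exp (- (q * s)) * (s + 1 / q))) s :> q * exp (- (q * s)) * (d * s)" for s
   by (rule derivative_eq_intros refl)+ (use q in \<open>simp add: field_simps\<close>)
 qed measurable
 thus ?thesis by simp
qed

text \<open>Independence is a property of the joint law, which does not see null sets.\<close>

lemma (in prob_space) indep_vars_cong_AE: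
 assumes X: "indep_vars (%_. borel) X I" and Y: "!!i. i \<in> I ==> Y i \<in> borel_measurable M"
  and eq: "!!i. i \<in> I ==> AE w in M. Y i w = X i w" and I: "finite I"
 shows "indep_vars (%_. borel) Y I"
proof (cases "I = {}")
 case True thus ?thesis by (simp add: indep_vars_def indep_sets_def)
next
 case False
 have X': "!!i. i \<in> I ==> X i \<in> borel_measurable M" using X by (simp add: indep_vars_def)
 have ae: "AE w in M. \<forall>i\<in>I. Y i w = X i w" using eq I by (intro AE_finite_allI) auto
 have "distr M (PiM I (%_. borel)) (%w. \<lambda>i\<in>I. Y i w) = distr M (PiM I (%_. borel)) (%w. \<lambda>i\<in>I. X i w)"
 proof (rule distr_cong_AE)
  show "AE w in M. (\<lambda>i\<in>I. Y i w) = (\<lambda>i\<in>I. X i w)" using ae by eventually_elim (auto simp: restrict_def)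
 qed (use X' Y in \<open>auto intro!: measurable_restrict\<close>)
 also have "... = PiM I (%i. distr M borel (X i))"
  using X False X' by (simp add: indep_vars_iff_distr_eq_PiM')
 also have "... = PiM I (%i. distr M borel (Y i))"
 proof (intro PiM_cong refl distr_cong_AE)
  fix i assume i: "i \<in> I"
  show "AE w in M. X i w = Y i w" using eq[OF i] by eventually_elim simp
 qed (use X' Y in auto)
 finally show ?thesis using False Y by (simp add: indep_vars_iff_distr_eq_PiM')
qed

locale rr_levy = spectrally_negative_levy M X \<gamma> \<sigma> \<nu>
 for M :: "'a measure" and X \<gamma> \<sigma> \<nu> +
 fixes V :: "real => 'a => real" and x b \<delta> q m :: real and W WY :: "real => real" and G :: "'a set"
 assumes b0: "0 < b" and d0: "0 <= \<delta>" and q0: "0 < q"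
  and bv: "bounded_variation_paths M X ==> \<delta> < bv_drift \<gamma> \<nu>"
  and m: "(deriv (levy_khintchine \<gamma> \<sigma> \<nu>) \<longlongrightarrow> m) (at_right 0)"
  and W_scale: "scale_function (levy_khintchine \<gamma> \<sigma> \<nu>) q W"
  and WY_scale: "scale_function (%\<theta>. levy_khintchine \<gamma> \<sigma> \<nu> \<theta> - \<delta> * \<theta>) q WY"
  and V_rv: "!!t. 0 <= t ==> V t \<in> borel_measurable M"
  and G_sets [measurable]: "G \<in> sets M" and G_AE: "AE w in M. w \<in> G"
  and G_zero: "!!w. w \<in> G ==> X 0 w = 0"
  and G_path: "!!w. w \<in> G ==> rr_path \<delta> b (%t. x + X t w) (%t. V t w)"
begin

text \<open>Outside the full-measure set \<open>G\<close> and at negative times the processes are set to 0; this makes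
 them jointly measurable.\<close>

definition restricted :: "(real => 'a => real) => real => 'a => real" where
 "restricted Y t w = (if 0 <= t & w \<in> G then Y t w else 0)"

lemma restricted_AE: "0 <= t ==> AE w in M. restricted Y t w = Y t w"
 using G_AE by eventually_elim (simp add: restricted_def)

lemma restricted_measurable:
 assumes "!!t. 0 <= t ==> (%w. if w \<in> G then Y t w else 0) \<in> borel_measurable M"
  and "!!t w. w \<in> G ==> 0 <= t ==> continuous (at_right t) (%t. Y t w)"
 shows "(%(t, w). restricted Y t w) \<in> borel_measurable (borel \<Otimes>\<^sub>M M)"
proof (rule right_continuous_process_measurable)
 fix t :: real assume t: "0 <= t"
 hence "restricted Y t = (%w. if w \<in> G then Y t w else 0)" by (simp add: restricted_def fun_eq_iff)
 thus "restricted Y t \<in> borel_measurable M" using assms(1)[OF t] by simp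
 fix w
 show "continuous (at_right t) (%t. restricted Y t w)"
 proof (cases "w \<in> G")
  case True
  have "\<forall>\<^sub>F u in at_right t. Y u w = restricted Y u w"
   unfolding eventually_at_right_field using t True by (intro exI[of _ "t + 1"]) (simp add: restricted_def)
  moreover have "((%u. Y u w) \<longlongrightarrow> Y t w) (at_right t)" using assms(2)[OF True t] by (simp add: continuous_within)
  ultimately have "((%u. restricted Y u w) \<longlongrightarrow> Y t w) (at_right t)" by (rule Lim_transform_eventually[rotated])
  thus ?thesis using t True by (simp add: continuous_within restricted_def)
 qed (simp add: restricted_def)
qed (simp add: restricted_def)

abbreviation "X' \<equiv> restricted X"

lemma X_measurable: "0 <= t ==> X t \<in> borel_measurable M"
 by (rule random_variable_X)

lemma X'_joint: "(%(t, w). X' t w) \<in> borel_measurable (borel \<Otimes>\<^sub>M M)"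
proof (rule restricted_measurable)
 fix t :: real assume t: "0 <= t"
 have [measurable]: "X t \<in> borel_measurable M" by (rule X_measurable[OF t])
 show "(%w. if w \<in> G then X t w else 0) \<in> borel_measurable M" by measurable
 fix w assume "w \<in> G"
 then interpret rr_path \<delta> b "%t. x + X t w" "%t. V t w" by (rule G_path)
 have "((%t. (x + X t w) - x) \<longlongrightarrow> (x + X t w) - x) (at_right t)"
  using cadlag t by (intro tendsto_diff tendsto_const) (simp add: cadlag_def continuous_within)
 thus "continuous (at_right t) (%t. X t w)" by (simp add: continuous_within)
qed

lemma X'_meas: "X' t \<in> borel_measurable M"
 using measurable_Pair2[OF X'_joint, of t] by simp

definition K where "K = (SOME K. ALL \<theta>>=1. psi \<theta> <= K * \<theta>\<^sup>2)"
abbreviation "Phi \<equiv> right_inverse psi q"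
abbreviation "phi \<equiv> right_inverse (%\<theta>. psi \<theta> - \<delta> * \<theta>) q"

lemma K: "1 <= \<theta> ==> psi \<theta> <= K * \<theta>\<^sup>2"
 unfolding K_def using someI_ex[OF psi_growth] by blast

lemma psiY_continuous: "continuous_on {0..} (%\<theta>. psi \<theta> - \<delta> * \<theta>)"
 by (intro continuous_intros psi_continuous)

lemma psiY_large: "\<forall>\<^sub>F \<theta> in at_top. B < psi \<theta> - \<delta> * \<theta>"
 by (rule psi_large[OF d0]) (rule bv)

lemma psi_tends: "\<forall>\<^sub>F \<theta> in at_top. B < psi \<theta>"
 using psiY_large[of B] eventually_ge_at_top[of 0]
proof eventually_elim
 case (elim \<theta>)
 have "0 <= \<delta> * \<theta>" using elim(2) d0 by simp
 thus ?case using elim(1) by linarith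
qed

lemma psiY_0: "psi 0 - \<delta> * 0 = 0"
 by (simp add: psi_0)

lemmas Phi = right_inverse_facts[OF psi_continuous psi_0 q0 psi_tends]
lemmas phi = right_inverse_facts[OF psiY_continuous psiY_0 q0 psiY_large]

lemma K_Y: "1 <= \<theta> ==> psi \<theta> - \<delta> * \<theta> <= K * \<theta>\<^sup>2"
 using K[of \<theta>] mult_nonneg_nonneg[OF d0, of \<theta>] by linarith

lemmas W_facts = scale_function_facts[OF W_scale Phi(3,1) K q0]
lemmas WY_facts = scale_function_facts[OF WY_scale phi(3,1) K_Y q0]

lemma Phi_less_phi: "0 < \<delta> ==> Phi < phi"
proof (rule ccontr)
 assume d: "0 < \<delta>" and n: "\<not> Phi < phi"
 have "q <= psi Phi - \<delta> * Phi" using n phi(2) phi(3)[of Phi] by (cases "Phi = phi") auto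
 moreover have "0 < \<delta> * Phi" using d Phi(1) by simp
 ultimately show False using Phi(2) by linarith
qed

lemma exp_X':
 assumes "0 <= t" "0 <= \<theta>"
 shows "integrable M (%w. exp (\<theta> * X' t w))" "expectation (%w. exp (\<theta> * X' t w)) = exp (t * psi \<theta>)"
proof -
 have [measurable]: "X t \<in> borel_measurable M" "X' t \<in> borel_measurable M" by (auto intro: X_measurable[OF assms(1)] X'_meas)
 have ae: "AE w in M. exp (\<theta> * X' t w) = exp (\<theta> * X t w)" using restricted_AE[OF assms(1), of X] by eventually_elim simp
 show "integrable M (%w. exp (\<theta> * X' t w))" by (subst integrable_cong_AE[OF _ _ ae]) (auto intro!: exp_X assms)
 have "expectation (%w. exp (\<theta> * X' t w)) = expectation (%w. exp (\<theta> * X t w))" by (rule integral_cong_AE[OF _ _ ae]) measurable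
 thus "expectation (%w. exp (\<theta> * X' t w)) = exp (t * psi \<theta>)" using exp_X(2)[OF assms(2,1)] by simp
qed

lemma mean_X':
 assumes "0 <= t"
 shows "integrable M (X' t)" "expectation (X' t) = m * t"
proof -
 have [measurable]: "X t \<in> borel_measurable M" "X' t \<in> borel_measurable M" by (auto intro: X_measurable[OF assms] X'_meas)
 show "integrable M (X' t)" by (subst integrable_cong_AE[OF _ _ restricted_AE[OF assms]]) (auto intro!: X_mean(1)[OF m assms])
 have "expectation (X' t) = expectation (X t)" by (rule integral_cong_AE[OF _ _ restricted_AE[OF assms]]) measurable
 thus "expectation (X' t) = m * t" using X_mean(2)[OF m assms] by simp
qed

lemma exp_Y':
 assumes "0 <= t" "0 <= \<theta>"
 shows "integrable M (%w. exp (\<theta> * (X' t w - \<delta> * t)))"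
  "expectation (%w. exp (\<theta> * (X' t w - \<delta> * t))) = exp (t * (psi \<theta> - \<delta> * \<theta>))"
proof -
 have e: "(%w. exp (\<theta> * (X' t w - \<delta> * t))) = (%w. exp (- (\<theta> * (\<delta> * t))) * exp (\<theta> * X' t w))"
  by (simp add: fun_eq_iff exp_add[symmetric] algebra_simps)
 show "integrable M (%w. exp (\<theta> * (X' t w - \<delta> * t)))" unfolding e by (intro integrable_mult_right exp_X' assms)
 show "expectation (%w. exp (\<theta> * (X' t w - \<delta> * t))) = exp (t * (psi \<theta> - \<delta> * \<theta>))"
  unfolding e integral_mult_right_zero exp_X'(2)[OF assms] by (simp add: exp_add[symmetric] algebra_simps)
qed

lemma increment_AE: "AE w in M. X' (real (Suc i) / real n) w - X' (real i / real n) w = X (real (Suc i) / real n) w - X (real i / real n) w"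
 using G_AE by eventually_elim (simp add: restricted_def)

sublocale R: levy_refraction M X' psi m K q Phi W \<delta> phi WY b
proof -
 have exp': "exponential_process M X' psi"
  unfolding exponential_process_def exponential_process_axioms_def using prob_space_axioms X'_joint exp_X' by blast
 have joint_Y: "(%(t, w). X' t w - \<delta> * t) \<in> borel_measurable (borel \<Otimes>\<^sub>M M)"
 proof -
  note X'_joint[measurable]
  have "(%p. (case p of (t, w) => X' t w) - \<delta> * fst p) \<in> borel_measurable (borel \<Otimes>\<^sub>M M)" by measurable
  thus ?thesis by (simp add: case_prod_unfold)
 qed
 have expY: "exponential_process M (%t w. X' t w - \<delta> * t) (%\<theta>. psi \<theta> - \<delta> * \<theta>)"
  unfolding exponential_process_def exponential_process_axioms_def using prob_space_axioms joint_Y exp_Y' by blast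
 have LX: "levy_marginals M X' psi m K"
  unfolding levy_marginals_def levy_marginals_axioms_def using exp' mean_X' K by blast
 have W_ge0: "0 <= W z" "0 <= WY z" for z
  using scale_calculus.W_ge0[OF W_facts(1)] scale_calculus.W_ge0[OF WY_facts(1)] by auto
 have SX: "scaled_process M X' psi q Phi W"
  unfolding scaled_process_def scaled_process_axioms_def using exp' Phi W_facts(2,4) W_ge0 by (auto intro: less_imp_le)
 have SY: "scaled_process M (%t w. X' t w - \<delta> * t) (%\<theta>. psi \<theta> - \<delta> * \<theta>) q phi WY"
  unfolding scaled_process_def scaled_process_axioms_def using expY phi WY_facts(2,4) W_ge0 by (auto intro: less_imp_le)
 have ref: "refraction M X' psi m K q Phi W \<delta> phi WY b"
  unfolding refraction_def refraction_axioms_def using LX SX SY W_facts(1) WY_facts(1) d0 b0 q0 by blast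
 have ind: "indep_vars (%_. borel) (%i w. X' (real (Suc i) / real n) w - X' (real i / real n) w) {..<N}" if n: "0 < n" for n N
 proof (rule indep_vars_cong_AE)
  have "mono (%i. real i / real n)" by (intro monoI divide_right_mono) auto
  thus "indep_vars (%_. borel) (%i w. X (real (Suc i) / real n) w - X (real i / real n) w) {..<N}"
   by (rule independent_increments[rotated]) simp
  show "(%w. X' (real (Suc i) / real n) w - X' (real i / real n) w) \<in> borel_measurable M" for i
   by (intro borel_measurable_diff X'_meas)
 qed (use increment_AE in \<open>simp_all del: of_nat_Suc\<close>)
 have stat: "distr M borel (%w. X' (real (Suc i) / real n) w - X' (real i / real n) w) = distr M borel (X' (1 / real n))" if n: "0 < n" for n i
 proof -
  have "distr M borel (%w. X' (real (Suc i) / real n) w - X' (real i / real n) w) =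
    distr M borel (%w. X (real i / real n + 1 / real n) w - X (real i / real n) w)"
  proof (rule distr_cong_AE)
   show "AE w in M. X' (real (Suc i) / real n) w - X' (real i / real n) w = X (real i / real n + 1 / real n) w - X (real i / real n) w"
    using increment_AE[of i n] by (simp add: add_divide_distrib add.commute)
  qed (auto intro!: borel_measurable_diff X'_meas X_measurable)
  also have "... = distr M borel (X (1 / real n))" by (rule stationary_increments) auto
  also have "... = distr M borel (X' (1 / real n))"
   by (rule distr_cong_AE) (use restricted_AE[of "1 / real n" X] in \<open>auto intro!: X'_meas X_measurable elim!: eventually_mono\<close>)
  finally show ?thesis .
 qed
 show "levy_refraction M X' psi m K q Phi W \<delta> phi WY b"
  unfolding levy_refraction_def levy_refraction_axioms_def using ref ind stat by blast
qed

definition v0 :: real where "v0 = max x 0"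
text \<open>A start below 0 is pushed up to 0 at once; this atom at time 0 carries no discount, and
  the chain starts from \<open>v0\<close>.\<close>

definition r0 :: real where "r0 = max (- x) 0"

lemma v0: "0 <= v0" and r0: "0 <= r0"
 by (auto simp: v0_def r0_def)

definition push :: "nat => real => 'a => nat => real" where
 "push n b' w i = chain_push (\<delta> * (1 / real n)) b' v0 (R.incr n w) i"

definition refl_grid :: "nat => real => real => 'a => real" where
 "refl_grid n b' s w = r0 + (\<Sum>i<nat \<lfloor>real n * s\<rfloor>. push n b' w i)"

lemma push_nonneg: "0 <= push n b' w i"
 by (simp add: push_def chain_push_nonneg)

lemma push_meas [measurable]: "(%w. push n b' w i) \<in> borel_measurable M"
 unfolding push_def by measurable

lemma refl_grid_meas [measurable]: "(%(s, w). refl_grid n b' s w) \<in> borel_measurable (borel \<Otimes>\<^sub>M M)"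
proof -
 have "(%p. r0 + (\<Sum>i<nat \<lfloor>real n * fst p\<rfloor>. push n b' (snd p) i)) \<in> borel_measurable (borel \<Otimes>\<^sub>M M)"
  by (rule measurable_compose_countable[where g="%p. nat \<lfloor>real n * fst p\<rfloor>" and f="%k p. r0 + (\<Sum>i<k. push n b' (snd p) i)"]) measurable
 thus ?thesis by (simp add: refl_grid_def case_prod_unfold)
qed

lemma refl_grid_eq:
 assumes G: "w \<in> G"
 shows "r0 + (\<Sum>i<k. push n b' w i) = grid_reflection (\<delta> / real n) b' (%i. x + X (real i / real n) w) k"
proof -
 have "R.incr n w = grid_increment (%i. x + X (real i / real n) w)"
  using G by (simp add: R.incr_def grid_increment_def restricted_def fun_eq_iff)
 thus ?thesis using G_zero[OF G] by (simp add: grid_reflection_def push_def v0_def r0_def)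
qed

abbreviation NN :: "'a => real => real" where "NN w \<equiv> rr_path.N \<delta> b (%t. x + X t w) (%t. V t w)"
definition N' :: "real => 'a => real" where "N' = restricted (%t w. NN w t)"

text \<open>Right continuity of \<open>V\<close> is read off the Skorokhod equation, whose
  right-hand side is right continuous term by term.\<close>

lemma V'_joint: "(%(t, w). restricted V t w) \<in> borel_measurable (borel \<Otimes>\<^sub>M M)"
proof (rule restricted_measurable)
 fix t :: real assume t: "0 <= t"
 have [measurable]: "V t \<in> borel_measurable M" by (rule V_rv[OF t])
 show "(%w. if w \<in> G then V t w else 0) \<in> borel_measurable M" by measurable
 fix w assume "w \<in> G"
 then interpret P: rr_path \<delta> b "%t. x + X t w" "%t. V t w" by (rule G_path)
 have f: "((%t. x + X t w) \<longlongrightarrow> x + X t w) (at_right t)" using P.cadlag t by (simp add: cadlag_def continuous_within)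
 have N: "(P.N \<longlongrightarrow> P.N t) (at_right t)" using P.N_right_continuous[OF t] by (simp add: continuous_within)
 have L: "((%u. cumulative_refraction \<delta> b (%t. V t w) u) \<longlongrightarrow> cumulative_refraction \<delta> b (%t. V t w) t) (at_right t)"
 proof (rule tendsto_sandwich)
  let ?L = "cumulative_refraction \<delta> b (%t. V t w)"
  show "\<forall>\<^sub>F u in at_right t. ?L t <= ?L u" "\<forall>\<^sub>F u in at_right t. ?L u <= ?L t + \<delta> * (u - t)"
   unfolding eventually_at_right_field using t P.L_mono[OF t] P.L_diff_le[OF t]
   by (auto intro!: exI[of _ "t + 1"] simp: diff_le_eq add.commute less_imp_le)
  show "((%u. ?L t + \<delta> * (u - t)) \<longlongrightarrow> ?L t) (at_right t)" by (auto intro!: tendsto_eq_intros)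
 qed auto
 have "((%u. (x + X u w) - cumulative_refraction \<delta> b (%t. V t w) u + P.N u) \<longlongrightarrow> V t w) (at_right t)"
  unfolding P.skorokhod_equation[OF t] by (intro tendsto_intros f N L)
 moreover have "\<forall>\<^sub>F u in at_right t. (x + X u w) - cumulative_refraction \<delta> b (%t. V t w) u + P.N u = V u w"
  unfolding eventually_at_right_field using t by (intro exI[of _ "t + 1"]) (simp add: P.skorokhod_equation)
 ultimately have "((%u. V u w) \<longlongrightarrow> V t w) (at_right t)" by (rule Lim_transform_eventually)
 thus "continuous (at_right t) (%t. V t w)" by (simp add: continuous_within)
qed

text \<open>\<open>N\<close> is a supremum over uncountably many times. Its measurability comes from
  solving the Skorokhod equation for it, with the refraction an integral of the jointly measurable
  \<open>V\<close>.\<close>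

lemma N'_joint [measurable]: "(%(t, w). N' t w) \<in> borel_measurable (borel \<Otimes>\<^sub>M M)"
 unfolding N'_def
proof (rule restricted_measurable)
 fix t :: real assume t: "0 <= t"
 have [measurable]: "V t \<in> borel_measurable M" "X t \<in> borel_measurable M" by (auto intro: V_rv[OF t] X_measurable[OF t])
 define L' where "L' w = \<delta> * (LBINT s. indicator {0..t} s * indicat_real {b<..} (restricted V s w))" for w
 have L'm: "L' \<in> borel_measurable M"
 proof -
  have "(%p. restricted V (snd p) (fst p)) \<in> borel_measurable (M \<Otimes>\<^sub>M borel)"
   using measurable_compose[OF measurable_pair_swap' V'_joint] by (simp add: case_prod_unfold)
  hence [measurable]: "(%p. restricted V (snd p) (fst p)) \<in> borel_measurable (M \<Otimes>\<^sub>M lborel)" by simp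
  have "(%p. indicator {0..t} (snd p) * indicat_real {b<..} (restricted V (snd p) (fst p))) \<in> borel_measurable (M \<Otimes>\<^sub>M lborel)" by measurable
  thus ?thesis unfolding L'_def
   by (intro borel_measurable_times borel_measurable_const lborel.borel_measurable_lebesgue_integral) (simp add: case_prod_unfold)
 qed
 have "NN w t = V t w - (x + X t w) + L' w" if G: "w \<in> G" for w
 proof -
  interpret P: rr_path \<delta> b "%t. x + X t w" "%t. V t w" using G by (rule G_path)
  have "L' w = cumulative_refraction \<delta> b (%t. V t w) t"
   unfolding L'_def cumulative_refraction_def set_lebesgue_integral_def
   by (intro arg_cong[where f="%z. \<delta> * z"] Bochner_Integration.integral_cong refl) (use G in \<open>auto simp: restricted_def indicator_def\<close>)
  thus ?thesis using P.skorokhod_equation[OF t] by simp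
 qed
 hence "(%w. if w \<in> G then NN w t else 0) = (%w. if w \<in> G then V t w - (x + X t w) + L' w else 0)" by auto
 thus "(%w. if w \<in> G then NN w t else 0) \<in> borel_measurable M" using L'm by simp
 fix w assume "w \<in> G"
 then interpret P: rr_path \<delta> b "%t. x + X t w" "%t. V t w" by (rule G_path)
 show "continuous (at_right t) P.N" by (rule P.N_right_continuous[OF t])
qed

lemma N'_nonneg: "0 <= N' t w"
proof (cases "0 <= t & w \<in> G")
 case True
 then interpret P: rr_path \<delta> b "%t. x + X t w" "%t. V t w" by (intro G_path) simp
 show ?thesis using P.N_nn[of t] True by (simp add: N'_def restricted_def)
qed (auto simp: N'_def restricted_def)

text \<open>With this density discounted Stieltjes integrals become ordinary integrals of the
  reflection itself, so pointwise comparison of reflections suffices.\<close>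

definition weight :: "real => real => ennreal" where
 "weight y s = ennreal (q * exp (- (q * s)) * y) * indicator {0..} s"

lemma weight_meas [measurable]: "f \<in> borel_measurable N ==> g \<in> borel_measurable N ==> (%z. weight (f z) (g z)) \<in> borel_measurable N"
proof -
 assume [measurable]: "f \<in> borel_measurable N" "g \<in> borel_measurable N"
 have "(%z. weight (f z) (g z)) = (%z. if 0 <= g z then ennreal (q * exp (- (q * g z)) * f z) else 0)"
  by (simp add: weight_def fun_eq_iff)
 thus ?thesis by simp
qed

lemma weight_mono: "y <= z ==> weight y s <= weight z s"
 unfolding weight_def using q0 by (intro mult_right_mono ennreal_leI mult_left_mono) auto

abbreviation disc :: "(real => 'a => real) => 'a => ennreal" where
 "disc F w \<equiv> \<integral>\<^sup>+s. weight (F s w) s \<partial>lborel"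

lemma disc_meas:
 assumes "(%(s, w). F s w) \<in> borel_measurable (borel \<Otimes>\<^sub>M M)"
 shows "disc F \<in> borel_measurable M"
proof -
 have "(%p. F (snd p) (fst p)) \<in> borel_measurable (M \<Otimes>\<^sub>M borel)"
  using measurable_compose[OF measurable_pair_swap' assms] by (simp add: case_prod_unfold)
 hence [measurable]: "(%p. F (snd p) (fst p)) \<in> borel_measurable (M \<Otimes>\<^sub>M lborel)" by simp
 have "(%p. weight (F (snd p) (fst p)) (snd p)) \<in> borel_measurable (M \<Otimes>\<^sub>M lborel)" by measurable
 thus ?thesis by (intro lborel.borel_measurable_nn_integral) (simp add: case_prod_unfold)
qed

definition excess :: "nat => real => real => 'a => real" where
 "excess n b' s w = max (refl_grid n b' s w - N' s w) 0"

lemma excess_meas: "(%(s, w). excess n b' s w) \<in> borel_measurable (borel \<Otimes>\<^sub>M M)"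
proof -
 have "(%p. max ((case p of (s, w) => refl_grid n b' s w) - (case p of (s, w) => N' s w)) 0) \<in> borel_measurable (borel \<Otimes>\<^sub>M M)" by measurable
 thus ?thesis by (simp add: excess_def case_prod_unfold)
qed

definition total :: ennreal where "total = (\<integral>\<^sup>+w. disc N' w \<partial>M)"

lemma total_eq:
 "(\<integral>\<^sup>+w. (\<integral>\<^sup>+t\<in>{0..}. ennreal (exp (- (q * t))) \<partial>interval_measure (cumulative_reflection \<delta> b (%t. x + X t w) (%t. V t w))) \<partial>M) = total"
 unfolding total_def
proof (rule nn_integral_cong_AE)
 show "AE w in M. (\<integral>\<^sup>+t\<in>{0..}. ennreal (exp (- (q * t))) \<partial>interval_measure (cumulative_reflection \<delta> b (%t. x + X t w) (%t. V t w)))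
   = disc N' w"
  using G_AE
 proof eventually_elim
  case (elim w)
  then interpret P: rr_path \<delta> b "%t. x + X t w" "%t. V t w" by (rule G_path)
  show ?case unfolding P.reflection_integral[OF q0] weight_def
   by (intro nn_integral_cong) (use elim in \<open>auto simp: N'_def restricted_def indicator_def\<close>)
 qed
qed

lemma grid_total:
 assumes n: "0 < n"
 shows "(\<integral>\<^sup>+w. disc (refl_grid n b') w \<partial>M) =
  ennreal r0 + (SUP k. ennreal (expectation (R.push_sum n b' v0 k)))"
proof -
 let ?a = "%i w. ennreal (exp (- (q * (real (Suc i) / real n))) * push n b' w i)"
 have "(\<integral>\<^sup>+w. disc (refl_grid n b') w \<partial>M) = (\<integral>\<^sup>+w. ennreal r0 + (\<Sum>i. ?a i w) \<partial>M)"
  unfolding weight_def refl_grid_def by (intro nn_integral_cong nn_integral_step_exp q0 n push_nonneg r0)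
 also have "... = ennreal r0 + (\<integral>\<^sup>+w. (\<Sum>i. ?a i w) \<partial>M)" by (subst nn_integral_add) (auto simp: emeasure_space_1)
 also have "(\<integral>\<^sup>+w. (\<Sum>i. ?a i w) \<partial>M) = (\<Sum>i. \<integral>\<^sup>+w. ?a i w \<partial>M)" by (rule nn_integral_suminf) measurable
 also have "... = (SUP k. \<Sum>i<k. \<integral>\<^sup>+w. ?a i w \<partial>M)" by (rule suminf_eq_SUP)
 also have "... = (SUP k. ennreal (expectation (R.push_sum n b' v0 k)))"
 proof (intro SUP_cong refl)
  fix k
  have "(\<Sum>i<k. \<integral>\<^sup>+w. ?a i w \<partial>M) = (\<integral>\<^sup>+w. (\<Sum>i<k. ?a i w) \<partial>M)" by (rule nn_integral_sum[symmetric]) measurable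
  also have "... = (\<integral>\<^sup>+w. ennreal (R.push_sum n b' v0 k w) \<partial>M)"
   unfolding R.push_sum_def push_def[symmetric] using push_nonneg by (intro nn_integral_cong sum_ennreal) simp
  also have "... = ennreal (expectation (R.push_sum n b' v0 k))"
  proof (rule nn_integral_eq_integral[OF R.push_sum_integrable[OF n v0]])
   show "AE w in M. 0 <= R.push_sum n b' v0 k w"
    unfolding R.push_sum_def push_def[symmetric] using push_nonneg by (intro AE_I2 sum_nonneg mult_nonneg_nonneg) auto
  qed
  finally show "(\<Sum>i<k. \<integral>\<^sup>+w. ?a i w \<partial>M) = ennreal (expectation (R.push_sum n b' v0 k))" .
 qed
 finally show ?thesis .
qed

text \<open>Pointwise the excess vanishes as the mesh tends to 0, and it is at most
  \<open>\<delta> * s\<close>. Dominated convergence is used twice, first in time and then over the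
  paths.\<close>

lemma excess_tendsto_0:
 assumes \<epsilon>: "0 < \<epsilon>"
 shows "(%n. \<integral>\<^sup>+w. disc (excess (Suc n) (b + \<epsilon>)) w \<partial>M) \<longlonglongrightarrow> 0"
proof -
 let ?u = "%n. excess (Suc n) (b + \<epsilon>)"
 have lin: "(\<integral>\<^sup>+s. weight (\<delta> * s) s \<partial>lborel) < \<infinity>" unfolding weight_def by (rule nn_integral_exp_linear_finite[OF q0 d0])
 have grid: "refl_grid (Suc n) b' s w - N' s w = grid_reflection (\<delta> / real (Suc n)) b' (%i. x + X (real i / real (Suc n)) w) (nat \<lfloor>real (Suc n) * s\<rfloor>) - NN w s"
  if "w \<in> G" "0 <= s" for n b' s w
  using that by (simp add: refl_grid_def refl_grid_eq N'_def restricted_def)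
 have bound: "weight (?u n s w) s <= weight (\<delta> * s) s" if G: "w \<in> G" for n s w
 proof (cases "0 <= s")
  case True
  interpret P: rr_path \<delta> b "%t. x + X t w" "%t. V t w" using G by (rule G_path)
  have "0 <= \<delta> * s" using True d0 by simp
  hence "?u n s w <= \<delta> * s" unfolding excess_def grid[OF G True]
   using P.grid_reflection_le[OF zero_less_Suc True, of n "b + \<epsilon>"] by (intro max.boundedI) linarith
  thus ?thesis by (rule weight_mono)
 qed (simp add: weight_def)
 have inner: "(%n. disc (?u n) w) \<longlonglongrightarrow> (\<integral>\<^sup>+s. 0 \<partial>(lborel :: real measure))" if G: "w \<in> G" and sp: "w \<in> space M" for w
 proof (rule nn_integral_dominated_convergence[where w="%s. weight (\<delta> * s) s"])
  have [measurable]: "(%s. ?u n s w) \<in> borel_measurable borel" for n using measurable_Pair1[OF excess_meas sp] by simp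
  show "(%s. weight (?u n s w) s) \<in> borel_measurable lborel" for n by measurable
  show "AE s in lborel. weight (?u n s w) s <= weight (\<delta> * s) s" for n by (intro AE_I2 bound G)
  show "AE s in lborel. (%n. weight (?u n s w) s) \<longlonglongrightarrow> 0"
  proof (intro AE_I2)
   fix s :: real
   show "(%n. weight (?u n s w) s) \<longlonglongrightarrow> 0"
   proof (cases "0 <= s")
    case True
    interpret P: rr_path \<delta> b "%t. x + X t w" "%t. V t w" using G by (rule G_path)
    have "(%n. ?u n s w) \<longlonglongrightarrow> 0" unfolding excess_def grid[OF G True]
     using LIMSEQ_Suc[OF P.grid_reflection_excess[OF \<epsilon> True]] .
    hence "(%n. ennreal (q * exp (- (q * s)) * ?u n s w)) \<longlonglongrightarrow> ennreal (q * exp (- (q * s)) * 0)"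
     by (intro tendsto_ennrealI tendsto_mult tendsto_const)
    thus ?thesis using True by (simp add: weight_def)
   qed (simp add: weight_def)
  qed
 qed (use lin in auto)
 have "(%n. \<integral>\<^sup>+w. disc (?u n) w \<partial>M) \<longlonglongrightarrow> (\<integral>\<^sup>+w. 0 \<partial>M)"
 proof (rule nn_integral_dominated_convergence[where w="%w. \<integral>\<^sup>+s. weight (\<delta> * s) s \<partial>lborel"])
  show "disc (?u n) \<in> borel_measurable M" for n by (intro disc_meas excess_meas)
  show "AE w in M. disc (?u n) w <= (\<integral>\<^sup>+s. weight (\<delta> * s) s \<partial>lborel)" for n
   using G_AE by eventually_elim (intro nn_integral_mono bound)
  show "(\<integral>\<^sup>+w. (\<integral>\<^sup>+s. weight (\<delta> * s) s \<partial>lborel) \<partial>M) < \<infinity>" using lin by (simp add: emeasure_space_1)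
  show "AE w in M. (%n. disc (?u n) w) \<longlonglongrightarrow> 0"
   using G_AE AE_space by eventually_elim (use inner in simp)
 qed auto
 thus ?thesis by simp
qed

text \<open>With the level raised to \<open>b + \<epsilon>\<close> the pushes of the chain exceed
  \<open>N\<close> only by the vanishing excess, while their discounted expectation is at least
  \<open>R.gfun C v0 - \<eta>\<close>. For a start below 0 the atom \<open>r0\<close> accounts for
  the linear part of \<open>R.gfun\<close>.\<close>

lemma total_lower:
 assumes N: "v0 <= N" and neg: "R.gfun C N < 0"
 shows "ennreal (R.gfun C x) <= total"
proof -
 have gx: "R.gfun C x = r0 + R.gfun C v0"
  using R.gfun_neg[of x C] by (cases "0 <= x") (auto simp: v0_def r0_def max_def)
 have main: "ennreal (R.gfun C x - \<eta>) <= total" if \<eta>: "0 < \<eta>" for \<eta>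
 proof -
  obtain \<epsilon>1 where e1: "0 < \<epsilon>1" and E: "ALL \<epsilon>. 0 < \<epsilon> --> \<epsilon> < \<epsilon>1 --> (EX n0>0. ALL n>=n0. ALL b'. \<bar>b' - b\<bar> <= \<epsilon> -->
    (EX M0. ALL k>=M0. R.gfun C v0 - \<eta> <= expectation (R.push_sum n b' v0 k)))"
   using R.push_lower_bound[OF v0 N neg \<eta>] by (elim exE conjE)
  define \<epsilon> where "\<epsilon> = \<epsilon>1 / 2"
  have e: "0 < \<epsilon>" "\<epsilon> < \<epsilon>1" using e1 by (auto simp: \<epsilon>_def)
  obtain n0 where n0: "ALL n>=n0. ALL b'. \<bar>b' - b\<bar> <= \<epsilon> --> (EX M0. ALL k>=M0. R.gfun C v0 - \<eta> <= expectation (R.push_sum n b' v0 k))"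
   using E[rule_format, OF e] by (elim exE conjE)
  let ?err = "%n. \<integral>\<^sup>+w. disc (excess (Suc n) (b + \<epsilon>)) w \<partial>M"
  have "ennreal (R.gfun C x - \<eta>) <= total + ?err n" if n: "n0 <= n" for n
  proof -
   obtain M0 where "ALL k>=M0. R.gfun C v0 - \<eta> <= expectation (R.push_sum (Suc n) (b + \<epsilon>) v0 k)"
    using n0[rule_format, of "Suc n" "b + \<epsilon>"] n e by auto
   hence k: "R.gfun C v0 - \<eta> <= expectation (R.push_sum (Suc n) (b + \<epsilon>) v0 M0)" by simp
   have pn: "0 <= expectation (R.push_sum (Suc n) (b + \<epsilon>) v0 M0)"
    unfolding R.push_sum_def push_def[symmetric] using push_nonneg by (intro integral_nonneg_AE AE_I2 sum_nonneg mult_nonneg_nonneg) auto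
   have "ennreal (R.gfun C x - \<eta>) <= ennreal (r0 + expectation (R.push_sum (Suc n) (b + \<epsilon>) v0 M0))"
    using k gx by (intro ennreal_leI) simp
   also have "... = ennreal r0 + ennreal (expectation (R.push_sum (Suc n) (b + \<epsilon>) v0 M0))" using r0 pn by (rule ennreal_plus)
   also have "... <= ennreal r0 + (SUP k. ennreal (expectation (R.push_sum (Suc n) (b + \<epsilon>) v0 k)))"
    by (intro add_left_mono SUP_upper) simp
   also have "... = (\<integral>\<^sup>+w. disc (refl_grid (Suc n) (b + \<epsilon>)) w \<partial>M)" by (rule grid_total[symmetric]) simp
   also have "... <= (\<integral>\<^sup>+w. disc N' w + disc (excess (Suc n) (b + \<epsilon>)) w \<partial>M)"
   proof (rule nn_integral_mono)
    fix w assume sp: "w \<in> space M"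
    have [measurable]: "(%s. N' s w) \<in> borel_measurable borel" "(%s. excess (Suc n) (b + \<epsilon>) s w) \<in> borel_measurable borel"
     using measurable_Pair1[OF N'_joint sp] measurable_Pair1[OF excess_meas sp] by simp_all
    have "weight (refl_grid (Suc n) (b + \<epsilon>) s w) s <= weight (N' s w) s + weight (excess (Suc n) (b + \<epsilon>) s w) s" for s
    proof -
     have "weight (refl_grid (Suc n) (b + \<epsilon>) s w) s <= weight (N' s w + excess (Suc n) (b + \<epsilon>) s w) s"
      by (rule weight_mono) (simp add: excess_def)
     also have "... = weight (N' s w) s + weight (excess (Suc n) (b + \<epsilon>) s w) s"
      unfolding weight_def distrib_right[symmetric] using q0 N'_nonneg[of s w]
      by (subst ennreal_plus[symmetric]) (auto simp: distrib_left excess_def)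
     finally show ?thesis .
    qed
    hence "disc (refl_grid (Suc n) (b + \<epsilon>)) w <= (\<integral>\<^sup>+s. weight (N' s w) s + weight (excess (Suc n) (b + \<epsilon>) s w) s \<partial>lborel)"
     by (rule nn_integral_mono)
    also have "... = disc N' w + disc (excess (Suc n) (b + \<epsilon>)) w" by (rule nn_integral_add) measurable
    finally show "disc (refl_grid (Suc n) (b + \<epsilon>)) w <= disc N' w + disc (excess (Suc n) (b + \<epsilon>)) w" .
   qed
   also have "... = total + ?err n"
    unfolding total_def by (intro nn_integral_add disc_meas N'_joint excess_meas)
   finally show ?thesis .
  qed
  moreover have "(%n. total + ?err n) \<longlonglongrightarrow> total + 0" by (intro tendsto_add tendsto_const excess_tendsto_0 e)
  ultimately show ?thesis by (intro LIMSEQ_le_const[of "%n. total + ?err n" total]) auto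
 qed
 have "(%n. ennreal (R.gfun C x - 1 / real (Suc n))) \<longlonglongrightarrow> ennreal (R.gfun C x - 0)"
  by (intro tendsto_ennrealI tendsto_diff tendsto_const) real_asymp
 thus ?thesis using main by (intro LIMSEQ_le_const2[of _ "ennreal (R.gfun C x)" total]) auto
qed

text \<open>With the level lowered to \<open>b - \<epsilon>\<close> the pushes of the chain catch up
  with \<open>N\<close>, though one grid point late. The delay is a shift in time by
  \<open>1 / real n\<close> and costs a factor \<open>exp (q / real n)\<close>; Fatou's lemma then
  gives the bound.\<close>

lemma total_upper:
 assumes lim: "!!A. EX N0. ALL y>=N0. A <= R.gfun C y"
 shows "total <= ennreal (R.gfun C x)"
proof -
 have gx: "R.gfun C x = r0 + R.gfun C v0"
  using R.gfun_neg[of x C] by (cases "0 <= x") (auto simp: v0_def r0_def max_def)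
 have main: "total <= ennreal (R.gfun C x + \<eta>)" if \<eta>: "0 < \<eta>" for \<eta>
 proof -
  obtain \<epsilon>1 where e1: "0 < \<epsilon>1" and E: "ALL \<epsilon>. 0 < \<epsilon> --> \<epsilon> < \<epsilon>1 --> (EX n0>0. ALL n>=n0. ALL b'. \<bar>b' - b\<bar> <= \<epsilon> -->
    (ALL k. expectation (R.push_sum n b' v0 k) <= R.gfun C v0 + \<eta>))"
   using R.push_upper_bound[OF v0 lim \<eta>] by (elim exE conjE)
  define \<epsilon> where "\<epsilon> = \<epsilon>1 / 2"
  have e: "0 < \<epsilon>" "\<epsilon> < \<epsilon>1" using e1 by (auto simp: \<epsilon>_def)
  obtain n0 where n0: "0 < n0" "ALL n>=n0. ALL b'. \<bar>b' - b\<bar> <= \<epsilon> --> (ALL k. expectation (R.push_sum n b' v0 k) <= R.gfun C v0 + \<eta>)"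
   using E[rule_format, OF e] by (elim exE conjE)
  define c where "c = b - \<epsilon>"
  have push_le: "expectation (R.push_sum n c v0 k) <= R.gfun C v0 + \<eta>" if "n0 <= n" for n k
   using n0(2)[rule_format, OF that, of c] e by (simp add: c_def)
  have g0: "0 <= R.gfun C v0 + \<eta>" using push_le[OF order_refl, of 0] by (simp add: R.push_sum_def[abs_def])
  let ?B = "ennreal (R.gfun C x + \<eta>)"
  have grid_le: "(\<integral>\<^sup>+w. disc (refl_grid n c) w \<partial>M) <= ?B" if n: "n0 <= n" for n
  proof -
   have "0 < n" using n n0 by simp
   hence "(\<integral>\<^sup>+w. disc (refl_grid n c) w \<partial>M) = ennreal r0 + (SUP k. ennreal (expectation (R.push_sum n c v0 k)))"
    by (rule grid_total)
   also have "... <= ennreal r0 + ennreal (R.gfun C v0 + \<eta>)"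
    by (intro add_left_mono SUP_least ennreal_leI push_le n)
   also have "... = ?B" using r0 g0 by (simp add: gx ennreal_plus[symmetric] add.assoc del: ennreal_plus)
   finally show ?thesis .
  qed
  have shift: "disc (%s. refl_grid n c (s + 1 / real n)) w <= ennreal (exp (q / real n)) * disc (refl_grid n c) w"
   if sp: "w \<in> space M" for n w
  proof -
   have [measurable]: "(%s. refl_grid n c s w) \<in> borel_measurable borel"
    using measurable_Pair1[OF refl_grid_meas[of n c] sp] by simp
   have w: "weight (refl_grid n c s w) (s - 1 / real n) <= ennreal (exp (q / real n)) * weight (refl_grid n c s w) s" for s
   proof (cases "0 <= s - 1 / real n")
    case True
    have "0 <= 1 / real n" by simp
    hence s: "0 <= s" using True by linarith
    have "q * exp (- (q * (s - 1 / real n))) * refl_grid n c s w = exp (q / real n) * (q * exp (- (q * s)) * refl_grid n c s w)"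
     by (simp add: exp_add[symmetric] algebra_simps)
    moreover have "weight (refl_grid n c s w) (s - 1 / real n) = ennreal (q * exp (- (q * (s - 1 / real n))) * refl_grid n c s w)"
     using True by (simp add: weight_def)
    moreover have "ennreal (exp (q / real n)) * weight (refl_grid n c s w) s = ennreal (exp (q / real n) * (q * exp (- (q * s)) * refl_grid n c s w))"
     using s by (subst ennreal_mult') (auto simp: weight_def)
    ultimately show ?thesis by (simp only: order_refl)
   qed (simp add: weight_def)
   have "disc (%s. refl_grid n c (s + 1 / real n)) w = (\<integral>\<^sup>+s. weight (refl_grid n c s w) (s - 1 / real n) \<partial>lborel)"
    by (subst nn_integral_real_affine[where c=1 and t="1 / real n"]) (auto simp: add.commute)
   also have "... <= (\<integral>\<^sup>+s. ennreal (exp (q / real n)) * weight (refl_grid n c s w) s \<partial>lborel)" by (intro nn_integral_mono w)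
   also have "... = ennreal (exp (q / real n)) * disc (refl_grid n c) w" by (rule nn_integral_cmult) measurable
   finally show ?thesis .
  qed
  let ?S = "%n. disc (%s. refl_grid n c (s + 1 / real n))"
  have Sm [measurable]: "?S n \<in> borel_measurable M" for n
  proof (rule disc_meas)
   have "(%p. (fst p + 1 / real n, snd p)) \<in> borel \<Otimes>\<^sub>M M \<rightarrow>\<^sub>M borel \<Otimes>\<^sub>M M" by measurable
   from measurable_compose[OF this refl_grid_meas[of n c]]
   show "(%(s, w). refl_grid n c (s + 1 / real n) w) \<in> borel_measurable (borel \<Otimes>\<^sub>M M)" by (simp add: case_prod_unfold)
  qed
  have S_le: "(\<integral>\<^sup>+w. ?S n w \<partial>M) <= ennreal (exp (q / real n)) * ?B" if n: "n0 <= n" for n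
  proof -
   note disc_meas[OF refl_grid_meas, measurable]
   have "(\<integral>\<^sup>+w. ?S n w \<partial>M) <= (\<integral>\<^sup>+w. ennreal (exp (q / real n)) * disc (refl_grid n c) w \<partial>M)"
    by (intro nn_integral_mono shift)
   also have "... = ennreal (exp (q / real n)) * (\<integral>\<^sup>+w. disc (refl_grid n c) w \<partial>M)"
    by (rule nn_integral_cmult) measurable
   also have "... <= ennreal (exp (q / real n)) * ?B" by (intro mult_left_mono grid_le n) simp
   finally show ?thesis .
  qed
  have fatou: "disc N' w <= liminf (%n. ?S n w)" if G: "w \<in> G" and sp: "w \<in> space M" for w
  proof -
   interpret P: rr_path \<delta> b "%t. x + X t w" "%t. V t w" using G by (rule G_path)
   have [measurable]: "(%s. refl_grid n c s w) \<in> borel_measurable borel" for n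
    using measurable_Pair1[OF refl_grid_meas[of n c] sp] by simp
   have "disc N' w <= (\<integral>\<^sup>+s. liminf (%n. weight (refl_grid n c (s + 1 / real n) w) s) \<partial>lborel)"
   proof (intro nn_integral_mono)
    fix s :: real
    show "weight (N' s w) s <= liminf (%n. weight (refl_grid n c (s + 1 / real n) w) s)"
    proof (cases "0 <= s")
     case True
     let ?c = "q * exp (- (q * s))"
     have c: "0 < ?c" using q0 by simp
     have "ennreal (?c * N' s w) <= liminf (%n. ennreal (?c * refl_grid n c (s + 1 / real n) w))"
     proof (rule le_liminf_ennreal)
      fix \<kappa> :: real assume "0 < \<kappa>"
      hence k: "0 < \<kappa> / ?c" using c by simp
      show "\<forall>\<^sub>F n in sequentially. ?c * N' s w <= ?c * refl_grid n c (s + 1 / real n) w + \<kappa>"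
       using P.grid_reflection_catches_up[OF e(1) True k] eventually_gt_at_top[of 0]
      proof eventually_elim
       case (elim n)
       \<comment> \<open>The shift by one mesh width raises the grid index by exactly one, which is
         the index at which the chain has caught up.\<close>
       have "real n * (s + 1 / real n) = real n * s + 1" using elim(2) by (simp add: distrib_left)
       hence "nat \<lfloor>real n * (s + 1 / real n)\<rfloor> = Suc (nat \<lfloor>real n * s\<rfloor>)" using True by (simp add: nat_add_distrib)
       hence "refl_grid n c (s + 1 / real n) w = grid_reflection (\<delta> / real n) c (%i. x + X (real i / real n) w) (Suc (nat \<lfloor>real n * s\<rfloor>))"
        by (simp only: refl_grid_def refl_grid_eq[OF G])
       moreover have "N' s w = P.N s" using True G by (simp add: N'_def restricted_def)
       ultimately have "N' s w <= refl_grid n c (s + 1 / real n) w + \<kappa> / ?c"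
        using elim(1) by (simp only: c_def)
       hence "?c * N' s w <= ?c * (refl_grid n c (s + 1 / real n) w + \<kappa> / ?c)" using c by (intro mult_left_mono) auto
       also have "?c * (refl_grid n c (s + 1 / real n) w + \<kappa> / ?c) = ?c * refl_grid n c (s + 1 / real n) w + \<kappa>"
        unfolding distrib_left using c by (simp only: nonzero_mult_div_cancel_left times_divide_eq_right less_imp_neq[symmetric] not_False_eq_True)
       finally show ?case .
      qed
     qed
     thus ?thesis using True by (simp add: weight_def)
    qed (simp add: weight_def)
   qed
   also have "... <= liminf (%n. ?S n w)" by (rule nn_integral_liminf) measurable
   finally show ?thesis .
  qed
  have "total <= (\<integral>\<^sup>+w. liminf (%n. ?S n w) \<partial>M)"
   unfolding total_def
  proof (rule nn_integral_mono_AE)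
   show "AE w in M. disc N' w <= liminf (%n. ?S n w)"
    using G_AE AE_space by eventually_elim (rule fatou)
  qed
  also have "... <= liminf (%n. \<integral>\<^sup>+w. ?S n w \<partial>M)" by (rule nn_integral_liminf) measurable
  also have "... <= liminf (%n. ennreal (exp (q / real n)) * ?B)"
   by (rule Liminf_mono) (use S_le in \<open>auto simp: eventually_sequentially\<close>)
  also have "... = ?B"
  proof (rule lim_imp_Liminf)
   have "(%n. exp (q / real n)) \<longlonglongrightarrow> 1" by real_asymp
   hence "(%n. exp (q / real n) * (R.gfun C x + \<eta>)) \<longlonglongrightarrow> 1 * (R.gfun C x + \<eta>)" by (intro tendsto_mult tendsto_const)
   hence "(%n. ennreal (exp (q / real n) * (R.gfun C x + \<eta>))) \<longlonglongrightarrow> ennreal (1 * (R.gfun C x + \<eta>))" by (rule tendsto_ennrealI)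
   thus "(%n. ennreal (exp (q / real n)) * ?B) \<longlonglongrightarrow> ?B" by (simp add: ennreal_mult')
  qed simp
  finally show ?thesis .
 qed
 have "(%n. ennreal (R.gfun C x + 1 / real (Suc n))) \<longlonglongrightarrow> ennreal (R.gfun C x + 0)"
  by (intro tendsto_ennrealI tendsto_add tendsto_const) real_asymp
 thus ?thesis using main by (intro LIMSEQ_le_const[of _ "ennreal (R.gfun C x)" total]) auto
qed

end

section \<open>The explicit form of g_C and the identification of the constant\<close>

context refraction
begin

text \<open>\<open>slope_b C\<close> is affine in \<open>C\<close>, so the integrability of its two
  parts can be extracted from \<open>C = 0\<close> and \<open>C = 1\<close>.\<close>

lemma slope_parts_integrable:
 "integrable lborel (%z. WY (y - z) * (Z z * indicator {b<..} z))"
 "integrable lborel (%z. WY (y - z) * (W z * indicator {b<..} z))"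
proof -
 have i: "integrable lborel (%z. WY (y - z) * slope_b C z)" for C by (rule SY.pot_integrable[OF dominated_slope_b])
 have "integrable lborel (%z. - (WY (y - z) * slope_b 0 z))" by (intro Bochner_Integration.integrable_minus i)
 thus "integrable lborel (%z. WY (y - z) * (Z z * indicator {b<..} z))"
  by (simp add: slope_b_def slope_def)
 have "integrable lborel (%z. (WY (y - z) * slope_b 1 z - WY (y - z) * slope_b 0 z) / q)"
  by (intro integrable_divide Bochner_Integration.integrable_diff i)
 moreover have "(%z. (WY (y - z) * slope_b 1 z - WY (y - z) * slope_b 0 z) / q) = (%z. WY (y - z) * (W z * indicator {b<..} z))"
  using q by (auto simp: fun_eq_iff slope_b_def slope_def indicator_def algebra_simps)
 ultimately show "integrable lborel (%z. WY (y - z) * (W z * indicator {b<..} z))" by simp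
qed

lemma convolution_interval:
 assumes [measurable]: "h \<in> borel_measurable borel"
 shows "(LBINT z:{b..y}. WY (y - z) * h z) = (LBINT z. WY (y - z) * (h z * indicator {b<..} z))"
 unfolding set_lebesgue_integral_def
proof (rule integral_cong_AE)
 show "AE z in lborel. indicat_real {b..y} z *\<^sub>R (WY (y - z) * h z) = WY (y - z) * (h z * indicator {b<..} z)"
  using AE_lborel_singleton[of b] by eventually_elim (auto simp: indicator_def CY.W_neg)
qed (use CY.W_borel in measurable)

lemma gfun_eq: "gfun C y = - r_tilde q \<delta> b m W WY y + C * r_fun q \<delta> b W WY y"
proof -
 note [measurable] = CX.W_borel
 have Zm: "Z \<in> borel_measurable borel" by (rule borel_measurable_continuous_onI[OF CX.Z_cont])
 have "SY.pot (slope_b C) y = (LBINT z. C * q * (WY (y - z) * (W z * indicator {b<..} z)) - WY (y - z) * (Z z * indicator {b<..} z))"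
  unfolding SY.pot_def slope_b_def slope_def by (intro Bochner_Integration.integral_cong) (auto simp: algebra_simps)
 also have "... = C * q * (LBINT z:{b..y}. WY (y - z) * W z) - (LBINT z:{b..y}. WY (y - z) * Z z)"
  unfolding convolution_interval[OF CX.W_borel] convolution_interval[OF Zm] using slope_parts_integrable
  by (subst Bochner_Integration.integral_diff) auto
 finally have "gfun C y = - Zb y - m / q + C * Z y +
   \<delta> * (C * q * (LBINT z:{b..y}. WY (y - z) * W z) - (LBINT z:{b..y}. WY (y - z) * Z z))"
  by (simp only: gfun_def base_def)
 thus ?thesis unfolding r_tilde_def r_fun_def by algebra
qed

lemma Z_le_r_fun: "Z y <= r_fun q \<delta> b W WY y"
 unfolding r_fun_def set_lebesgue_integral_def using q delta CX.W_ge0 CY.W_ge0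
 by (auto intro!: mult_nonneg_nonneg integral_nonneg_AE)

lemma gfun_diff: "gfun C y = gfun C' y + (C - C') * r_fun q \<delta> b W WY y"
 unfolding gfun_eq by (simp add: algebra_simps)

lemma Z_ge: "1 <= y ==> 1 + q * (W 1 * (y - 1)) <= Z y"
proof -
 assume y: "1 <= y"
 have "W 1 * (y - 1) = integral {1..y} (%_. W 1)" using y by simp
 also have "... <= integral {1..y} W"
  using y by (intro integral_le integrable_continuous_real CX.W_contI continuous_on_const) (auto intro: CX.W_mono)
 also have "... <= integral {0..y} W"
  using y CX.W_ge0 by (intro integral_subset_le integrable_continuous_real CX.W_contI) auto
 finally show ?thesis using q y by (simp add: CX.Z_eq CX.IW_integral)
qed

lemma Z_ge1: "1 <= Z y"
 using CX.IW_ge0[of y] q by (simp add: CX.Z_eq)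

lemma DERIV_Z: "0 < x ==> (Z has_real_derivative q * W x) (at x)"
 and DERIV_Zb: "0 < x ==> (Zb has_real_derivative Z x) (at x)"
 using CX.Z_deriv[of x "x + 1"] CX.Zb_deriv[of x "x + 1"] by (simp_all add: at_within_Icc_at)

end

context rr_levy
begin

lemma critical_compare:
 assumes ev: "!!y. N0 <= y ==> 0 <= s * R.gfun C y" and N0: "0 <= N0"
 shows "0 <= s * (C - R.critical)"
proof (rule R.critical_sign[OF _ phi(2,1) _ _ W_facts(3) ev N0])
 fix \<theta> :: "nat => real" assume "\<theta> \<longlonglongrightarrow> phi"
 thus "(%n. psi (\<theta> n)) \<longlonglongrightarrow> psi phi"
  by (rule isCont_tendsto_compose[OF DERIV_isCont[OF psi_has_derivative[OF phi(1)]]])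
qed (use Phi_less_phi in auto)

text \<open>By the comparison principle a negative value at \<open>y\<close> rules out positive
  values further right, and a function that is nonpositive from some point on forces
  \<open>C\<close> to be at most \<open>R.critical\<close>.\<close>

lemma gfun_nonneg_above:
 assumes C: "R.critical < C" and y: "0 <= y"
 shows "0 <= R.gfun C y"
proof (rule ccontr)
 assume n: "\<not> 0 <= R.gfun C y"
 have "0 <= -1 * R.gfun C N" if "y <= N" for N using R.gfun_comparison[OF y that] n by force
 hence "0 <= -1 * (C - R.critical)" by (rule critical_compare[of y]) (use y in simp_all)
 thus False using C by simp
qed

lemma gfun_negative_below:
 assumes C: "C < R.critical"
 shows "EX N>=N0. R.gfun C N < 0"
proof (rule ccontr)
 assume n: "\<not> ?thesis"
 have "0 <= 1 * R.gfun C y" if "max N0 0 <= y" for y using n that by force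
 hence "0 <= 1 * (C - R.critical)" by (rule critical_compare[of "max N0 0"]) simp_all
 thus False using C by simp
qed

text \<open>Strict inequality leaves room for an intermediate constant \<open>C'\<close> whose
  function is still nonnegative. The difference of the two functions is a positive multiple of
  \<open>r_fun\<close>, which grows at least linearly.\<close>

lemma gfun_tends_to_infinity:
 assumes C: "R.critical < C"
 shows "EX N0. ALL y>=N0. A <= R.gfun C y"
proof -
 define C' where "C' = (C + R.critical) / 2"
 have C': "R.critical < C'" "C' < C" using C by (auto simp: C'_def field_simps)
 have W1: "0 < W 1" by (rule W_facts(3)) simp_all
 have "filterlim (%y. (C - C') * (1 + q * (W 1 * (y - 1)))) at_top at_top" using C' W1 q0 by real_asymp
 hence "\<forall>\<^sub>F y in at_top. A <= (C - C') * (1 + q * (W 1 * (y - 1)))" by (simp add: filterlim_at_top)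
 hence "\<forall>\<^sub>F y in at_top. A <= R.gfun C y" using eventually_ge_at_top[of 1]
 proof eventually_elim
  case (elim y)
  have "(C - C') * (1 + q * (W 1 * (y - 1))) <= (C - C') * r_fun q \<delta> b W WY y"
   using R.Z_ge[OF elim(2)] R.Z_le_r_fun[of y] C' by (intro mult_left_mono) auto
  also have "... <= R.gfun C y" using R.gfun_diff[of C y C'] gfun_nonneg_above[OF C'(1), of y] elim(2) by simp
  finally show ?case using elim(1) by simp
 qed
 thus ?thesis unfolding eventually_at_top_linorder .
qed

theorem total_eq_gfun: "enn2ereal total = ereal (R.gfun R.critical x)"
proof -
 have lim: "(%n. R.gfun (R.critical + s / real (Suc n)) y) \<longlonglongrightarrow> R.gfun R.critical y" for s y
 proof -
  have "(%n. a + s / real (Suc n) * c) \<longlonglongrightarrow> a" for a c by real_asymp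
  thus ?thesis by (subst R.gfun_diff[of _ y R.critical]) (simp del: of_nat_Suc)
 qed
 have up: "total <= ennreal (R.gfun R.critical x)"
 proof (rule LIMSEQ_le_const[OF tendsto_ennrealI[OF lim[of 1 x]]], intro exI allI impI)
  fix n show "total <= ennreal (R.gfun (R.critical + 1 / real (Suc n)) x)"
   by (intro total_upper gfun_tends_to_infinity) simp
 qed
 have lo: "ennreal (R.gfun R.critical x) <= total"
 proof (rule LIMSEQ_le_const2[OF tendsto_ennrealI[OF lim[of "-1" x]]], intro exI allI impI)
  fix n
  have "R.critical + -1 / real (Suc n) < R.critical" by simp
  from gfun_negative_below[OF this, of v0] obtain N where "v0 <= N" "R.gfun (R.critical + -1 / real (Suc n)) N < 0" by (elim exE conjE)
  thus "ennreal (R.gfun (R.critical + -1 / real (Suc n)) x) <= total" by (rule total_lower)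
 qed
 \<comment> \<open>\<open>ennreal\<close> sends negative numbers to 0, so the identity of extended
   reals needs nonnegativity; it is inherited from constants above the critical one.\<close>
 have "0 <= R.gfun R.critical v0"
  by (rule LIMSEQ_le_const[OF lim[of 1 v0]], intro exI allI impI gfun_nonneg_above v0) simp
 hence "0 <= R.gfun R.critical x"
  using R.gfun_neg[of x R.critical] by (cases "0 <= x") (auto simp: v0_def max_def)
 moreover have "total = ennreal (R.gfun R.critical x)" using up lo by (rule antisym)
 ultimately show ?thesis by (simp add: enn2ereal_ennreal)
qed

lemma shifted_transform:
 assumes [measurable]: "h \<in> borel_measurable borel"
 shows "(LBINT y:{b..}. exp (- (phi * (y - b))) * h y) = exp (phi * b) * (LBINT z. exp (- (phi * z)) * (h z * indicator {b<..} z))"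
proof -
 have "(LBINT y:{b..}. exp (- (phi * (y - b))) * h y) = (LBINT z. exp (phi * b) * (exp (- (phi * z)) * (h z * indicator {b<..} z)))"
  unfolding set_lebesgue_integral_def
 proof (rule integral_cong_AE)
  show "AE y in lborel. indicat_real {b..} y *\<^sub>R (exp (- (phi * (y - b))) * h y) = exp (phi * b) * (exp (- (phi * y)) * (h y * indicator {b<..} y))"
   using AE_lborel_singleton[of b]
  proof eventually_elim
   case (elim y)
   have "exp (- (phi * (y - b))) = exp (phi * b) * exp (- (phi * y))" by (simp add: exp_add[symmetric] algebra_simps)
   thus ?case using elim by (auto simp: indicator_def)
  qed
 qed measurable
 thus ?thesis by simp
qed

text \<open>For \<open>\<delta> = 0\<close> put \<open>y = Z_bar + m / q\<close>, so \<open>y' = Z\<close>.  The critical constant \<open>1 / \<Phi>\<close> gives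
 \<open>y <= Z / \<Phi>\<close> and \<open>Z \<sim> \<Phi> y\<close>; hence \<open>e^(-\<Phi> N) y(N)\<close> grows subexponentially and is negligible
 against the integral of \<open>e^(-\<Phi> z) Z(z)\<close>, the only error in integrating \<open>e^(-\<Phi> z) W(z)\<close> by parts.\<close>

lemma ratio_limit:
 assumes d: "\<delta> = 0"
 shows "((%N. (LBINT y:{b..N}. exp (- (phi * (y - b))) * Z_fun q W y) / (q * (LBINT y:{b..N}. exp (- (phi * (y - b))) * W y))) \<longlongrightarrow> 1 / phi) at_top"
proof -
 define pp where "pp = phi"
 define e where "e y = exp (- (pp * (y - b)))" for y
 define E where "E y = e y * R.Z y" for y
 define A where "A N = integral {b..N} E" for N
 define B where "B N = integral {b..N} (%y. e y * W y)" for N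
 define Y where "Y N = R.Zb N + m / q" for N
 define Q where "Q N = e N * Y N" for N
 have p: "0 < pp" unfolding pp_def by (rule phi(1))
 have e0: "0 < e y" for y by (simp add: e_def)
 have de: "(e has_real_derivative - pp * e y) (at y)" for y unfolding e_def by (auto intro!: derivative_eq_intros)
 have econt: "continuous_on S e" for S unfolding e_def by (intro continuous_intros)
 have Econt: "continuous_on S E" for S unfolding E_def by (intro continuous_intros econt R.CX.Z_cont)
 have Wcont: "continuous_on {b..N} W" for N using b0 by (intro R.CX.W_contI) simp
 have crit: "R.critical = 1 / pp" unfolding R.critical_def pp_def using d by (rule if_P)
 have gf: "R.gfun C y = C * R.Z y - Y y" for C y unfolding R.gfun_def R.base_def Y_def using d by simp
 \<comment> \<open>Read off from \<open>R.gfun C y >= 0\<close> for \<open>C\<close> slightly above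
   \<open>1 / pp\<close>; the excess of \<open>C\<close> is divided by \<open>R.Z y\<close> so that
   it contributes just \<open>\<epsilon>\<close>.\<close>
 have Y_le: "pp * Y y <= R.Z y" if y: "0 <= y" for y
 proof -
  have "Y y <= 1 / pp * R.Z y"
  proof (rule field_le_epsilon)
   fix \<epsilon> :: real assume \<epsilon>: "0 < \<epsilon>"
   have Zp: "0 < R.Z y" using R.Z_ge1[of y] by linarith
   have "R.critical < 1 / pp + \<epsilon> / R.Z y" using \<epsilon> Zp by (simp add: crit)
   from gfun_nonneg_above[OF this y] have "Y y <= (1 / pp + \<epsilon> / R.Z y) * R.Z y" by (simp add: gf)
   thus "Y y <= 1 / pp * R.Z y + \<epsilon>" using Zp by (simp add: distrib_right)
  qed
  thus ?thesis using p by (simp add: pos_le_divide_eq mult.commute)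
 qed
 have dA: "(A has_real_derivative E y) (at y)" if "b < y" for y
 proof -
  have "(A has_real_derivative E y) (at y within {b..y + 1})"
   unfolding A_def[abs_def] by (rule integral_has_real_derivative) (use Econt that in auto)
  thus ?thesis using that by (simp add: at_within_Icc_at)
 qed
 have dQ: "(Q has_real_derivative e y * (R.Z y - pp * Y y)) (at y)" if "b < y" for y
 proof -
  have "0 < y" using that b0 by simp
  from DERIV_add[OF R.DERIV_Zb[OF this] DERIV_const] have dY: "(Y has_real_derivative R.Z y) (at y)" by (simp add: Y_def[abs_def])
  show ?thesis unfolding Q_def[abs_def] using DERIV_mult[OF de dY] by (rule DERIV_cong) (simp add: algebra_simps)
 qed
 have parts: "q * B N = E N - E b + pp * A N" if N: "b <= N" for N
 proof -
  have "((%y. e y * (q * W y) - pp * E y) has_integral (E N - E b)) {b..N}"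
  proof (rule fundamental_theorem_of_calculus[OF N])
   fix y assume y: "y \<in> {b..N}"
   have "(E has_real_derivative e y * (q * W y) - pp * E y) (at y)"
    unfolding E_def[abs_def] using y b0 by (auto intro!: derivative_eq_intros de R.DERIV_Z simp: algebra_simps)
   thus "(E has_vector_derivative e y * (q * W y) - pp * E y) (at y within {b..N})"
    unfolding has_real_derivative_iff_has_vector_derivative by (rule has_vector_derivative_at_within)
  qed
  moreover have "((%y. q * (e y * W y) - pp * E y) has_integral (q * B N - pp * A N)) {b..N}"
   unfolding A_def B_def by (intro has_integral_diff has_integral_mult_right integrable_integral integrable_continuous_real continuous_intros econt Econt Wcont)
  ultimately have "E N - E b = q * B N - pp * A N" by (simp add: mult.left_commute has_integral_unique)
  thus ?thesis by simp
 qed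
 \<comment> \<open>For a constant just below \<open>1 / pp\<close> the function
   \<open>R.gfun\<close> is negative somewhere, and by the comparison principle it is nonpositive
   from there on.\<close>
 have growth: "EX N1>b. ALL N>=N1. R.Z N <= (pp + \<iota>) * Y N" if \<iota>: "0 < \<iota>" for \<iota>
 proof -
  have "1 / (pp + \<iota>) < R.critical" using \<iota> p by (simp add: crit frac_less2)
  from gfun_negative_below[OF this, of "b + 1"] obtain N1 where N1: "b + 1 <= N1" "R.gfun (1 / (pp + \<iota>)) N1 < 0" by (elim exE conjE)
  have "R.Z N <= (pp + \<iota>) * Y N" if N: "N1 <= N" for N
  proof -
   have "0 <= N1" using N1(1) b0 by linarith
   hence "R.gfun (1 / (pp + \<iota>)) N <= 0" using R.gfun_comparison[OF _ N, of "1 / (pp + \<iota>)"] N1(2) by linarith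
   hence "R.Z N / (pp + \<iota>) <= Y N" by (simp add: gf)
   moreover have "0 < pp + \<iota>" using p \<iota> by simp
   ultimately show ?thesis by (simp add: pos_divide_le_eq mult.commute)
  qed
  thus ?thesis using N1(1) by (intro exI[of _ N1]) auto
 qed
 have A_mono: "A N1 + c * (N - N1) <= A N" if N: "b < N1" "N1 <= N" and c: "!!y. N1 <= y ==> c <= E y" for c N1 N
 proof -
  have "A N1 - c * N1 <= A N - c * N"
  proof (rule DERIV_nonneg_imp_nondecreasing[OF N(2)])
   fix y assume "N1 <= y"
   thus "EX z. ((%N. A N - c * N) has_real_derivative z) (at y) & 0 <= z"
    using c[of y] N(1) by (intro exI[of _ "E y - c"]) (auto intro!: derivative_eq_intros dA)
  qed
  thus ?thesis by (simp add: algebra_simps)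
 qed
 \<comment> \<open>\<open>Q\<close> is positive at \<open>N1\<close> and does not decrease from
   there on, so the integrand \<open>E\<close> stays above the positive constant
   \<open>pp * Q N1\<close>.\<close>
 have A_top: "filterlim A at_top at_top"
 proof -
  obtain N1 where N1: "b < N1" "!!N. N1 <= N ==> R.Z N <= (pp + 1) * Y N" using growth[of 1] by auto
  have Qm: "Q N1 <= Q N" if "N1 <= N" for N
  proof (rule DERIV_nonneg_imp_nondecreasing[OF that])
   fix y assume y: "N1 <= y"
   have "0 <= e y * (R.Z y - pp * Y y)" using Y_le[of y] e0[of y] y N1(1) b0 by (intro mult_nonneg_nonneg) auto
   thus "EX z. (Q has_real_derivative z) (at y) & 0 <= z" using dQ[of y] y N1(1) by (intro exI[of _ "e y * (R.Z y - pp * Y y)"]) auto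
  qed
  have "0 < (pp + 1) * Y N1" using N1(2)[OF order_refl] R.Z_ge1[of N1] by linarith
  hence "0 < Y N1" using p by (simp add: zero_less_mult_iff)
  hence c: "0 < pp * Q N1" using p e0[of N1] by (simp add: Q_def)
  have "pp * Q N1 <= E y" if "N1 <= y" for y
  proof -
   have "pp * Q N1 <= pp * Q y" using Qm[OF that] p by simp
   also have "... <= E y" unfolding Q_def E_def using mult_left_mono[OF Y_le[of y], of "e y"] e0[of y] that N1(1) b0 by (simp add: mult.left_commute)
   finally show ?thesis .
  qed
  note lb = A_mono[OF N1(1) _ this]
  have "filterlim (%N. A N1 + pp * Q N1 * (N - N1)) at_top at_top" using c by real_asymp
  thus ?thesis by (rule filterlim_at_top_mono) (use lb in \<open>auto simp: eventually_at_top_linorder\<close>)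
 qed
 have small: "((%N. (E N - E b) / A N) \<longlongrightarrow> 0) at_top"
 proof (rule tendstoI)
  fix \<epsilon> :: real assume \<epsilon>: "0 < \<epsilon>"
  define \<iota> where "\<iota> = min pp (\<epsilon> / 8)"
  have \<iota>: "0 < \<iota>" "\<iota> <= pp" "8 * \<iota> <= \<epsilon>" using p \<epsilon> by (auto simp: \<iota>_def)
  obtain N1 where N1: "b < N1" "!!N. N1 <= N ==> R.Z N <= (pp + \<iota>) * Y N" using growth[OF \<iota>(1)] by auto
  define c where "c = \<iota> / pp"
  have c: "0 < c" "c * pp = \<iota>" using p \<iota> by (auto simp: c_def)
  \<comment> \<open>The derivative of \<open>Q\<close> is at most \<open>c * E\<close>, so
    \<open>Q\<close> exceeds a constant by at most \<open>c * A\<close>. As \<open>c\<close> can be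
    chosen small, the boundary term \<open>E N\<close> is negligible against
    \<open>A N\<close>.\<close>
  have Q_le: "Q N <= Q N1 - c * A N1 + c * A N" if N: "N1 <= N" for N
  proof -
   have "Q N - c * A N <= Q N1 - c * A N1"
   proof (rule DERIV_nonpos_imp_nonincreasing[OF N])
    fix y assume y: "N1 <= y"
    have "R.Z y - pp * Y y <= \<iota> * Y y" using N1(2)[OF y] by (simp add: distrib_right)
    also have "... = c * (pp * Y y)" unfolding c(2)[symmetric] by simp
    also have "... <= c * R.Z y" using Y_le[of y] y N1(1) b0 c(1) by (intro mult_left_mono) auto
    finally have "e y * (R.Z y - pp * Y y) <= c * E y" unfolding E_def using e0[of y] by (simp add: mult.left_commute)
    thus "EX z. ((%N. Q N - c * A N) has_real_derivative z) (at y) & z <= 0"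
     using y N1(1) by (intro exI[of _ "e y * (R.Z y - pp * Y y) - c * E y"]) (auto intro!: derivative_eq_intros dQ dA)
   qed
   thus ?thesis by simp
  qed
  define k where "k = (pp + \<iota>) * \<bar>Q N1 - c * A N1\<bar> + \<bar>E b\<bar>"
  have k: "\<bar>E N - E b\<bar> <= k + 2 * \<iota> * A N" if N: "N1 <= N" and AN: "0 <= A N" for N
  proof -
   have E0: "0 <= E N" unfolding E_def using e0[of N] R.Z_ge1[of N] by simp
   have "E N <= (pp + \<iota>) * Q N" unfolding E_def Q_def using mult_left_mono[OF N1(2)[OF N], of "e N"] e0[of N] by (simp add: mult.left_commute)
   also have "... <= (pp + \<iota>) * (\<bar>Q N1 - c * A N1\<bar> + c * A N)"
    using Q_le[OF N] p \<iota> by (intro mult_left_mono) auto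
   also have "... = (pp + \<iota>) * \<bar>Q N1 - c * A N1\<bar> + (pp + \<iota>) * c * A N" by (simp add: distrib_left)
   also have "(pp + \<iota>) * c * A N <= 2 * \<iota> * A N"
   proof (rule mult_right_mono[OF _ AN])
    have "(pp + \<iota>) * c <= (2 * pp) * c" using \<iota> c by (intro mult_right_mono) auto
    thus "(pp + \<iota>) * c <= 2 * \<iota>" using c(2) by (simp add: mult.commute)
   qed
   finally show ?thesis using E0 unfolding k_def by linarith
  qed
  have "\<forall>\<^sub>F N in at_top. max 1 (4 * \<bar>k\<bar> / \<epsilon>) <= A N" using A_top unfolding filterlim_at_top by blast
  thus "\<forall>\<^sub>F N in at_top. dist ((E N - E b) / A N) 0 < \<epsilon>" using eventually_ge_at_top[of N1]
  proof eventually_elim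
   case (elim N)
   hence AN: "0 < A N" "4 * \<bar>k\<bar> / \<epsilon> <= A N" by auto
   have "4 * \<bar>k\<bar> <= \<epsilon> * A N" using AN(2) \<epsilon> by (simp add: pos_divide_le_eq mult.commute)
   moreover have "8 * \<iota> * A N <= \<epsilon> * A N" using \<iota>(3) AN(1) by (intro mult_right_mono) auto
   moreover have "0 < \<epsilon> * A N" using \<epsilon> AN by simp
   ultimately have "\<bar>E N - E b\<bar> < \<epsilon> * A N" using k[OF elim(2)] AN(1) by linarith
   thus ?case using AN(1) by (simp add: dist_real_def abs_divide pos_divide_less_eq)
  qed
 qed
 have "((%N. 1 / ((E N - E b) / A N + pp)) \<longlongrightarrow> 1 / (0 + pp)) at_top"
  by (intro tendsto_intros small) (use p in simp)
 moreover have "\<forall>\<^sub>F N in at_top. 1 / ((E N - E b) / A N + pp) = A N / (q * B N)"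
 proof -
  have "\<forall>\<^sub>F N in at_top. 1 <= A N" using A_top unfolding filterlim_at_top by blast
  thus ?thesis using eventually_ge_at_top[of b]
  proof eventually_elim
   case (elim N)
   hence "(E N - E b) / A N + pp = (q * B N) / A N" using parts[OF elim(2)] by (simp add: add_divide_distrib)
   thus ?case by simp
  qed
 qed
 ultimately have main: "((%N. A N / (q * B N)) \<longlongrightarrow> 1 / pp) at_top" by (auto elim: Lim_transform_eventually)
 have "(LBINT y:{b..N}. e y * R.Z y) = A N" "(LBINT y:{b..N}. e y * W y) = B N" for N
  unfolding A_def B_def E_def
  by (intro set_borel_integral_eq_integral borel_integrable_atLeastAtMost' continuous_intros econt R.CX.Z_cont Wcont)+
 thus ?thesis using main unfolding e_def pp_def by (simp only:)
qed

end

section \<open>Transfer to the given process and conclusion\<close>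

lemma cadlag_shift: "cadlag f ==> cadlag (%t. x + f t)"
 unfolding cadlag_def
proof (intro conjI allI impI)
 fix t :: real assume f: "(ALL t>=0. continuous (at_right t) f) & (ALL t>0. EX l. (f \<longlongrightarrow> l) (at_left t))"
 show "continuous (at_right t) (%t. x + f t)" if "0 <= t" using f that by (intro continuous_add continuous_const) simp
 assume "0 < t"
 then obtain l where "(f \<longlongrightarrow> l) (at_left t)" using f by (elim conjE allE[of _ t]) auto
 thus "EX l. ((%t. x + f t) \<longlongrightarrow> l) (at_left t)" by (intro exI[of _ "x + l"] tendsto_add tendsto_const)
qed

lemma no_positive_jumps_shift: "no_positive_jumps f ==> no_positive_jumps (%t. x + f t)"
 unfolding no_positive_jumps_def
proof (intro allI impI)
 fix t l :: real
 assume f: "ALL t>0. ALL l. (f \<longlongrightarrow> l) (at_left t) --> f t <= l" and t: "0 < t" and l: "((%t. x + f t) \<longlongrightarrow> l) (at_left t)"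
 have "((%t. (x + f t) - x) \<longlongrightarrow> l - x) (at_left t)" by (intro tendsto_diff l tendsto_const)
 hence "(f \<longlongrightarrow> l - x) (at_left t)" by simp
 hence "f t <= l - x" using f t by (elim allE[of _ t] impE allE[of _ "l - x"])
 thus "x + f t <= l" by simp
qed

theorem corollary5p1:
  fixes M :: "'a measure" and X V :: "real \<Rightarrow> 'a \<Rightarrow> real"
    and \<nu> :: "real measure" and \<gamma> \<sigma> b \<delta> q m x :: real
    and \<psi> \<psi>\<^sub>Y W WY :: "real \<Rightarrow> real" and ER :: ereal
  assumes levy: "spectrally_negative_levy M X \<gamma> \<sigma> \<nu>"
    and b: "0 < b" and \<delta>: "0 \<le> \<delta>"
    and bv: "bounded_variation_paths M X \<Longrightarrow> \<delta> < bv_drift \<gamma> \<nu>"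
    and q: "0 < q"
  defines "\<psi> \<equiv> levy_khintchine \<gamma> \<sigma> \<nu>"
    and "\<psi>\<^sub>Y \<equiv> (\<lambda>\<theta>. \<psi> \<theta> - \<delta> * \<theta>)"
  assumes psi'_0plus: "(deriv \<psi> \<longlongrightarrow> m) (at_right 0)"
    and W: "scale_function \<psi> q W"
    and WY: "scale_function \<psi>\<^sub>Y q WY"
    and V_rv: "\<And>t. 0 \<le> t \<Longrightarrow> V t \<in> borel_measurable M"
    and V: "AE \<omega> in M. refracted_reflected_path \<delta> b (\<lambda>t. x + X t \<omega>) (\<lambda>t. V t \<omega>)"
  defines "ER \<equiv> enn2ereal (\<integral>\<^sup>+\<omega>. (\<integral>\<^sup>+t\<in>{0..}. ennreal (exp (- (q * t)))
             \<partial>interval_measure (cumulative_reflection \<delta> b (\<lambda>t. x + X t \<omega>) (\<lambda>t. V t \<omega>))) \<partial>M)"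
  \<comment> \<open>For \<open>\<delta> = 0\<close> both integrals over \<open>[b, \<infinity>)\<close> diverge; their quotient is then read as the limit
      of the quotients of the integrals over \<open>[b, N]\<close>.\<close>
  shows "(0 < \<delta> \<longrightarrow>
           ER = ereal (- r_tilde q \<delta> b m W WY x +
             (LBINT y:{b..}. exp (- (right_inverse \<psi>\<^sub>Y q * (y - b))) * Z_fun q W y) *
             (r_fun q \<delta> b W WY x /
               (q * (LBINT y:{b..}. exp (- (right_inverse \<psi>\<^sub>Y q * (y - b))) * W y))))) \<and>
         (\<delta> = 0 \<longrightarrow>
           ((\<lambda>N. ereal (- r_tilde q \<delta> b m W WY x +
             (LBINT y:{b..N}. exp (- (right_inverse \<psi>\<^sub>Y q * (y - b))) * Z_fun q W y) *
             (r_fun q \<delta> b W WY x /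
               (q * (LBINT y:{b..N}. exp (- (right_inverse \<psi>\<^sub>Y q * (y - b))) * W y)))))
             \<longlongrightarrow> ER) at_top)"
proof -
 interpret L: spectrally_negative_levy M X \<gamma> \<sigma> \<nu> by (rule levy)
 have "AE w in M. X 0 w = 0 & rr_path \<delta> b (%t. x + X t w) (%t. V t w)"
  using L.start_zero L.cadlag_paths L.spectrally_negative V
  by eventually_elim (auto simp: rr_path_def b \<delta> intro: cadlag_shift no_positive_jumps_shift)
 \<comment> \<open>The set of exceptional paths need not be measurable; the complement of a null set
   containing it serves as the measurable set of good paths.\<close>
 then obtain S where S: "{w \<in> space M. \<not> (X 0 w = 0 & rr_path \<delta> b (%t. x + X t w) (%t. V t w))} \<subseteq> S" "S \<in> null_sets M"
  unfolding eventually_ae_filter by (elim bexE)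
 define G where "G = space M - S"
 interpret F: rr_levy M X \<gamma> \<sigma> \<nu> V x b \<delta> q m W WY G
 proof (intro rr_levy.intro rr_levy_axioms.intro)
  show "AE w in M. w \<in> G" using AE_not_in[OF S(2)] AE_space by eventually_elim (simp add: G_def)
 qed (use levy b \<delta> q bv psi'_0plus W WY V_rv S in \<open>auto simp: G_def \<psi>_def \<psi>\<^sub>Y_def\<close>)
 have ER: "ER = ereal (- r_tilde q \<delta> b m W WY x + F.R.critical * r_fun q \<delta> b W WY x)"
  unfolding ER_def F.total_eq F.total_eq_gfun F.R.gfun_eq ..
 have \<phi>: "right_inverse \<psi>\<^sub>Y q = F.phi" by (simp add: \<psi>_def \<psi>\<^sub>Y_def)
 have Zm: "Z_fun q W \<in> borel_measurable borel" by (rule borel_measurable_continuous_onI[OF F.R.CX.Z_cont])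
 show ?thesis
 proof (intro conjI impI)
  assume d: "0 < \<delta>"
  have "F.R.critical = (LBINT z. exp (- (F.phi * z)) * (Z_fun q W z * indicator {b<..} z)) /
    (q * (LBINT z. exp (- (F.phi * z)) * (W z * indicator {b<..} z)))"
   unfolding F.R.critical_def using d by (intro if_not_P) simp
  thus "ER = ereal (- r_tilde q \<delta> b m W WY x +
    (LBINT y:{b..}. exp (- (right_inverse \<psi>\<^sub>Y q * (y - b))) * Z_fun q W y) *
    (r_fun q \<delta> b W WY x / (q * (LBINT y:{b..}. exp (- (right_inverse \<psi>\<^sub>Y q * (y - b))) * W y))))"
   unfolding ER \<phi> F.shifted_transform[OF Zm] F.shifted_transform[OF F.R.CX.W_borel] by simp
 next
  assume d: "\<delta> = 0"
  have "((%N. - r_tilde q \<delta> b m W WY x + (LBINT y:{b..N}. exp (- (F.phi * (y - b))) * Z_fun q W y) /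
    (q * (LBINT y:{b..N}. exp (- (F.phi * (y - b))) * W y)) * r_fun q \<delta> b W WY x)
    \<longlongrightarrow> - r_tilde q \<delta> b m W WY x + 1 / F.phi * r_fun q \<delta> b W WY x) at_top"
   by (intro tendsto_add tendsto_mult tendsto_const F.ratio_limit d)
  moreover have "F.R.critical = 1 / F.phi" unfolding F.R.critical_def using d by (rule if_P)
  ultimately show "((%N. ereal (- r_tilde q \<delta> b m W WY x +
    (LBINT y:{b..N}. exp (- (right_inverse \<psi>\<^sub>Y q * (y - b))) * Z_fun q W y) *
    (r_fun q \<delta> b W WY x / (q * (LBINT y:{b..N}. exp (- (right_inverse \<psi>\<^sub>Y q * (y - b))) * W y)))))
    \<longlongrightarrow> ER) at_top"
   unfolding ER \<phi> by (intro tendsto_ereal) (simp add: times_divide_eq_right)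
 qed
qed

end
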